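(* Let $n\ge2$, let $z\in\mathbb{C}[\Delta]$ be monic of degree $n+1$, and let $c$ be a nonzero complex number. Then there is an algebra isomorphism $$\mathcal{O}^{\lambda(z)}\cong\big(U_z/U_z(e-c)\big)^{e-c}.$$ The functor $M\mapsto Wh(M)=\{m\in M:(e-c)m=0\}$ defines an equivalence between the category of $U_z$-modules on which $e-c$ acts locally nilpotently and the category of $\mathcal{O}^{\lambda(z)}$-modules, and the inverse functor is given by $N\mapsto F(N)=U_z/U_z(e-c)\otimes_{\mathcal{O}^{\lambda(z)}}N$.
   Context: Everything is over $\mathbb{C}$; modules are left modules unless stated otherwise. **The algebras $H_{z'}$ and $U_z$.** Let $e,h,f$ be the standard basis of $\mathfrak{sl}_2$, and $\Delta=h^2+4fe+2h\in \mathfrak{U}\mathfrak{sl}_2$ the rescaled Casimir element. Let $V=\mathbb{C}x\oplus\mathbb{C}y$ be the standard representation: $[e,x]=0,\ [f,x]=y,\ [h,x]=x,\ [e,y]=x,\ [f,y]=0,\ [h,y]=-y$. For $z'\in\mathbb{C}[\Delta]$, $H_{z'}$ is the quotient of the smash product $\mathfrak{U}\mathfrak{sl}_2\ltimes T(V)$ by the relation $[x,y]=z'$. It is known that for each $z'$ there is $z\in\mathbb{C}[\Delta]$, unique up to an additive constant, such that $t_z=ey^2+\tfrac12 h(xy+yx)-fx^2+z$ is central in $H_{z'}$; the center is then $\mathbb{C}[t_z]$, $\deg z=\deg z'+1$ (degrees in $\Delta$), and $z'$ is uniquely determined by $z$. Put $U_z=H_{z'}/(t_z)$; here $n=\deg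 z'$. **Hamiltonian reduction.** $(U_z/U_z(e-c))^{e-c}$ is the space of $\bar m\in U_z/U_z(e-c)$ with $(e-c)\bar m=0$ (equivalently $[e,m]\in U_z(e-c)$ for a representative $m$); it is an algebra, with multiplication induced from $U_z$, identified with $\mathrm{End}_{U_z}(U_z/U_z(e-c))^{op}$. It acts on $U_z/U_z(e-c)$ on the right and on $Wh(M)=\mathrm{Hom}_{U_z}(U_z/U_z(e-c),M)$ on the left, and via the isomorphism of the claim these become $\mathcal{O}^{\lambda(z)}$-module structures. **The algebra $U'_z$.** For a domain $A$ over $\mathbb{C}$ and $e\in A$ with $\mathrm{ad}(e)$ locally nilpotent and $\bigcap_k (e-1)^kA=0$, $A[e^{-1/2}]$ denotes the subalgebra of the $(e-1)$-adic completion $\varprojlim A/(e-1)^kA$ generated over $A$ by $e^{-1/2}=\exp(-\tfrac12\log e)$, with $\log e$ the power series in $e-1$. $U'_z$ is the subalgebra of $U_z[e^{-1/2}]$ generated by $A=e^{-1/2}x$, $C=e^{1/2}y+\tfrac12 hA$ and $\Delta$. **The algebra $\mathcal{O}^{\lambda(z)}$ (Crawley-Boevey–Holland).** For a finite subgroup $\Gamma\subset SL_2(\mathbb{C})$ and $\lambda$ in the center of $\mathbb{C}[\Gamma]$, $\mathcal{O}^\lambda=\varepsilon\big((T(\mathbb{C}^2)\rtimes\Gamma)/(uv-vu-\lambda)\big)\varepsilon$, where $u,v$ is the standard basis of $\mathbb{C}^2$ and $\varepsilon=\frac{1}{|\Gamma|}\sum_{g\in\Gamma}g$. Here $\Gamma$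 is the binary dihedral group of order $4n$, so $\mathcal{O}^\lambda$ is a noncommutative deformation of the Kleinian singularity of type $D_{n+2}$. The parameter $\lambda(z)$ is a central element of $\mathbb{C}[\Gamma]$ for which $\mathcal{O}^{\lambda(z)}$ is isomorphic as an algebra to $U'_z$ (such a parameter exists for every monic $z\in\mathbb{C}[\Delta]$ of degree $n+1$ with $n\ge2$). *)

theory Defs
  imports
    "HOL-Analysis.Analysis"
    "HOL-Computational_Algebra.Polynomial"
    "HOL-Computational_Algebra.Formal_Power_Series"
    "HOL-Library.Poly_Mapping"
    "HOL-Algebra.QuotRing"
    "HOL-Algebra.Module"
    "HOL-Algebra.Generated_Rings"
    "HOL-Algebra.Free_Abelian_Groups"
begin

section \<open>Associative algebras over the complex numbers\<close>

text \<open>A \<open>\<complex>\<close>-algebra is carried by the library record for modules, whose ring operations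
  are the operations of the algebra and whose scalar operation is the \<open>\<complex>\<close>-action.\<close>

type_synonym 'a calg = "(complex, 'a) module"

definition commutator :: "'a calg \<Rightarrow> 'a \<Rightarrow> 'a \<Rightarrow> 'a" where
  "commutator A a b = a \<otimes>\<^bsub>A\<^esub> b \<ominus>\<^bsub>A\<^esub> b \<otimes>\<^bsub>A\<^esub> a"

definition alg_center :: "'a calg \<Rightarrow> 'a set" where
  "alg_center A = {a \<in> carrier A. \<forall>b \<in> carrier A. a \<otimes>\<^bsub>A\<^esub> b = b \<otimes>\<^bsub>A\<^esub> a}"

definition poly_eval :: "'a calg \<Rightarrow> complex poly \<Rightarrow> 'a \<Rightarrow> 'a" where
  "poly_eval A p a = (\<Oplus>\<^bsub>A\<^esub>i\<in>{..degree p}. Polynomial.coeff p i \<odot>\<^bsub>A\<^esub> (a [^]\<^bsub>A\<^esub> i))"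

definition alg_iso :: "'a calg \<Rightarrow> 'b calg \<Rightarrow> ('a \<Rightarrow> 'b) set" where
  "alg_iso A B = {\<phi> \<in> ring_iso A B. \<forall>k. \<forall>a \<in> carrier A. \<phi> (k \<odot>\<^bsub>A\<^esub> a) = k \<odot>\<^bsub>B\<^esub> \<phi> a}"

definition quot_alg :: "'a calg \<Rightarrow> 'a set \<Rightarrow> 'a set calg" where
  "quot_alg A S = (let I = Idl\<^bsub>A\<^esub> S in
     \<lparr>carrier = carrier (A Quot I), mult = mult (A Quot I), one = one (A Quot I),
      ring.zero = ring.zero (A Quot I), add = add (A Quot I),
      smult = (\<lambda>k X. \<Union>a\<in>X. I +>\<^bsub>A\<^esub> (k \<odot>\<^bsub>A\<^esub> a))\<rparr>)"

definition quot_proj :: "'a calg \<Rightarrow> 'a set \<Rightarrow> 'a \<Rightarrow> 'a set" where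
  "quot_proj A S a = (Idl\<^bsub>A\<^esub> S) +>\<^bsub>A\<^esub> a"

definition gen_subalg :: "'a calg \<Rightarrow> 'a set \<Rightarrow> 'a calg" where
  "gen_subalg A S = A\<lparr>carrier := generate_ring A (S \<union> {k \<odot>\<^bsub>A\<^esub> \<one>\<^bsub>A\<^esub> | k. True})\<rparr>"

definition corner_alg :: "'a calg \<Rightarrow> 'a \<Rightarrow> 'a calg" where
  "corner_alg A p = A\<lparr>carrier := {p \<otimes>\<^bsub>A\<^esub> a \<otimes>\<^bsub>A\<^esub> p | a. a \<in> carrier A}, one := p\<rparr>"


section \<open>Free algebras\<close>

text \<open>\<open>'g word\<close> is the free monoid on \<open>'g\<close>, written additively, so that \<open>'g word \<Rightarrow>\<^sub>0 complex\<close> with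
  the convolution product of the library is the free algebra (tensor algebra) on \<open>'g\<close>.\<close>

datatype 'g word = Word (letters: "'g list")

instantiation word :: (type) monoid_add
begin

definition zero_word :: "'a word" where
  "zero_word = Word []"

definition plus_word :: "'a word \<Rightarrow> 'a word \<Rightarrow> 'a word" where
  "plus_word v w = Word (letters v @ letters w)"

instance
  by standard (simp_all add: zero_word_def plus_word_def)

end

type_synonym 'g free = "'g word \<Rightarrow>\<^sub>0 complex"

definition free_const :: "complex \<Rightarrow> 'g free" where
  "free_const k = Poly_Mapping.single 0 k"

definition letter :: "'g \<Rightarrow> 'g free" where
  "letter g = Poly_Mapping.single (Word [g]) 1"

definition free_alg :: "'g free calg" where
  "free_alg = \<lparr>carrier = UNIV, mult = (*), one = 1, ring.zero = 0, add = (+),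
     smult = (\<lambda>k p. free_const k * p)\<rparr>"

definition free_subst :: "('g \<Rightarrow> 'h free) \<Rightarrow> 'g free \<Rightarrow> 'h free" where
  "free_subst s p = (\<Sum>w\<in>Poly_Mapping.keys p.
     free_const (Poly_Mapping.lookup p w) * prod_list (map s (letters w)))"


section \<open>The algebras \<open>H\<^sub>z\<^sub>'\<close> and \<open>U\<^sub>z\<close>\<close>

datatype sl2V = gen_e | gen_h | gen_f | gen_x | gen_y

text \<open>The smash product of the enveloping algebra of \<open>sl\<^sub>2\<close> with the tensor algebra of \<open>V\<close>, by
  generators and relations: the relations of \<open>sl\<^sub>2\<close>, and \<open>[g, v] = g\<cdot>v\<close> for \<open>g\<close> in \<open>sl\<^sub>2\<close>, \<open>v\<close> in \<open>V\<close>.\<close>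

definition smash_rels :: "sl2V free set" where
  "smash_rels =
     (let e = letter gen_e; h = letter gen_h; f = letter gen_f; x = letter gen_x; y = letter gen_y;
          br = commutator free_alg in
      {br h e - 2 * e, br h f + 2 * f, br e f - h,
       br e x, br f x - y, br h x - x,
       br e y - x, br f y, br h y + y})"

type_synonym smash_elt = "sl2V free set"

definition smash_alg :: "smash_elt calg" where
  "smash_alg = quot_alg free_alg smash_rels"

definition smash_gen :: "sl2V \<Rightarrow> smash_elt" where
  "smash_gen g = quot_proj free_alg smash_rels (letter g)"

text \<open>In the next two definitions \<open>s\<close> gives the elements of \<open>A\<close> in the roles of the generators.\<close>

definition casimir :: "'a calg \<Rightarrow> (sl2V \<Rightarrow> 'a) \<Rightarrow> 'a" where
  "casimir A s =
     s gen_h \<otimes>\<^bsub>A\<^esub> s gen_h \<oplus>\<^bsub>A\<^esub> 4 \<odot>\<^bsub>A\<^esub> (s gen_f \<otimes>\<^bsub>A\<^esub> s gen_e) \<oplus>\<^bsub>A\<^esub> 2 \<odot>\<^bsub>A\<^esub> s gen_h"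

definition t_elt :: "'a calg \<Rightarrow> (sl2V \<Rightarrow> 'a) \<Rightarrow> complex poly \<Rightarrow> 'a" where
  "t_elt A s z =
     (let e = s gen_e; h = s gen_h; f = s gen_f; x = s gen_x; y = s gen_y in
        (e \<otimes>\<^bsub>A\<^esub> (y \<otimes>\<^bsub>A\<^esub> y))
        \<oplus>\<^bsub>A\<^esub> ((1/2) \<odot>\<^bsub>A\<^esub> (h \<otimes>\<^bsub>A\<^esub> (x \<otimes>\<^bsub>A\<^esub> y \<oplus>\<^bsub>A\<^esub> y \<otimes>\<^bsub>A\<^esub> x)))
        \<ominus>\<^bsub>A\<^esub> (f \<otimes>\<^bsub>A\<^esub> (x \<otimes>\<^bsub>A\<^esub> x))
        \<oplus>\<^bsub>A\<^esub> poly_eval A z (casimir A s))"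

definition H_rels :: "complex poly \<Rightarrow> smash_elt set" where
  "H_rels z' = {commutator smash_alg (smash_gen gen_x) (smash_gen gen_y)
                  \<ominus>\<^bsub>smash_alg\<^esub> poly_eval smash_alg z' (casimir smash_alg smash_gen)}"

type_synonym H_elt = "smash_elt set"

definition H_alg :: "complex poly \<Rightarrow> H_elt calg" where
  "H_alg z' = quot_alg smash_alg (H_rels z')"

definition H_gen :: "complex poly \<Rightarrow> sl2V \<Rightarrow> H_elt" where
  "H_gen z' g = quot_proj smash_alg (H_rels z') (smash_gen g)"

definition t_H :: "complex poly \<Rightarrow> complex poly \<Rightarrow> H_elt" where
  "t_H z' z = t_elt (H_alg z') (H_gen z') z"

text \<open>\<open>U\<^sub>z = H\<^sub>z\<^sub>' / (t\<^sub>z)\<close>; the polynomial \<open>z'\<close>, which \<open>z\<close> determines by the requirement that \<open>t\<^sub>z\<close> be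
  central, is carried along as an argument.\<close>

type_synonym U_elt = "H_elt set"

definition U_alg :: "complex poly \<Rightarrow> complex poly \<Rightarrow> U_elt calg" where
  "U_alg z' z = quot_alg (H_alg z') {t_H z' z}"

definition U_gen :: "complex poly \<Rightarrow> complex poly \<Rightarrow> sl2V \<Rightarrow> U_elt" where
  "U_gen z' z g = quot_proj (H_alg z') {t_H z' z} (H_gen z' g)"


section \<open>Completion and the algebra \<open>U'\<^sub>z\<close>\<close>

definition right_ideal_pow :: "'a calg \<Rightarrow> 'a \<Rightarrow> nat \<Rightarrow> 'a set" where
  "right_ideal_pow A e k = {((e \<ominus>\<^bsub>A\<^esub> \<one>\<^bsub>A\<^esub>) [^]\<^bsub>A\<^esub> k) \<otimes>\<^bsub>A\<^esub> a | a. a \<in> carrier A}"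

text \<open>The \<open>(e-1)\<close>-adic completion \<open>lim A/(e-1)\<^sup>kA\<close>: compatible sequences of cosets. As \<open>(e-1)\<^sup>kA\<close> is
  only a right ideal, \<open>\<sigma> k\<close> does not act on \<open>A/(e-1)\<^sup>kA\<close>; but if \<open>ad e\<close> is locally nilpotent then
  for fixed \<open>a\<close> and \<open>k\<close> one has \<open>a (e-1)\<^sup>m A \<subseteq> (e-1)\<^sup>k A\<close> for all large \<open>m\<close>, so the product
  \<open>\<sigma> k \<cdot> \<tau> m\<close> lies in one coset of \<open>(e-1)\<^sup>kA\<close> for all large \<open>m\<close>.\<close>

definition completion_alg :: "'a calg \<Rightarrow> 'a \<Rightarrow> (nat \<Rightarrow> 'a set) calg" where
  "completion_alg A e = (let I = right_ideal_pow A e in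
     \<lparr>carrier = {\<sigma>. \<forall>k. \<sigma> k \<in> a_rcosets\<^bsub>A\<^esub> (I k) \<and> \<sigma> (Suc k) \<subseteq> \<sigma> k},
      mult = (\<lambda>\<sigma> \<tau> k. THE X. X \<in> a_rcosets\<^bsub>A\<^esub> (I k) \<and>
                (\<exists>m0. \<forall>m\<ge>m0. \<forall>a\<in>\<sigma> k. \<forall>b\<in>\<tau> m. a \<otimes>\<^bsub>A\<^esub> b \<in> X)),
      one = (\<lambda>k. I k +>\<^bsub>A\<^esub> \<one>\<^bsub>A\<^esub>),
      ring.zero = I,
      add = (\<lambda>\<sigma> \<tau> k. \<sigma> k <+>\<^bsub>A\<^esub> \<tau> k),
      smult = (\<lambda>r \<sigma> k. \<Union>a\<in>\<sigma> k. I k +>\<^bsub>A\<^esub> (r \<odot>\<^bsub>A\<^esub> a))\<rparr>)"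

definition to_completion :: "'a calg \<Rightarrow> 'a \<Rightarrow> 'a \<Rightarrow> nat \<Rightarrow> 'a set" where
  "to_completion A e a = (\<lambda>k. right_ideal_pow A e k +>\<^bsub>A\<^esub> a)"

definition series_at :: "'a calg \<Rightarrow> 'a \<Rightarrow> complex fps \<Rightarrow> nat \<Rightarrow> 'a set" where
  "series_at A e p = (\<lambda>k. right_ideal_pow A e k +>\<^bsub>A\<^esub>
     (\<Oplus>\<^bsub>A\<^esub>i\<in>{..<k}. fps_nth p i \<odot>\<^bsub>A\<^esub> ((e \<ominus>\<^bsub>A\<^esub> \<one>\<^bsub>A\<^esub>) [^]\<^bsub>A\<^esub> i)))"

text \<open>\<open>e\<^sup>r = exp (r log e)\<close>; the series \<open>fps_ln 1\<close> is \<open>log (1 + X)\<close>.\<close>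

definition e_power :: "'a calg \<Rightarrow> 'a \<Rightarrow> complex \<Rightarrow> nat \<Rightarrow> 'a set" where
  "e_power A e r = series_at A e (fps_compose (fps_exp r) (fps_ln 1))"

definition adjoin_inv_sqrt :: "'a calg \<Rightarrow> 'a \<Rightarrow> (nat \<Rightarrow> 'a set) calg" where
  "adjoin_inv_sqrt A e = gen_subalg (completion_alg A e)
     (to_completion A e ` carrier A \<union> {e_power A e (-1/2)})"

definition U'_alg :: "complex poly \<Rightarrow> complex poly \<Rightarrow> (nat \<Rightarrow> U_elt set) calg" where
  "U'_alg z' z =
     (let U = U_alg z' z; g = U_gen z' z; e = g gen_e;
          B = adjoin_inv_sqrt U e; \<iota> = to_completion U e;
          a = e_power U e (-1/2) \<otimes>\<^bsub>B\<^esub> \<iota> (g gen_x);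
          c = e_power U e (1/2) \<otimes>\<^bsub>B\<^esub> \<iota> (g gen_y) \<oplus>\<^bsub>B\<^esub> (1/2) \<odot>\<^bsub>B\<^esub> (\<iota> (g gen_h) \<otimes>\<^bsub>B\<^esub> a)
      in gen_subalg B {a, c, \<iota> (casimir U g)})"


section \<open>The algebras of Crawley-Boevey and Holland\<close>

type_synonym mat2 = "complex^2^2"

definition binary_dihedral :: "nat \<Rightarrow> mat2 set" where
  "binary_dihedral n =
     {vector [vector [r, 0], vector [0, inverse r]] | r. r ^ (2 * n) = 1} \<union>
     {vector [vector [0, r], vector [- inverse r, 0]] | r. r ^ (2 * n) = 1}"

text \<open>The skew group algebra \<open>B \<rtimes> G\<close> of a finite group \<open>G\<close> of matrices acting on \<open>B\<close> through \<open>act\<close>.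
  A function \<open>a\<close> on \<open>G\<close> stands for the sum of the products \<open>a(g) g\<close>, and
  \<open>(b h) (b' k) = (b act(h)(b')) (h k)\<close>.\<close>

definition skew_group_alg :: "mat2 set \<Rightarrow> 'b calg \<Rightarrow> (mat2 \<Rightarrow> 'b \<Rightarrow> 'b) \<Rightarrow> (mat2 \<Rightarrow> 'b) calg" where
  "skew_group_alg G B act =
     \<lparr>carrier = G \<rightarrow>\<^sub>E carrier B,
      mult = (\<lambda>a b. \<lambda>g\<in>G. \<Oplus>\<^bsub>B\<^esub>p\<in>{p \<in> G \<times> G. fst p ** snd p = g}.
                a (fst p) \<otimes>\<^bsub>B\<^esub> act (fst p) (b (snd p))),
      one = (\<lambda>g\<in>G. if g = mat 1 then \<one>\<^bsub>B\<^esub> else \<zero>\<^bsub>B\<^esub>),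
      ring.zero = (\<lambda>g\<in>G. \<zero>\<^bsub>B\<^esub>),
      add = (\<lambda>a b. \<lambda>g\<in>G. a g \<oplus>\<^bsub>B\<^esub> b g),
      smult = (\<lambda>r a. \<lambda>g\<in>G. r \<odot>\<^bsub>B\<^esub> a g)\<rparr>"

definition complex_alg :: "complex calg" where
  "complex_alg = \<lparr>carrier = UNIV, mult = (*), one = 1, ring.zero = 0, add = (+), smult = (*)\<rparr>"

definition group_alg :: "mat2 set \<Rightarrow> (mat2 \<Rightarrow> complex) calg" where
  "group_alg G = skew_group_alg G complex_alg (\<lambda>g r. r)"

text \<open>The tensor algebra of \<open>\<complex>\<^sup>2\<close> is the free algebra on the type \<open>2\<close>, the letters \<open>1\<close> and \<open>2\<close> being the
  standard basis \<open>u\<close>, \<open>v\<close>; a matrix \<open>g\<close> sends the \<open>j\<close>-th basis vector to the \<open>j\<close>-th column of \<open>g\<close>.\<close>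

definition tensor_act :: "mat2 \<Rightarrow> 2 free \<Rightarrow> 2 free" where
  "tensor_act g = free_subst (\<lambda>j. \<Sum>i\<in>UNIV. free_const (g $ i $ j) * letter i)"

definition tensor_skew :: "mat2 set \<Rightarrow> (mat2 \<Rightarrow> 2 free) calg" where
  "tensor_skew G = skew_group_alg G free_alg tensor_act"

definition CBH_rels :: "mat2 set \<Rightarrow> (mat2 \<Rightarrow> complex) \<Rightarrow> (mat2 \<Rightarrow> 2 free) set" where
  "CBH_rels G lam =
     {(\<lambda>g\<in>G. (if g = mat 1 then letter 1 * letter 2 - letter 2 * letter 1 else 0)
              - free_const (lam g))}"

type_synonym O_elt = "(mat2 \<Rightarrow> 2 free) set"

definition O_alg :: "mat2 set \<Rightarrow> (mat2 \<Rightarrow> complex) \<Rightarrow> O_elt calg" where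
  "O_alg G lam = corner_alg (quot_alg (tensor_skew G) (CBH_rels G lam))
     (quot_proj (tensor_skew G) (CBH_rels G lam) (\<lambda>g\<in>G. free_const (1 / of_nat (card G))))"


section \<open>Left modules\<close>

text \<open>The library locale \<open>module\<close> requires a commutative ring of scalars. As there, the
  multiplicative fields of a record used as a module carry no meaning.\<close>

locale left_module = R?: ring R + M?: abelian_group M
  for R :: "('r, 'x) ring_scheme" (structure) and M :: "('r, 'm) module" (structure) +
  assumes smult_closed:
      "\<lbrakk>a \<in> carrier R; x \<in> carrier M\<rbrakk> \<Longrightarrow> a \<odot>\<^bsub>M\<^esub> x \<in> carrier M"
    and smult_l_distr:
      "\<lbrakk>a \<in> carrier R; b \<in> carrier R; x \<in> carrier M\<rbrakk> \<Longrightarrow>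
       (a \<oplus>\<^bsub>R\<^esub> b) \<odot>\<^bsub>M\<^esub> x = a \<odot>\<^bsub>M\<^esub> x \<oplus>\<^bsub>M\<^esub> b \<odot>\<^bsub>M\<^esub> x"
    and smult_r_distr:
      "\<lbrakk>a \<in> carrier R; x \<in> carrier M; y \<in> carrier M\<rbrakk> \<Longrightarrow>
       a \<odot>\<^bsub>M\<^esub> (x \<oplus>\<^bsub>M\<^esub> y) = a \<odot>\<^bsub>M\<^esub> x \<oplus>\<^bsub>M\<^esub> a \<odot>\<^bsub>M\<^esub> y"
    and smult_assoc:
      "\<lbrakk>a \<in> carrier R; b \<in> carrier R; x \<in> carrier M\<rbrakk> \<Longrightarrow>
       (a \<otimes>\<^bsub>R\<^esub> b) \<odot>\<^bsub>M\<^esub> x = a \<odot>\<^bsub>M\<^esub> (b \<odot>\<^bsub>M\<^esub> x)"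
    and smult_one:
      "x \<in> carrier M \<Longrightarrow> \<one>\<^bsub>R\<^esub> \<odot>\<^bsub>M\<^esub> x = x"

text \<open>Homomorphisms are extensional functions, so that equality of homomorphisms is equality in HOL.\<close>

definition lmod_hom ::
  "('r, 'x) ring_scheme \<Rightarrow> ('r, 'm) module \<Rightarrow> ('r, 'k) module \<Rightarrow> ('m \<Rightarrow> 'k) set" where
  "lmod_hom R M N = {f \<in> carrier M \<rightarrow>\<^sub>E carrier N.
     (\<forall>x\<in>carrier M. \<forall>y\<in>carrier M. f (x \<oplus>\<^bsub>M\<^esub> y) = f x \<oplus>\<^bsub>N\<^esub> f y) \<and>
     (\<forall>a\<in>carrier R. \<forall>x\<in>carrier M. f (a \<odot>\<^bsub>M\<^esub> x) = a \<odot>\<^bsub>N\<^esub> f x)}"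

definition lmod_iso ::
  "('r, 'x) ring_scheme \<Rightarrow> ('r, 'm) module \<Rightarrow> ('r, 'k) module \<Rightarrow> ('m \<Rightarrow> 'k) set" where
  "lmod_iso R M N = {f \<in> lmod_hom R M N. bij_betw f (carrier M) (carrier N)}"

text \<open>Functors between the full subcategories of left \<open>R\<close>-modules and of left \<open>S\<close>-modules on the
  classes \<open>\<C>\<close> and \<open>\<D>\<close> of objects; \<open>Fa M N f\<close> is the value of the functor on \<open>f : M \<rightarrow> N\<close>.\<close>

definition lmod_functor ::
  "('r, 'x) ring_scheme \<Rightarrow> ('r, 'm) module set \<Rightarrow> ('s, 'y) ring_scheme \<Rightarrow> ('s, 'k) module set \<Rightarrow>
   (('r, 'm) module \<Rightarrow> ('s, 'k) module) \<Rightarrow>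
   (('r, 'm) module \<Rightarrow> ('r, 'm) module \<Rightarrow> ('m \<Rightarrow> 'm) \<Rightarrow> ('k \<Rightarrow> 'k)) \<Rightarrow> bool" where
  "lmod_functor R \<C> S \<D> Fo Fa \<longleftrightarrow>
     (\<forall>M\<in>\<C>. Fo M \<in> \<D>) \<and>
     (\<forall>M\<in>\<C>. \<forall>N\<in>\<C>. \<forall>f\<in>lmod_hom R M N. Fa M N f \<in> lmod_hom S (Fo M) (Fo N)) \<and>
     (\<forall>M\<in>\<C>. Fa M M (\<lambda>x\<in>carrier M. x) = (\<lambda>x\<in>carrier (Fo M). x)) \<and>
     (\<forall>L\<in>\<C>. \<forall>M\<in>\<C>. \<forall>N\<in>\<C>. \<forall>f\<in>lmod_hom R L M. \<forall>g\<in>lmod_hom R M N.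
        Fa L N (compose (carrier L) g f) = compose (carrier (Fo L)) (Fa M N g) (Fa L M f))"

text \<open>\<open>(To, Ta)\<close> is naturally isomorphic to the identity functor of the full subcategory on \<open>\<C>\<close>.
  The modules \<open>To M\<close> may be carried by another type than the modules in \<open>\<C>\<close>.\<close>

definition naturally_iso_id ::
  "('r, 'x) ring_scheme \<Rightarrow> ('r, 'm) module set \<Rightarrow>
   (('r, 'm) module \<Rightarrow> ('r, 'k) module) \<Rightarrow>
   (('r, 'm) module \<Rightarrow> ('r, 'm) module \<Rightarrow> ('m \<Rightarrow> 'm) \<Rightarrow> ('k \<Rightarrow> 'k)) \<Rightarrow> bool" where
  "naturally_iso_id R \<C> To Ta \<longleftrightarrow>
     (\<exists>\<eta>. (\<forall>M\<in>\<C>. \<eta> M \<in> lmod_iso R M (To M)) \<and>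
          (\<forall>M\<in>\<C>. \<forall>N\<in>\<C>. \<forall>f\<in>lmod_hom R M N.
             compose (carrier M) (\<eta> N) f = compose (carrier M) (Ta M N f) (\<eta> M)))"

text \<open>The tensor product \<open>P \<otimes>\<^sub>S N\<close> of a left \<open>R\<close>-module \<open>P\<close> with commuting right action \<open>ract\<close> of \<open>S\<close>
  and a left \<open>S\<close>-module \<open>N\<close>, as a left \<open>R\<close>-module: the quotient of the free abelian group on
  the pairs \<open>(p, x)\<close> by the biadditivity and balancing relations.\<close>

definition tensor_sub ::
  "('r, 'p) module \<Rightarrow> ('p \<Rightarrow> 's \<Rightarrow> 'p) \<Rightarrow> ('s, 'y) ring_scheme \<Rightarrow> ('s, 'k) module \<Rightarrow>
   ('p \<times> 'k \<Rightarrow>\<^sub>0 int) set" where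
  "tensor_sub P ract S N = generate (free_Abelian_group (carrier P \<times> carrier N))
     ({frag_of (p \<oplus>\<^bsub>P\<^esub> q, x) - frag_of (p, x) - frag_of (q, x) | p q x.
         p \<in> carrier P \<and> q \<in> carrier P \<and> x \<in> carrier N} \<union>
      {frag_of (p, x \<oplus>\<^bsub>N\<^esub> y) - frag_of (p, x) - frag_of (p, y) | p x y.
         p \<in> carrier P \<and> x \<in> carrier N \<and> y \<in> carrier N} \<union>
      {frag_of (ract p s, x) - frag_of (p, s \<odot>\<^bsub>N\<^esub> x) | p s x.
         p \<in> carrier P \<and> s \<in> carrier S \<and> x \<in> carrier N})"

definition tensor_mod ::
  "('r, 'p) module \<Rightarrow> ('p \<Rightarrow> 's \<Rightarrow> 'p) \<Rightarrow> ('s, 'y) ring_scheme \<Rightarrow> ('s, 'k) module \<Rightarrow>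
   ('r, ('p \<times> 'k \<Rightarrow>\<^sub>0 int) set) module" where
  "tensor_mod P ract S N =
     (let G = free_Abelian_group (carrier P \<times> carrier N); K = tensor_sub P ract S N in
      \<lparr>carrier = carrier (G Mod K), mult = undefined, one = undefined,
       ring.zero = one (G Mod K), add = mult (G Mod K),
       smult = (\<lambda>r X. \<Union>d\<in>X. K #>\<^bsub>G\<^esub> frag_extend (\<lambda>(p, x). frag_of (r \<odot>\<^bsub>P\<^esub> p, x)) d)\<rparr>)"

definition tensor_map ::
  "('r, 'p) module \<Rightarrow> ('p \<Rightarrow> 's \<Rightarrow> 'p) \<Rightarrow> ('s, 'y) ring_scheme \<Rightarrow> ('s, 'k) module \<Rightarrow>
   ('s, 'k) module \<Rightarrow> ('k \<Rightarrow> 'k) \<Rightarrow> ('p \<times> 'k \<Rightarrow>\<^sub>0 int) set \<Rightarrow> ('p \<times> 'k \<Rightarrow>\<^sub>0 int) set" where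
  "tensor_map P ract S N N' g =
     (\<lambda>X\<in>carrier (tensor_mod P ract S N).
        \<Union>d\<in>X. tensor_sub P ract S N' #>\<^bsub>free_Abelian_group (carrier P \<times> carrier N')\<^esub>
                frag_extend (\<lambda>(p, x). frag_of (p, g x)) d)"


section \<open>Hamiltonian reduction and Whittaker vectors\<close>

text \<open>Throughout, \<open>A\<close> is an algebra and \<open>w\<close> an element of it, to be specialised to \<open>e - c\<close> in \<open>U\<^sub>z\<close>.\<close>

definition left_ideal :: "'a calg \<Rightarrow> 'a \<Rightarrow> 'a set" where
  "left_ideal A w = {a \<otimes>\<^bsub>A\<^esub> w | a. a \<in> carrier A}"

definition whit_mod :: "'a calg \<Rightarrow> 'a \<Rightarrow> ('a, 'a set) module" where
  "whit_mod A w = (let J = left_ideal A w in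
     \<lparr>carrier = a_rcosets\<^bsub>A\<^esub> J, mult = undefined, one = undefined,
      ring.zero = J, add = set_add A, smult = (\<lambda>a X. \<Union>b\<in>X. J +>\<^bsub>A\<^esub> (a \<otimes>\<^bsub>A\<^esub> b))\<rparr>)"

text \<open>The product of cosets is well defined on \<open>(A/Aw) \<times> (A/Aw)\<^sup>w\<close>; it gives the multiplication of the
  reduction \<open>(A/Aw)\<^sup>w\<close> as well as its right action on \<open>A/Aw\<close>.\<close>

definition ham_red :: "'a calg \<Rightarrow> 'a \<Rightarrow> 'a set calg" where
  "ham_red A w = (let J = left_ideal A w; P = whit_mod A w in
     \<lparr>carrier = {X \<in> carrier P. w \<odot>\<^bsub>P\<^esub> X = \<zero>\<^bsub>P\<^esub>},
      mult = rcoset_mult A J, one = J +>\<^bsub>A\<^esub> \<one>\<^bsub>A\<^esub>, ring.zero = J, add = set_add A,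
      smult = (\<lambda>r X. \<Union>a\<in>X. J +>\<^bsub>A\<^esub> (r \<odot>\<^bsub>A\<^esub> a))\<rparr>)"

definition loc_nilp_mods :: "'a calg \<Rightarrow> 'a \<Rightarrow> ('a, 'm) module set" where
  "loc_nilp_mods A w =
     {M. left_module A M \<and> (\<forall>x\<in>carrier M. \<exists>k::nat. ((\<odot>\<^bsub>M\<^esub>) w ^^ k) x = \<zero>\<^bsub>M\<^esub>)}"

definition all_mods :: "('r, 'x) ring_scheme \<Rightarrow> ('r, 'm) module set" where
  "all_mods R = {M. left_module R M}"

text \<open>For a map \<open>\<phi>\<close> from an algebra \<open>S\<close> to the reduction \<open>(A/Aw)\<^sup>w\<close>, the functor \<open>Wh\<close> takes \<open>M\<close> to the
  kernel of \<open>w\<close>, on which \<open>s\<close> acts as any representative in \<open>A\<close> of the coset \<open>\<phi> s\<close>.\<close>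

definition Wh :: "'a calg \<Rightarrow> 'a \<Rightarrow> ('s \<Rightarrow> 'a set) \<Rightarrow> ('a, 'm) module \<Rightarrow> ('s, 'm) module" where
  "Wh A w \<phi> M =
     \<lparr>carrier = {x \<in> carrier M. w \<odot>\<^bsub>M\<^esub> x = \<zero>\<^bsub>M\<^esub>}, mult = undefined, one = undefined,
      ring.zero = \<zero>\<^bsub>M\<^esub>, add = add M, smult = (\<lambda>s x. the_elem ((\<lambda>a. a \<odot>\<^bsub>M\<^esub> x) ` \<phi> s))\<rparr>"

definition Wh_map ::
  "'a calg \<Rightarrow> 'a \<Rightarrow> ('s \<Rightarrow> 'a set) \<Rightarrow> ('a, 'm) module \<Rightarrow> ('a, 'm) module \<Rightarrow> ('m \<Rightarrow> 'm) \<Rightarrow> 'm \<Rightarrow> 'm" where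
  "Wh_map A w \<phi> M N f = restrict f (carrier (Wh A w \<phi> M))"

definition whit_ract :: "'a calg \<Rightarrow> 'a \<Rightarrow> ('s \<Rightarrow> 'a set) \<Rightarrow> 'a set \<Rightarrow> 's \<Rightarrow> 'a set" where
  "whit_ract A w \<phi> X s = rcoset_mult A (left_ideal A w) X (\<phi> s)"

definition Ind ::
  "'a calg \<Rightarrow> 'a \<Rightarrow> 's calg \<Rightarrow> ('s \<Rightarrow> 'a set) \<Rightarrow> ('s, 'k) module \<Rightarrow>
   ('a, ('a set \<times> 'k \<Rightarrow>\<^sub>0 int) set) module" where
  "Ind A w S \<phi> N = tensor_mod (whit_mod A w) (whit_ract A w \<phi>) S N"

definition Ind_map ::
  "'a calg \<Rightarrow> 'a \<Rightarrow> 's calg \<Rightarrow> ('s \<Rightarrow> 'a set) \<Rightarrow> ('s, 'k) module \<Rightarrow> ('s, 'k) module \<Rightarrow> ('k \<Rightarrow> 'k) \<Rightarrow>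
   ('a set \<times> 'k \<Rightarrow>\<^sub>0 int) set \<Rightarrow> ('a set \<times> 'k \<Rightarrow>\<^sub>0 int) set" where
  "Ind_map A w S \<phi> N N' g = tensor_map (whit_mod A w) (whit_ract A w \<phi>) S N N' g"

definition e_minus :: "complex poly \<Rightarrow> complex poly \<Rightarrow> complex \<Rightarrow> U_elt" where
  "e_minus z' z c = U_gen z' z gen_e \<ominus>\<^bsub>U_alg z' z\<^esub> (c \<odot>\<^bsub>U_alg z' z\<^esub> \<one>\<^bsub>U_alg z' z\<^esub>)"

end

theory Submission
  imports Defs
begin

text \<open>Put \<open>w = e - c\<close>. Since \<open>e h = (h - 2) e\<close>, suitable multiples \<open>b\<^sub>i\<close> of the binomials of \<open>-h/2\<close>
  satisfy \<open>b\<^sub>0 = 1\<close> and \<open>w b\<^sub>i\<^sub>+\<^sub>1 - b\<^sub>i \<in> U w\<close>. Hence on a module on which \<open>w\<close> acts locally nilpotently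
  every element is uniquely a sum of \<open>b\<^sub>i v\<^sub>i\<close> with \<open>w v\<^sub>i = 0\<close>, as in Kashiwara's lemma; the projection to
  \<open>v\<^sub>0\<close> shows that the unit and the counit of the adjunction between \<open>F\<close> and \<open>Wh\<close> are bijective.

  For the algebra isomorphism let \<open>G\<close> be the subalgebra of \<open>U\<close> generated by \<open>x\<close>, \<open>e y + x h/2\<close> and \<open>\<Delta>\<close>,
  which commutes with \<open>e\<close>. The \<open>b\<^sub>i G\<close> span \<open>U\<close> modulo \<open>U w\<close>, so \<open>G\<close> maps onto the reduction. On the other
  side the elements of \<open>U'\<close> commute with \<open>h\<close>, which forces them to be determined by their first
  component, in \<open>U / (e - 1) U\<close>, and these components are the images of \<open>G\<close>. The automorphism
  \<open>\<gamma>\<close> to the power \<open>ad h\<close> with \<open>\<gamma>\<^sup>2 = 1/c\<close> carries \<open>e - 1\<close> to a multiple of \<open>w\<close>, and the two kernels match,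
  because \<open>e - 1\<close> is regular and therefore \<open>(e - 1) U\<close> and \<open>U (e - 1)\<close> have the same elements commuting
  with \<open>e\<close>.\<close>

text \<open>No basis of U is used: U enters through the commutation rules of e and h with the
  generators and through induction over words. Hence the regularity of e - 1 cannot be read off from
  a PBW theorem. It comes from the weight 2 of e: ad h sends (e - 1)^m to 2m((e - 1)^m + (e -
  1)^(m-1)), so an eigenvector of ad h annihilated by one power is annihilated by the preceding one.
  The same formula says that ad h lowers the (e - 1)-adic filtration by exactly one step, and this
  makes elements of the completion that commute with h rigid. The constants have similar origins.
  With t = -h/2 one has e p(t) = p(t + 1) e, and Pascal's rule turns c^(-i) binom(t, i) into a
  sequence lowered by w. The generators x and e y + x h/2 are e^(1/2) \<open>elA\<close> and e^(1/2)
  \<open>elC\<close>, with the fractional powers cancelled. The weight 2 of e also dictates the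
  square root in \<open>\<gamma>\<close>. The delicate point is that the completion divides by right
  ideals and the reduction by a left ideal, so the two are comparable only on elements commuting
  with e.\<close>

lemma (in abelian_group) minus_zero_right [simp]: "a \<in> carrier G \<Longrightarrow> a \<ominus> \<zero> = a"
  using l_neg[of \<zero>] r_zero[of "\<ominus> \<zero>"] by (simp add: minus_eq)

lemma (in abelian_group) minus_eq_zero_iff:
  assumes "a \<in> carrier G" "b \<in> carrier G" shows "a \<ominus> b = \<zero> \<longleftrightarrow> a = b"
proof
  assume "a \<ominus> b = \<zero>"
  then have "a = \<ominus> (\<ominus> b)"
    using assms minus_equality[of a "\<ominus> b"] by (simp add: minus_eq)
  then show "a = b" using assms by simp
qed (use assms in \<open>simp add: minus_eq r_neg\<close>)

text \<open>Left ideals, two-sided ideals, the powers of a right ideal and the relations of a tensor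
  product are all divided out below. They share only their additive structure, so the coset calculus
  is developed once for additive subgroups.\<close>

locale cosets = abelian_group G + additive_subgroup I G for I and G (structure)
begin

lemma mem_rcos: "a \<in> carrier G \<Longrightarrow> x \<in> I +> a \<longleftrightarrow> x \<in> carrier G \<and> x \<ominus> a \<in> I"
proof
  assume a: "a \<in> carrier G" and "x \<in> I +> a"
  then obtain i where "i \<in> I" "x = i \<oplus> a" by (auto simp: a_r_coset_def')
  then show "x \<in> carrier G \<and> x \<ominus> a \<in> I"
    using a a_subset by (auto simp: minus_eq a_assoc r_neg)
next
  assume a: "a \<in> carrier G" and "x \<in> carrier G \<and> x \<ominus> a \<in> I"
  moreover from this have "x = (x \<ominus> a) \<oplus> a" by (simp add: minus_eq a_assoc l_neg)
  ultimately show "x \<in> I +> a" by (force simp: a_r_coset_def')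
qed

lemma rcos_self [simp]: "a \<in> carrier G \<Longrightarrow> a \<in> I +> a"
  by (simp add: mem_rcos minus_eq r_neg)

lemma minus_sym: "a \<in> carrier G \<Longrightarrow> b \<in> carrier G \<Longrightarrow> a \<ominus> b \<in> I \<Longrightarrow> b \<ominus> a \<in> I"
proof -
  assume c: "a \<in> carrier G" "b \<in> carrier G" and "a \<ominus> b \<in> I"
  then have "\<ominus> (a \<ominus> b) \<in> I" by simp
  then show ?thesis using c by (simp add: minus_eq minus_add a_comm)
qed

lemma minus_trans:
  "a \<in> carrier G \<Longrightarrow> b \<in> carrier G \<Longrightarrow> c \<in> carrier G \<Longrightarrow> a \<ominus> b \<in> I \<Longrightarrow> b \<ominus> c \<in> I \<Longrightarrow> a \<ominus> c \<in> I"
proof -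
  assume c: "a \<in> carrier G" "b \<in> carrier G" "c \<in> carrier G" and "a \<ominus> b \<in> I" "b \<ominus> c \<in> I"
  then have "(a \<ominus> b) \<oplus> (b \<ominus> c) \<in> I" by simp
  moreover have "(a \<ominus> b) \<oplus> (b \<ominus> c) = a \<ominus> c"
    using c by (simp add: minus_eq a_assoc r_neg1)
  ultimately show ?thesis by simp
qed

lemma rcos_eq_iff:
  assumes "a \<in> carrier G" "b \<in> carrier G"
  shows "I +> a = I +> b \<longleftrightarrow> a \<ominus> b \<in> I"
proof
  assume "I +> a = I +> b"
  then have "a \<in> I +> b" using assms rcos_self by blast
  then show "a \<ominus> b \<in> I" using assms by (simp add: mem_rcos)
next
  assume "a \<ominus> b \<in> I"
  then have "x \<in> I +> a \<longleftrightarrow> x \<in> I +> b" for x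
    using assms minus_sym[of a b] minus_trans[of x a b] minus_trans[of x b a] by (metis mem_rcos)
  then show "I +> a = I +> b" by blast
qed

lemma rcos_zero [simp]: "I +> \<zero> = I"
  using a_subset by (auto simp: mem_rcos minus_eq)

lemma rcos_eq_self_iff: "a \<in> carrier G \<Longrightarrow> I +> a = I \<longleftrightarrow> a \<in> I"
  using rcos_eq_iff[of a \<zero>] by simp

lemma mem_a_rcosets: "X \<in> a_rcosets I \<longleftrightarrow> (\<exists>a\<in>carrier G. X = I +> a)"
  by (auto simp: A_RCOSETS_def')

lemma rcos_in_a_rcosets [simp]: "a \<in> carrier G \<Longrightarrow> I +> a \<in> a_rcosets I"
  by (auto simp: mem_a_rcosets)

lemma rcos_eqI: "X \<in> a_rcosets I \<Longrightarrow> a \<in> X \<Longrightarrow> X = I +> a"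
proof -
  assume "X \<in> a_rcosets I" "a \<in> X"
  then obtain b where b: "b \<in> carrier G" "X = I +> b" by (auto simp: mem_a_rcosets)
  with \<open>a \<in> X\<close> have "a \<in> carrier G" "a \<ominus> b \<in> I" by (simp_all add: mem_rcos)
  with b show ?thesis by (simp add: rcos_eq_iff minus_sym)
qed

lemma rcos_subset: "X \<in> a_rcosets I \<Longrightarrow> X \<subseteq> carrier G"
  by (auto simp: mem_a_rcosets mem_rcos)

lemma rcos_nonempty: "X \<in> a_rcosets I \<Longrightarrow> X \<noteq> {}"
  by (metis empty_iff mem_a_rcosets rcos_self)

lemma rcos_add:
  assumes "a \<in> carrier G" "b \<in> carrier G"
  shows "set_add G (I +> a) (I +> b) = I +> (a \<oplus> b)"
proof (intro equalityI subsetI)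
  fix x assume "x \<in> set_add G (I +> a) (I +> b)"
  then obtain p q where p: "p \<in> I +> a" "q \<in> I +> b" and x: "x = p \<oplus> q"
    by (auto simp: set_add_def')
  with assms obtain i j where ij: "i \<in> I" "p = i \<oplus> a" "j \<in> I" "q = j \<oplus> b"
    by (auto simp: a_r_coset_def')
  have "x = (i \<oplus> j) \<oplus> (a \<oplus> b)"
    unfolding x ij(2,4) using assms ij a_subset by (simp add: a_ac subset_iff)
  with ij show "x \<in> I +> (a \<oplus> b)" by (force simp: a_r_coset_def')
next
  fix x assume "x \<in> I +> (a \<oplus> b)"
  then obtain i where i: "i \<in> I" "x = i \<oplus> (a \<oplus> b)" by (auto simp: a_r_coset_def')
  then have "x = (i \<oplus> a) \<oplus> b" "i \<oplus> a \<in> I +> a" using assms a_subset by (auto simp: a_assoc a_r_coset_def')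
  with rcos_self[OF assms(2)] show "x \<in> set_add G (I +> a) (I +> b)" by (auto simp: set_add_def')
qed

text \<open>Scalar actions and induced maps on the quotients are defined as unions over all
  representatives. When \<open>g\<close> respects the subgroups all members of such a union
  coincide, and it collapses to the coset of one representative.\<close>

lemma UN_rcos:
  assumes "a \<in> carrier G" "cosets J H"
    and "\<And>x. x \<in> I +> a \<Longrightarrow> g x \<in> carrier H" and "\<And>x. x \<in> I +> a \<Longrightarrow> g x \<ominus>\<^bsub>H\<^esub> g a \<in> J"
  shows "(\<Union>x\<in>I +> a. J +>\<^bsub>H\<^esub> g x) = J +>\<^bsub>H\<^esub> g a"
proof -
  interpret H: cosets J H by fact
  have "J +>\<^bsub>H\<^esub> g x = J +>\<^bsub>H\<^esub> g a" if "x \<in> I +> a" for x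
    using assms(3,4)[OF that] assms(3)[OF rcos_self[OF assms(1)]] by (simp add: H.rcos_eq_iff)
  then show ?thesis by (intro UN_constant_eq[OF rcos_self[OF assms(1)]]) simp_all
qed

text \<open>The record \<open>Q\<close> is arbitrary apart from its additive fields, because the
  quotients in question carry different or undefined multiplications.\<close>

lemma
  assumes "carrier Q = a_rcosets I" "add Q = set_add G" "ring.zero Q = I"
  shows coset_abelian_group: "abelian_group Q"
    and coset_a_inv: "a \<in> carrier G \<Longrightarrow> \<ominus>\<^bsub>Q\<^esub> (I +> a) = I +> (\<ominus> a)"
    and coset_minus: "a \<in> carrier G \<Longrightarrow> b \<in> carrier G \<Longrightarrow> (I +> a) \<ominus>\<^bsub>Q\<^esub> (I +> b) = I +> (a \<ominus> b)"
proof -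
  have car: "x \<in> carrier Q \<longleftrightarrow> (\<exists>a\<in>carrier G. x = I +> a)" for x
    by (simp add: assms mem_a_rcosets)
  have add: "(I +> a) \<oplus>\<^bsub>Q\<^esub> (I +> b) = I +> (a \<oplus> b)" if "a \<in> carrier G" "b \<in> carrier G" for a b
    using that by (simp add: assms rcos_add)
  have zero: "\<zero>\<^bsub>Q\<^esub> = I +> \<zero>" by (simp add: assms)
  show Q: "abelian_group Q"
  proof (rule abelian_groupI)
    fix x assume "x \<in> carrier Q"
    then obtain a where "a \<in> carrier G" "x = I +> a" by (auto simp: car)
    then show "\<exists>y\<in>carrier Q. y \<oplus>\<^bsub>Q\<^esub> x = \<zero>\<^bsub>Q\<^esub>"
      by (intro bexI[of _ "I +> (\<ominus> a)"]) (auto simp: add car zero l_neg simp del: rcos_zero)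
  next
    show "\<zero>\<^bsub>Q\<^esub> \<in> carrier Q" unfolding car zero using zero_closed by blast
  next
    fix x y assume "x \<in> carrier Q" "y \<in> carrier Q"
    then obtain a b where "a \<in> carrier G" "x = I +> a" "b \<in> carrier G" "y = I +> b" by (auto simp: car)
    then show "x \<oplus>\<^bsub>Q\<^esub> y \<in> carrier Q" by (auto simp: add car)
  next
    fix x y assume "x \<in> carrier Q" "y \<in> carrier Q"
    then obtain a b where "a \<in> carrier G" "x = I +> a" "b \<in> carrier G" "y = I +> b" by (auto simp: car)
    then show "x \<oplus>\<^bsub>Q\<^esub> y = y \<oplus>\<^bsub>Q\<^esub> x" by (simp add: add a_comm)
  next
    fix x y z assume "x \<in> carrier Q" "y \<in> carrier Q" "z \<in> carrier Q"
    then obtain a b c where "a \<in> carrier G" "x = I +> a" "b \<in> carrier G" "y = I +> b"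
      "c \<in> carrier G" "z = I +> c" by (auto simp: car)
    then show "(x \<oplus>\<^bsub>Q\<^esub> y) \<oplus>\<^bsub>Q\<^esub> z = x \<oplus>\<^bsub>Q\<^esub> (y \<oplus>\<^bsub>Q\<^esub> z)" by (simp add: add a_assoc)
  next
    fix x assume "x \<in> carrier Q"
    then obtain a where "a \<in> carrier G" "x = I +> a" by (auto simp: car)
    then show "\<zero>\<^bsub>Q\<^esub> \<oplus>\<^bsub>Q\<^esub> x = x" by (simp add: add zero del: rcos_zero)
  qed
  show inv: "\<ominus>\<^bsub>Q\<^esub> (I +> a) = I +> (\<ominus> a)" if a: "a \<in> carrier G" for a
  proof (rule abelian_group.minus_equality[OF Q])
    show "(I +> \<ominus> a) \<oplus>\<^bsub>Q\<^esub> (I +> a) = \<zero>\<^bsub>Q\<^esub>"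
      using a by (simp add: add zero l_neg del: rcos_zero)
  qed (use a in \<open>auto simp: car\<close>)
  show "(I +> a) \<ominus>\<^bsub>Q\<^esub> (I +> b) = I +> (a \<ominus> b)" if "a \<in> carrier G" "b \<in> carrier G" for a b
    using that by (simp add: a_minus_def inv add)
qed

end

section \<open>Elementary rules for left modules\<close>

context left_module
begin

lemma smult_zero_r [simp]:
  assumes "a \<in> carrier R" shows "a \<odot>\<^bsub>M\<^esub> \<zero>\<^bsub>M\<^esub> = \<zero>\<^bsub>M\<^esub>"
proof -
  have "a \<odot>\<^bsub>M\<^esub> \<zero>\<^bsub>M\<^esub> \<oplus>\<^bsub>M\<^esub> a \<odot>\<^bsub>M\<^esub> \<zero>\<^bsub>M\<^esub> = a \<odot>\<^bsub>M\<^esub> \<zero>\<^bsub>M\<^esub>"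
    using assms smult_r_distr[of a "\<zero>\<^bsub>M\<^esub>" "\<zero>\<^bsub>M\<^esub>"] by simp
  then show ?thesis using assms smult_closed by (metis M.add.l_cancel_one M.zero_closed)
qed

lemma smult_zero_l [simp]:
  assumes "x \<in> carrier M" shows "\<zero>\<^bsub>R\<^esub> \<odot>\<^bsub>M\<^esub> x = \<zero>\<^bsub>M\<^esub>"
proof -
  have "\<zero>\<^bsub>R\<^esub> \<odot>\<^bsub>M\<^esub> x \<oplus>\<^bsub>M\<^esub> \<zero>\<^bsub>R\<^esub> \<odot>\<^bsub>M\<^esub> x = \<zero>\<^bsub>R\<^esub> \<odot>\<^bsub>M\<^esub> x"
    using assms smult_l_distr[of "\<zero>\<^bsub>R\<^esub>" "\<zero>\<^bsub>R\<^esub>" x] by simp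
  then show ?thesis using assms smult_closed by (metis M.add.l_cancel_one R.zero_closed)
qed

lemma smult_minus_r:
  assumes "a \<in> carrier R" "x \<in> carrier M" shows "a \<odot>\<^bsub>M\<^esub> (\<ominus>\<^bsub>M\<^esub> x) = \<ominus>\<^bsub>M\<^esub> (a \<odot>\<^bsub>M\<^esub> x)"
proof (rule M.minus_equality[symmetric])
  show "a \<odot>\<^bsub>M\<^esub> (\<ominus>\<^bsub>M\<^esub> x) \<oplus>\<^bsub>M\<^esub> a \<odot>\<^bsub>M\<^esub> x = \<zero>\<^bsub>M\<^esub>"
    using assms by (simp add: smult_r_distr[symmetric] M.l_neg)
qed (use assms smult_closed in auto)

lemma smult_minus_l:
  assumes "a \<in> carrier R" "x \<in> carrier M" shows "(\<ominus>\<^bsub>R\<^esub> a) \<odot>\<^bsub>M\<^esub> x = \<ominus>\<^bsub>M\<^esub> (a \<odot>\<^bsub>M\<^esub> x)"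
proof (rule M.minus_equality[symmetric])
  show "(\<ominus>\<^bsub>R\<^esub> a) \<odot>\<^bsub>M\<^esub> x \<oplus>\<^bsub>M\<^esub> a \<odot>\<^bsub>M\<^esub> x = \<zero>\<^bsub>M\<^esub>"
    using assms by (simp add: smult_l_distr[symmetric] R.l_neg)
qed (use assms smult_closed in auto)

lemma smult_diff_r:
  assumes "a \<in> carrier R" "x \<in> carrier M" "y \<in> carrier M"
  shows "a \<odot>\<^bsub>M\<^esub> (x \<ominus>\<^bsub>M\<^esub> y) = a \<odot>\<^bsub>M\<^esub> x \<ominus>\<^bsub>M\<^esub> a \<odot>\<^bsub>M\<^esub> y"
  using assms by (simp add: a_minus_def smult_r_distr smult_minus_r)

lemma smult_diff_l:
  assumes "a \<in> carrier R" "b \<in> carrier R" "x \<in> carrier M"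
  shows "(a \<ominus>\<^bsub>R\<^esub> b) \<odot>\<^bsub>M\<^esub> x = a \<odot>\<^bsub>M\<^esub> x \<ominus>\<^bsub>M\<^esub> b \<odot>\<^bsub>M\<^esub> x"
  using assms by (simp add: a_minus_def smult_l_distr smult_minus_l)

lemma smult_funpow:
  assumes "a \<in> carrier R" "x \<in> carrier M"
  shows "((\<odot>\<^bsub>M\<^esub>) a ^^ k) x = (a [^]\<^bsub>R\<^esub> k) \<odot>\<^bsub>M\<^esub> x"
proof (induction k)
  case (Suc k)
  then show ?case
    using assms R.nat_pow_Suc2[of a k] by (simp add: smult_assoc)
qed (use assms smult_one in simp)

end

lemma additive_map_zero_minus:
  assumes "abelian_group M" "abelian_group N" "\<And>x. x \<in> carrier M \<Longrightarrow> f x \<in> carrier N"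
    and "\<And>x y. x \<in> carrier M \<Longrightarrow> y \<in> carrier M \<Longrightarrow> f (x \<oplus>\<^bsub>M\<^esub> y) = f x \<oplus>\<^bsub>N\<^esub> f y"
  shows "f \<zero>\<^bsub>M\<^esub> = \<zero>\<^bsub>N\<^esub>" and "x \<in> carrier M \<Longrightarrow> f (\<ominus>\<^bsub>M\<^esub> x) = \<ominus>\<^bsub>N\<^esub> f x"
    and "x \<in> carrier M \<Longrightarrow> y \<in> carrier M \<Longrightarrow> f (x \<ominus>\<^bsub>M\<^esub> y) = f x \<ominus>\<^bsub>N\<^esub> f y"
proof -
  interpret M: abelian_group M by fact
  interpret N: abelian_group N by fact
  have "f \<zero>\<^bsub>M\<^esub> \<oplus>\<^bsub>N\<^esub> f \<zero>\<^bsub>M\<^esub> = f \<zero>\<^bsub>M\<^esub>" using assms(4)[of "\<zero>\<^bsub>M\<^esub>" "\<zero>\<^bsub>M\<^esub>"] by simp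
  then show z: "f \<zero>\<^bsub>M\<^esub> = \<zero>\<^bsub>N\<^esub>" using assms(3) by (metis M.zero_closed N.add.l_cancel_one)
  show m: "f (\<ominus>\<^bsub>M\<^esub> x) = \<ominus>\<^bsub>N\<^esub> f x" if "x \<in> carrier M" for x
  proof (rule N.minus_equality[symmetric])
    show "f (\<ominus>\<^bsub>M\<^esub> x) \<oplus>\<^bsub>N\<^esub> f x = \<zero>\<^bsub>N\<^esub>" using that by (simp add: assms(4)[symmetric] M.l_neg z)
  qed (use that assms(3) in auto)
  show "f (x \<ominus>\<^bsub>M\<^esub> y) = f x \<ominus>\<^bsub>N\<^esub> f y" if "x \<in> carrier M" "y \<in> carrier M" for x y
    using that by (simp add: a_minus_def assms(4) m)
qed

lemma lmod_homI:
  assumes "f \<in> carrier M \<rightarrow>\<^sub>E carrier N"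
    and "\<And>x y. x \<in> carrier M \<Longrightarrow> y \<in> carrier M \<Longrightarrow> f (x \<oplus>\<^bsub>M\<^esub> y) = f x \<oplus>\<^bsub>N\<^esub> f y"
    and "\<And>a x. a \<in> carrier R \<Longrightarrow> x \<in> carrier M \<Longrightarrow> f (a \<odot>\<^bsub>M\<^esub> x) = a \<odot>\<^bsub>N\<^esub> f x"
  shows "f \<in> lmod_hom R M N"
  using assms by (simp add: lmod_hom_def)

lemma lmod_homD:
  assumes "f \<in> lmod_hom R M N"
  shows "x \<in> carrier M \<Longrightarrow> f x \<in> carrier N"
    and "x \<in> carrier M \<Longrightarrow> y \<in> carrier M \<Longrightarrow> f (x \<oplus>\<^bsub>M\<^esub> y) = f x \<oplus>\<^bsub>N\<^esub> f y"
    and "a \<in> carrier R \<Longrightarrow> x \<in> carrier M \<Longrightarrow> f (a \<odot>\<^bsub>M\<^esub> x) = a \<odot>\<^bsub>N\<^esub> f x"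
    and "f \<in> extensional (carrier M)"
  using assms by (auto simp: lmod_hom_def PiE_def)

section \<open>Tensor products\<close>

locale tensor_product =
  P: left_module R P + N: left_module S N
  for R :: "('r, 'x) ring_scheme" and P :: "('r, 'p) module"
    and S :: "('s, 'y) ring_scheme" and N :: "('s, 'k) module" +
  fixes ract :: "'p \<Rightarrow> 's \<Rightarrow> 'p"
  assumes ract_closed: "\<lbrakk>p \<in> carrier P; s \<in> carrier S\<rbrakk> \<Longrightarrow> ract p s \<in> carrier P"
    and ract_smult: "\<lbrakk>r \<in> carrier R; p \<in> carrier P; s \<in> carrier S\<rbrakk> \<Longrightarrow>
      ract (r \<odot>\<^bsub>P\<^esub> p) s = r \<odot>\<^bsub>P\<^esub> ract p s"
begin

abbreviation T where "T \<equiv> tensor_mod P ract S N"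
abbreviation K where "K \<equiv> tensor_sub P ract S N"
abbreviation pairs where "pairs \<equiv> carrier P \<times> carrier N"

text \<open>The free abelian group as an additive group, so that cosets are cosets of \<^const>\<open>add_monoid\<close>.\<close>

definition FG :: "('p \<times> 'k \<Rightarrow>\<^sub>0 int) ring" where
  "FG = \<lparr>carrier = {c. Poly_Mapping.keys c \<subseteq> pairs}, mult = undefined, one = undefined,
     ring.zero = 0, add = (+)\<rparr>"

definition tens :: "'p \<Rightarrow> 'k \<Rightarrow> ('p \<times> 'k \<Rightarrow>\<^sub>0 int) set" where
  "tens p x = K +>\<^bsub>FG\<^esub> frag_of (p, x)"

lemma FG_simps [simp]:
  "carrier FG = {c. Poly_Mapping.keys c \<subseteq> pairs}" "ring.zero FG = 0" "add FG = (+)"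
  by (auto simp: FG_def)

lemma add_monoid_FG: "add_monoid FG = free_Abelian_group pairs"
  by (simp add: FG_def free_Abelian_group_def)

lemma FG_abelian_group: "abelian_group FG"
  by (rule comm_group_abelian_groupI) (simp only: add_monoid_FG abelian_free_Abelian_group)

lemma FG_minus [simp]: "Poly_Mapping.keys a \<subseteq> pairs \<Longrightarrow> \<ominus>\<^bsub>FG\<^esub> a = - a"
  unfolding a_inv_def add_monoid_FG by simp

lemma FG_diff [simp]: "Poly_Mapping.keys a \<subseteq> pairs \<Longrightarrow> Poly_Mapping.keys b \<subseteq> pairs \<Longrightarrow> a \<ominus>\<^bsub>FG\<^esub> b = a - b"
  by (simp add: a_minus_def)

definition rels where "rels =
     ({frag_of (p \<oplus>\<^bsub>P\<^esub> q, x) - frag_of (p, x) - frag_of (q, x) | p q x.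
         p \<in> carrier P \<and> q \<in> carrier P \<and> x \<in> carrier N} \<union>
      {frag_of (p, x \<oplus>\<^bsub>N\<^esub> y) - frag_of (p, x) - frag_of (p, y) | p x y.
         p \<in> carrier P \<and> x \<in> carrier N \<and> y \<in> carrier N} \<union>
      {frag_of (ract p s, x) - frag_of (p, s \<odot>\<^bsub>N\<^esub> x) | p s x.
         p \<in> carrier P \<and> s \<in> carrier S \<and> x \<in> carrier N})"

lemma K_eq: "K = generate (free_Abelian_group pairs) rels"
  by (simp add: tensor_sub_def rels_def)

lemma keys_diff_subset: "Poly_Mapping.keys a \<subseteq> A \<Longrightarrow> Poly_Mapping.keys b \<subseteq> A \<Longrightarrow> Poly_Mapping.keys (a - b :: _ \<Rightarrow>\<^sub>0 int) \<subseteq> A"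
  using keys_diff by fast

lemma keys_add_subset: "Poly_Mapping.keys a \<subseteq> A \<Longrightarrow> Poly_Mapping.keys b \<subseteq> A \<Longrightarrow> Poly_Mapping.keys (a + b :: _ \<Rightarrow>\<^sub>0 int) \<subseteq> A"
  using Poly_Mapping.keys_add by fast

lemma rels_carrier: "rels \<subseteq> carrier (free_Abelian_group pairs)"
proof
  fix d assume "d \<in> rels"
  then show "d \<in> carrier (free_Abelian_group pairs)"
    unfolding rels_def carrier_free_Abelian_group_iff
    by (elim UnE CollectE exE conjE; hypsubst; intro keys_diff_subset)
      (simp_all add: P.M.a_closed N.M.a_closed ract_closed N.smult_closed)
qed

lemma K_subgroup: "subgroup K (add_monoid FG)"
  unfolding K_eq add_monoid_FG
  by (rule group.generate_is_subgroup[OF group_free_Abelian_group rels_carrier])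

lemma K_cosets: "cosets K FG"
  unfolding cosets_def using FG_abelian_group K_subgroup by (simp add: additive_subgroup_def)

sublocale C: cosets K FG by (rule K_cosets)

lemma T_simps:
  "carrier T = a_rcosets\<^bsub>FG\<^esub> K" "add T = set_add FG" "ring.zero T = K"
  "smult T r X = (\<Union>d\<in>X. K +>\<^bsub>FG\<^esub> frag_extend (\<lambda>(p, x). frag_of (r \<odot>\<^bsub>P\<^esub> p, x)) d)"
  unfolding tensor_mod_def Let_def FactGroup_def A_RCOSETS_def set_add_def a_r_coset_def add_monoid_FG
  by simp_all

lemma rels_in_K: "d \<in> rels \<Longrightarrow> d \<in> K"
  unfolding K_eq by (rule generate.incl)

text \<open>Closure under differences replaces the separate cases for inverses and sums of
  \<open>generate\<close>: the inverse of b is 0 - b.\<close>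

lemma K_induct [consumes 1, case_names rel zero diff]:
  assumes "d \<in> K" "\<And>d. d \<in> rels \<Longrightarrow> Q d" "Q 0" "\<And>a b. a \<in> K \<Longrightarrow> b \<in> K \<Longrightarrow> Q a \<Longrightarrow> Q b \<Longrightarrow> Q (a - b)"
  shows "Q d"
  using assms(1) unfolding K_eq
proof (induction rule: generate.induct)
  case (inv h)
  have "h \<in> K" by (rule rels_in_K) fact
  moreover have "0 \<in> K" using C.zero_closed unfolding FG_simps .
  moreover have "Poly_Mapping.keys h \<subseteq> pairs"
    using subsetD[OF rels_carrier inv] by (simp only: carrier_free_Abelian_group_iff)
  ultimately show ?case using assms(4)[of 0 h] assms(2)[OF inv] assms(3) by simp
next
  case (eng a b)
  have "0 \<in> K" using C.zero_closed unfolding FG_simps .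
  moreover have "a \<in> K" "b \<in> K" unfolding K_eq by fact+
  moreover from this have "Poly_Mapping.keys b \<subseteq> pairs" using C.a_subset by auto
  ultimately have "Q (0 - b)" "0 - b \<in> K" using assms(3) assms(4)[of 0 b] eng(4) C.a_inv_closed[of b] by simp_all
  then have "Q (a - (0 - b))" using assms(4)[of a "0 - b"] eng \<open>a \<in> K\<close> by simp
  then show ?case by simp
qed (use assms in auto)

lemma tens_eq_iff:
  "Poly_Mapping.keys a \<subseteq> pairs \<Longrightarrow> Poly_Mapping.keys b \<subseteq> pairs \<Longrightarrow> K +>\<^bsub>FG\<^esub> a = K +>\<^bsub>FG\<^esub> b \<longleftrightarrow> a - b \<in> K"
  by (simp add: C.rcos_eq_iff)

lemma T_abelian_group: "abelian_group T"
  by (rule C.coset_abelian_group) (simp_all add: T_simps)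

lemma T_minus: "Poly_Mapping.keys a \<subseteq> pairs \<Longrightarrow> \<ominus>\<^bsub>T\<^esub> (K +>\<^bsub>FG\<^esub> a) = K +>\<^bsub>FG\<^esub> (- a)"
  using C.coset_a_inv[of T a] by (simp add: T_simps)

lemma T_add: "Poly_Mapping.keys a \<subseteq> pairs \<Longrightarrow> Poly_Mapping.keys b \<subseteq> pairs \<Longrightarrow>
    (K +>\<^bsub>FG\<^esub> a) \<oplus>\<^bsub>T\<^esub> (K +>\<^bsub>FG\<^esub> b) = K +>\<^bsub>FG\<^esub> (a + b)"
  by (simp add: T_simps C.rcos_add)

lemma T_zero: "\<zero>\<^bsub>T\<^esub> = K +>\<^bsub>FG\<^esub> 0"
  using C.rcos_zero by (simp add: T_simps)

lemma in_T_iff: "X \<in> carrier T \<longleftrightarrow> (\<exists>d. Poly_Mapping.keys d \<subseteq> pairs \<and> X = K +>\<^bsub>FG\<^esub> d)"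
  by (simp add: T_simps C.mem_a_rcosets)

lemma tens_closed [simp]: "p \<in> carrier P \<Longrightarrow> x \<in> carrier N \<Longrightarrow> tens p x \<in> carrier T"
  unfolding in_T_iff tens_def by (intro exI[of _ "frag_of (p, x)"]) simp

lemma tens_add_l:
  assumes "p \<in> carrier P" "q \<in> carrier P" "x \<in> carrier N"
  shows "tens (p \<oplus>\<^bsub>P\<^esub> q) x = tens p x \<oplus>\<^bsub>T\<^esub> tens q x"
proof -
  have "frag_of (p \<oplus>\<^bsub>P\<^esub> q, x) - frag_of (p, x) - frag_of (q, x) \<in> K"
    by (rule rels_in_K, unfold rels_def, rule UnI1, rule UnI1, rule CollectI, intro exI conjI, rule refl) (fact assms)+
  moreover have "Poly_Mapping.keys (frag_of (p, x) + frag_of (q, x)) \<subseteq> pairs"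
    using assms by (intro keys_add_subset) auto
  ultimately show ?thesis
    using assms by (simp add: tens_def T_add tens_eq_iff diff_diff_eq)
qed

lemma tens_add_r:
  assumes "p \<in> carrier P" "x \<in> carrier N" "y \<in> carrier N"
  shows "tens p (x \<oplus>\<^bsub>N\<^esub> y) = tens p x \<oplus>\<^bsub>T\<^esub> tens p y"
proof -
  have "frag_of (p, x \<oplus>\<^bsub>N\<^esub> y) - frag_of (p, x) - frag_of (p, y) \<in> K"
    by (rule rels_in_K, unfold rels_def, rule UnI1, rule UnI2, rule CollectI, intro exI conjI, rule refl) (fact assms)+
  moreover have "Poly_Mapping.keys (frag_of (p, x) + frag_of (p, y)) \<subseteq> pairs"
    using assms by (intro keys_add_subset) auto
  ultimately show ?thesis
    using assms by (simp add: tens_def T_add tens_eq_iff diff_diff_eq)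
qed

lemma tens_ract:
  assumes "p \<in> carrier P" "s \<in> carrier S" "x \<in> carrier N"
  shows "tens (ract p s) x = tens p (s \<odot>\<^bsub>N\<^esub> x)"
proof -
  have "frag_of (ract p s, x) - frag_of (p, s \<odot>\<^bsub>N\<^esub> x) \<in> K"
    by (rule rels_in_K, unfold rels_def, rule UnI2, rule CollectI, intro exI conjI, rule refl) (fact assms)+
  then show ?thesis
    using assms ract_closed N.smult_closed by (simp add: tens_def tens_eq_iff)
qed

lemma tens_minus_l:
  assumes "p \<in> carrier P" "x \<in> carrier N"
  shows "tens (\<ominus>\<^bsub>P\<^esub> p) x = \<ominus>\<^bsub>T\<^esub> tens p x"
  by (rule additive_map_zero_minus(2)[OF P.M.abelian_group_axioms T_abelian_group, of "\<lambda>p. tens p x"])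
    (use assms tens_add_l in auto)

lemma T_induct [consumes 1, case_names add tens]:
  assumes "X \<in> carrier T"
    and add: "\<And>X Y. X \<in> carrier T \<Longrightarrow> Y \<in> carrier T \<Longrightarrow> Q X \<Longrightarrow> Q Y \<Longrightarrow> Q (X \<oplus>\<^bsub>T\<^esub> Y)"
    and tens: "\<And>p x. p \<in> carrier P \<Longrightarrow> x \<in> carrier N \<Longrightarrow> Q (tens p x)"
  shows "Q X"
proof -
  interpret T: abelian_group T by (rule T_abelian_group)
  have zero: "Q \<zero>\<^bsub>T\<^esub>"
  proof -
    have "\<zero>\<^bsub>T\<^esub> = tens \<zero>\<^bsub>P\<^esub> \<zero>\<^bsub>N\<^esub>"
      by (rule additive_map_zero_minus(1)[OF P.M.abelian_group_axioms T_abelian_group, of "\<lambda>p. tens p \<zero>\<^bsub>N\<^esub>", symmetric])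
        (use tens_add_l in auto)
    then show ?thesis using tens by simp
  qed
  obtain d where d: "Poly_Mapping.keys d \<subseteq> pairs" "X = K +>\<^bsub>FG\<^esub> d" using assms(1) by (auto simp: in_T_iff)
  \<comment> \<open>Induction over the free abelian group runs through differences, so the claim for
    -d has to be carried along.\<close>
  have "Q (K +>\<^bsub>FG\<^esub> d) \<and> Q (K +>\<^bsub>FG\<^esub> (- d))"
    using d(1)
  proof (induction d rule: free_Abelian_group_induct[consumes 1, case_names null diff of])
    case null
    then show ?case using zero unfolding T_zero by simp
  next
    case (diff a b)
    have "K +>\<^bsub>FG\<^esub> (a - b) = (K +>\<^bsub>FG\<^esub> a) \<oplus>\<^bsub>T\<^esub> (K +>\<^bsub>FG\<^esub> (- b))"
      "K +>\<^bsub>FG\<^esub> (- (a - b)) = (K +>\<^bsub>FG\<^esub> (- a)) \<oplus>\<^bsub>T\<^esub> (K +>\<^bsub>FG\<^esub> b)"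
      using diff by (auto simp: T_add)
    moreover have "K +>\<^bsub>FG\<^esub> c \<in> carrier T" if "Poly_Mapping.keys c \<subseteq> pairs" for c
      using that by (auto simp: in_T_iff)
    ultimately show ?case using diff by (auto intro!: add)
  next
    case (of a)
    then obtain p x where a: "a = (p, x)" "p \<in> carrier P" "x \<in> carrier N" by auto
    have "K +>\<^bsub>FG\<^esub> (- frag_of a) = tens (\<ominus>\<^bsub>P\<^esub> p) x"
      using a T_minus[of "frag_of (p, x)"] tens_minus_l[of p x] by (simp add: tens_def)
    moreover have "K +>\<^bsub>FG\<^esub> frag_of a = tens p x" by (simp add: a tens_def)
    ultimately show ?case using tens a by simp
  qed
  then show ?thesis by (simp add: d)
qed

text \<open>The universal property for balanced biadditive maps. Only additivity is asserted;
  linearity over \<open>R\<close> is checked afterwards on tensors with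
  \<open>T_induct\<close>.\<close>

lemma tensor_lift:
  assumes "abelian_group M"
    and closed: "\<And>p x. p \<in> carrier P \<Longrightarrow> x \<in> carrier N \<Longrightarrow> \<beta> p x \<in> carrier M"
    and add_l: "\<And>p q x. p \<in> carrier P \<Longrightarrow> q \<in> carrier P \<Longrightarrow> x \<in> carrier N \<Longrightarrow>
      \<beta> (p \<oplus>\<^bsub>P\<^esub> q) x = \<beta> p x \<oplus>\<^bsub>M\<^esub> \<beta> q x"
    and add_r: "\<And>p x y. p \<in> carrier P \<Longrightarrow> x \<in> carrier N \<Longrightarrow> y \<in> carrier N \<Longrightarrow>
      \<beta> p (x \<oplus>\<^bsub>N\<^esub> y) = \<beta> p x \<oplus>\<^bsub>M\<^esub> \<beta> p y"
    and bal: "\<And>p s x. p \<in> carrier P \<Longrightarrow> s \<in> carrier S \<Longrightarrow> x \<in> carrier N \<Longrightarrow>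
      \<beta> (ract p s) x = \<beta> p (s \<odot>\<^bsub>N\<^esub> x)"
  shows "\<exists>h. (\<forall>X\<in>carrier T. h X \<in> carrier M) \<and>
    (\<forall>X\<in>carrier T. \<forall>Y\<in>carrier T. h (X \<oplus>\<^bsub>T\<^esub> Y) = h X \<oplus>\<^bsub>M\<^esub> h Y) \<and>
    (\<forall>p\<in>carrier P. \<forall>x\<in>carrier N. h (tens p x) = \<beta> p x)"
proof -
  interpret M: abelian_group M by fact
  have cg: "comm_group (add_monoid M)" by (rule M.a_comm_group)
  obtain g where g: "g \<in> hom (free_Abelian_group pairs) (add_monoid M)"
    and g_of: "\<And>x. x \<in> pairs \<Longrightarrow> g (frag_of x) = (\<lambda>(p, x). \<beta> p x) x"
    by (rule comm_group.free_Abelian_group_universal[OF cg, of "\<lambda>(p, x). \<beta> p x" pairs])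
      (use closed in auto)
  have gc: "g a \<in> carrier M" if "Poly_Mapping.keys a \<subseteq> pairs" for a
    using g that by (auto simp: hom_def Pi_def)
  have gadd: "g (a + b) = g a \<oplus>\<^bsub>M\<^esub> g b" if "Poly_Mapping.keys a \<subseteq> pairs" "Poly_Mapping.keys b \<subseteq> pairs" for a b
    using g that by (auto simp: hom_def)
  have gmap: "abelian_group FG" "\<And>x. x \<in> carrier FG \<Longrightarrow> g x \<in> carrier M"
    "\<And>x y. x \<in> carrier FG \<Longrightarrow> y \<in> carrier FG \<Longrightarrow> g (x \<oplus>\<^bsub>FG\<^esub> y) = g x \<oplus>\<^bsub>M\<^esub> g y"
    using FG_abelian_group gc gadd by auto
  have g0: "g 0 = \<zero>\<^bsub>M\<^esub>"
    using additive_map_zero_minus(1)[OF gmap(1) assms(1) gmap(2,3)] by simp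
  have gdiff: "g (a - b) = g a \<ominus>\<^bsub>M\<^esub> g b" if "Poly_Mapping.keys a \<subseteq> pairs" "Poly_Mapping.keys b \<subseteq> pairs" for a b
    using additive_map_zero_minus(3)[OF gmap(1) assms(1) gmap(2,3), of a b] that by simp
  have gK: "g d = \<zero>\<^bsub>M\<^esub>" if "d \<in> K" for d
    using that
  proof (induction rule: K_induct)
    case (rel d)
    have fr: "Poly_Mapping.keys (frag_of a) \<subseteq> pairs" if "a \<in> pairs" for a
      using that by simp
    have sub: "Poly_Mapping.keys (frag_of a - frag_of b) \<subseteq> pairs" if "a \<in> pairs" "b \<in> pairs" for a b
      using that by (intro keys_diff_subset) auto
    have g2: "g (frag_of a - frag_of b) = g (frag_of a) \<ominus>\<^bsub>M\<^esub> g (frag_of b)"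
      if "a \<in> pairs" "b \<in> pairs" for a b using that by (simp add: gdiff)
    have g3: "g (frag_of a - frag_of b - frag_of c) = (g (frag_of a) \<ominus>\<^bsub>M\<^esub> g (frag_of b)) \<ominus>\<^bsub>M\<^esub> g (frag_of c)"
      if "a \<in> pairs" "b \<in> pairs" "c \<in> pairs" for a b c using that by (simp add: gdiff sub)
    have cancel: "((a \<oplus>\<^bsub>M\<^esub> b) \<ominus>\<^bsub>M\<^esub> a) \<ominus>\<^bsub>M\<^esub> b = \<zero>\<^bsub>M\<^esub>" if "a \<in> carrier M" "b \<in> carrier M" for a b
      using that by (simp add: a_minus_def M.a_assoc M.a_comm[of a] M.r_neg M.r_neg1 M.r_neg2)
    consider p q x where "d = frag_of (p \<oplus>\<^bsub>P\<^esub> q, x) - frag_of (p, x) - frag_of (q, x)"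
        "p \<in> carrier P" "q \<in> carrier P" "x \<in> carrier N"
      | p x y where "d = frag_of (p, x \<oplus>\<^bsub>N\<^esub> y) - frag_of (p, x) - frag_of (p, y)"
        "p \<in> carrier P" "x \<in> carrier N" "y \<in> carrier N"
      | p s x where "d = frag_of (ract p s, x) - frag_of (p, s \<odot>\<^bsub>N\<^esub> x)"
        "p \<in> carrier P" "s \<in> carrier S" "x \<in> carrier N"
      using rel unfolding rels_def by (elim UnE CollectE exE conjE) metis+
    then show ?case
    proof cases
      case 1
      then show ?thesis by (simp add: g3 g_of add_l closed cancel)
    next
      case 2
      then show ?thesis by (simp add: g3 g_of add_r closed cancel)
    next
      case 3
      then show ?thesis by (simp add: g2 g_of ract_closed N.smult_closed bal closed a_minus_def M.r_neg)
    qed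
  next
    case (diff a b)
    then show ?case using C.a_subset by (subst gdiff) (auto simp: a_minus_def M.r_neg)
  qed (rule g0)
  \<comment> \<open>As g vanishes on the relations it is constant on each coset; h is that constant
    value.\<close>
  define h where "h X = the_elem (g ` X)" for X
  have h: "h (K +>\<^bsub>FG\<^esub> d) = g d" if d: "Poly_Mapping.keys d \<subseteq> pairs" for d
  proof -
    have "g e = g d" if "e \<in> K +>\<^bsub>FG\<^esub> d" for e
    proof -
      have e: "Poly_Mapping.keys e \<subseteq> pairs" "e - d \<in> K" using that d C.mem_rcos[of d e] by auto
      have "g e = g ((e - d) + d)" by simp
      also have "\<dots> = g d" using d keys_diff_subset[OF e(1) d] e(2) by (simp only: gadd gK gc M.l_zero)
      finally show ?thesis .
    qed
    moreover have "d \<in> K +>\<^bsub>FG\<^esub> d" using d by simp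
    ultimately have "g ` (K +>\<^bsub>FG\<^esub> d) = {g d}" by blast
    then show ?thesis by (simp add: h_def)
  qed
  show ?thesis
  proof (intro exI[of _ h] conjI ballI)
    show "h X \<in> carrier M" if "X \<in> carrier T" for X
      using that by (auto simp: in_T_iff h gc)
    show "h (X \<oplus>\<^bsub>T\<^esub> Y) = h X \<oplus>\<^bsub>M\<^esub> h Y" if "X \<in> carrier T" "Y \<in> carrier T" for X Y
      using that by (auto simp: in_T_iff h gadd T_add keys_add_subset)
    show "h (tens p x) = \<beta> p x" if "p \<in> carrier P" "x \<in> carrier N" for p x
      using that by (simp add: tens_def h g_of)
  qed
qed

end

text \<open>Maps u on P and v on N are treated together so that two constructions follow at once:
  the action of a scalar (v the identity) and the map induced by a homomorphism (u the
  identity).\<close>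

lemma frag_map_tensor:
  fixes u :: "'p \<Rightarrow> 'p" and v :: "'k \<Rightarrow> 'l" and N' :: "('s, 'l) module"
  assumes T1: "tensor_product R P S N ract" and T2: "tensor_product R P S N' ract"
    and u: "\<And>p. p \<in> carrier P \<Longrightarrow> u p \<in> carrier P"
      "\<And>p q. p \<in> carrier P \<Longrightarrow> q \<in> carrier P \<Longrightarrow> u (p \<oplus>\<^bsub>P\<^esub> q) = u p \<oplus>\<^bsub>P\<^esub> u q"
      "\<And>p s. p \<in> carrier P \<Longrightarrow> s \<in> carrier S \<Longrightarrow> u (ract p s) = ract (u p) s"
    and v: "\<And>x. x \<in> carrier N \<Longrightarrow> v x \<in> carrier N'"
      "\<And>x y. x \<in> carrier N \<Longrightarrow> y \<in> carrier N \<Longrightarrow> v (x \<oplus>\<^bsub>N\<^esub> y) = v x \<oplus>\<^bsub>N'\<^esub> v y"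
      "\<And>s x. s \<in> carrier S \<Longrightarrow> x \<in> carrier N \<Longrightarrow> v (s \<odot>\<^bsub>N\<^esub> x) = s \<odot>\<^bsub>N'\<^esub> v x"
  defines "E \<equiv> frag_extend (\<lambda>(p, x). frag_of (u p, v x))"
  assumes d: "Poly_Mapping.keys d \<subseteq> carrier P \<times> carrier N"
  shows "Poly_Mapping.keys (E d) \<subseteq> carrier P \<times> carrier N'"
    and "(\<Union>d\<in>tensor_sub P ract S N +>\<^bsub>tensor_product.FG P N\<^esub> d.
        tensor_sub P ract S N' +>\<^bsub>tensor_product.FG P N'\<^esub> E d)
      = tensor_sub P ract S N' +>\<^bsub>tensor_product.FG P N'\<^esub> E d"
proof -
  interpret T1: tensor_product R P S N ract by fact
  interpret T2: tensor_product R P S N' ract by fact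
  have E_of: "E (frag_of (p, x)) = frag_of (u p, v x)" for p x by (simp add: E_def)
  have E_diff: "E (a - b) = E a - E b" for a b by (simp add: E_def frag_extend_diff)
  have closed: "Poly_Mapping.keys (E d) \<subseteq> carrier P \<times> carrier N'"
    if "Poly_Mapping.keys d \<subseteq> carrier P \<times> carrier N" for d
    using that
  proof (induction d rule: free_Abelian_group_induct[consumes 1, case_names null diff of])
    case (diff a b)
    then show ?case unfolding E_diff by (intro T2.keys_diff_subset)
  qed (use u v in \<open>auto simp: E_of E_def\<close>)
  then show "Poly_Mapping.keys (E d) \<subseteq> carrier P \<times> carrier N'" using d .
  have EK: "E d \<in> T2.K" if "d \<in> T1.K" for d
    using that
  proof (induction rule: T1.K_induct)
    case (rel d)
    then consider p q x where "d = frag_of (p \<oplus>\<^bsub>P\<^esub> q, x) - frag_of (p, x) - frag_of (q, x)"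
        "p \<in> carrier P" "q \<in> carrier P" "x \<in> carrier N"
      | p x y where "d = frag_of (p, x \<oplus>\<^bsub>N\<^esub> y) - frag_of (p, x) - frag_of (p, y)"
        "p \<in> carrier P" "x \<in> carrier N" "y \<in> carrier N"
      | p s x where "d = frag_of (ract p s, x) - frag_of (p, s \<odot>\<^bsub>N\<^esub> x)"
        "p \<in> carrier P" "s \<in> carrier S" "x \<in> carrier N"
      unfolding T1.rels_def by (elim UnE CollectE exE conjE) metis+
    then show ?case
    proof cases
      case 1
      then show ?thesis
        by (intro T2.rels_in_K) (unfold T2.rels_def, rule UnI1, rule UnI1, rule CollectI,
            intro exI[of _ "u p"] exI[of _ "u q"] exI[of _ "v x"], simp add: E_diff E_of u v)
    next
      case 2
      then show ?thesis
        by (intro T2.rels_in_K) (unfold T2.rels_def, rule UnI1, rule UnI2, rule CollectI,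
            intro exI[of _ "u p"] exI[of _ "v x"] exI[of _ "v y"], simp add: E_diff E_of u v)
    next
      case 3
      then show ?thesis
        by (intro T2.rels_in_K) (unfold T2.rels_def, rule UnI2, rule CollectI,
            intro exI[of _ "u p"] exI[of _ s] exI[of _ "v x"], simp add: E_diff E_of u v)
    qed
  next
    case zero
    have "\<zero>\<^bsub>T2.FG\<^esub> \<in> T2.K" by (rule T2.C.zero_closed)
    then show ?case by (simp add: E_def)
  next
    case (diff a b)
    then have "E a \<oplus>\<^bsub>T2.FG\<^esub> (\<ominus>\<^bsub>T2.FG\<^esub> E b) \<in> T2.K" by (intro T2.C.a_closed T2.C.a_inv_closed)
    moreover have "Poly_Mapping.keys (E b) \<subseteq> carrier P \<times> carrier N'"
      using diff T2.C.a_subset by auto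
    ultimately show ?case by (simp add: E_diff)
  qed
  show "(\<Union>d\<in>T1.K +>\<^bsub>T1.FG\<^esub> d. T2.K +>\<^bsub>T2.FG\<^esub> E d) = T2.K +>\<^bsub>T2.FG\<^esub> E d"
  proof (rule T1.C.UN_rcos[OF _ T2.K_cosets])
    show "d \<in> carrier T1.FG" using d by simp
    fix x assume "x \<in> T1.K +>\<^bsub>T1.FG\<^esub> d"
    then have x: "Poly_Mapping.keys x \<subseteq> carrier P \<times> carrier N" "x - d \<in> T1.K"
      using T1.C.mem_rcos[of d x] d by auto
    then show "E x \<in> carrier T2.FG" using closed by simp
    show "E x \<ominus>\<^bsub>T2.FG\<^esub> E d \<in> T2.K" using EK[OF x(2)] closed x(1) d by (simp add: E_diff)
  qed
qed

context tensor_product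
begin

lemma smult_rcos:
  assumes r: "r \<in> carrier R" and d: "Poly_Mapping.keys d \<subseteq> pairs"
  shows "r \<odot>\<^bsub>T\<^esub> (K +>\<^bsub>FG\<^esub> d) = K +>\<^bsub>FG\<^esub> frag_extend (\<lambda>(p, x). frag_of (r \<odot>\<^bsub>P\<^esub> p, x)) d"
    and "Poly_Mapping.keys (frag_extend (\<lambda>(p, x). frag_of (r \<odot>\<^bsub>P\<^esub> p, x)) d) \<subseteq> pairs"
  using frag_map_tensor[OF tensor_product_axioms tensor_product_axioms, of "(\<odot>\<^bsub>P\<^esub>) r" "\<lambda>x. x" d]
  using r d P.smult_closed P.smult_r_distr ract_smult by (simp_all add: T_simps)

lemma smult_tens [simp]:
  assumes "r \<in> carrier R" "p \<in> carrier P" "x \<in> carrier N"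
  shows "r \<odot>\<^bsub>T\<^esub> tens p x = tens (r \<odot>\<^bsub>P\<^esub> p) x"
  using assms by (simp add: tens_def smult_rcos)

lemma T_smult_closed: "r \<in> carrier R \<Longrightarrow> X \<in> carrier T \<Longrightarrow> r \<odot>\<^bsub>T\<^esub> X \<in> carrier T"
  unfolding in_T_iff using smult_rcos by metis

lemma T_smult_add:
  assumes "r \<in> carrier R" "X \<in> carrier T" "Y \<in> carrier T"
  shows "r \<odot>\<^bsub>T\<^esub> (X \<oplus>\<^bsub>T\<^esub> Y) = r \<odot>\<^bsub>T\<^esub> X \<oplus>\<^bsub>T\<^esub> r \<odot>\<^bsub>T\<^esub> Y"
  using assms by (auto simp: in_T_iff smult_rcos T_add frag_extend_add keys_add_subset)

lemma T_left_module: "left_module R T"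
proof -
  interpret T: abelian_group T by (rule T_abelian_group)
  show ?thesis
  proof (intro left_module.intro left_module_axioms.intro P.R.ring_axioms T_abelian_group)
    fix a b X assume ab: "a \<in> carrier R" "b \<in> carrier R" and X: "X \<in> carrier T"
    show "(a \<oplus>\<^bsub>R\<^esub> b) \<odot>\<^bsub>T\<^esub> X = a \<odot>\<^bsub>T\<^esub> X \<oplus>\<^bsub>T\<^esub> b \<odot>\<^bsub>T\<^esub> X"
      using X
    proof (induction rule: T_induct)
      case (add X Y)
      then show ?case using ab by (simp add: T_smult_add T_smult_closed T.a_ac)
    next
      case (tens p x)
      then show ?case using ab by (simp add: P.smult_l_distr tens_add_l P.smult_closed)
    qed
    show "(a \<otimes>\<^bsub>R\<^esub> b) \<odot>\<^bsub>T\<^esub> X = a \<odot>\<^bsub>T\<^esub> (b \<odot>\<^bsub>T\<^esub> X)"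
      using X by (induction rule: T_induct)
        (use ab in \<open>simp_all add: P.smult_assoc P.smult_closed T_smult_add T_smult_closed\<close>)
  next
    fix X assume X: "X \<in> carrier T"
    show "\<one>\<^bsub>R\<^esub> \<odot>\<^bsub>T\<^esub> X = X"
      using X by (induction rule: T_induct) (simp_all add: P.smult_one T_smult_add)
  qed (simp_all add: T_smult_closed T_smult_add)
qed

lemma additive_map_eqI:
  assumes "abelian_group M" "X \<in> carrier T"
    and "\<And>X Y. X \<in> carrier T \<Longrightarrow> Y \<in> carrier T \<Longrightarrow> f (X \<oplus>\<^bsub>T\<^esub> Y) = f X \<oplus>\<^bsub>M\<^esub> f Y"
    and "\<And>X Y. X \<in> carrier T \<Longrightarrow> Y \<in> carrier T \<Longrightarrow> g (X \<oplus>\<^bsub>T\<^esub> Y) = g X \<oplus>\<^bsub>M\<^esub> g Y"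
    and "\<And>p x. p \<in> carrier P \<Longrightarrow> x \<in> carrier N \<Longrightarrow> f (tens p x) = g (tens p x)"
  shows "f X = g X"
  using assms(2) by (induction rule: T_induct) (use assms in auto)

lemma tensor_map_hom:
  assumes T2: "tensor_product R P S N' ract" and g: "g \<in> lmod_hom S N N'"
  shows "tensor_map P ract S N N' g \<in> lmod_hom R T (tensor_mod P ract S N')"
    and "p \<in> carrier P \<Longrightarrow> x \<in> carrier N \<Longrightarrow>
      tensor_map P ract S N N' g (tens p x) = tensor_product.tens P S N' ract p (g x)"
proof -
  interpret T2: tensor_product R P S N' ract by fact
  define E where "E = frag_extend (\<lambda>(p :: 'p, x). frag_of (p, g x))"
  have Ed: "Poly_Mapping.keys (E d) \<subseteq> carrier P \<times> carrier N'"
    "(\<Union>d\<in>K +>\<^bsub>FG\<^esub> d. T2.K +>\<^bsub>T2.FG\<^esub> E d) = T2.K +>\<^bsub>T2.FG\<^esub> E d"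
    if "Poly_Mapping.keys d \<subseteq> pairs" for d
    unfolding E_def
    using frag_map_tensor[OF tensor_product_axioms T2, of "\<lambda>p. p" g d] that lmod_homD[OF g]
    by simp_all
  have map: "tensor_map P ract S N N' g (K +>\<^bsub>FG\<^esub> d) = T2.K +>\<^bsub>T2.FG\<^esub> E d"
    if d: "Poly_Mapping.keys d \<subseteq> pairs" for d
  proof -
    have "K +>\<^bsub>FG\<^esub> d \<in> carrier T" using d by (auto simp: in_T_iff)
    then have "tensor_map P ract S N N' g (K +>\<^bsub>FG\<^esub> d) = (\<Union>d\<in>K +>\<^bsub>FG\<^esub> d. T2.K +>\<^bsub>T2.FG\<^esub> E d)"
      by (simp only: tensor_map_def restrict_apply if_True E_def a_r_coset_def T2.add_monoid_FG)
    then show ?thesis using Ed(2)[OF d] by simp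
  qed
  show tens: "tensor_map P ract S N N' g (tens p x) = T2.tens p (g x)"
    if "p \<in> carrier P" "x \<in> carrier N" for p x
    using that by (simp add: tens_def map T2.tens_def E_def)
  have closed: "tensor_map P ract S N N' g X \<in> carrier T2.T" if "X \<in> carrier T" for X
    using that Ed(1) map unfolding in_T_iff T2.in_T_iff by metis
  have add: "tensor_map P ract S N N' g (X \<oplus>\<^bsub>T\<^esub> Y) = tensor_map P ract S N N' g X \<oplus>\<^bsub>T2.T\<^esub> tensor_map P ract S N N' g Y"
    if "X \<in> carrier T" "Y \<in> carrier T" for X Y
    using that Ed(1) by (auto simp: in_T_iff map T_add T2.T_add keys_add_subset E_def frag_extend_add)
  show "tensor_map P ract S N N' g \<in> lmod_hom R T T2.T"
  proof (rule lmod_homI)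
    show "tensor_map P ract S N N' g \<in> carrier T \<rightarrow>\<^sub>E carrier T2.T"
      using closed by (auto simp: PiE_def extensional_def tensor_map_def)
    fix a X assume a: "a \<in> carrier R" and X: "X \<in> carrier T"
    show "tensor_map P ract S N N' g (a \<odot>\<^bsub>T\<^esub> X) = a \<odot>\<^bsub>T2.T\<^esub> tensor_map P ract S N N' g X"
      using X
      by (induction rule: T_induct)
        (use a lmod_homD[OF g] in \<open>simp_all add: T_smult_add T_smult_closed add T2.T_smult_add closed tens P.smult_closed\<close>)
  qed (rule add)
qed

end

section \<open>Whittaker vectors\<close>

text \<open>The \<open>b i\<close> behave like divided powers and w like the derivative: modulo Aw,
  multiplication by w lowers the index by one. The last assumption says that w is locally nilpotent
  on A/Aw. This is the data on which the Kashiwara-type argument rests.\<close>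

locale whittaker = ring A for A :: "'a calg" (structure) +
  fixes w :: 'a and b :: "nat \<Rightarrow> 'a"
  assumes w_closed [simp]: "w \<in> carrier A" and b_closed [simp]: "b i \<in> carrier A"
    and b_0: "b 0 = \<one>"
    and b_Suc: "\<exists>r\<in>carrier A. w \<otimes> b (Suc i) = b i \<oplus> r \<otimes> w"
    and nilpotent: "a \<in> carrier A \<Longrightarrow> \<exists>k. \<exists>r\<in>carrier A. w [^] (k::nat) \<otimes> a = r \<otimes> w"
begin

abbreviation J where "J \<equiv> left_ideal A w"
abbreviation P where "P \<equiv> whit_mod A w"
abbreviation H where "H \<equiv> ham_red A w"

lemma J_iff: "x \<in> J \<longleftrightarrow> (\<exists>a\<in>carrier A. x = a \<otimes> w)"
  by (auto simp: left_ideal_def)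

lemma J_subgroup: "additive_subgroup J A"
proof (rule additive_subgroup.intro, rule group.subgroupI[OF a_group])
  show "J \<subseteq> carrier (add_monoid A)" by (auto simp: J_iff)
  show "J \<noteq> {}" by (auto simp: left_ideal_def)
  show "inv\<^bsub>add_monoid A\<^esub> x \<in> J" if "x \<in> J" for x
  proof -
    from that obtain a where "a \<in> carrier A" "x = a \<otimes> w" by (auto simp: J_iff)
    then have "\<ominus> x = (\<ominus> a) \<otimes> w" "\<ominus> a \<in> carrier A" by (simp_all add: l_minus)
    then show ?thesis unfolding a_inv_def[symmetric] J_iff by blast
  qed
  show "x \<otimes>\<^bsub>add_monoid A\<^esub> y \<in> J" if "x \<in> J" "y \<in> J" for x y
  proof -
    from that obtain a c where "a \<in> carrier A" "x = a \<otimes> w" "c \<in> carrier A" "y = c \<otimes> w" by (auto simp: J_iff)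
    then have "x \<oplus> y = (a \<oplus> c) \<otimes> w" "a \<oplus> c \<in> carrier A" by (simp_all add: l_distr)
    then show ?thesis by (auto simp: J_iff)
  qed
qed

lemma J_cosets: "cosets J A"
  by (simp add: cosets_def J_subgroup abelian_group_axioms)

sublocale JC: cosets J A by (rule J_cosets)

lemma J_left [intro]: "a \<in> carrier A \<Longrightarrow> x \<in> J \<Longrightarrow> a \<otimes> x \<in> J"
  by (auto simp: J_iff m_assoc[symmetric])

lemma P_simps:
  "carrier P = a_rcosets J" "add P = set_add A" "ring.zero P = J"
  "smult P a X = (\<Union>b\<in>X. J +> (a \<otimes> b))"
  by (simp_all add: whit_mod_def Let_def)

lemma in_P_iff: "X \<in> carrier P \<longleftrightarrow> (\<exists>a\<in>carrier A. X = J +> a)"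
  by (simp add: P_simps JC.mem_a_rcosets)

lemma P_add: "a \<in> carrier A \<Longrightarrow> c \<in> carrier A \<Longrightarrow> (J +> a) \<oplus>\<^bsub>P\<^esub> (J +> c) = J +> (a \<oplus> c)"
  by (simp add: P_simps JC.rcos_add)

lemma P_smult:
  assumes "a \<in> carrier A" "x \<in> carrier A" shows "a \<odot>\<^bsub>P\<^esub> (J +> x) = J +> (a \<otimes> x)"
  unfolding P_simps
proof (rule JC.UN_rcos[OF _ J_cosets])
  fix y assume "y \<in> J +> x"
  then have y: "y \<in> carrier A" "y \<ominus> x \<in> J" using assms JC.mem_rcos by auto
  then show "a \<otimes> y \<in> carrier A" using assms by simp
  have "a \<otimes> y \<ominus> a \<otimes> x = a \<otimes> (y \<ominus> x)" using assms y by (simp add: minus_eq r_distr r_minus)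
  then show "a \<otimes> y \<ominus> a \<otimes> x \<in> J" using J_left assms y by auto
qed (fact assms)

lemma P_abelian_group: "abelian_group P"
  by (rule JC.coset_abelian_group) (simp_all add: P_simps)

lemma P_left_module: "left_module A P"
proof (intro left_module.intro left_module_axioms.intro ring_axioms P_abelian_group)
qed (auto simp: in_P_iff P_smult P_add l_distr r_distr m_assoc)

sublocale PM: left_module A P by (rule P_left_module)

lemma P_zero: "\<zero>\<^bsub>P\<^esub> = J" by (simp add: P_simps)

lemma rcos_eq_zero_iff: "a \<in> carrier A \<Longrightarrow> J +> a = \<zero>\<^bsub>P\<^esub> \<longleftrightarrow> a \<in> J"
  by (simp add: P_zero JC.rcos_eq_self_iff)

lemma H_simps:
  "carrier H = {X \<in> carrier P. w \<odot>\<^bsub>P\<^esub> X = \<zero>\<^bsub>P\<^esub>}" "mult H = rcoset_mult A J" "one H = J +> \<one>"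
  "add H = set_add A" "ring.zero H = J" "smult H k X = (\<Union>a\<in>X. J +> (k \<odot>\<^bsub>A\<^esub> a))"
  by (simp_all add: ham_red_def Let_def)

lemma in_H_iff: "X \<in> carrier H \<longleftrightarrow> (\<exists>a\<in>carrier A. X = J +> a \<and> w \<otimes> a \<in> J)"
proof -
  have "w \<odot>\<^bsub>P\<^esub> (J +> a) = \<zero>\<^bsub>P\<^esub> \<longleftrightarrow> w \<otimes> a \<in> J" if "a \<in> carrier A" for a
    using that by (simp add: P_smult rcos_eq_zero_iff)
  then show ?thesis unfolding H_simps(1) mem_Collect_eq in_P_iff by metis
qed

text \<open>Changing the left factor by r w changes the product by r w a, which lies in Aw exactly
  because a represents an element of the reduction. Changes of the right factor by multiples of w
  are harmless.\<close>

lemma rcoset_mult_H: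
  assumes x: "x \<in> carrier A" and a: "a \<in> carrier A" "w \<otimes> a \<in> J"
  shows "rcoset_mult A J (J +> x) (J +> a) = J +> (x \<otimes> a)"
proof -
  have "J +> (y \<otimes> c) = J +> (x \<otimes> a)" if "y \<in> J +> x" "c \<in> J +> a" for y c
  proof -
    from that x a obtain r s where r: "r \<in> carrier A" "y = r \<otimes> w \<oplus> x" and s: "s \<in> carrier A" "c = s \<otimes> w \<oplus> a"
      by (auto simp: a_r_coset_def' J_iff)
    have eq: "y \<otimes> c \<ominus> x \<otimes> a = (y \<otimes> s) \<otimes> w \<oplus> r \<otimes> (w \<otimes> a)"
    proof -
      have "y \<otimes> c = y \<otimes> (s \<otimes> w) \<oplus> (r \<otimes> (w \<otimes> a) \<oplus> x \<otimes> a)"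
        using r s x a by (simp add: r_distr l_distr m_assoc)
      then show ?thesis
        using r s x a by (simp add: minus_eq a_assoc r_neg m_assoc)
    qed
    have "y \<in> carrier A" using r x by simp
    then have "(y \<otimes> s) \<otimes> w \<in> J" using s unfolding J_iff by (intro bexI[of _ "y \<otimes> s"]) simp_all
    then have "y \<otimes> c \<ominus> x \<otimes> a \<in> J"
      unfolding eq using J_left[OF r(1) a(2)] by (rule JC.a_closed)
    then show ?thesis using r s x a by (subst JC.rcos_eq_iff) auto
  qed
  then show ?thesis
    unfolding rcoset_mult_def
    using JC.rcos_self[OF x] JC.rcos_self[OF a(1)] by blast
qed

lemma pow_split: "w [^] (i + j :: nat) = w [^] i \<otimes> w [^] j"
  by (simp add: nat_pow_mult)

end

section \<open>Decomposition of a module by the powers of w\<close>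

locale whittaker_module = whittaker A w b + M: left_module A M
  for A :: "'a calg" (structure) and w b and M :: "('a, 'm) module"
begin

definition killed :: "nat \<Rightarrow> 'm \<Rightarrow> bool" where
  "killed k x \<longleftrightarrow> x \<in> carrier M \<and> (w [^] k) \<odot>\<^bsub>M\<^esub> x = \<zero>\<^bsub>M\<^esub>"

definition whit :: "'m set" where
  "whit = {x \<in> carrier M. w \<odot>\<^bsub>M\<^esub> x = \<zero>\<^bsub>M\<^esub>}"

lemma killed_0: "killed 0 x \<longleftrightarrow> x = \<zero>\<^bsub>M\<^esub>"
  by (auto simp: killed_def M.smult_one)

lemma killed_1: "killed (Suc 0) x \<longleftrightarrow> x \<in> whit"
  by (auto simp: killed_def whit_def)

lemma killed_mono: "killed k x \<Longrightarrow> k \<le> l \<Longrightarrow> killed l x"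
  unfolding killed_def using pow_split[of "l - k" k] by (auto simp: M.smult_assoc)

lemma killed_pow: "killed (i + j) x \<Longrightarrow> killed i (w [^] j \<odot>\<^bsub>M\<^esub> x)"
  unfolding killed_def by (auto simp: pow_split M.smult_assoc M.smult_closed)

lemma killed_add: "killed k x \<Longrightarrow> killed k y \<Longrightarrow> killed k (x \<oplus>\<^bsub>M\<^esub> y)"
  by (auto simp: killed_def M.smult_r_distr)

lemma J_whit: "x \<in> whit \<Longrightarrow> j \<in> J \<Longrightarrow> j \<odot>\<^bsub>M\<^esub> x = \<zero>\<^bsub>M\<^esub>"
  by (auto simp: whit_def J_iff M.smult_assoc)

lemma rcos_whit:
  assumes "x \<in> whit" "a \<in> carrier A" "c \<in> J +> a" shows "c \<odot>\<^bsub>M\<^esub> x = a \<odot>\<^bsub>M\<^esub> x"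
proof -
  obtain j where j: "j \<in> J" "c = j \<oplus> a" using assms by (auto simp: a_r_coset_def')
  then show ?thesis
    using assms J_whit[OF assms(1) j(1)] JC.a_Hcarr[OF j(1)] by (auto simp: M.smult_l_distr whit_def M.smult_closed)
qed

lemma the_elem_whit:
  assumes "x \<in> whit" "a \<in> carrier A" shows "the_elem ((\<lambda>a. a \<odot>\<^bsub>M\<^esub> x) ` (J +> a)) = a \<odot>\<^bsub>M\<^esub> x"
proof -
  have "(\<lambda>a. a \<odot>\<^bsub>M\<^esub> x) ` (J +> a) = {a \<odot>\<^bsub>M\<^esub> x}"
    using rcos_whit[OF assms] JC.rcos_self[OF assms(2)] by blast
  then show ?thesis by simp
qed

text \<open>By \<open>b_Suc\<close>, w lowers the index of b by one, since the error term ends in w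
  and so annihilates x. After i steps only b_0 x = x is left.\<close>

lemma pow_b_whit: "x \<in> whit \<Longrightarrow> w [^] i \<odot>\<^bsub>M\<^esub> (b i \<odot>\<^bsub>M\<^esub> x) = x"
proof (induction i)
  case 0
  then show ?case by (simp add: b_0 whit_def M.smult_one)
next
  case (Suc i)
  then have x: "x \<in> carrier M" "w \<odot>\<^bsub>M\<^esub> x = \<zero>\<^bsub>M\<^esub>" by (auto simp: whit_def)
  obtain r where r: "r \<in> carrier A" "w \<otimes> b (Suc i) = b i \<oplus> r \<otimes> w" using b_Suc by blast
  have "w \<odot>\<^bsub>M\<^esub> (b (Suc i) \<odot>\<^bsub>M\<^esub> x) = b i \<odot>\<^bsub>M\<^esub> x"
    using x r by (simp add: M.smult_assoc[symmetric] M.smult_l_distr) (simp add: M.smult_assoc M.smult_closed)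
  then show ?case
    using Suc x by (simp add: M.smult_assoc M.smult_closed)
qed

end

context whittaker begin

text \<open>On vectors killed by \<open>w\<^sup>k\<^sup>+\<^sup>1\<close>, \<open>proj k\<close> is the projection onto the \<open>b\<^sub>0\<close>-component of the
  decomposition of a module into the subspaces \<open>b\<^sub>i \<cdot> ker w\<close>.\<close>

primrec proj :: "nat \<Rightarrow> 'a" where
  "proj 0 = \<one>"
| "proj (Suc k) = proj k \<otimes> (\<one> \<ominus> b (Suc k) \<otimes> w [^] Suc k)"

lemma proj_closed [simp]: "proj k \<in> carrier A"
  by (induction k) auto

end

context whittaker_module begin

text \<open>The extra factor of \<open>proj (Suc k)\<close> is 1 minus a multiple of w^(k+1) and
  acts as the identity here. Hence \<open>proj k\<close> stabilises as k grows and its value does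
  not depend on the exponent chosen for a vector.\<close>

lemma proj_killed: "killed (Suc k) x \<Longrightarrow> proj (Suc k) \<odot>\<^bsub>M\<^esub> x = proj k \<odot>\<^bsub>M\<^esub> x"
  unfolding killed_def
  by (simp add: M.smult_assoc M.smult_diff_l M.smult_one del: nat_pow_Suc)

lemma proj_stable: "killed (Suc k) x \<Longrightarrow> k \<le> l \<Longrightarrow> proj l \<odot>\<^bsub>M\<^esub> x = proj k \<odot>\<^bsub>M\<^esub> x"
proof (induction l)
  case (Suc l)
  show ?case
  proof (cases "k = Suc l")
    case False
    then have "killed (Suc l) x" "k \<le> l" using Suc.prems killed_mono by auto
    then show ?thesis using proj_killed Suc by metis
  qed simp
qed simp

lemma proj_whit: "x \<in> whit \<Longrightarrow> proj k \<odot>\<^bsub>M\<^esub> x = x"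
  using proj_stable[of 0 x k] by (simp add: killed_1 M.smult_one whit_def)

text \<open>Subtracting b_(k+1) w^(k+1) x lowers the annihilating exponent by one: w^(k+1) x lies in
  ker w, and there w^(k+1) b_(k+1) is the identity by \<open>pow_b_whit\<close>.\<close>

lemma proj_in_whit: "killed (Suc k) x \<Longrightarrow> proj k \<odot>\<^bsub>M\<^esub> x \<in> whit"
proof (induction k arbitrary: x)
  case 0
  then show ?case by (simp add: killed_1 whit_def M.smult_one)
next
  case (Suc k)
  then have x: "x \<in> carrier M" by (simp add: killed_def)
  have wx: "w [^] Suc k \<odot>\<^bsub>M\<^esub> x \<in> whit"
    using killed_pow[of "Suc 0" "Suc k" x] Suc.prems by (simp add: killed_1)
  then have wxc: "w [^] Suc k \<odot>\<^bsub>M\<^esub> x \<in> carrier M" by (simp add: whit_def)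
  define y where "y = x \<ominus>\<^bsub>M\<^esub> b (Suc k) \<odot>\<^bsub>M\<^esub> (w [^] Suc k \<odot>\<^bsub>M\<^esub> x)"
  have y: "y \<in> carrier M" using x wxc by (simp add: y_def M.smult_closed)
  have "w [^] Suc k \<odot>\<^bsub>M\<^esub> y = w [^] Suc k \<odot>\<^bsub>M\<^esub> x \<ominus>\<^bsub>M\<^esub> w [^] Suc k \<odot>\<^bsub>M\<^esub> x"
    unfolding y_def using x wxc
    by (subst M.smult_diff_r, simp_all only: M.smult_closed b_closed nat_pow_closed w_closed pow_b_whit[OF wx])
  then have "w [^] Suc k \<odot>\<^bsub>M\<^esub> y = \<zero>\<^bsub>M\<^esub>"
    using wxc by (simp only: M.M.minus_eq_zero_iff)
  then have "proj k \<odot>\<^bsub>M\<^esub> y \<in> whit" using y by (intro Suc.IH) (simp add: killed_def)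
  moreover have "proj (Suc k) \<odot>\<^bsub>M\<^esub> x = proj k \<odot>\<^bsub>M\<^esub> y"
    using x by (simp add: y_def M.smult_assoc M.smult_diff_l M.smult_one M.smult_closed del: nat_pow_Suc)
  ultimately show ?case by simp
qed

text \<open>If w^(k+1) annihilates x, then w^k x is a Whittaker vector and x - b_k w^k x is
  annihilated by w^k. Peeling off these top components writes x as a sum of terms b_i v with v in
  ker w.\<close>

lemma killed_induct [consumes 1, case_names b add]:
  assumes x: "killed k x"
    and b: "\<And>i x. x \<in> whit \<Longrightarrow> Q (b i \<odot>\<^bsub>M\<^esub> x)"
    and add: "\<And>x y. x \<in> carrier M \<Longrightarrow> y \<in> carrier M \<Longrightarrow> Q x \<Longrightarrow> Q y \<Longrightarrow> Q (x \<oplus>\<^bsub>M\<^esub> y)"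
  shows "Q x"
  using x
proof (induction k arbitrary: x)
  case 0
  then have "x \<in> whit" "b 0 \<odot>\<^bsub>M\<^esub> x = x" by (simp_all add: killed_0 whit_def)
  then show ?case using b[of x 0] by simp
next
  case (Suc k)
  then have x: "x \<in> carrier M" by (simp add: killed_def)
  have wx: "w [^] k \<odot>\<^bsub>M\<^esub> x \<in> whit"
    using killed_pow[of "Suc 0" k x] Suc.prems by (simp add: killed_1)
  then have wxc: "w [^] k \<odot>\<^bsub>M\<^esub> x \<in> carrier M" by (simp add: whit_def)
  define y where "y = x \<ominus>\<^bsub>M\<^esub> b k \<odot>\<^bsub>M\<^esub> (w [^] k \<odot>\<^bsub>M\<^esub> x)"
  have y: "y \<in> carrier M" using x wxc by (simp add: y_def M.smult_closed)
  have "w [^] k \<odot>\<^bsub>M\<^esub> y = \<zero>\<^bsub>M\<^esub>"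
    unfolding y_def using x wxc
    by (subst M.smult_diff_r) (auto simp: M.smult_closed pow_b_whit[OF wx] a_minus_def M.M.r_neg)
  then have "Q y" using y by (intro Suc.IH) (simp add: killed_def)
  moreover have "x = y \<oplus>\<^bsub>M\<^esub> b k \<odot>\<^bsub>M\<^esub> (w [^] k \<odot>\<^bsub>M\<^esub> x)"
    using x wxc by (simp add: y_def a_minus_def M.M.a_assoc M.M.l_neg M.smult_closed)
  ultimately show ?case using add[OF y _ _ b[OF wx]] wxc M.smult_closed b_closed by metis
qed

end

section \<open>The module structure of Wh and the bimodule A/Aw\<close>

locale whittaker_iso = whittaker A w b + S: ring S
  for A :: "'a calg" (structure) and w b and S :: "'s calg" +
  fixes \<phi> :: "'s \<Rightarrow> 'a set"
  assumes iso: "\<phi> \<in> ring_iso S (ham_red A w)"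
begin

abbreviation ract where "ract \<equiv> whit_ract A w \<phi>"

lemma phi_rep:
  assumes "s \<in> carrier S"
  obtains a where "a \<in> carrier A" "w \<otimes> a \<in> J" "\<phi> s = J +> a"
  using ring_iso_memE(1)[OF iso assms] in_H_iff that by blast

lemma phi_inj: "s \<in> carrier S \<Longrightarrow> t \<in> carrier S \<Longrightarrow> \<phi> s = \<phi> t \<Longrightarrow> s = t"
  using ring_iso_memE(5)[OF iso] by (auto simp: bij_betw_def inj_on_def)

lemma phi_one: "\<phi> \<one>\<^bsub>S\<^esub> = J +> \<one>"
  using ring_iso_memE(4)[OF iso] by (simp add: H_simps)

lemma phi_add:
  assumes "s \<in> carrier S" "t \<in> carrier S" "a \<in> carrier A" "c \<in> carrier A" "\<phi> s = J +> a" "\<phi> t = J +> c"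
  shows "\<phi> (s \<oplus>\<^bsub>S\<^esub> t) = J +> (a \<oplus> c)"
  using ring_iso_memE(3)[OF iso assms(1,2)] assms by (simp add: H_simps JC.rcos_add)

lemma phi_mult:
  assumes "s \<in> carrier S" "t \<in> carrier S" "a \<in> carrier A" "c \<in> carrier A" "w \<otimes> c \<in> J"
    "\<phi> s = J +> a" "\<phi> t = J +> c"
  shows "\<phi> (s \<otimes>\<^bsub>S\<^esub> t) = J +> (a \<otimes> c)"
  using ring_iso_memE(2)[OF iso assms(1,2)] assms by (simp add: H_simps rcoset_mult_H)

lemma ract_rcos:
  assumes "x \<in> carrier A" "a \<in> carrier A" "w \<otimes> a \<in> J" "\<phi> s = J +> a"
  shows "ract (J +> x) s = J +> (x \<otimes> a)"
  using assms by (simp add: whit_ract_def rcoset_mult_H)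

lemma ract_one: "s \<in> carrier S \<Longrightarrow> ract (J +> \<one>) s = \<phi> s"
  by (rule phi_rep[of s]) (simp_all add: ract_rcos)

lemma tensor_product_whit:
  assumes "left_module S N" shows "tensor_product A P S N ract"
proof (intro tensor_product.intro tensor_product_axioms.intro P_left_module assms)
  fix p s assume p: "p \<in> carrier P" and s: "s \<in> carrier S"
  obtain x where x: "x \<in> carrier A" "p = J +> x" using p in_P_iff by blast
  obtain a where a: "a \<in> carrier A" "w \<otimes> a \<in> J" "\<phi> s = J +> a" using s by (rule phi_rep)
  show "ract p s \<in> carrier P" using x a by (auto simp: ract_rcos in_P_iff)
  show "ract (r \<odot>\<^bsub>P\<^esub> p) s = r \<odot>\<^bsub>P\<^esub> ract p s" if "r \<in> carrier A" for r
    using x a that by (simp add: ract_rcos P_smult m_assoc)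
qed

lemma Wh_simps:
  "carrier (Wh A w \<phi> M) = {x \<in> carrier M. w \<odot>\<^bsub>M\<^esub> x = \<zero>\<^bsub>M\<^esub>}" "ring.zero (Wh A w \<phi> M) = \<zero>\<^bsub>M\<^esub>"
  "add (Wh A w \<phi> M) = add M" "smult (Wh A w \<phi> M) s x = the_elem ((\<lambda>a. a \<odot>\<^bsub>M\<^esub> x) ` \<phi> s)"
  by (simp_all add: Wh_def)

end

locale whittaker_iso_module = whittaker_iso A w b S \<phi> + whittaker_module A w b M
  for A :: "'a calg" (structure) and w b and S :: "'s calg" and \<phi> and M :: "('a, 'm) module"
begin

lemma Wh_carrier: "carrier (Wh A w \<phi> M) = whit"
  by (simp add: Wh_simps whit_def)

lemma Wh_smult: "x \<in> whit \<Longrightarrow> a \<in> carrier A \<Longrightarrow> \<phi> s = J +> a \<Longrightarrow> s \<odot>\<^bsub>Wh A w \<phi> M\<^esub> x = a \<odot>\<^bsub>M\<^esub> x"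
  by (simp add: Wh_simps the_elem_whit)

lemma whit_smult_closed:
  assumes "x \<in> whit" "a \<in> carrier A" "w \<otimes> a \<in> J" shows "a \<odot>\<^bsub>M\<^esub> x \<in> whit"
  using assms J_whit[of x "w \<otimes> a"] by (simp add: whit_def M.smult_closed M.smult_assoc)

lemma whit_add: "x \<in> whit \<Longrightarrow> y \<in> whit \<Longrightarrow> x \<oplus>\<^bsub>M\<^esub> y \<in> whit"
  by (simp add: whit_def M.smult_r_distr)

lemma Wh_abelian_group: "abelian_group (Wh A w \<phi> M)"
proof (rule abelian_groupI)
  fix x assume "x \<in> carrier (Wh A w \<phi> M)"
  then have "\<ominus>\<^bsub>M\<^esub> x \<in> whit" "\<ominus>\<^bsub>M\<^esub> x \<oplus>\<^bsub>M\<^esub> x = \<zero>\<^bsub>M\<^esub>"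
    by (auto simp: Wh_carrier whit_def M.smult_minus_r M.M.l_neg)
  then show "\<exists>y\<in>carrier (Wh A w \<phi> M). y \<oplus>\<^bsub>Wh A w \<phi> M\<^esub> x = \<zero>\<^bsub>Wh A w \<phi> M\<^esub>"
    unfolding Wh_carrier by (auto simp: Wh_simps)
qed (auto simp: Wh_simps M.smult_r_distr M.M.a_ac)

lemma Wh_left_module: "left_module S (Wh A w \<phi> M)"
proof (intro left_module.intro left_module_axioms.intro Wh_abelian_group S.ring_axioms)
  let ?W = "Wh A w \<phi> M"
  fix s x assume s: "s \<in> carrier S" and "x \<in> carrier ?W"
  then have x: "x \<in> whit" "x \<in> carrier M" by (simp_all add: Wh_carrier whit_def)
  obtain a where a: "a \<in> carrier A" "w \<otimes> a \<in> J" "\<phi> s = J +> a" using s by (rule phi_rep)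
  show "s \<odot>\<^bsub>?W\<^esub> x \<in> carrier ?W"
    using x a by (simp add: Wh_smult Wh_carrier whit_smult_closed)
  show "s \<odot>\<^bsub>?W\<^esub> (x \<oplus>\<^bsub>?W\<^esub> y) = s \<odot>\<^bsub>?W\<^esub> x \<oplus>\<^bsub>?W\<^esub> s \<odot>\<^bsub>?W\<^esub> y" if "y \<in> carrier ?W" for y
  proof -
    have y: "y \<in> whit" "y \<in> carrier M" using that by (simp_all add: Wh_carrier whit_def)
    then show ?thesis
      using x a whit_add[of x y] by (simp add: Wh_smult Wh_simps(3) M.smult_r_distr)
  qed
  fix t assume t: "t \<in> carrier S"
  obtain c where c: "c \<in> carrier A" "w \<otimes> c \<in> J" "\<phi> t = J +> c" using t by (rule phi_rep)
  show "(s \<oplus>\<^bsub>S\<^esub> t) \<odot>\<^bsub>?W\<^esub> x = s \<odot>\<^bsub>?W\<^esub> x \<oplus>\<^bsub>?W\<^esub> t \<odot>\<^bsub>?W\<^esub> x"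
    using Wh_smult[OF x(1) _ phi_add[OF s t a(1) c(1) a(3) c(3)]] x a c
    by (simp add: Wh_smult Wh_simps(3) M.smult_l_distr)
  show "(s \<otimes>\<^bsub>S\<^esub> t) \<odot>\<^bsub>?W\<^esub> x = s \<odot>\<^bsub>?W\<^esub> (t \<odot>\<^bsub>?W\<^esub> x)"
    using Wh_smult[OF x(1) _ phi_mult[OF s t a(1) c(1,2) a(3) c(3)]] x a c whit_smult_closed[OF x(1) c(1,2)]
    by (simp add: Wh_smult M.smult_assoc)
next
  fix x assume "x \<in> carrier (Wh A w \<phi> M)"
  then show "\<one>\<^bsub>S\<^esub> \<odot>\<^bsub>Wh A w \<phi> M\<^esub> x = x"
    using Wh_smult[of x \<one> "\<one>\<^bsub>S\<^esub>"] phi_one by (simp add: Wh_carrier M.smult_one whit_def)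
qed

lemma Wh_tensor_product: "tensor_product A P S (Wh A w \<phi> M) ract"
  by (rule tensor_product_whit) (rule Wh_left_module)

definition locally_killed :: bool where
  "locally_killed \<longleftrightarrow> (\<forall>x\<in>carrier M. \<exists>k. killed k x)"

lemma locally_killed_iff: "locally_killed \<longleftrightarrow> M \<in> loc_nilp_mods A w"
  using M.left_module_axioms
  by (auto simp: locally_killed_def loc_nilp_mods_def killed_def M.smult_funpow)

text \<open>The counit is the action map. The product a x depends only on the coset of a because x
  is annihilated by w, and balancing is the definition of the action on Wh.\<close>

lemma counit_exists:
  defines "T \<equiv> Ind A w S \<phi> (Wh A w \<phi> M)"
  obtains h where "h \<in> lmod_hom A T M"
    and "\<And>a x. a \<in> carrier A \<Longrightarrow> x \<in> whit \<Longrightarrow>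
      h (tensor_product.tens P S (Wh A w \<phi> M) ract (J +> a) x) = a \<odot>\<^bsub>M\<^esub> x"
proof -
  interpret T: tensor_product A P S "Wh A w \<phi> M" ract by (rule Wh_tensor_product)
  let ?W = "Wh A w \<phi> M"
  define \<beta> where "\<beta> p x = the_elem ((\<lambda>a. a \<odot>\<^bsub>M\<^esub> x) ` p)" for p :: "'a set" and x
  have \<beta>: "\<beta> (J +> a) x = a \<odot>\<^bsub>M\<^esub> x" if "a \<in> carrier A" "x \<in> whit" for a x
    using that by (simp add: \<beta>_def the_elem_whit)
  have wM: "x \<in> whit \<Longrightarrow> x \<in> carrier M" for x by (simp add: whit_def)
  have "\<exists>h. (\<forall>X\<in>carrier T.T. h X \<in> carrier M) \<and>
    (\<forall>X\<in>carrier T.T. \<forall>Y\<in>carrier T.T. h (X \<oplus>\<^bsub>T.T\<^esub> Y) = h X \<oplus>\<^bsub>M\<^esub> h Y) \<and>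
    (\<forall>p\<in>carrier P. \<forall>x\<in>carrier ?W. h (T.tens p x) = \<beta> p x)"
  proof (rule T.tensor_lift[OF M.M.abelian_group_axioms])
    show "\<beta> p x \<in> carrier M" if "p \<in> carrier P" "x \<in> carrier ?W" for p x
      using that by (auto simp: in_P_iff Wh_carrier \<beta> wM M.smult_closed)
    show "\<beta> (p \<oplus>\<^bsub>P\<^esub> q) x = \<beta> p x \<oplus>\<^bsub>M\<^esub> \<beta> q x"
      if "p \<in> carrier P" "q \<in> carrier P" "x \<in> carrier ?W" for p q x
      using that by (auto simp: in_P_iff Wh_carrier \<beta> wM P_add M.smult_l_distr)
    show "\<beta> p (x \<oplus>\<^bsub>?W\<^esub> y) = \<beta> p x \<oplus>\<^bsub>M\<^esub> \<beta> p y"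
      if "p \<in> carrier P" "x \<in> carrier ?W" "y \<in> carrier ?W" for p x y
      using that by (auto simp: in_P_iff Wh_carrier Wh_simps(3) \<beta> wM whit_add M.smult_r_distr)
    show "\<beta> (ract p s) x = \<beta> p (s \<odot>\<^bsub>?W\<^esub> x)"
      if p: "p \<in> carrier P" and s: "s \<in> carrier S" and x: "x \<in> carrier ?W" for p s x
    proof -
      obtain c where c: "c \<in> carrier A" "p = J +> c" using p in_P_iff by blast
      obtain a where a: "a \<in> carrier A" "w \<otimes> a \<in> J" "\<phi> s = J +> a" using s by (rule phi_rep)
      show ?thesis
        using a c x whit_smult_closed[of x a]
        by (simp add: ract_rcos \<beta> Wh_smult Wh_carrier wM M.smult_assoc)
    qed
  qed
  then obtain h where h': "(\<forall>X\<in>carrier T.T. h X \<in> carrier M) \<and>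
    (\<forall>X\<in>carrier T.T. \<forall>Y\<in>carrier T.T. h (X \<oplus>\<^bsub>T.T\<^esub> Y) = h X \<oplus>\<^bsub>M\<^esub> h Y) \<and>
    (\<forall>p\<in>carrier P. \<forall>x\<in>carrier ?W. h (T.tens p x) = \<beta> p x)" ..
  note h = h'[THEN conjunct1, rule_format] h'[THEN conjunct2, THEN conjunct1, rule_format]
    h'[THEN conjunct2, THEN conjunct2, rule_format]
  have h_tens: "h (T.tens (J +> a) x) = a \<odot>\<^bsub>M\<^esub> x" if "a \<in> carrier A" "x \<in> whit" for a x
  proof -
    have "J +> a \<in> carrier P" using that in_P_iff by blast
    then show ?thesis using that by (simp add: h(3) \<beta> Wh_carrier)
  qed
  have h_smult: "h (r \<odot>\<^bsub>T.T\<^esub> X) = r \<odot>\<^bsub>M\<^esub> h X" if r: "r \<in> carrier A" and X: "X \<in> carrier T.T" for r X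
    using X
  proof (induction rule: T.T_induct)
    case (add X Y)
    then show ?case using r h(1,2) by (simp add: T.T_smult_add T.T_smult_closed M.smult_r_distr)
  next
    case (tens p x)
    then obtain a where a: "a \<in> carrier A" "p = J +> a" using in_P_iff by blast
    then show ?case
      using r tens by (simp add: P_smult h_tens Wh_carrier wM M.smult_assoc)
  qed
  show ?thesis
  proof (rule that[of "restrict h (carrier T)"])
    show "restrict h (carrier T) \<in> lmod_hom A T M"
      by (rule lmod_homI)
        (use h h_smult T.T_left_module T.T_smult_closed in
          \<open>auto simp: T_def Ind_def abelian_groupE(1)[OF T.T_abelian_group]\<close>)
    fix a x assume a: "a \<in> carrier A" "x \<in> whit"
    then have "J +> a \<in> carrier P" using in_P_iff by blast
    then have "T.tens (J +> a) x \<in> carrier T" using a by (simp add: T_def Ind_def Wh_carrier)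
    then show "restrict h (carrier T) (T.tens (J +> a) x) = a \<odot>\<^bsub>M\<^esub> x" using h_tens[OF a] by simp
  qed
qed

end

context whittaker begin

sublocale PW: whittaker_module A w b P
  by (rule whittaker_module.intro) (rule whittaker_axioms, rule P_left_module)

lemma PW_killed: "p \<in> carrier P \<Longrightarrow> \<exists>k. PW.killed (Suc k) p"
proof -
  assume p: "p \<in> carrier P"
  then obtain a where a: "a \<in> carrier A" "p = J +> a" using in_P_iff by blast
  obtain k r where k: "r \<in> carrier A" "w [^] (k::nat) \<otimes> a = r \<otimes> w" using nilpotent[OF a(1)] by blast
  then have "w [^] k \<otimes> a \<in> J" unfolding J_iff by blast
  then have "PW.killed k p"
    using a p by (simp add: PW.killed_def P_smult rcos_eq_zero_iff)
  then show ?thesis using PW.killed_mono[of k p "Suc k"] by auto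
qed

lemma PW_whit: "PW.whit = carrier H"
  by (simp add: PW.whit_def H_simps)

end

context whittaker_iso begin

text \<open>The projection of A/Aw onto its Whittaker vectors, read in S through the inverse of
  \<open>\<phi>\<close>. It splits the inclusion of S into A/Aw and will make the unit injective.
  Any admissible k gives the same value by \<open>proj_stable\<close>, so the description is
  unambiguous.\<close>

definition kappa :: "'a set \<Rightarrow> 's" where
  "kappa p = (THE s. s \<in> carrier S \<and> (\<exists>k. PW.killed (Suc k) p \<and> \<phi> s = proj k \<odot>\<^bsub>P\<^esub> p))"

lemma kappa:
  assumes k: "PW.killed (Suc k) p"
  shows kappa_closed: "kappa p \<in> carrier S" and phi_kappa: "\<phi> (kappa p) = proj k \<odot>\<^bsub>P\<^esub> p"
proof -
  have "proj k \<odot>\<^bsub>P\<^esub> p \<in> carrier H" using PW.proj_in_whit[OF k] PW_whit by simp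
  then have "proj k \<odot>\<^bsub>P\<^esub> p \<in> \<phi> ` carrier S"
    using ring_iso_memE(5)[OF iso] unfolding bij_betw_def by simp
  then obtain s where s: "s \<in> carrier S" "\<phi> s = proj k \<odot>\<^bsub>P\<^esub> p" by auto
  have "kappa p = s" unfolding kappa_def
  proof (rule the_equality)
    show "s \<in> carrier S \<and> (\<exists>k. PW.killed (Suc k) p \<and> \<phi> s = proj k \<odot>\<^bsub>P\<^esub> p)" using s k by blast
    fix t assume "t \<in> carrier S \<and> (\<exists>k. PW.killed (Suc k) p \<and> \<phi> t = proj k \<odot>\<^bsub>P\<^esub> p)"
    then obtain l where t: "t \<in> carrier S" "PW.killed (Suc l) p" "\<phi> t = proj l \<odot>\<^bsub>P\<^esub> p" by blast
    have "proj l \<odot>\<^bsub>P\<^esub> p = proj (max k l) \<odot>\<^bsub>P\<^esub> p" "proj k \<odot>\<^bsub>P\<^esub> p = proj (max k l) \<odot>\<^bsub>P\<^esub> p"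
      using PW.proj_stable[OF t(2), of "max k l"] PW.proj_stable[OF k, of "max k l"] by simp_all
    then show "t = s" using phi_inj[OF t(1) s(1)] t s by simp
  qed
  then show "kappa p \<in> carrier S" "\<phi> (kappa p) = proj k \<odot>\<^bsub>P\<^esub> p" using s by simp_all
qed

lemma kappa_add:
  assumes p: "p \<in> carrier P" and q: "q \<in> carrier P"
  shows "kappa (p \<oplus>\<^bsub>P\<^esub> q) = kappa p \<oplus>\<^bsub>S\<^esub> kappa q"
proof -
  obtain k l where kl: "PW.killed (Suc k) p" "PW.killed (Suc l) q" using PW_killed p q by blast
  define m where "m = max k l"
  have m: "PW.killed (Suc m) p" "PW.killed (Suc m) q"
    using kl PW.killed_mono[OF kl(1), of "Suc m"] PW.killed_mono[OF kl(2), of "Suc m"] by (simp_all add: m_def)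
  note mm = PW.killed_add[OF m]
  have "\<phi> (kappa p \<oplus>\<^bsub>S\<^esub> kappa q) = \<phi> (kappa p) \<oplus>\<^bsub>H\<^esub> \<phi> (kappa q)"
    using ring_iso_memE(3)[OF iso] kappa_closed m by blast
  also have "\<dots> = proj m \<odot>\<^bsub>P\<^esub> p \<oplus>\<^bsub>P\<^esub> proj m \<odot>\<^bsub>P\<^esub> q"
    using phi_kappa m by (simp add: H_simps P_simps(2))
  also have "\<dots> = \<phi> (kappa (p \<oplus>\<^bsub>P\<^esub> q))"
    using phi_kappa[OF mm] p q by (simp add: PM.smult_r_distr)
  finally show ?thesis using phi_inj kappa_closed m mm by (metis S.a_closed)
qed

text \<open>The projection is a left multiplication and therefore commutes with the right action of
  S. The same exponent serves p and \<open>ract p s\<close>, since w^(k+1) x in Aw gives w^(k+1) x a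
  in A w a, which is contained in Aw.\<close>

lemma kappa_ract:
  assumes p: "p \<in> carrier P" and s: "s \<in> carrier S"
  shows "kappa (ract p s) = kappa p \<otimes>\<^bsub>S\<^esub> s"
proof -
  obtain k where k: "PW.killed (Suc k) p" using PW_killed p by blast
  obtain x where x: "x \<in> carrier A" "p = J +> x" using p in_P_iff by blast
  obtain a where a: "a \<in> carrier A" "w \<otimes> a \<in> J" "\<phi> s = J +> a" using s by (rule phi_rep)
  have ps: "ract p s = J +> (x \<otimes> a)" using x a by (simp add: ract_rcos)
  have "w [^] Suc k \<otimes> x \<in> J"
    using k x unfolding PW.killed_def by (metis P_smult rcos_eq_zero_iff nat_pow_closed m_closed w_closed)
  then obtain r where r: "r \<in> carrier A" "w [^] Suc k \<otimes> x = r \<otimes> w" unfolding J_iff by blast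
  have "w [^] Suc k \<otimes> (x \<otimes> a) = r \<otimes> (w \<otimes> a)"
    using r x a by (simp add: m_assoc[symmetric] del: nat_pow_Suc)
  then have wxa: "w [^] Suc k \<otimes> (x \<otimes> a) \<in> J" using J_left[OF r(1) a(2)] by simp
  have psk: "PW.killed (Suc k) (ract p s)"
    unfolding PW.killed_def ps
    using wxa x a P_smult[of "w [^] Suc k" "x \<otimes> a"] rcos_eq_zero_iff[of "w [^] Suc k \<otimes> (x \<otimes> a)"] in_P_iff
    by (simp only: m_closed nat_pow_closed w_closed) blast
  have "\<phi> (kappa p \<otimes>\<^bsub>S\<^esub> s) = rcoset_mult A J (\<phi> (kappa p)) (\<phi> s)"
    using ring_iso_memE(2)[OF iso kappa_closed[OF k] s] by (simp add: H_simps)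
  also have "\<dots> = J +> (proj k \<otimes> x \<otimes> a)"
    using phi_kappa[OF k] x a by (simp add: P_smult rcoset_mult_H)
  also have "\<dots> = \<phi> (kappa (ract p s))"
  proof -
    have "J +> (proj k \<otimes> x \<otimes> a) = proj k \<odot>\<^bsub>P\<^esub> ract p s"
      unfolding ps using x(1) a(1) by (simp add: P_smult m_assoc)
    then show ?thesis unfolding phi_kappa[OF psk] .
  qed
  finally show ?thesis using phi_inj kappa_closed[OF k] kappa_closed[OF psk] s by (metis S.m_closed)
qed

lemma kappa_one: "kappa (J +> \<one>) = \<one>\<^bsub>S\<^esub>"
proof -
  have "J +> \<one> \<in> carrier P" using in_P_iff by blast
  moreover have "w \<odot>\<^bsub>P\<^esub> (J +> \<one>) = \<zero>\<^bsub>P\<^esub>"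
  proof -
    have "w \<in> J" unfolding J_iff by (rule bexI[of _ \<one>]) auto
    then show ?thesis using rcos_eq_zero_iff[of w] by (simp add: P_smult)
  qed
  ultimately have "PW.killed (Suc 0) (J +> \<one>)" by (simp add: PW.killed_def)
  then have "kappa (J +> \<one>) \<in> carrier S" "\<phi> (kappa (J +> \<one>)) = J +> \<one>"
    using kappa_closed phi_kappa[of 0 "J +> \<one>"] by (blast, simp add: P_smult)
  then show ?thesis using phi_inj phi_one by simp
qed

end

section \<open>The unit of the adjunction\<close>

locale whittaker_iso_smod = whittaker_iso A w b S \<phi> + N: left_module S N
  for A :: "'a calg" (structure) and w b and S :: "'s calg" and \<phi> and N :: "('s, 'k) module"
begin

sublocale T: tensor_product A P S N ract
  by (rule tensor_product_whit) (rule N.left_module_axioms)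

lemma Ind_eq: "Ind A w S \<phi> N = T.T"
  by (simp add: Ind_def)

sublocale TM: whittaker_iso_module A w b S \<phi> T.T
  by (intro whittaker_iso_module.intro whittaker_module.intro whittaker_iso_axioms whittaker_axioms T.T_left_module)

lemma one_in_P: "J +> \<one> \<in> carrier P"
  using in_P_iff by blast

definition unit_map :: "'k \<Rightarrow> ('a set \<times> 'k \<Rightarrow>\<^sub>0 int) set" where
  "unit_map x = T.tens (J +> \<one>) x"

lemma unit_map_whit: "x \<in> carrier N \<Longrightarrow> unit_map x \<in> TM.whit"
proof -
  assume x: "x \<in> carrier N"
  have "w \<otimes> \<one> \<in> J" unfolding J_iff by (rule bexI[of _ \<one>]) auto
  then have "w \<odot>\<^bsub>T.T\<^esub> unit_map x = T.tens \<zero>\<^bsub>P\<^esub> x"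
    using x rcos_eq_zero_iff[of "w \<otimes> \<one>"] by (simp add: unit_map_def one_in_P P_smult)
  also have "\<dots> = \<zero>\<^bsub>T.T\<^esub>"
    by (rule additive_map_zero_minus(1)[OF P_abelian_group T.T_abelian_group])
      (use x T.tens_add_l in auto)
  finally show ?thesis using x by (simp add: TM.whit_def unit_map_def one_in_P)
qed

lemma unit_map_add:
  "x \<in> carrier N \<Longrightarrow> y \<in> carrier N \<Longrightarrow> unit_map (x \<oplus>\<^bsub>N\<^esub> y) = unit_map x \<oplus>\<^bsub>T.T\<^esub> unit_map y"
  by (simp add: unit_map_def T.tens_add_r one_in_P)

text \<open>Every Whittaker vector of A/Aw is the class of 1 moved by an element of S, and that
  element can be shifted across the tensor sign.\<close>

lemma tens_whit:
  assumes "s \<in> carrier S" "x \<in> carrier N" shows "T.tens (\<phi> s) x = unit_map (s \<odot>\<^bsub>N\<^esub> x)"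
  using T.tens_ract[OF one_in_P assms] by (simp add: unit_map_def ract_one assms)

lemma unit_map_smult:
  assumes "s \<in> carrier S" "x \<in> carrier N"
  shows "unit_map (s \<odot>\<^bsub>N\<^esub> x) = s \<odot>\<^bsub>Wh A w \<phi> T.T\<^esub> unit_map x"
proof -
  obtain a where a: "a \<in> carrier A" "w \<otimes> a \<in> J" "\<phi> s = J +> a" using assms(1) by (rule phi_rep)
  have "s \<odot>\<^bsub>Wh A w \<phi> T.T\<^esub> unit_map x = a \<odot>\<^bsub>T.T\<^esub> unit_map x"
    using TM.Wh_smult[OF unit_map_whit[OF assms(2)] a(1,3)] .
  also have "\<dots> = T.tens (\<phi> s) x" using a assms by (simp add: unit_map_def one_in_P P_smult)
  finally show ?thesis using tens_whit[OF assms] by simp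
qed

text \<open>As \<open>kappa\<close> is additive and right S-linear, sending p tensor x to kappa(p) x
  is well defined on the tensor product. Since kappa maps the class of 1 to 1, this is a left
  inverse of the unit.\<close>

lemma unit_map_inj: "inj_on unit_map (carrier N)"
proof -
  have kc: "kappa p \<in> carrier S" if "p \<in> carrier P" for p
    using PW_killed[OF that] kappa_closed by blast
  have "\<exists>h. (\<forall>X\<in>carrier T.T. h X \<in> carrier N) \<and>
    (\<forall>X\<in>carrier T.T. \<forall>Y\<in>carrier T.T. h (X \<oplus>\<^bsub>T.T\<^esub> Y) = h X \<oplus>\<^bsub>N\<^esub> h Y) \<and>
    (\<forall>p\<in>carrier P. \<forall>x\<in>carrier N. h (T.tens p x) = kappa p \<odot>\<^bsub>N\<^esub> x)"
    by (rule T.tensor_lift[OF N.M.abelian_group_axioms])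
      (simp_all add: kc N.smult_closed kappa_add N.smult_l_distr N.smult_r_distr kappa_ract N.smult_assoc)
  then obtain h where h: "\<forall>p\<in>carrier P. \<forall>x\<in>carrier N. h (T.tens p x) = kappa p \<odot>\<^bsub>N\<^esub> x" by blast
  have "h (unit_map x) = x" if "x \<in> carrier N" for x
    using that h one_in_P kappa_one by (simp add: unit_map_def N.smult_one)
  then show ?thesis by (rule inj_on_inverseI)
qed

lemma T_killed: "X \<in> carrier T.T \<Longrightarrow> \<exists>k. TM.killed (Suc k) X"
proof (induction rule: T.T_induct)
  case (add X Y)
  then obtain k l where kl: "TM.killed (Suc k) X" "TM.killed (Suc l) Y" by blast
  have "TM.killed (Suc (max k l)) (X \<oplus>\<^bsub>T.T\<^esub> Y)"
    by (rule TM.killed_add) (use kl in \<open>auto intro: TM.killed_mono\<close>)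
  then show ?case by blast
next
  case (tens p x)
  obtain k where k: "PW.killed (Suc k) p" using PW_killed tens by blast
  have "T.tens \<zero>\<^bsub>P\<^esub> x = \<zero>\<^bsub>T.T\<^esub>"
    by (rule additive_map_zero_minus(1)[OF P_abelian_group T.T_abelian_group])
      (use tens T.tens_add_l in auto)
  then have "TM.killed (Suc k) (T.tens p x)"
    using k tens by (simp add: TM.killed_def PW.killed_def del: nat_pow_Suc)
  then show ?case by blast
qed

lemma T_locally_killed: "TM.locally_killed"
  unfolding TM.locally_killed_def using T_killed by blast

text \<open>The projection \<open>proj k\<close> moves each tensor into \<open>Wh P \<otimes> N\<close>, hence into the image of the unit.\<close>

lemma proj_unit_map:
  assumes "X \<in> carrier T.T"
  shows "\<exists>m. \<forall>k\<ge>m. \<exists>x\<in>carrier N. proj k \<odot>\<^bsub>T.T\<^esub> X = unit_map x"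
  using assms
proof (induction rule: T.T_induct)
  case (add X Y)
  then obtain m1 m2 where m: "\<forall>k\<ge>m1. \<exists>x\<in>carrier N. proj k \<odot>\<^bsub>T.T\<^esub> X = unit_map x"
    "\<forall>k\<ge>m2. \<exists>x\<in>carrier N. proj k \<odot>\<^bsub>T.T\<^esub> Y = unit_map x" by blast
  show ?case
  proof (intro exI allI impI)
    fix k assume "max m1 m2 \<le> k"
    then obtain x y where "x \<in> carrier N" "proj k \<odot>\<^bsub>T.T\<^esub> X = unit_map x"
      "y \<in> carrier N" "proj k \<odot>\<^bsub>T.T\<^esub> Y = unit_map y" using m by (meson max.boundedE)
    then show "\<exists>x\<in>carrier N. proj k \<odot>\<^bsub>T.T\<^esub> (X \<oplus>\<^bsub>T.T\<^esub> Y) = unit_map x"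
      using add by (intro bexI[of _ "x \<oplus>\<^bsub>N\<^esub> y"]) (simp_all add: T.T_smult_add unit_map_add)
  qed
next
  case (tens p x)
  obtain m where m: "PW.killed (Suc m) p" using PW_killed tens by blast
  show ?case
  proof (intro exI allI impI)
    fix k assume "m \<le> k"
    then have k: "PW.killed (Suc k) p" using PW.killed_mono[OF m] by simp
    then show "\<exists>y\<in>carrier N. proj k \<odot>\<^bsub>T.T\<^esub> T.tens p x = unit_map y"
      using tens kappa_closed[OF k] phi_kappa[OF k] tens_whit[of "kappa p" x]
      by (intro bexI[of _ "kappa p \<odot>\<^bsub>N\<^esub> x"]) (simp_all add: N.smult_closed)
  qed
qed

text \<open>For large k the projection moves any element into the image of the unit, but it fixes
  Whittaker vectors.\<close>

lemma unit_map_surj: "unit_map ` carrier N = TM.whit"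
proof (intro equalityI subsetI)
  fix X assume X: "X \<in> TM.whit"
  then obtain m where "\<forall>k\<ge>m. \<exists>x\<in>carrier N. proj k \<odot>\<^bsub>T.T\<^esub> X = unit_map x"
    using proj_unit_map[of X] by (auto simp: TM.whit_def)
  then obtain x where "x \<in> carrier N" "proj m \<odot>\<^bsub>T.T\<^esub> X = unit_map x" by blast
  then show "X \<in> unit_map ` carrier N" using TM.proj_whit[OF X] by auto
qed (auto simp: unit_map_whit)

lemma unit_iso: "restrict unit_map (carrier N) \<in> lmod_iso S N (Wh A w \<phi> (Ind A w S \<phi> N))"
proof -
  have "restrict unit_map (carrier N) \<in> lmod_hom S N (Wh A w \<phi> T.T)"
    by (rule lmod_homI)
      (use unit_map_whit unit_map_add unit_map_smult in \<open>auto simp: TM.Wh_carrier Wh_simps(3) N.smult_closed\<close>)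
  moreover have "bij_betw unit_map (carrier N) TM.whit"
    using unit_map_inj unit_map_surj by (simp add: bij_betw_def)
  then have "bij_betw (restrict unit_map (carrier N)) (carrier N) (carrier (Wh A w \<phi> T.T))"
    unfolding TM.Wh_carrier by (simp cong: bij_betw_cong)
  ultimately show ?thesis by (simp add: lmod_iso_def Ind_eq)
qed

end

section \<open>The counit of the adjunction\<close>

locale whittaker_iso_nilp = whittaker_iso_module A w b S \<phi> M
  for A :: "'a calg" (structure) and w b and S :: "'s calg" and \<phi> and M :: "('a, 'm) module" +
  assumes locally_killed: locally_killed
begin

sublocale W: whittaker_iso_smod A w b S \<phi> "Wh A w \<phi> M"
  by (intro whittaker_iso_smod.intro whittaker_iso_axioms Wh_left_module)

definition counit :: "('a set \<times> 'm \<Rightarrow>\<^sub>0 int) set \<Rightarrow> 'm" where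
  "counit = (SOME h. h \<in> lmod_hom A W.T.T M \<and>
     (\<forall>a\<in>carrier A. \<forall>x\<in>whit. h (W.T.tens (J +> a) x) = a \<odot>\<^bsub>M\<^esub> x))"

lemma counit:
  shows counit_hom: "counit \<in> lmod_hom A W.T.T M"
    and counit_tens: "a \<in> carrier A \<Longrightarrow> x \<in> whit \<Longrightarrow> counit (W.T.tens (J +> a) x) = a \<odot>\<^bsub>M\<^esub> x"
proof -
  have "\<exists>h. h \<in> lmod_hom A W.T.T M \<and>
     (\<forall>a\<in>carrier A. \<forall>x\<in>whit. h (W.T.tens (J +> a) x) = a \<odot>\<^bsub>M\<^esub> x)"
    by (rule counit_exists) (auto simp: W.Ind_eq)
  then have c: "counit \<in> lmod_hom A W.T.T M \<and>
     (\<forall>a\<in>carrier A. \<forall>x\<in>whit. counit (W.T.tens (J +> a) x) = a \<odot>\<^bsub>M\<^esub> x)"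
    unfolding counit_def by (rule someI_ex)
  show "counit \<in> lmod_hom A W.T.T M" using c ..
  show "a \<in> carrier A \<Longrightarrow> x \<in> whit \<Longrightarrow> counit (W.T.tens (J +> a) x) = a \<odot>\<^bsub>M\<^esub> x"
    using c[THEN conjunct2, rule_format] .
qed

lemma counit_unit: "x \<in> whit \<Longrightarrow> counit (W.unit_map x) = x"
  by (simp add: W.unit_map_def counit_tens M.smult_one whit_def)

lemma counit_minus: "X \<in> carrier W.T.T \<Longrightarrow> Y \<in> carrier W.T.T \<Longrightarrow> counit (X \<ominus>\<^bsub>W.T.T\<^esub> Y) = counit X \<ominus>\<^bsub>M\<^esub> counit Y"
  by (rule additive_map_zero_minus(3)[OF W.T.T_abelian_group M.M.abelian_group_axioms
      lmod_homD(1)[OF counit_hom] lmod_homD(2)[OF counit_hom]])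

text \<open>A nonzero kernel would contain a nonzero Whittaker vector: multiply by the last power of
  w that does not annihilate. Whittaker vectors of the tensor product come from the unit, and counit
  after unit is the identity. In the induction this lowers the annihilating exponent.\<close>

lemma counit_eq_zero: "W.TM.killed k X \<Longrightarrow> counit X = \<zero>\<^bsub>M\<^esub> \<Longrightarrow> X = \<zero>\<^bsub>W.T.T\<^esub>"
proof (induction k)
  case 0
  then show ?case by (simp add: W.TM.killed_0)
next
  case (Suc k)
  then have X: "X \<in> carrier W.T.T" by (simp add: W.TM.killed_def)
  have "w [^] k \<odot>\<^bsub>W.T.T\<^esub> X \<in> W.TM.whit"
    using W.TM.killed_pow[of "Suc 0" k X] Suc.prems(1) by (simp add: W.TM.killed_1)
  then obtain x where x: "x \<in> whit" "w [^] k \<odot>\<^bsub>W.T.T\<^esub> X = W.unit_map x"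
    using W.unit_map_surj by (auto simp: Wh_carrier)
  have "counit (W.unit_map x) = w [^] k \<odot>\<^bsub>M\<^esub> counit X"
    unfolding x(2)[symmetric] using lmod_homD(3)[OF counit_hom] X by simp
  then have "x = \<zero>\<^bsub>M\<^esub>" using Suc.prems(2) x by (simp add: counit_unit)
  then have "w [^] k \<odot>\<^bsub>W.T.T\<^esub> X = \<zero>\<^bsub>W.T.T\<^esub>"
    using x(2) additive_map_zero_minus(1)[OF Wh_abelian_group W.T.T_abelian_group, of W.unit_map]
      W.unit_map_add W.unit_map_whit
    by (simp add: Wh_simps(2) W.TM.whit_def)
  then have "W.TM.killed k X" using X by (simp add: W.TM.killed_def)
  then show ?case using Suc by blast
qed

lemma counit_inj: "inj_on counit (carrier W.T.T)"
proof (rule inj_onI)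
  fix X Y assume X: "X \<in> carrier W.T.T" and Y: "Y \<in> carrier W.T.T" and eq: "counit X = counit Y"
  have c: "counit Y \<in> carrier M" using lmod_homD(1)[OF counit_hom Y] .
  obtain k where "W.TM.killed k (X \<ominus>\<^bsub>W.T.T\<^esub> Y)" using W.T_killed[OF W.TM.M.M.minus_closed[OF X Y]] by blast
  moreover have "counit (X \<ominus>\<^bsub>W.T.T\<^esub> Y) = \<zero>\<^bsub>M\<^esub>" using counit_minus X Y eq c by (simp add: M.M.minus_eq_zero_iff)
  ultimately have "X \<ominus>\<^bsub>W.T.T\<^esub> Y = \<zero>\<^bsub>W.T.T\<^esub>" by (rule counit_eq_zero)
  then show "X = Y" using X Y by (simp add: W.TM.M.M.minus_eq_zero_iff)
qed

lemma counit_range: "killed k x \<Longrightarrow> x \<in> counit ` carrier W.T.T"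
proof (erule killed_induct[where Q = "\<lambda>x. x \<in> counit ` carrier W.T.T"])
  fix i x assume b: "x \<in> whit"
  have "J +> b i \<in> carrier P" unfolding in_P_iff by (rule bexI[OF refl b_closed])
  then have "W.T.tens (J +> b i) x \<in> carrier W.T.T" using b by (simp add: Wh_carrier)
  moreover have "b i \<odot>\<^bsub>M\<^esub> x = counit (W.T.tens (J +> b i) x)" using counit_tens[of "b i" x] b by simp
  ultimately show "b i \<odot>\<^bsub>M\<^esub> x \<in> counit ` carrier W.T.T" by (rule rev_image_eqI)
next
  fix x y assume "x \<in> counit ` carrier W.T.T" "y \<in> counit ` carrier W.T.T"
  then obtain X Y where X: "X \<in> carrier W.T.T" "x = counit X" and Y: "Y \<in> carrier W.T.T" "y = counit Y"
    by (elim imageE)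
  have "X \<oplus>\<^bsub>W.T.T\<^esub> Y \<in> carrier W.T.T" using X Y by simp
  moreover have "x \<oplus>\<^bsub>M\<^esub> y = counit (X \<oplus>\<^bsub>W.T.T\<^esub> Y)"
    using lmod_homD(2)[OF counit_hom X(1) Y(1)] X Y by simp
  ultimately show "x \<oplus>\<^bsub>M\<^esub> y \<in> counit ` carrier W.T.T" by (rule rev_image_eqI)
qed

lemma counit_surj: "counit ` carrier W.T.T = carrier M"
proof (rule equalityI)
  show "counit ` carrier W.T.T \<subseteq> carrier M" using lmod_homD(1)[OF counit_hom] by (rule image_subsetI)
  show "carrier M \<subseteq> counit ` carrier W.T.T"
  proof (rule subsetI)
    fix x assume "x \<in> carrier M"
    then have "\<exists>k. killed k x" using locally_killed by (simp only: locally_killed_def)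
    then show "x \<in> counit ` carrier W.T.T" by (rule exE) (rule counit_range)
  qed
qed

lemma counit_bij: "bij_betw counit (carrier W.T.T) (carrier M)"
  using counit_inj counit_surj by (simp add: bij_betw_def)

end

text \<open>Natural isomorphisms are required to start at the identity functor, while the counit
  ends there; hence the passage to inverses.\<close>

lemma lmod_iso_inv:
  assumes h: "h \<in> lmod_hom R T M" "bij_betw h (carrier T) (carrier M)" and T: "left_module R T"
  shows "restrict (inv_into (carrier T) h) (carrier M) \<in> lmod_iso R M T"
proof -
  interpret T: left_module R T by fact
  note hD = lmod_homD[OF h(1)]
  let ?g = "inv_into (carrier T) h"
  have g: "?g x \<in> carrier T" "h (?g x) = x" if "x \<in> carrier M" for x
    using that h(2) by (auto simp: bij_betw_def inv_into_into f_inv_into_f)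
  have gh: "?g (h X) = X" if "X \<in> carrier T" for X
    using that h(2) by (simp add: bij_betw_def)
  have "restrict ?g (carrier M) \<in> lmod_hom R M T"
  proof (rule lmod_homI)
    show "restrict ?g (carrier M) (x \<oplus>\<^bsub>M\<^esub> y) = restrict ?g (carrier M) x \<oplus>\<^bsub>T\<^esub> restrict ?g (carrier M) y"
      if x: "x \<in> carrier M" and y: "y \<in> carrier M" for x y
    proof -
      have "?g x \<oplus>\<^bsub>T\<^esub> ?g y \<in> carrier T" using g x y by simp
      moreover have "h (?g x \<oplus>\<^bsub>T\<^esub> ?g y) = x \<oplus>\<^bsub>M\<^esub> y" using g x y hD(2) by simp
      ultimately show ?thesis using gh[of "?g x \<oplus>\<^bsub>T\<^esub> ?g y"] hD(1)[of "?g x \<oplus>\<^bsub>T\<^esub> ?g y"] x y by simp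
    qed
    show "restrict ?g (carrier M) (a \<odot>\<^bsub>M\<^esub> x) = a \<odot>\<^bsub>T\<^esub> restrict ?g (carrier M) x"
      if a: "a \<in> carrier R" and x: "x \<in> carrier M" for a x
    proof -
      have "a \<odot>\<^bsub>T\<^esub> ?g x \<in> carrier T" using g a x T.smult_closed by simp
      moreover have "h (a \<odot>\<^bsub>T\<^esub> ?g x) = a \<odot>\<^bsub>M\<^esub> x" using g a x hD(3) by simp
      ultimately show ?thesis using gh[of "a \<odot>\<^bsub>T\<^esub> ?g x"] hD(1)[of "a \<odot>\<^bsub>T\<^esub> ?g x"] x by simp
    qed
  qed (use g in auto)
  moreover have "bij_betw (restrict ?g (carrier M)) (carrier M) (carrier T)"
    using bij_betw_inv_into[OF h(2)] by (simp cong: bij_betw_cong)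
  ultimately show ?thesis by (simp add: lmod_iso_def)
qed

section \<open>Functoriality and naturality\<close>

context whittaker_iso begin

lemma nilp_module:
  assumes "M \<in> loc_nilp_mods A w" shows "whittaker_iso_nilp A w b S \<phi> M"
proof -
  interpret M: whittaker_iso_module A w b S \<phi> M
    using assms by (intro whittaker_iso_module.intro whittaker_module.intro whittaker_iso_axioms whittaker_axioms)
      (simp add: loc_nilp_mods_def)
  show ?thesis
    using assms M.locally_killed_iff
    by (intro whittaker_iso_nilp.intro whittaker_iso_nilp_axioms.intro M.whittaker_iso_module_axioms) simp
qed

lemma S_module: "N \<in> all_mods S \<Longrightarrow> whittaker_iso_smod A w b S \<phi> N"
  by (intro whittaker_iso_smod.intro whittaker_iso_axioms) (simp add: all_mods_def)

lemma Wh_in_mods: "M \<in> loc_nilp_mods A w \<Longrightarrow> Wh A w \<phi> M \<in> all_mods S"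
proof -
  assume "M \<in> loc_nilp_mods A w"
  then interpret whittaker_iso_nilp A w b S \<phi> M by (rule nilp_module)
  show ?thesis using Wh_left_module by (simp add: all_mods_def)
qed

lemma Ind_in_mods: "N \<in> all_mods S \<Longrightarrow> Ind A w S \<phi> N \<in> loc_nilp_mods A w"
proof -
  assume "N \<in> all_mods S"
  then interpret whittaker_iso_smod A w b S \<phi> N by (rule S_module)
  show ?thesis using T_locally_killed TM.locally_killed_iff by (simp add: Ind_eq)
qed

lemma Wh_map_hom:
  assumes M: "M \<in> loc_nilp_mods A w" and N: "N \<in> loc_nilp_mods A w" and f: "f \<in> lmod_hom A M N"
  shows "Wh_map A w \<phi> M N f \<in> lmod_hom S (Wh A w \<phi> M) (Wh A w \<phi> N)"
proof -
  interpret M: whittaker_iso_nilp A w b S \<phi> M using M by (rule nilp_module)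
  interpret N: whittaker_iso_nilp A w b S \<phi> N using N by (rule nilp_module)
  note fD = lmod_homD[OF f]
  have f0: "f \<zero>\<^bsub>M\<^esub> = \<zero>\<^bsub>N\<^esub>"
    by (rule additive_map_zero_minus(1)[OF M.M.M.abelian_group_axioms N.M.M.abelian_group_axioms fD(1,2)])
  have fw: "f x \<in> N.whit" if "x \<in> M.whit" for x
    using that fD(1)[of x] fD(3)[of w x] f0 by (simp add: M.whit_def N.whit_def)
  show ?thesis
  proof (rule lmod_homI)
    show "Wh_map A w \<phi> M N f \<in> carrier (Wh A w \<phi> M) \<rightarrow>\<^sub>E carrier (Wh A w \<phi> N)"
      using fw by (auto simp: Wh_map_def M.Wh_carrier N.Wh_carrier)
    fix x assume x: "x \<in> carrier (Wh A w \<phi> M)"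
    then have x': "x \<in> M.whit" "x \<in> carrier M" by (simp_all add: M.Wh_carrier M.whit_def)
    show "Wh_map A w \<phi> M N f (x \<oplus>\<^bsub>Wh A w \<phi> M\<^esub> y) = Wh_map A w \<phi> M N f x \<oplus>\<^bsub>Wh A w \<phi> N\<^esub> Wh_map A w \<phi> M N f y"
      if y: "y \<in> carrier (Wh A w \<phi> M)" for y
    proof -
      have y': "y \<in> M.whit" "y \<in> carrier M" using y by (simp_all add: M.Wh_carrier M.whit_def)
      then show ?thesis
        using x' M.whit_add[of x y] fD(2) by (simp add: Wh_map_def M.Wh_carrier Wh_simps(3))
    qed
    fix s assume "s \<in> carrier S"
    then obtain a where a: "a \<in> carrier A" "w \<otimes> a \<in> J" "\<phi> s = J +> a" by (rule phi_rep)
    then show "Wh_map A w \<phi> M N f (s \<odot>\<^bsub>Wh A w \<phi> M\<^esub> x) = s \<odot>\<^bsub>Wh A w \<phi> N\<^esub> Wh_map A w \<phi> M N f x"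
      using x' fw[OF x'(1)] M.whit_smult_closed[of x a] fD(3)[of a x]
      by (simp add: Wh_map_def M.Wh_carrier M.Wh_smult N.Wh_smult)
  qed
qed

theorem Wh_functor: "lmod_functor A (loc_nilp_mods A w :: ('a, 'm) module set) S (all_mods S) (Wh A w \<phi>) (Wh_map A w \<phi>)"
  unfolding lmod_functor_def
proof (intro conjI ballI)
  show "Wh A w \<phi> M \<in> all_mods S" if "M \<in> loc_nilp_mods A w" for M :: "('a, 'm) module"
    using that by (rule Wh_in_mods)
  show "Wh_map A w \<phi> M N f \<in> lmod_hom S (Wh A w \<phi> M) (Wh A w \<phi> N)"
    if "M \<in> loc_nilp_mods A w" "N \<in> loc_nilp_mods A w" "f \<in> lmod_hom A M N" for M N :: "('a, 'm) module" and f
    using that by (rule Wh_map_hom)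
  show "Wh_map A w \<phi> M M (\<lambda>x\<in>carrier M. x) = (\<lambda>x\<in>carrier (Wh A w \<phi> M). x)" for M :: "('a, 'm) module"
    by (auto simp: Wh_map_def Wh_simps fun_eq_iff)
  show "Wh_map A w \<phi> L N (compose (carrier L) g f)
      = compose (carrier (Wh A w \<phi> L)) (Wh_map A w \<phi> M N g) (Wh_map A w \<phi> L M f)"
    if "L \<in> loc_nilp_mods A w" "M \<in> loc_nilp_mods A w" "f \<in> lmod_hom A L M"
    for L M N :: "('a, 'm) module" and f g
  proof -
    have "f x \<in> carrier (Wh A w \<phi> M)" if x: "x \<in> carrier (Wh A w \<phi> L)" for x
      using lmod_homD(1)[OF Wh_map_hom[OF \<open>L \<in> _\<close> \<open>M \<in> _\<close> \<open>f \<in> _\<close>] x] x by (simp add: Wh_map_def)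
    moreover have "x \<in> carrier L" if "x \<in> carrier (Wh A w \<phi> L)" for x
      using that by (simp add: Wh_simps)
    ultimately show ?thesis by (auto simp: Wh_map_def compose_def fun_eq_iff restrict_def)
  qed
qed

lemma Ind_map_tens:
  assumes "N \<in> all_mods S" "N' \<in> all_mods S" "g \<in> lmod_hom S N N'" "p \<in> carrier P" "x \<in> carrier N"
  shows "Ind_map A w S \<phi> N N' g (tensor_product.tens P S N ract p x) = tensor_product.tens P S N' ract p (g x)"
proof -
  interpret N: whittaker_iso_smod A w b S \<phi> N using assms(1) by (rule S_module)
  interpret N': whittaker_iso_smod A w b S \<phi> N' using assms(2) by (rule S_module)
  show ?thesis using N.T.tensor_map_hom(2)[OF N'.T.tensor_product_axioms assms(3-5)] by (simp add: Ind_map_def)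
qed

lemma Ind_map_hom:
  assumes "N \<in> all_mods S" "N' \<in> all_mods S" "g \<in> lmod_hom S N N'"
  shows "Ind_map A w S \<phi> N N' g \<in> lmod_hom A (Ind A w S \<phi> N) (Ind A w S \<phi> N')"
proof -
  interpret N: whittaker_iso_smod A w b S \<phi> N using assms(1) by (rule S_module)
  interpret N': whittaker_iso_smod A w b S \<phi> N' using assms(2) by (rule S_module)
  show ?thesis using N.T.tensor_map_hom(1)[OF N'.T.tensor_product_axioms assms(3)] by (simp add: Ind_map_def Ind_def)
qed

theorem Ind_functor: "lmod_functor S (all_mods S :: ('s, 'k) module set) A (loc_nilp_mods A w) (Ind A w S \<phi>) (Ind_map A w S \<phi>)"
  unfolding lmod_functor_def
proof (intro conjI ballI)
  show "Ind A w S \<phi> N \<in> loc_nilp_mods A w" if "N \<in> all_mods S" for N :: "('s, 'k) module"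
    using that by (rule Ind_in_mods)
  show "Ind_map A w S \<phi> M N f \<in> lmod_hom A (Ind A w S \<phi> M) (Ind A w S \<phi> N)"
    if "M \<in> all_mods S" "N \<in> all_mods S" "f \<in> lmod_hom S M N" for M N :: "('s, 'k) module" and f
    using that by (rule Ind_map_hom)
  show "Ind_map A w S \<phi> N N (\<lambda>x\<in>carrier N. x) = (\<lambda>x\<in>carrier (Ind A w S \<phi> N). x)"
    if N: "N \<in> all_mods S" for N :: "('s, 'k) module"
  proof (rule extensionalityI[of _ "carrier (Ind A w S \<phi> N)"])
    interpret N: whittaker_iso_smod A w b S \<phi> N using N by (rule S_module)
    have id: "(\<lambda>x\<in>carrier N. x) \<in> lmod_hom S N N"
      by (rule lmod_homI) (auto simp: N.N.smult_closed)
    note hom = Ind_map_hom[OF N N id]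
    show "Ind_map A w S \<phi> N N (\<lambda>x\<in>carrier N. x) \<in> extensional (carrier (Ind A w S \<phi> N))"
      using lmod_homD(4)[OF hom] .
    fix X assume X: "X \<in> carrier (Ind A w S \<phi> N)"
    have "Ind_map A w S \<phi> N N (\<lambda>x\<in>carrier N. x) X = X"
    proof (rule N.T.additive_map_eqI[OF N.T.T_abelian_group X[unfolded N.Ind_eq], where g = "\<lambda>X. X"])
      fix Y Z assume "Y \<in> carrier N.T.T" "Z \<in> carrier N.T.T"
      then show "Ind_map A w S \<phi> N N (\<lambda>x\<in>carrier N. x) (Y \<oplus>\<^bsub>N.T.T\<^esub> Z) =
          Ind_map A w S \<phi> N N (\<lambda>x\<in>carrier N. x) Y \<oplus>\<^bsub>N.T.T\<^esub> Ind_map A w S \<phi> N N (\<lambda>x\<in>carrier N. x) Z"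
        by (rule lmod_homD(2)[OF hom, unfolded N.Ind_eq])
    next
      fix p x assume px: "p \<in> carrier P" "x \<in> carrier N"
      show "Ind_map A w S \<phi> N N (\<lambda>x\<in>carrier N. x) (N.T.tens p x) = N.T.tens p x"
        unfolding Ind_map_tens[OF N N id px] using px by simp
    qed (rule refl)
    then show "Ind_map A w S \<phi> N N (\<lambda>x\<in>carrier N. x) X = (\<lambda>x\<in>carrier (Ind A w S \<phi> N). x) X"
      using X by simp
  qed auto
  show "Ind_map A w S \<phi> L N (compose (carrier L) g f)
      = compose (carrier (Ind A w S \<phi> L)) (Ind_map A w S \<phi> M N g) (Ind_map A w S \<phi> L M f)"
    if L: "L \<in> all_mods S" and M: "M \<in> all_mods S" and N: "N \<in> all_mods S"
      and f: "f \<in> lmod_hom S L M" and g: "g \<in> lmod_hom S M N"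
    for L M N :: "('s, 'k) module" and f g
  proof (rule extensionalityI[of _ "carrier (Ind A w S \<phi> L)"])
    interpret L: whittaker_iso_smod A w b S \<phi> L using L by (rule S_module)
    interpret N: whittaker_iso_smod A w b S \<phi> N using N by (rule S_module)
    have gf: "compose (carrier L) g f \<in> lmod_hom S L N"
      by (rule lmod_homI)
        (use lmod_homD[OF f] lmod_homD[OF g] L.N.smult_closed in \<open>auto simp: compose_def\<close>)
    note hL = lmod_homD[OF Ind_map_hom[OF L M f]] and hM = lmod_homD[OF Ind_map_hom[OF M N g]]
      and hgf = lmod_homD[OF Ind_map_hom[OF L N gf]]
    show "Ind_map A w S \<phi> L N (compose (carrier L) g f) \<in> extensional (carrier (Ind A w S \<phi> L))"
      by (rule hgf(4))
    fix X assume X: "X \<in> carrier (Ind A w S \<phi> L)"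
    have "Ind_map A w S \<phi> L N (compose (carrier L) g f) X = Ind_map A w S \<phi> M N g (Ind_map A w S \<phi> L M f X)"
    proof (rule L.T.additive_map_eqI[OF N.T.T_abelian_group X[unfolded L.Ind_eq]])
      fix X Y assume XY: "X \<in> carrier L.T.T" "Y \<in> carrier L.T.T"
      show "Ind_map A w S \<phi> L N (compose (carrier L) g f) (X \<oplus>\<^bsub>L.T.T\<^esub> Y) =
          Ind_map A w S \<phi> L N (compose (carrier L) g f) X \<oplus>\<^bsub>N.T.T\<^esub> Ind_map A w S \<phi> L N (compose (carrier L) g f) Y"
        using hgf(2) XY by (simp add: L.Ind_eq N.Ind_eq)
      show "Ind_map A w S \<phi> M N g (Ind_map A w S \<phi> L M f (X \<oplus>\<^bsub>L.T.T\<^esub> Y)) =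
          Ind_map A w S \<phi> M N g (Ind_map A w S \<phi> L M f X) \<oplus>\<^bsub>N.T.T\<^esub> Ind_map A w S \<phi> M N g (Ind_map A w S \<phi> L M f Y)"
        using hL(1,2) hM(2) XY by (simp add: L.Ind_eq N.Ind_eq)
    next
      fix p x assume px: "p \<in> carrier P" "x \<in> carrier L"
      then show "Ind_map A w S \<phi> L N (compose (carrier L) g f) (L.T.tens p x)
          = Ind_map A w S \<phi> M N g (Ind_map A w S \<phi> L M f (L.T.tens p x))"
        using Ind_map_tens[OF L M f px] Ind_map_tens[OF M N g px(1) lmod_homD(1)[OF f px(2)]]
          Ind_map_tens[OF L N gf px] by (simp add: compose_eq)
    qed
    then show "Ind_map A w S \<phi> L N (compose (carrier L) g f) X =
        compose (carrier (Ind A w S \<phi> L)) (Ind_map A w S \<phi> M N g) (Ind_map A w S \<phi> L M f) X"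
      using X by (simp add: compose_eq)
  qed auto
qed

theorem Ind_Wh_id:
  "naturally_iso_id A (loc_nilp_mods A w :: ('a, 'm) module set)
     (\<lambda>M. Ind A w S \<phi> (Wh A w \<phi> M))
     (\<lambda>M N f. Ind_map A w S \<phi> (Wh A w \<phi> M) (Wh A w \<phi> N) (Wh_map A w \<phi> M N f))"
proof -
  let ?e = "\<lambda>M :: ('a, 'm) module. whittaker_iso_nilp.counit A w S \<phi> M"
  let ?T = "\<lambda>M :: ('a, 'm) module. Ind A w S \<phi> (Wh A w \<phi> M)"
  let ?\<eta> = "\<lambda>M. restrict (inv_into (carrier (?T M)) (?e M)) (carrier M)"
  have iso: "?\<eta> M \<in> lmod_iso A M (?T M)" if "M \<in> loc_nilp_mods A w" for M
  proof -
    interpret M: whittaker_iso_nilp A w b S \<phi> M using that by (rule nilp_module)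
    show ?thesis using lmod_iso_inv[OF M.counit_hom M.counit_bij M.W.T.T_left_module] by (simp add: M.W.Ind_eq)
  qed
  have nat: "compose (carrier M) (?\<eta> N) f =
      compose (carrier M) (Ind_map A w S \<phi> (Wh A w \<phi> M) (Wh A w \<phi> N) (Wh_map A w \<phi> M N f)) (?\<eta> M)"
    if M: "M \<in> loc_nilp_mods A w" and N: "N \<in> loc_nilp_mods A w" and f: "f \<in> lmod_hom A M N"
    for M N :: "('a, 'm) module" and f
  proof (rule extensionalityI[of _ "carrier M"])
    interpret M: whittaker_iso_nilp A w b S \<phi> M using M by (rule nilp_module)
    interpret N: whittaker_iso_nilp A w b S \<phi> N using N by (rule nilp_module)
    let ?F = "Ind_map A w S \<phi> (Wh A w \<phi> M) (Wh A w \<phi> N) (Wh_map A w \<phi> M N f)"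
    note Whf = Wh_map_hom[OF M N f] and fD = lmod_homD[OF f]
    note FD = lmod_homD[OF Ind_map_hom[OF Wh_in_mods[OF M] Wh_in_mods[OF N] Whf], unfolded M.W.Ind_eq N.W.Ind_eq]
    note cM = lmod_homD[OF M.counit_hom] and cN = lmod_homD[OF N.counit_hom]
    \<comment> \<open>This is naturality of the counit itself, checked on tensors; naturality of its
      inverse then follows from injectivity.\<close>
    have key: "N.counit (?F X) = f (M.counit X)" if X: "X \<in> carrier M.W.T.T" for X
      using N.M.M.abelian_group_axioms X
    proof (rule M.W.T.additive_map_eqI)
      fix X Y assume XY: "X \<in> carrier M.W.T.T" "Y \<in> carrier M.W.T.T"
      show "N.counit (?F (X \<oplus>\<^bsub>M.W.T.T\<^esub> Y)) = N.counit (?F X) \<oplus>\<^bsub>N\<^esub> N.counit (?F Y)"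
        using XY FD(1,2) cN(2) by simp
      show "f (M.counit (X \<oplus>\<^bsub>M.W.T.T\<^esub> Y)) = f (M.counit X) \<oplus>\<^bsub>N\<^esub> f (M.counit Y)"
        using XY cM(1,2) fD(2) by simp
    next
      fix p x assume p: "p \<in> carrier P" and x: "x \<in> carrier (Wh A w \<phi> M)"
      then obtain a where a: "a \<in> carrier A" "p = J +> a" using in_P_iff by blast
      have fx: "Wh_map A w \<phi> M N f x = f x" using x by (simp add: Wh_map_def)
      have "f x \<in> N.whit" using lmod_homD(1)[OF Whf x] by (simp add: fx N.Wh_carrier)
      then show "N.counit (?F (M.W.T.tens p x)) = f (M.counit (M.W.T.tens p x))"
        using Ind_map_tens[OF Wh_in_mods[OF M] Wh_in_mods[OF N] Whf p x] a x fD(3)[of a x]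
        by (simp add: fx N.counit_tens M.counit_tens M.Wh_carrier M.whit_def)
    qed
    fix x assume x: "x \<in> carrier M"
    define X where "X = inv_into (carrier M.W.T.T) M.counit x"
    have X: "X \<in> carrier M.W.T.T" "M.counit X = x"
      using x M.counit_surj by (auto simp: X_def inv_into_into f_inv_into_f)
    have "inv_into (carrier N.W.T.T) N.counit (f x) = ?F X"
      using key[OF X(1)] X FD(1)[OF X(1)] N.counit_inj by (metis inv_into_f_f)
    then show "compose (carrier M) (?\<eta> N) f x = compose (carrier M) ?F (?\<eta> M) x"
      using x fD(1)[OF x] by (simp add: compose_eq M.W.Ind_eq N.W.Ind_eq X_def)
  qed (auto simp: compose_def)
  show ?thesis unfolding naturally_iso_id_def
    by (rule exI[of _ ?\<eta>]) (use iso nat in simp)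
qed

theorem Wh_Ind_id:
  "naturally_iso_id S (all_mods S :: ('s, 'k) module set)
     (\<lambda>N. Wh A w \<phi> (Ind A w S \<phi> N))
     (\<lambda>M N g. Wh_map A w \<phi> (Ind A w S \<phi> M) (Ind A w S \<phi> N) (Ind_map A w S \<phi> M N g))"
proof -
  let ?\<eta> = "\<lambda>N :: ('s, 'k) module. restrict (whittaker_iso_smod.unit_map A w S \<phi> N) (carrier N)"
  have iso: "?\<eta> N \<in> lmod_iso S N (Wh A w \<phi> (Ind A w S \<phi> N))" if "N \<in> all_mods S" for N
    using whittaker_iso_smod.unit_iso[OF S_module[OF that]] .
  have nat: "compose (carrier M) (?\<eta> N) g =
      compose (carrier M) (Wh_map A w \<phi> (Ind A w S \<phi> M) (Ind A w S \<phi> N) (Ind_map A w S \<phi> M N g)) (?\<eta> M)"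
    if M: "M \<in> all_mods S" and N: "N \<in> all_mods S" and g: "g \<in> lmod_hom S M N"
    for M N :: "('s, 'k) module" and g
  proof (rule extensionalityI[of _ "carrier M"])
    interpret M: whittaker_iso_smod A w b S \<phi> M using M by (rule S_module)
    interpret N: whittaker_iso_smod A w b S \<phi> N using N by (rule S_module)
    fix x assume x: "x \<in> carrier M"
    have "M.unit_map x \<in> carrier (Wh A w \<phi> (Ind A w S \<phi> M))"
      using M.unit_map_whit[OF x] by (simp add: M.Ind_eq M.TM.Wh_carrier)
    then show "compose (carrier M) (?\<eta> N) g x =
        compose (carrier M) (Wh_map A w \<phi> (Ind A w S \<phi> M) (Ind A w S \<phi> N) (Ind_map A w S \<phi> M N g)) (?\<eta> M) x"
      using x lmod_homD(1)[OF g x] Ind_map_tens[OF M N g M.one_in_P x]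
      by (simp add: compose_eq Wh_map_def M.unit_map_def N.unit_map_def)
  qed (auto simp: compose_def)
  show ?thesis unfolding naturally_iso_id_def
    by (rule exI[of _ ?\<eta>]) (use iso nat in simp)
qed

end

section \<open>Algebras, quotients, free algebras\<close>

locale calgebra = ring A for A :: "'a calg" (structure) +
  assumes sm_closed [simp]: "a \<in> carrier A \<Longrightarrow> k \<odot>\<^bsub>A\<^esub> a \<in> carrier A"
    and sm_add_r: "a \<in> carrier A \<Longrightarrow> b \<in> carrier A \<Longrightarrow> k \<odot>\<^bsub>A\<^esub> (a \<oplus> b) = k \<odot>\<^bsub>A\<^esub> a \<oplus> k \<odot>\<^bsub>A\<^esub> b"
    and sm_add_l: "a \<in> carrier A \<Longrightarrow> (k + l) \<odot>\<^bsub>A\<^esub> a = k \<odot>\<^bsub>A\<^esub> a \<oplus> l \<odot>\<^bsub>A\<^esub> a"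
    and sm_assoc: "a \<in> carrier A \<Longrightarrow> (k * l) \<odot>\<^bsub>A\<^esub> a = k \<odot>\<^bsub>A\<^esub> (l \<odot>\<^bsub>A\<^esub> a)"
    and sm_one [simp]: "a \<in> carrier A \<Longrightarrow> 1 \<odot>\<^bsub>A\<^esub> a = a"
    and sm_mult_l: "a \<in> carrier A \<Longrightarrow> b \<in> carrier A \<Longrightarrow> (k \<odot>\<^bsub>A\<^esub> a) \<otimes> b = k \<odot>\<^bsub>A\<^esub> (a \<otimes> b)"
    and sm_mult_r: "a \<in> carrier A \<Longrightarrow> b \<in> carrier A \<Longrightarrow> a \<otimes> (k \<odot>\<^bsub>A\<^esub> b) = k \<odot>\<^bsub>A\<^esub> (a \<otimes> b)"
begin

lemma sm_zero_l [simp]: "a \<in> carrier A \<Longrightarrow> 0 \<odot>\<^bsub>A\<^esub> a = \<zero>"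
  using sm_add_l[of a 0 0] by (metis add.l_cancel_one add_0 sm_closed)

lemma sm_zero_r [simp]: "k \<odot>\<^bsub>A\<^esub> \<zero> = \<zero>"
  using sm_add_r[of \<zero> \<zero> k] by (metis add.l_cancel_one zero_closed r_zero sm_closed)

lemma sm_minus_one: "a \<in> carrier A \<Longrightarrow> (-1) \<odot>\<^bsub>A\<^esub> a = \<ominus> a"
  using sm_add_l[of a "-1" 1] minus_equality[of "(-1) \<odot>\<^bsub>A\<^esub> a" a] by simp

lemma sm_minus_r: "a \<in> carrier A \<Longrightarrow> k \<odot>\<^bsub>A\<^esub> (\<ominus> a) = \<ominus> (k \<odot>\<^bsub>A\<^esub> a)"
  by (simp add: sm_minus_one[symmetric] sm_assoc[symmetric])

lemma sm_minus_l: "a \<in> carrier A \<Longrightarrow> (- k) \<odot>\<^bsub>A\<^esub> a = \<ominus> (k \<odot>\<^bsub>A\<^esub> a)"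
  by (simp add: sm_minus_one[symmetric] sm_assoc[symmetric])

lemma sm_diff_r: "a \<in> carrier A \<Longrightarrow> b \<in> carrier A \<Longrightarrow> k \<odot>\<^bsub>A\<^esub> (a \<ominus> b) = k \<odot>\<^bsub>A\<^esub> a \<ominus> k \<odot>\<^bsub>A\<^esub> b"
  by (simp add: minus_eq sm_add_r sm_minus_r)

lemma sm_eq_one_mult: "a \<in> carrier A \<Longrightarrow> k \<odot>\<^bsub>A\<^esub> a = (k \<odot>\<^bsub>A\<^esub> \<one>) \<otimes> a"
  by (simp add: sm_mult_l)

lemma sm_inverse: "a \<in> carrier A \<Longrightarrow> k \<noteq> 0 \<Longrightarrow> (1 / k) \<odot>\<^bsub>A\<^esub> (k \<odot>\<^bsub>A\<^esub> a) = a"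
  by (simp add: sm_assoc[symmetric])

lemma sm_cancel: "a \<in> carrier A \<Longrightarrow> k \<noteq> 0 \<Longrightarrow> k \<odot>\<^bsub>A\<^esub> a = \<zero> \<Longrightarrow> a = \<zero>"
  by (metis left_inverse sm_assoc sm_one sm_zero_r)

end

definition alg_hom :: "'a calg \<Rightarrow> 'b calg \<Rightarrow> ('a \<Rightarrow> 'b) set" where
  "alg_hom A B = {f \<in> ring_hom A B. \<forall>k. \<forall>a\<in>carrier A. f (k \<odot>\<^bsub>A\<^esub> a) = k \<odot>\<^bsub>B\<^esub> f a}"

lemma alg_homD:
  assumes "f \<in> alg_hom A B"
  shows "a \<in> carrier A \<Longrightarrow> f a \<in> carrier B"
    and "a \<in> carrier A \<Longrightarrow> b \<in> carrier A \<Longrightarrow> f (a \<oplus>\<^bsub>A\<^esub> b) = f a \<oplus>\<^bsub>B\<^esub> f b"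
    and "a \<in> carrier A \<Longrightarrow> b \<in> carrier A \<Longrightarrow> f (a \<otimes>\<^bsub>A\<^esub> b) = f a \<otimes>\<^bsub>B\<^esub> f b"
    and "f \<one>\<^bsub>A\<^esub> = \<one>\<^bsub>B\<^esub>"
    and "a \<in> carrier A \<Longrightarrow> f (k \<odot>\<^bsub>A\<^esub> a) = k \<odot>\<^bsub>B\<^esub> f a"
  using assms by (auto simp: alg_hom_def ring_hom_def)

lemma alg_hom_compose:
  assumes "f \<in> alg_hom A B" "g \<in> alg_hom B C" shows "g \<circ> f \<in> alg_hom A C"
  using alg_homD[OF assms(1)] alg_homD[OF assms(2)] by (auto simp: alg_hom_def ring_hom_def)

lemma alg_hom_zero_minus:
  assumes "f \<in> alg_hom A B" "calgebra A" "calgebra B"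
  shows "f \<zero>\<^bsub>A\<^esub> = \<zero>\<^bsub>B\<^esub>" and "a \<in> carrier A \<Longrightarrow> f (\<ominus>\<^bsub>A\<^esub> a) = \<ominus>\<^bsub>B\<^esub> f a"
    and "a \<in> carrier A \<Longrightarrow> b \<in> carrier A \<Longrightarrow> f (a \<ominus>\<^bsub>A\<^esub> b) = f a \<ominus>\<^bsub>B\<^esub> f b"
proof -
  interpret A: calgebra A by fact
  interpret B: calgebra B by fact
  note h = additive_map_zero_minus[OF A.abelian_group_axioms B.abelian_group_axioms
      alg_homD(1)[OF assms(1)] alg_homD(2)[OF assms(1)]]
  show "f \<zero>\<^bsub>A\<^esub> = \<zero>\<^bsub>B\<^esub>" by (rule h(1))
  show "a \<in> carrier A \<Longrightarrow> f (\<ominus>\<^bsub>A\<^esub> a) = \<ominus>\<^bsub>B\<^esub> f a" by (rule h(2))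
  show "a \<in> carrier A \<Longrightarrow> b \<in> carrier A \<Longrightarrow> f (a \<ominus>\<^bsub>A\<^esub> b) = f a \<ominus>\<^bsub>B\<^esub> f b" by (rule h(3))
qed

text \<open>U arises from a free algebra by three successive quotients of this kind, and the algebra
  of Crawley-Boevey and Holland is a corner of another one.\<close>

locale quotient_algebra = calgebra A for A :: "'a calg" (structure) +
  fixes R :: "'a set" assumes R_carrier: "R \<subseteq> carrier A"
begin

abbreviation Q where "Q \<equiv> quot_alg A R"
abbreviation I where "I \<equiv> Idl\<^bsub>A\<^esub> R"

sublocale I: ideal I A by (rule genideal_ideal[OF R_carrier])

lemma I_cosets: "cosets I A"
  by (simp add: cosets_def abelian_group_axioms I.additive_subgroup_axioms)

sublocale IC: cosets I A by (rule I_cosets)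

lemma Q_simps:
  "carrier Q = a_rcosets I" "mult Q = rcoset_mult A I" "one Q = I +> \<one>" "ring.zero Q = I"
  "add Q = set_add A" "smult Q k X = (\<Union>a\<in>X. I +> (k \<odot>\<^bsub>A\<^esub> a))"
  by (simp_all add: quot_alg_def Let_def FactRing_def)

lemma in_Q_iff: "X \<in> carrier Q \<longleftrightarrow> (\<exists>a\<in>carrier A. X = quot_proj A R a)"
  by (simp add: Q_simps IC.mem_a_rcosets quot_proj_def)

lemma proj_smult:
  assumes "a \<in> carrier A" shows "k \<odot>\<^bsub>Q\<^esub> quot_proj A R a = quot_proj A R (k \<odot>\<^bsub>A\<^esub> a)"
  unfolding Q_simps quot_proj_def
proof (rule IC.UN_rcos[OF assms I_cosets])
  fix x assume "x \<in> I +> a"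
  then have x: "x \<in> carrier A" "x \<ominus> a \<in> I" using IC.mem_rcos assms by auto
  then show "k \<odot>\<^bsub>A\<^esub> x \<in> carrier A" by simp
  have "k \<odot>\<^bsub>A\<^esub> x \<ominus> k \<odot>\<^bsub>A\<^esub> a = (k \<odot>\<^bsub>A\<^esub> \<one>) \<otimes> (x \<ominus> a)"
    using x assms by (simp add: sm_diff_r[symmetric] sm_eq_one_mult[symmetric])
  then show "k \<odot>\<^bsub>A\<^esub> x \<ominus> k \<odot>\<^bsub>A\<^esub> a \<in> I" using x(2) I.I_l_closed by simp
qed

lemma quot_proj_hom: "quot_proj A R \<in> alg_hom A Q"
  unfolding alg_hom_def ring_hom_def
  using proj_smult by (auto simp: Q_simps quot_proj_def IC.rcos_add I.rcoset_mult_add)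

lemma Q_ring: "ring Q"
proof -
  interpret F: ring "A Quot I" by (rule I.quotient_is_ring)
  have eq: "carrier Q = carrier (A Quot I)" "mult Q = mult (A Quot I)" "one Q = one (A Quot I)"
    "ring.zero Q = ring.zero (A Quot I)" "add Q = add (A Quot I)"
    by (simp_all add: quot_alg_def Let_def)
  show ?thesis
  proof (rule ringI)
    show "abelian_group Q" by (rule IC.coset_abelian_group) (simp_all add: Q_simps)
    show "Group.monoid Q" by (rule monoidI) (simp_all add: eq F.m_assoc)
  qed (simp_all add: eq F.l_distr F.r_distr)
qed

lemma Q_calgebra: "calgebra Q"
proof (intro calgebra.intro calgebra_axioms.intro Q_ring)
  note p = alg_homD(2,3,5)[OF quot_proj_hom, symmetric] and pc = alg_homD(1)[OF quot_proj_hom]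
  fix X k l assume "X \<in> carrier Q"
  then obtain a where a: "a \<in> carrier A" "X = quot_proj A R a" unfolding in_Q_iff by (elim bexE)
  show "k \<odot>\<^bsub>Q\<^esub> X \<in> carrier Q" "(k + l) \<odot>\<^bsub>Q\<^esub> X = k \<odot>\<^bsub>Q\<^esub> X \<oplus>\<^bsub>Q\<^esub> l \<odot>\<^bsub>Q\<^esub> X"
    "(k * l) \<odot>\<^bsub>Q\<^esub> X = k \<odot>\<^bsub>Q\<^esub> (l \<odot>\<^bsub>Q\<^esub> X)" "1 \<odot>\<^bsub>Q\<^esub> X = X"
    using a by (simp_all add: p sm_add_l sm_assoc pc)
  fix Y assume "Y \<in> carrier Q"
  then obtain b where b: "b \<in> carrier A" "Y = quot_proj A R b" unfolding in_Q_iff by (elim bexE)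
  show "k \<odot>\<^bsub>Q\<^esub> (X \<oplus>\<^bsub>Q\<^esub> Y) = k \<odot>\<^bsub>Q\<^esub> X \<oplus>\<^bsub>Q\<^esub> k \<odot>\<^bsub>Q\<^esub> Y"
    using a b by (simp add: p sm_add_r)
  show "(k \<odot>\<^bsub>Q\<^esub> X) \<otimes>\<^bsub>Q\<^esub> Y = k \<odot>\<^bsub>Q\<^esub> (X \<otimes>\<^bsub>Q\<^esub> Y)"
    using a b by (simp add: p sm_mult_l)
  show "X \<otimes>\<^bsub>Q\<^esub> (k \<odot>\<^bsub>Q\<^esub> Y) = k \<odot>\<^bsub>Q\<^esub> (X \<otimes>\<^bsub>Q\<^esub> Y)"
    using a b by (simp add: p sm_mult_r)
qed

lemma proj_eq_zero:
  assumes "a \<in> R" shows "quot_proj A R a = \<zero>\<^bsub>Q\<^esub>"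
proof -
  have "a \<in> carrier A" "a \<in> I" using genideal_self[OF R_carrier] R_carrier assms by auto
  then show ?thesis unfolding quot_proj_def Q_simps by (simp only: IC.rcos_eq_self_iff)
qed

end

section \<open>Free algebras and substitution\<close>

lemma free_alg_simps [simp]:
  "carrier free_alg = UNIV" "mult free_alg = (*)" "one free_alg = 1" "ring.zero free_alg = 0"
  "add free_alg = (+)" "smult free_alg k p = free_const k * p"
  by (simp_all add: free_alg_def)

lemma free_add_induct [case_names add single]:
  assumes "\<And>p q. Q p \<Longrightarrow> Q q \<Longrightarrow> Q (p + q)" "\<And>v k. Q (Poly_Mapping.single v k)"
  shows "Q (p :: 'g free)"
proof -
  have "Q (\<Sum>x\<in>V. Poly_Mapping.single x (Poly_Mapping.lookup p x))" if "finite V" for V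
    using that
  proof (induction V rule: finite_induct)
    case empty
    then show ?case using assms(2)[of 0 0] by simp
  qed (simp add: assms)
  moreover have "p = (\<Sum>x\<in>Poly_Mapping.keys p. Poly_Mapping.single x (Poly_Mapping.lookup p x))"
    by (rule poly_mapping_eqI) (simp add: lookup_sum lookup_single when_def sum.delta' in_keys_iff)
  ultimately show ?thesis using finite_keys by metis
qed

lemma free_const_mult: "free_const k * Poly_Mapping.single v l = Poly_Mapping.single v (k * l)"
  by (simp add: free_const_def mult_single)

lemma mult_free_const: "p * free_const k = free_const k * (p :: 'g free)"
  by (induction p rule: free_add_induct)
    (simp_all add: distrib_left distrib_right free_const_def mult_single mult.commute)

lemma free_const_simps:
  "free_const (k + l) = free_const k + free_const l" "free_const (k * l) = free_const k * free_const l"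
  "free_const 1 = 1" "free_const 0 = 0"
  by (simp_all add: free_const_def single_add mult_single)

lemma free_alg_calgebra: "calgebra free_alg"
proof (intro calgebra.intro calgebra_axioms.intro ringI abelian_groupI monoidI)
  show "\<exists>y\<in>carrier free_alg. y \<oplus>\<^bsub>free_alg\<^esub> x = \<zero>\<^bsub>free_alg\<^esub>" for x :: "'a free"
    by (rule bexI[of _ "- x"]) simp_all
  show "a \<otimes>\<^bsub>free_alg\<^esub> (k \<odot>\<^bsub>free_alg\<^esub> b) = k \<odot>\<^bsub>free_alg\<^esub> (a \<otimes>\<^bsub>free_alg\<^esub> b)" for a b :: "'a free" and k
    by (simp add: mult.assoc[symmetric] mult_free_const)
qed (simp_all add: algebra_simps free_const_simps)

lemma free_alg_minus [simp]: "\<ominus>\<^bsub>free_alg\<^esub> p = - p"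
proof -
  interpret calgebra free_alg by (rule free_alg_calgebra)
  show ?thesis by (rule minus_equality) simp_all
qed

lemma free_alg_diff [simp]: "p \<ominus>\<^bsub>free_alg\<^esub> q = p - q"
  by (simp add: a_minus_def)

lemma single_Word: "Poly_Mapping.single (Word gs) 1 = prod_list (map letter gs)"
proof (induction gs)
  case Nil
  then show ?case by (simp add: zero_word_def[symmetric])
next
  case (Cons g gs)
  have "Word (g # gs) = Word [g] + Word gs" by (simp add: plus_word_def)
  then have "Poly_Mapping.single (Word (g # gs)) (1 :: complex) = letter g * Poly_Mapping.single (Word gs) 1"
    by (simp add: letter_def mult_single)
  then show ?case using Cons by simp
qed

lemma single_eq_const_prod: "Poly_Mapping.single v k = free_const k * prod_list (map letter (letters v))"
  using single_Word[of "letters v"] by (metis free_const_mult mult.right_neutral word.collapse)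

text \<open>Words grow by prepending a letter, which is the form in which the induction principle of
  \<open>slV_algebra\<close> is transported to U.\<close>

lemma free_induct [case_names add const letter]:
  assumes "\<And>p q. Q p \<Longrightarrow> Q q \<Longrightarrow> Q (p + q)" "\<And>k. Q (free_const k)" "\<And>g p. Q p \<Longrightarrow> Q (letter g * p)"
  shows "Q (p :: 'g free)"
proof (induction p rule: free_add_induct)
  case (single v k)
  have "Q (prod_list (map letter gs) * free_const k)" for gs
    by (induction gs) (simp_all add: assms mult.assoc)
  then show ?case by (simp add: single_eq_const_prod mult_free_const)
qed (rule assms)

lemma free_subst_superset:
  assumes "finite V" "Poly_Mapping.keys p \<subseteq> V"
  shows "free_subst s p = (\<Sum>w\<in>V. free_const (Poly_Mapping.lookup p w) * prod_list (map s (letters w)))"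
  unfolding free_subst_def
  by (rule sum.mono_neutral_left) (use assms in \<open>auto simp: in_keys_iff free_const_simps\<close>)

lemma free_subst_add: "free_subst s (p + q) = free_subst s p + free_subst s q"
proof -
  define V where "V = Poly_Mapping.keys p \<union> Poly_Mapping.keys q"
  have V: "finite V" "Poly_Mapping.keys p \<subseteq> V" "Poly_Mapping.keys q \<subseteq> V" "Poly_Mapping.keys (p + q) \<subseteq> V"
    using Poly_Mapping.keys_add[of p q] by (auto simp: V_def)
  show ?thesis
    unfolding V(2,3,4)[THEN free_subst_superset[OF V(1)]]
    by (simp add: lookup_add free_const_simps distrib_right sum.distrib)
qed

lemma free_subst_single: "free_subst s (Poly_Mapping.single v k) = free_const k * prod_list (map s (letters v))"
  using free_subst_superset[of "{v}" "Poly_Mapping.single v k" s] by (simp add: keys_single)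

lemma free_subst_const [simp]: "free_subst s (free_const k) = free_const k"
  using free_subst_single[of s 0 k] by (simp add: free_const_def zero_word_def)

lemma free_subst_one [simp]: "free_subst s 1 = 1"
  using free_subst_const[of s 1] by (simp add: free_const_simps)

lemma free_subst_zero [simp]: "free_subst s 0 = 0"
  using free_subst_const[of s 0] by (simp add: free_const_simps)

lemma free_subst_letter [simp]: "free_subst s (letter g) = s g"
  by (simp add: letter_def free_subst_single free_const_simps)

lemma free_subst_mult:
  fixes s :: "'g \<Rightarrow> 'h free"
  shows "free_subst s (p * q) = free_subst s p * free_subst s q"
proof (induction p rule: free_add_induct)
  case (single v k)
  show ?case
  proof (induction q rule: free_add_induct)
    case (single u l)
    have "free_const (k * l) * (a * b) = free_const k * a * (free_const l * b)" for a b :: "'h free"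
    proof -
      have "free_const k * a * (free_const l * b) = free_const k * ((a * free_const l) * b)" by (simp only: mult.assoc)
      also have "\<dots> = free_const k * ((free_const l * a) * b)" by (simp only: mult_free_const)
      finally show ?thesis by (simp only: free_const_simps mult.assoc)
    qed
    then show ?case by (simp add: mult_single free_subst_single plus_word_def)
  qed (simp add: distrib_left free_subst_add)
qed (simp add: distrib_right free_subst_add)

lemma free_subst_sum: "free_subst s (sum f X) = (\<Sum>x\<in>X. free_subst s (f x))"
  by (induction X rule: infinite_finite_induct) (simp_all add: free_subst_add)

lemma free_subst_comp: "free_subst s (free_subst t p) = free_subst (\<lambda>g. free_subst s (t g)) p"
  by (induction p rule: free_induct) (simp_all add: free_subst_add free_subst_mult)

lemma free_subst_id: "free_subst letter p = p"
  by (induction p rule: free_induct) (simp_all add: free_subst_add free_subst_mult)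

section \<open>Algebras generated by \<open>sl\<^sub>2\<close> and \<open>V\<close>\<close>

text \<open>An abstract stand-in for U. The relations are oriented so that no subtraction occurs,
  and the induction over left multiplication by generators replaces a spanning set of
  monomials.\<close>

locale slV_algebra = calgebra A for A :: "'a calg" (structure) +
  fixes s :: "sl2V \<Rightarrow> 'a"
  assumes s_closed [simp]: "s g \<in> carrier A"
    and he: "s gen_h \<otimes> s gen_e = s gen_e \<otimes> s gen_h \<oplus> 2 \<odot>\<^bsub>A\<^esub> s gen_e"
    and fh: "s gen_f \<otimes> s gen_h = s gen_h \<otimes> s gen_f \<oplus> 2 \<odot>\<^bsub>A\<^esub> s gen_f"
    and ef: "s gen_e \<otimes> s gen_f = s gen_f \<otimes> s gen_e \<oplus> s gen_h"
    and ex: "s gen_e \<otimes> s gen_x = s gen_x \<otimes> s gen_e"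
    and hx: "s gen_h \<otimes> s gen_x = s gen_x \<otimes> s gen_h \<oplus> s gen_x"
    and ey: "s gen_e \<otimes> s gen_y = s gen_y \<otimes> s gen_e \<oplus> s gen_x"
    and yh: "s gen_y \<otimes> s gen_h = s gen_h \<otimes> s gen_y \<oplus> s gen_y"
    and gen_induct: "\<lbrakk>a \<in> carrier A; \<And>k. Q (k \<odot>\<^bsub>A\<^esub> \<one>);
      \<And>a b. \<lbrakk>a \<in> carrier A; b \<in> carrier A; Q a; Q b\<rbrakk> \<Longrightarrow> Q (a \<oplus> b);
      \<And>g a. \<lbrakk>a \<in> carrier A; Q a\<rbrakk> \<Longrightarrow> Q (s g \<otimes> a)\<rbrakk> \<Longrightarrow> Q a"
begin

abbreviation e where "e \<equiv> s gen_e"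
abbreviation h where "h \<equiv> s gen_h"
abbreviation f where "f \<equiv> s gen_f"
abbreviation x where "x \<equiv> s gen_x"
abbreviation y where "y \<equiv> s gen_y"

lemma sm2: "a \<in> carrier A \<Longrightarrow> 2 \<odot>\<^bsub>A\<^esub> a = a \<oplus> a"
  using sm_add_l[of a 1 1] by simp

lemma sm4: "a \<in> carrier A \<Longrightarrow> 4 \<odot>\<^bsub>A\<^esub> a = (a \<oplus> a) \<oplus> (a \<oplus> a)"
  using sm_add_l[of a 2 2] by (simp add: sm2)

lemma sm8: "a \<in> carrier A \<Longrightarrow> 8 \<odot>\<^bsub>A\<^esub> a = ((a \<oplus> a) \<oplus> (a \<oplus> a)) \<oplus> ((a \<oplus> a) \<oplus> (a \<oplus> a))"
  using sm_add_l[of a 4 4] by (simp add: sm4)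

subsection \<open>The grading by eigenvalues of \<open>ad h\<close>\<close>

definition wt :: "int \<Rightarrow> 'a \<Rightarrow> bool" where
  "wt k a \<longleftrightarrow> a \<in> carrier A \<and> h \<otimes> a = a \<otimes> h \<oplus> of_int k \<odot>\<^bsub>A\<^esub> a"

definition ad :: "'a \<Rightarrow> 'a" where
  "ad a = h \<otimes> a \<ominus> a \<otimes> h"

lemma ad_closed [simp]: "a \<in> carrier A \<Longrightarrow> ad a \<in> carrier A"
  by (simp add: ad_def)

lemma ad_add: "a \<in> carrier A \<Longrightarrow> b \<in> carrier A \<Longrightarrow> ad (a \<oplus> b) = ad a \<oplus> ad b"
  by (simp add: ad_def r_distr l_distr minus_eq minus_add a_ac)

lemma ad_sm: "a \<in> carrier A \<Longrightarrow> ad (k \<odot>\<^bsub>A\<^esub> a) = k \<odot>\<^bsub>A\<^esub> ad a"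
  by (simp add: ad_def sm_mult_l sm_mult_r sm_diff_r)

lemma ad_mult:
  assumes "a \<in> carrier A" "b \<in> carrier A" shows "ad (a \<otimes> b) = ad a \<otimes> b \<oplus> a \<otimes> ad b"
  using assms
  by (simp add: ad_def minus_eq l_distr r_distr m_assoc l_minus r_minus a_assoc r_neg1 r_neg2)

lemma wt_ad: "wt k a \<longleftrightarrow> a \<in> carrier A \<and> ad a = of_int k \<odot>\<^bsub>A\<^esub> a"
proof -
  have "p \<ominus> q = r \<longleftrightarrow> p = q \<oplus> r" if "p \<in> carrier A" "q \<in> carrier A" "r \<in> carrier A" for p q r
    using that by (metis a_comm minus_eq add.inv_solve_right' a_inv_closed)
  then show ?thesis unfolding wt_def ad_def by auto
qed

lemma wt_closed: "wt k a \<Longrightarrow> a \<in> carrier A"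
  by (simp add: wt_def)

lemma wt_add: "wt k a \<Longrightarrow> wt k b \<Longrightarrow> wt k (a \<oplus> b)"
  by (simp add: wt_ad ad_add sm_add_r)

lemma wt_sm: "wt k a \<Longrightarrow> wt k (l \<odot>\<^bsub>A\<^esub> a)"
  by (simp add: wt_ad ad_sm sm_assoc[symmetric] mult.commute)

lemma wt_mult: "wt k a \<Longrightarrow> wt l b \<Longrightarrow> wt (k + l) (a \<otimes> b)"
  by (simp add: wt_ad ad_mult sm_add_l sm_mult_l sm_mult_r)

lemma wt_zero: "wt k \<zero>"
  by (simp add: wt_def)

lemma wt_one: "wt 0 \<one>"
  by (simp add: wt_def)

definition gen_wt :: "sl2V \<Rightarrow> int" where
  "gen_wt g = (case g of gen_e \<Rightarrow> 2 | gen_h \<Rightarrow> 0 | gen_f \<Rightarrow> -2 | gen_x \<Rightarrow> 1 | gen_y \<Rightarrow> -1)"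

lemma wt_gen: "wt (gen_wt g) (s g)"
proof -
  have cancel: "p = q \<oplus> r \<Longrightarrow> q \<in> carrier A \<Longrightarrow> r \<in> carrier A \<Longrightarrow> q = p \<oplus> (\<ominus> r)" for p q r
    by (simp add: a_assoc r_neg)
  show ?thesis
    by (cases g)
      (simp_all add: gen_wt_def wt_def he hx cancel[OF fh] cancel[OF yh] sm_minus_l)
qed

subsection \<open>Regularity of \<open>e - 1\<close>\<close>

text \<open>A list of weights k such that the product of the operators ad h - k annihilates a. It
  certifies that a involves finitely many weights without naming a decomposition, and it supports
  induction on the length of the list.\<close>

primrec killed_by :: "int list \<Rightarrow> 'a \<Rightarrow> bool" where
  "killed_by [] a \<longleftrightarrow> a = \<zero>"
| "killed_by (k # ks) a \<longleftrightarrow> killed_by ks (ad a \<ominus> of_int k \<odot>\<^bsub>A\<^esub> a)"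

lemma killed_by_zero: "killed_by ks \<zero>"
  by (induction ks) (simp_all add: ad_def)

lemma killed_by_add: "a \<in> carrier A \<Longrightarrow> b \<in> carrier A \<Longrightarrow> killed_by ks a \<Longrightarrow> killed_by ks b \<Longrightarrow> killed_by ks (a \<oplus> b)"
proof (induction ks arbitrary: a b)
  case (Cons k ks)
  have "(ad a \<ominus> of_int k \<odot>\<^bsub>A\<^esub> a) \<oplus> (ad b \<ominus> of_int k \<odot>\<^bsub>A\<^esub> b) = ad (a \<oplus> b) \<ominus> of_int k \<odot>\<^bsub>A\<^esub> (a \<oplus> b)"
    using Cons.prems by (simp add: ad_add sm_add_r minus_eq minus_add a_ac)
  then show ?case using Cons.IH[of "ad a \<ominus> of_int k \<odot>\<^bsub>A\<^esub> a" "ad b \<ominus> of_int k \<odot>\<^bsub>A\<^esub> b"] Cons.prems by simp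
qed simp

lemma killed_by_append_r: "a \<in> carrier A \<Longrightarrow> killed_by ks a \<Longrightarrow> killed_by (ks @ ls) a"
  by (induction ks arbitrary: a) (simp_all add: killed_by_zero)

lemma ad_swap:
  assumes "a \<in> carrier A"
  shows "ad (ad a \<ominus> k \<odot>\<^bsub>A\<^esub> a) \<ominus> l \<odot>\<^bsub>A\<^esub> (ad a \<ominus> k \<odot>\<^bsub>A\<^esub> a)
    = ad (ad a \<ominus> l \<odot>\<^bsub>A\<^esub> a) \<ominus> k \<odot>\<^bsub>A\<^esub> (ad a \<ominus> l \<odot>\<^bsub>A\<^esub> a)"
proof -
  have m: "ad (\<ominus> c) = \<ominus> ad c" if "c \<in> carrier A" for c
    using ad_sm[of c "-1"] that by (simp add: sm_minus_one)
  show ?thesis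
    using assms
    by (simp add: minus_eq ad_add m ad_sm sm_add_r sm_minus_r minus_add sm_assoc[symmetric] mult.commute a_ac)
qed

lemma killed_by_step: "a \<in> carrier A \<Longrightarrow> killed_by ks a \<Longrightarrow> killed_by ks (ad a \<ominus> of_int l \<odot>\<^bsub>A\<^esub> a)"
proof (induction ks arbitrary: a)
  case (Cons k ks)
  then show ?case using Cons.IH[of "ad a \<ominus> of_int k \<odot>\<^bsub>A\<^esub> a"] by (simp add: ad_swap[of a "of_int k"])
qed (simp add: ad_def)

lemma killed_by_append_l: "a \<in> carrier A \<Longrightarrow> killed_by ks a \<Longrightarrow> killed_by (ls @ ks) a"
  by (induction ls arbitrary: a) (simp_all add: killed_by_step)

text \<open>Sums of \<open>ad h\<close>-eigenvectors paired with their images under the automorphism \<open>a \<mapsto> \<gamma>\<^sup>k a\<close> for \<open>[h, a] = k a\<close>.\<close>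

inductive twist :: "complex \<Rightarrow> 'a \<Rightarrow> 'a \<Rightarrow> bool" for \<gamma> where
  wt: "wt k a \<Longrightarrow> twist \<gamma> a (\<gamma> powi k \<odot>\<^bsub>A\<^esub> a)"
| add: "twist \<gamma> a t \<Longrightarrow> twist \<gamma> b u \<Longrightarrow> twist \<gamma> (a \<oplus> b) (t \<oplus> u)"

lemma twist_closed: "twist \<gamma> a t \<Longrightarrow> a \<in> carrier A \<and> t \<in> carrier A"
  by (induction rule: twist.induct) (auto dest: wt_closed)

lemma twist_mult:
  assumes \<gamma>: "\<gamma> \<noteq> 0" and "twist \<gamma> a t" "twist \<gamma> b u"
  shows "twist \<gamma> (a \<otimes> b) (t \<otimes> u)"
  using assms(2)
proof (induction rule: twist.induct)
  case (wt k a)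
  note a = wt
  show ?case
    using assms(3)
  proof (induction rule: twist.induct)
    case (wt l b)
    have "(\<gamma> powi k \<odot>\<^bsub>A\<^esub> a) \<otimes> (\<gamma> powi l \<odot>\<^bsub>A\<^esub> b) = \<gamma> powi (k + l) \<odot>\<^bsub>A\<^esub> (a \<otimes> b)"
      using wt_closed[OF a] wt_closed[OF wt] \<gamma>
      by (simp add: sm_mult_l sm_mult_r sm_assoc[symmetric] power_int_add mult.commute[of "\<gamma> powi l"])
    then show ?case using twist.wt[OF wt_mult[OF a wt]] by simp
  next
    case (add b u c v)
    then show ?case
      using twist.add[OF add.IH] twist_closed add.hyps wt_closed[OF a] by (simp add: r_distr)
  qed
next
  case (add a t c v)
  then show ?case
    using twist.add[OF add.IH] twist_closed[OF add.hyps(1)] twist_closed[OF add.hyps(2)] twist_closed[OF assms(3)]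
    by (simp add: l_distr)
qed

lemma twist_sm: "twist \<gamma> a t \<Longrightarrow> twist \<gamma> (k \<odot>\<^bsub>A\<^esub> a) (k \<odot>\<^bsub>A\<^esub> t)"
proof (induction rule: twist.induct)
  case (wt l a)
  then show ?case
    using twist.wt[OF wt_sm[OF wt], of \<gamma> k] wt_closed[OF wt] by (simp add: sm_assoc[symmetric] mult.commute)
next
  case (add a t b u)
  then show ?case
    using twist.add[OF add.IH] twist_closed[OF add.hyps(1)] twist_closed[OF add.hyps(2)] by (simp add: sm_add_r)
qed

lemma twist_one: "twist \<gamma> \<one> \<one>"
  using twist.wt[OF wt_one, of \<gamma>] by simp

lemma twist_gen: "twist \<gamma> (s g) (\<gamma> powi gen_wt g \<odot>\<^bsub>A\<^esub> s g)"
  by (rule twist.wt[OF wt_gen])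

lemma twist_total: "\<gamma> \<noteq> 0 \<Longrightarrow> a \<in> carrier A \<Longrightarrow> \<exists>t. twist \<gamma> a t"
  by (rule gen_induct[of a "\<lambda>a. \<exists>t. twist \<gamma> a t"])
    (blast intro: twist_sm twist_one twist.add twist_mult twist_gen)+

lemma twist_inverse:
  assumes "\<gamma> \<noteq> 0" "twist \<gamma> a t" shows "twist (inverse \<gamma>) t a"
  using assms(2)
proof (induction rule: twist.induct)
  case (wt k a)
  have "inverse \<gamma> powi k * \<gamma> powi k = 1" using assms(1) by (simp add: power_int_inverse)
  then have "inverse \<gamma> powi k \<odot>\<^bsub>A\<^esub> (\<gamma> powi k \<odot>\<^bsub>A\<^esub> a) = a"
    using wt_closed[OF wt] by (simp add: sm_assoc[symmetric])
  then show ?case using twist.wt[OF wt_sm[OF wt], of "inverse \<gamma>" "\<gamma> powi k"] by simp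
qed (rule twist.add)

lemma killed_by_exists: "a \<in> carrier A \<Longrightarrow> \<exists>ks. killed_by ks a"
proof -
  assume "a \<in> carrier A"
  \<comment> \<open>The value 1 is arbitrary: \<open>twist\<close> only serves to present a as a sum
    of weight vectors.\<close>
  then obtain t where "twist 1 a t" using twist_total[of 1] by auto
  then show ?thesis
  proof (induction rule: twist.induct)
    case (wt k a)
    then have "killed_by [k] a" by (simp add: wt_ad minus_eq r_neg)
    then show ?case by blast
  next
    case (add a t b u)
    then obtain ks ls where "killed_by ks a" "killed_by ls b" by blast
    then have "killed_by (ks @ ls) (a \<oplus> b)"
      using twist_closed[OF add.hyps(1)] twist_closed[OF add.hyps(2)]
      by (simp add: killed_by_add killed_by_append_l killed_by_append_r)
    then show ?case by blast
  qed
qed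

text \<open>The two instances of \<open>W\<close> are left and right multiplication by \<open>e - 1\<close>.\<close>

lemma regular:
  fixes W :: "'a \<Rightarrow> 'a"
  assumes W_closed: "\<And>a. a \<in> carrier A \<Longrightarrow> W a \<in> carrier A"
    and W_add: "\<And>a b. a \<in> carrier A \<Longrightarrow> b \<in> carrier A \<Longrightarrow> W (a \<oplus> b) = W a \<oplus> W b"
    and W_sm: "\<And>a k. a \<in> carrier A \<Longrightarrow> W (k \<odot>\<^bsub>A\<^esub> a) = k \<odot>\<^bsub>A\<^esub> W a"
    and W_ad: "\<And>a. a \<in> carrier A \<Longrightarrow> ad (W a) = W (ad a) \<oplus> 2 \<odot>\<^bsub>A\<^esub> (W a \<oplus> a)"
    and "a \<in> carrier A" "W a = \<zero>"
  shows "a = \<zero>"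
proof -
  have Wc: "(W ^^ m) a \<in> carrier A" if "a \<in> carrier A" for m a
    by (induction m) (simp_all add: that W_closed)
  have Wa: "(W ^^ m) (a \<oplus> b) = (W ^^ m) a \<oplus> (W ^^ m) b" if "a \<in> carrier A" "b \<in> carrier A" for m a b
    by (induction m) (simp_all add: that W_add Wc)
  have Ws: "(W ^^ m) (k \<odot>\<^bsub>A\<^esub> a) = k \<odot>\<^bsub>A\<^esub> (W ^^ m) a" if "a \<in> carrier A" for m a k
    by (induction m) (simp_all add: that W_sm Wc)
  have Wm: "(W ^^ m) (\<ominus> a) = \<ominus> (W ^^ m) a" if "a \<in> carrier A" for m a
    using Ws[OF that, of m "-1"] that Wc by (simp add: sm_minus_one)
  have W0: "W \<zero> = \<zero>" using W_sm[of \<zero> 0] W_closed[of \<zero>] by simp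
  \<comment> \<open>Iteration of \<open>W_ad\<close>: each factor W contributes 2 (W + 1), and the
    summand 1 is what produces the lower power.\<close>
  have Wad: "ad ((W ^^ Suc m) a) = (W ^^ Suc m) (ad a) \<oplus> of_nat (2 * Suc m) \<odot>\<^bsub>A\<^esub> ((W ^^ Suc m) a \<oplus> (W ^^ m) a)"
    if a: "a \<in> carrier A" for m a
  proof (induction m)
    case (Suc m)
    have "ad ((W ^^ Suc (Suc m)) a) = W (ad ((W ^^ Suc m) a)) \<oplus> 2 \<odot>\<^bsub>A\<^esub> ((W ^^ Suc (Suc m)) a \<oplus> (W ^^ Suc m) a)"
      using W_ad[of "(W ^^ Suc m) a"] Wc[OF a, of "Suc m"] by simp
    also have "W (ad ((W ^^ Suc m) a)) = (W ^^ Suc (Suc m)) (ad a) \<oplus>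
        of_nat (2 * Suc m) \<odot>\<^bsub>A\<^esub> ((W ^^ Suc (Suc m)) a \<oplus> (W ^^ Suc m) a)"
      unfolding Suc.IH using a Wc W_closed by (simp add: W_add W_sm del: of_nat_Suc of_nat_mult)
    also have "\<dots> \<oplus> 2 \<odot>\<^bsub>A\<^esub> ((W ^^ Suc (Suc m)) a \<oplus> (W ^^ Suc m) a) = (W ^^ Suc (Suc m)) (ad a) \<oplus>
        (of_nat (2 * Suc m) + 2) \<odot>\<^bsub>A\<^esub> ((W ^^ Suc (Suc m)) a \<oplus> (W ^^ Suc m) a)"
      using a Wc W_closed by (simp add: sm_add_l a_assoc del: of_nat_Suc of_nat_mult)
    finally show ?case by (simp add: algebra_simps)
  qed (use a W_ad in simp)
  \<comment> \<open>For a weight vector, every term of \<open>Wad\<close> contains W^(m+1) a = 0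
    except 2 (m+1) W^m a, which must therefore vanish. The power of W thus descends to zero.\<close>
  have hom: "a = \<zero>" if "wt k a" "(W ^^ m) a = \<zero>" for k m a
    using that(2)
  proof (induction m)
    case (Suc m)
    have a: "a \<in> carrier A" "ad a = of_int k \<odot>\<^bsub>A\<^esub> a" using that(1) by (simp_all add: wt_ad)
    have "ad \<zero> = \<zero>" by (simp add: ad_def)
    then have "of_nat (2 * Suc m) \<odot>\<^bsub>A\<^esub> (W ^^ m) a = \<zero>"
      using Wad[OF a(1), of m] Suc.prems Ws[OF a(1), of "Suc m"] a Wc by simp
    then have "(W ^^ m) a = \<zero>"
      by (rule sm_cancel[OF Wc[OF a(1)], rotated]) (simp del: of_nat_Suc of_nat_mult)
    then show ?case by (rule Suc.IH)
  qed simp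
  \<comment> \<open>Since ad h does not commute with W, a higher power of W is used to annihilate
    (ad h - k) a. The induction on the list therefore allows an arbitrary power m, and
    \<open>hom\<close> brings it down again once a is known to be a weight vector.\<close>
  have main: "a = \<zero>" if "killed_by ks a" "a \<in> carrier A" "(W ^^ m) a = \<zero>" for ks a m
    using that
  proof (induction ks arbitrary: a m)
    case (Cons k ks)
    let ?b = "ad a \<ominus> of_int k \<odot>\<^bsub>A\<^esub> a"
    have W1: "(W ^^ Suc m) a = \<zero>" using Cons.prems W0 by simp
    then have W2: "(W ^^ Suc (Suc m)) a = \<zero>" using W0 by simp
    have "ad \<zero> = \<zero>" by (simp add: ad_def)
    then have "(W ^^ Suc (Suc m)) (ad a) = \<zero>"
      using Wad[OF Cons.prems(2), of "Suc m"] W1 W2 Cons.prems(2) Wc[of "ad a" "Suc (Suc m)"] by (simp del: funpow.simps)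
    then have "(W ^^ Suc (Suc m)) ?b = \<zero>"
      using Cons.prems(2) W2 by (simp add: minus_eq Wa Wm Ws del: funpow.simps)
    then have "?b = \<zero>" using Cons by (simp del: funpow.simps)
    then have "wt k a" using Cons.prems(2) by (simp add: wt_ad minus_eq_zero_iff)
    then show ?case by (rule hom[OF _ Cons.prems(3)])
  qed simp
  obtain ks where "killed_by ks a" using killed_by_exists[OF assms(5)] by blast
  then show ?thesis using main[of ks a 1] assms(5,6) by simp
qed

lemma e_minus_one_closed [simp]: "e \<ominus> \<one> \<in> carrier A" by simp

lemma ad_e1: "ad (e \<ominus> \<one>) = 2 \<odot>\<^bsub>A\<^esub> ((e \<ominus> \<one>) \<oplus> \<one>)"
proof -
  have "ad e = 2 \<odot>\<^bsub>A\<^esub> e" using wt_gen[of gen_e] by (simp add: wt_ad gen_wt_def)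
  moreover have "ad \<one> = \<zero>" by (simp add: ad_def minus_eq r_neg)
  moreover have "ad (\<ominus> \<one>) = \<ominus> ad \<one>" using ad_sm[of \<one> "-1"] by (simp add: sm_minus_one)
  moreover have "(e \<ominus> \<one>) \<oplus> \<one> = e" by (simp add: minus_eq a_assoc l_neg)
  ultimately show ?thesis by (simp add: minus_eq ad_add)
qed

lemma left_regular:
  assumes "a \<in> carrier A" "(e \<ominus> \<one>) \<otimes> a = \<zero>" shows "a = \<zero>"
proof (rule regular[of "\<lambda>a. (e \<ominus> \<one>) \<otimes> a"])
  show "ad ((e \<ominus> \<one>) \<otimes> a) = (e \<ominus> \<one>) \<otimes> ad a \<oplus> 2 \<odot>\<^bsub>A\<^esub> ((e \<ominus> \<one>) \<otimes> a \<oplus> a)" if a: "a \<in> carrier A" for a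
    unfolding ad_mult[OF e_minus_one_closed a] ad_e1
    using a by (simp only: sm_mult_l l_distr l_one e_minus_one_closed one_closed a_closed a_comm ad_closed m_closed sm_closed)
qed (use assms in \<open>simp_all add: r_distr sm_mult_r\<close>)

lemma right_regular:
  assumes "a \<in> carrier A" "a \<otimes> (e \<ominus> \<one>) = \<zero>" shows "a = \<zero>"
proof (rule regular[of "\<lambda>a. a \<otimes> (e \<ominus> \<one>)"])
  show "ad (a \<otimes> (e \<ominus> \<one>)) = ad a \<otimes> (e \<ominus> \<one>) \<oplus> 2 \<odot>\<^bsub>A\<^esub> (a \<otimes> (e \<ominus> \<one>) \<oplus> a)" if a: "a \<in> carrier A" for a
    unfolding ad_mult[OF a e_minus_one_closed] ad_e1
    using a by (simp only: sm_mult_r r_distr r_one e_minus_one_closed one_closed a_closed m_closed)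
qed (use assms in \<open>simp_all add: l_distr sm_mult_l\<close>)

end

section \<open>Independence of the weights and the automorphism \<open>tau\<close>\<close>

context slV_algebra
begin

lemma finsum_additive:
  assumes "finite K" "\<And>a. a \<in> carrier A \<Longrightarrow> E a \<in> carrier A" "E \<zero> = \<zero>"
    and "\<And>a b. a \<in> carrier A \<Longrightarrow> b \<in> carrier A \<Longrightarrow> E (a \<oplus> b) = E a \<oplus> E b"
    and "\<And>k. F k \<in> carrier A"
  shows "E (finsum A F K) = finsum A (\<lambda>k. E (F k)) K"
  using assms(1) by (induction K rule: finite_induct) (simp_all add: assms(2-5) finsum_insert)

text \<open>Applying ad h - k0 removes the term of weight k0 and multiplies the one of weight k by
  the nonzero number k - k0.\<close>

lemma wt_independent:
  assumes "finite K" "\<And>k. wt k (F k)" "finsum A F K = \<zero>" "k \<in> K"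
  shows "F k = \<zero>"
  using assms
proof (induction K arbitrary: F k rule: finite_induct)
  case (insert k0 K)
  define E where "E a = ad a \<ominus> of_int k0 \<odot>\<^bsub>A\<^esub> a" for a
  have Fc: "F k \<in> carrier A" for k using insert.prems(1) wt_closed by blast
  have EF: "E (F k) = of_int (k - k0) \<odot>\<^bsub>A\<^esub> F k" for k
    using insert.prems(1)[of k] by (simp add: E_def wt_ad minus_eq sm_minus_l[symmetric] sm_add_l[symmetric])
  have E0: "E \<zero> = \<zero>" by (simp add: E_def ad_def)
  have "finsum A (\<lambda>k. E (F k)) (insert k0 K) = E (finsum A F (insert k0 K))"
  proof (rule finsum_additive[symmetric])
    show "E (a \<oplus> b) = E a \<oplus> E b" if "a \<in> carrier A" "b \<in> carrier A" for a b
      using that by (simp add: E_def ad_add sm_add_r minus_eq minus_add a_ac)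
  qed (use insert.hyps E0 Fc in \<open>auto simp: E_def\<close>)
  also have "\<dots> = \<zero>" using insert.prems(2) E0 by simp
  finally have "finsum A (\<lambda>k. of_int (k - k0) \<odot>\<^bsub>A\<^esub> F k) K = \<zero>"
    using insert.hyps Fc by (simp add: EF finsum_insert)
  then have *: "of_int (k - k0) \<odot>\<^bsub>A\<^esub> F k = \<zero>" if "k \<in> K" for k
    using that by (intro insert.IH[of "\<lambda>k. of_int (k - k0) \<odot>\<^bsub>A\<^esub> F k"] wt_sm insert.prems(1))
  have FK: "F k = \<zero>" if "k \<in> K" for k
  proof (rule sm_cancel[OF Fc _ *[OF that]])
    show "complex_of_int (k - k0) \<noteq> 0" using that insert.hyps by auto
  qed
  then have "finsum A F K = \<zero>" using finsum_cong'[of K K "\<lambda>_. \<zero>" F] by (simp add: finsum_zero)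
  then have "F k0 = \<zero>" using insert.prems(2) insert.hyps Fc by (simp add: finsum_insert)
  then show ?case using FK insert.prems(3) by blast
qed simp

text \<open>The family F is demanded for all weights and vanishes off K, so that two decompositions
  can be extended to the union of their index sets and added there.\<close>

lemma twist_decomp:
  assumes "twist \<gamma> a t"
  shows "\<exists>K F. finite K \<and> (\<forall>k. wt k (F k)) \<and> (\<forall>k. k \<notin> K \<longrightarrow> F k = \<zero>) \<and> a = finsum A F K \<and>
    t = finsum A (\<lambda>k. \<gamma> powi k \<odot>\<^bsub>A\<^esub> F k) K"
  using assms
proof (induction rule: twist.induct)
  case (wt k a)
  have "wt i (if i = k then a else \<zero>)" for i using wt by (simp add: wt_zero)
  then show ?case
    using wt_closed[OF wt]
    by (intro exI[of _ "{k}"] exI[of _ "\<lambda>i. if i = k then a else \<zero>"]) (simp add: finsum_insert)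
next
  case (add a t b u)
  from add.IH(1) obtain K F where 1: "finite K" "\<And>k. wt k (F k)" "\<And>k. k \<notin> K \<Longrightarrow> F k = \<zero>" "a = finsum A F K"
    "t = finsum A (\<lambda>k. \<gamma> powi k \<odot>\<^bsub>A\<^esub> F k) K" by blast
  from add.IH(2) obtain L H where 2: "finite L" "\<And>k. wt k (H k)" "\<And>k. k \<notin> L \<Longrightarrow> H k = \<zero>" "b = finsum A H L"
    "u = finsum A (\<lambda>k. \<gamma> powi k \<odot>\<^bsub>A\<^esub> H k) L" by blast
  have c: "F k \<in> carrier A" "H k \<in> carrier A" for k using 1(2) 2(2) wt_closed by blast+
  have ext: "finsum A f X = finsum A f (K \<union> L)" if "X \<subseteq> K \<union> L" "\<And>k. k \<notin> X \<Longrightarrow> f k = \<zero>" "\<And>k. f k \<in> carrier A"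
    for f and X
    by (rule add.finprod_mono_neutral_cong_left) (use that 1(1) 2(1) in auto)
  have "a = finsum A F (K \<union> L)" "t = finsum A (\<lambda>k. \<gamma> powi k \<odot>\<^bsub>A\<^esub> F k) (K \<union> L)"
    "b = finsum A H (K \<union> L)" "u = finsum A (\<lambda>k. \<gamma> powi k \<odot>\<^bsub>A\<^esub> H k) (K \<union> L)"
    unfolding 1(4,5) 2(4,5) by (rule ext; use 1(3) 2(3) c in auto)+
  then have "a \<oplus> b = finsum A (\<lambda>k. F k \<oplus> H k) (K \<union> L)"
    "t \<oplus> u = finsum A (\<lambda>k. \<gamma> powi k \<odot>\<^bsub>A\<^esub> (F k \<oplus> H k)) (K \<union> L)"
    using c by (simp_all add: finsum_addf sm_add_r)
  then show ?case
    using 1 2 wt_add by (intro exI[of _ "K \<union> L"] exI[of _ "\<lambda>k. F k \<oplus> H k"]) auto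
qed

lemma twist_zero: "twist \<gamma> \<zero> t \<Longrightarrow> t = \<zero>"
proof -
  assume "twist \<gamma> \<zero> t"
  then obtain K F where "finite K" "\<forall>k. wt k (F k)" "\<zero> = finsum A F K"
    and t: "t = finsum A (\<lambda>k. \<gamma> powi k \<odot>\<^bsub>A\<^esub> F k) K" using twist_decomp by blast
  then have "F k = \<zero>" if "k \<in> K" for k using wt_independent[of K F k] that by simp
  then have "finsum A (\<lambda>k. \<gamma> powi k \<odot>\<^bsub>A\<^esub> F k) K = finsum A (\<lambda>_. \<zero>) K"
    by (intro finsum_cong') auto
  then show ?thesis by (simp add: t)
qed

text \<open>By linearity this reduces to \<open>twist_zero\<close>, that is, to the independence of
  the eigenspaces. It makes the relation the graph of a function.\<close>

lemma twist_unique: "twist \<gamma> a t \<Longrightarrow> twist \<gamma> a u \<Longrightarrow> t = u"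
proof -
  assume t: "twist \<gamma> a t" and u: "twist \<gamma> a u"
  note c = twist_closed[OF t] twist_closed[OF u]
  have "twist \<gamma> (a \<ominus> a) (t \<ominus> u)"
    using twist.add[OF t twist_sm[OF u, of "-1"]] c by (simp add: sm_minus_one minus_eq)
  then have "t \<ominus> u = \<zero>" using twist_zero c by (simp add: minus_eq r_neg)
  then show ?thesis using c by (simp add: minus_eq_zero_iff)
qed

definition tau :: "complex \<Rightarrow> 'a \<Rightarrow> 'a" where
  "tau \<gamma> a = (THE t. twist \<gamma> a t)"

lemma tau_eq: "twist \<gamma> a t \<Longrightarrow> tau \<gamma> a = t"
  unfolding tau_def by (rule the_equality) (use twist_unique in auto)

lemma twist_tau: "\<gamma> \<noteq> 0 \<Longrightarrow> a \<in> carrier A \<Longrightarrow> twist \<gamma> a (tau \<gamma> a)"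
  using twist_total[of \<gamma> a] tau_eq[of \<gamma> a] by auto

lemma tau_hom: assumes "\<gamma> \<noteq> 0" shows "tau \<gamma> \<in> alg_hom A A"
  using twist_tau[OF assms]
  by (auto simp: alg_hom_def ring_hom_def tau_eq twist_closed
      intro!: tau_eq twist.add twist_mult twist_sm twist_one assms dest: twist_closed)

lemma tau_inverse: "\<gamma> \<noteq> 0 \<Longrightarrow> a \<in> carrier A \<Longrightarrow> tau (inverse \<gamma>) (tau \<gamma> a) = a"
  using tau_eq[OF twist_inverse[OF _ twist_tau]] by blast

lemma tau_wt: "wt k a \<Longrightarrow> tau \<gamma> a = \<gamma> powi k \<odot>\<^bsub>A\<^esub> a"
  by (rule tau_eq) (rule twist.wt)

subsection \<open>The subalgebra corresponding to \<open>U'\<close>\<close>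

text \<open>This is e^(1/2) C for the generator C = e^(1/2) y + h A/2 of U': conjugation by e^(1/2)
  sends h to h - 1, and (h - 1) x = x h. Likewise x is e^(1/2) A.\<close>

definition Y :: 'a where "Y = e \<otimes> y \<oplus> (1/2) \<odot>\<^bsub>A\<^esub> (x \<otimes> h)"

definition Cas :: 'a where "Cas = casimir A s"

lemma Cas_eq: "Cas = h \<otimes> h \<oplus> 4 \<odot>\<^bsub>A\<^esub> (f \<otimes> e) \<oplus> 2 \<odot>\<^bsub>A\<^esub> h"
  by (simp add: Cas_def casimir_def)

lemma Y_closed [simp]: "Y \<in> carrier A" by (simp add: Y_def)
lemma Cas_closed [simp]: "Cas \<in> carrier A" by (simp add: Cas_eq)

inductive_set G :: "'a set" where
  const: "k \<odot>\<^bsub>A\<^esub> \<one> \<in> G"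
| x: "x \<in> G"
| Y: "Y \<in> G"
| Cas: "Cas \<in> G"
| add: "a \<in> G \<Longrightarrow> b \<in> G \<Longrightarrow> a \<oplus> b \<in> G"
| mult: "a \<in> G \<Longrightarrow> b \<in> G \<Longrightarrow> a \<otimes> b \<in> G"

lemma G_closed: "a \<in> G \<Longrightarrow> a \<in> carrier A"
  by (induction rule: G.induct) simp_all

lemma G_sm: "a \<in> G \<Longrightarrow> k \<odot>\<^bsub>A\<^esub> a \<in> G"
  using G.mult[OF G.const[of k]] G_closed by (simp add: sm_mult_l)

lemma G_zero: "\<zero> \<in> G" and G_one: "\<one> \<in> G"
  using G.const[of 0] G.const[of 1] by simp_all

lemma G_minus: "a \<in> G \<Longrightarrow> \<ominus> a \<in> G"
  using G_sm[of a "-1"] G_closed by (simp add: sm_minus_one)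

lemma ex': "a \<in> carrier A \<Longrightarrow> e \<otimes> (x \<otimes> a) = x \<otimes> (e \<otimes> a)"
  using ex by (simp add: m_assoc[symmetric])

lemma ey': "a \<in> carrier A \<Longrightarrow> e \<otimes> (y \<otimes> a) = y \<otimes> (e \<otimes> a) \<oplus> x \<otimes> a"
  using ey by (simp add: m_assoc[symmetric] l_distr)

lemma ef': "a \<in> carrier A \<Longrightarrow> e \<otimes> (f \<otimes> a) = f \<otimes> (e \<otimes> a) \<oplus> h \<otimes> a"
  using ef by (simp add: m_assoc[symmetric] l_distr)

lemma he': "a \<in> carrier A \<Longrightarrow> h \<otimes> (e \<otimes> a) = e \<otimes> (h \<otimes> a) \<oplus> 2 \<odot>\<^bsub>A\<^esub> (e \<otimes> a)"
  using he by (simp add: m_assoc[symmetric] l_distr sm_mult_l)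

text \<open>The summand e y contributes e [e, y] = e x to the commutator with e, and x h/2
  contributes x [e, h]/2 = - x e; these cancel.\<close>

lemma Y_comm: "e \<otimes> Y = Y \<otimes> e"
  by (simp add: Y_def l_distr r_distr m_assoc sm_mult_l sm_mult_r ex' ey ey' he ex
      sm_add_r sm_assoc[symmetric] a_ac)

lemma Cas_comm: "e \<otimes> Cas = Cas \<otimes> e"
  by (simp add: Cas_eq l_distr r_distr m_assoc sm_mult_l sm_mult_r ef' he he' sm_add_r sm_assoc[symmetric])
    (simp add: sm2 sm4 sm8 sm_add_r a_ac)

lemma G_comm: "a \<in> G \<Longrightarrow> e \<otimes> a = a \<otimes> e"
proof (induction rule: G.induct)
  case (mult a b)
  then show ?case using G_closed by (metis m_assoc s_closed)
qed (simp_all add: sm_mult_l sm_mult_r ex Y_comm Cas_comm l_distr r_distr G_closed)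

lemma wt_x: "wt 1 x" using wt_gen[of gen_x] by (simp add: gen_wt_def)
lemma wt_e: "wt 2 e" using wt_gen[of gen_e] by (simp add: gen_wt_def)
lemma wt_y: "wt (-1) y" using wt_gen[of gen_y] by (simp add: gen_wt_def)
lemma wt_f: "wt (-2) f" using wt_gen[of gen_f] by (simp add: gen_wt_def)
lemma wt_h: "wt 0 h" using wt_gen[of gen_h] by (simp add: gen_wt_def)

lemma wt_Y: "wt 1 Y"
  using wt_mult[OF wt_e wt_y] wt_mult[OF wt_x wt_h] by (simp add: Y_def wt_add wt_sm)

lemma wt_Cas: "wt 0 Cas"
  using wt_mult[OF wt_h wt_h] wt_mult[OF wt_f wt_e] wt_h by (simp add: Cas_eq wt_add wt_sm)

lemma tau_G: "\<gamma> \<noteq> 0 \<Longrightarrow> a \<in> G \<Longrightarrow> tau \<gamma> a \<in> G"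
proof -
  assume \<gamma>: "\<gamma> \<noteq> 0" and "a \<in> G"
  note t = alg_homD[OF tau_hom[OF \<gamma>]]
  show ?thesis
    using \<open>a \<in> G\<close>
    by (induction rule: G.induct)
      (simp_all add: t G_closed tau_wt[OF wt_x] tau_wt[OF wt_Y] tau_wt[OF wt_Cas] G.intros G_sm)
qed

subsection \<open>Nilpotency of \<open>ad e\<close>\<close>

lemma shift_e: "a \<in> carrier A \<Longrightarrow> (e \<ominus> c \<odot>\<^bsub>A\<^esub> \<one>) \<otimes> a = e \<otimes> a \<ominus> c \<odot>\<^bsub>A\<^esub> a"
  by (simp add: minus_eq l_distr l_minus sm_mult_l)

lemma shift_e_right: "a \<in> carrier A \<Longrightarrow> a \<otimes> (e \<ominus> c \<odot>\<^bsub>A\<^esub> \<one>) = a \<otimes> e \<ominus> c \<odot>\<^bsub>A\<^esub> a"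
  by (simp add: minus_eq r_distr r_minus sm_mult_r)

lemma shift_comm:
  assumes "a \<in> carrier A" "d \<in> carrier A" "e \<otimes> a = a \<otimes> e \<oplus> d"
  shows "(e \<ominus> c \<odot>\<^bsub>A\<^esub> \<one>) \<otimes> a = a \<otimes> (e \<ominus> c \<odot>\<^bsub>A\<^esub> \<one>) \<oplus> d"
proof -
  have "e \<otimes> a \<ominus> c \<odot>\<^bsub>A\<^esub> a = (a \<otimes> e \<ominus> c \<odot>\<^bsub>A\<^esub> a) \<oplus> d"
    unfolding assms(3) minus_eq using assms(1,2) by (simp add: a_ac)
  then show ?thesis by (simp only: shift_e[OF assms(1)] shift_e_right[OF assms(1)])
qed

lemma e_gen_comm:
  "e \<otimes> s g = s g \<otimes> e \<oplus> (case g of gen_e \<Rightarrow> \<zero> | gen_h \<Rightarrow> (-2) \<odot>\<^bsub>A\<^esub> e | gen_f \<Rightarrow> h | gen_x \<Rightarrow> \<zero> | gen_y \<Rightarrow> x)"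
proof -
  have "e \<otimes> h = h \<otimes> e \<oplus> (-2) \<odot>\<^bsub>A\<^esub> e"
    unfolding he by (simp add: sm_minus_l a_assoc r_neg)
  then show ?thesis by (cases g) (simp_all add: ex ey ef)
qed

lemmas gen_induct' = gen_induct [consumes 1, case_names const add mult]

text \<open>With \<open>rnil\<close> below, a pair of Ore-type conditions on a power of w moved past
  a. The left one yields local nilpotency of w on A/Aw, the right one continuity of left
  multiplication for the (e - 1)-adic filtration. Requiring every exponent j makes both stable under
  products: the power that one factor needs is supplied by the other.\<close>

definition lnil :: "'a \<Rightarrow> 'a \<Rightarrow> bool" where
  "lnil w a \<longleftrightarrow> (\<forall>j::nat. \<exists>m::nat. \<exists>r\<in>carrier A. w [^] m \<otimes> a = r \<otimes> w [^] j)"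

definition rnil :: "'a \<Rightarrow> 'a \<Rightarrow> bool" where
  "rnil w a \<longleftrightarrow> (\<forall>j::nat. \<exists>m::nat. \<exists>r\<in>carrier A. a \<otimes> w [^] m = w [^] j \<otimes> r)"

lemma lnil_more:
  assumes "w \<in> carrier A" "a \<in> carrier A" "r \<in> carrier A" "w [^] (m::nat) \<otimes> a = r \<otimes> w [^] (j::nat)" "m \<le> n"
  shows "\<exists>r\<in>carrier A. w [^] n \<otimes> a = r \<otimes> w [^] j"
proof -
  have "w [^] n \<otimes> a = w [^] (n - m) \<otimes> (w [^] m \<otimes> a)"
    using assms(1,2,5) by (simp add: m_assoc[symmetric] nat_pow_mult)
  also have "\<dots> = (w [^] (n - m) \<otimes> r) \<otimes> w [^] j" unfolding assms(4) using assms(1-3) by (simp add: m_assoc)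
  finally show ?thesis using assms(1,3) by blast
qed

lemma rnil_more:
  assumes "w \<in> carrier A" "a \<in> carrier A" "r \<in> carrier A" "a \<otimes> w [^] (m::nat) = w [^] (j::nat) \<otimes> r" "m \<le> n"
  shows "\<exists>r\<in>carrier A. a \<otimes> w [^] n = w [^] j \<otimes> r"
proof -
  have "a \<otimes> w [^] n = (a \<otimes> w [^] m) \<otimes> w [^] (n - m)"
    using assms(1,2,5) by (simp add: m_assoc nat_pow_mult)
  also have "\<dots> = w [^] j \<otimes> (r \<otimes> w [^] (n - m))" unfolding assms(4) using assms(1-3) by (simp add: m_assoc)
  finally show ?thesis using assms(1,3) by blast
qed

text \<open>If d = [w, a], then w^(m+1) a = (w^m a) w + w^m d, which gains one factor w on the right
  as soon as m is large enough for d. Thus the condition climbs back along chains of iterated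
  commutators with w.\<close>

lemma lnil_step:
  assumes w: "w \<in> carrier A" and a: "a \<in> carrier A" and d: "d \<in> carrier A"
    and eq: "w \<otimes> a = a \<otimes> w \<oplus> d" and nd: "lnil w d"
  shows "lnil w a"
  unfolding lnil_def
proof
  fix j :: nat
  show "\<exists>m::nat. \<exists>r\<in>carrier A. w [^] m \<otimes> a = r \<otimes> w [^] j"
  proof (induction j)
    case 0
    show ?case using a by (intro exI[of _ 0] bexI[of _ a]) simp_all
  next
    case (Suc j)
    then obtain m r where m: "r \<in> carrier A" "w [^] (m::nat) \<otimes> a = r \<otimes> w [^] j" by blast
    obtain m' r' where m': "r' \<in> carrier A" "w [^] (m'::nat) \<otimes> d = r' \<otimes> w [^] Suc j"
      using nd unfolding lnil_def by blast
    obtain p where p: "p \<in> carrier A" "w [^] max m m' \<otimes> a = p \<otimes> w [^] j"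
      using lnil_more[OF w a m max.cobounded1] by blast
    obtain q where q: "q \<in> carrier A" "w [^] max m m' \<otimes> d = q \<otimes> w [^] Suc j"
      using lnil_more[OF w d m' max.cobounded2] by blast
    have "w [^] Suc (max m m') \<otimes> a = w [^] max m m' \<otimes> (w \<otimes> a)" using w a by (simp add: m_assoc)
    also have "\<dots> = (w [^] max m m' \<otimes> a) \<otimes> w \<oplus> w [^] max m m' \<otimes> d"
      unfolding eq using w a d by (simp add: r_distr m_assoc)
    also have "\<dots> = (p \<oplus> q) \<otimes> w [^] Suc j" unfolding p(2) q(2) using w p(1) q(1) by (simp add: l_distr m_assoc)
    finally show ?case using p(1) q(1) by blast
  qed
qed

lemma rnil_step:
  assumes w: "w \<in> carrier A" and a: "a \<in> carrier A" and d: "d \<in> carrier A"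
    and eq: "a \<otimes> w = w \<otimes> a \<oplus> d" and nd: "rnil w d"
  shows "rnil w a"
  unfolding rnil_def
proof
  fix j :: nat
  show "\<exists>m::nat. \<exists>r\<in>carrier A. a \<otimes> w [^] m = w [^] j \<otimes> r"
  proof (induction j)
    case 0
    show ?case using a by (intro exI[of _ 0] bexI[of _ a]) simp_all
  next
    case (Suc j)
    then obtain m r where m: "r \<in> carrier A" "a \<otimes> w [^] (m::nat) = w [^] j \<otimes> r" by blast
    obtain m' r' where m': "r' \<in> carrier A" "d \<otimes> w [^] (m'::nat) = w [^] Suc j \<otimes> r'"
      using nd unfolding rnil_def by blast
    obtain p where p: "p \<in> carrier A" "a \<otimes> w [^] max m m' = w [^] j \<otimes> p"
      using rnil_more[OF w a m max.cobounded1] by blast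
    obtain q where q: "q \<in> carrier A" "d \<otimes> w [^] max m m' = w [^] Suc j \<otimes> q"
      using rnil_more[OF w d m' max.cobounded2] by blast
    have "a \<otimes> w [^] Suc (max m m') = (a \<otimes> w) \<otimes> w [^] max m m'"
      using w a nat_pow_Suc2[OF w, of "max m m'"] by (simp only: m_assoc nat_pow_closed)
    also have "\<dots> = w \<otimes> (a \<otimes> w [^] max m m') \<oplus> d \<otimes> w [^] max m m'"
      unfolding eq using w a d by (simp add: l_distr m_assoc)
    also have "\<dots> = w [^] Suc j \<otimes> (p \<oplus> q)"
      unfolding p(2) q(2) nat_pow_Suc2[OF w] using w p(1) q(1) by (simp add: r_distr m_assoc)
    finally show ?case using p(1) q(1) by blast
  qed
qed

lemma lnil_zero: "w \<in> carrier A \<Longrightarrow> lnil w \<zero>" and rnil_zero: "w \<in> carrier A \<Longrightarrow> rnil w \<zero>"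
  unfolding lnil_def rnil_def by (auto intro!: exI[of _ 0] bexI[of _ \<zero>])

lemma lnil_comm: "w \<in> carrier A \<Longrightarrow> a \<in> carrier A \<Longrightarrow> w \<otimes> a = a \<otimes> w \<Longrightarrow> lnil w a"
  and rnil_comm: "w \<in> carrier A \<Longrightarrow> a \<in> carrier A \<Longrightarrow> w \<otimes> a = a \<otimes> w \<Longrightarrow> rnil w a"
  by (rule lnil_step[where d = \<zero>], simp_all add: lnil_zero)
    (rule rnil_step[where d = \<zero>], simp_all add: rnil_zero)

context
  fixes c :: complex
begin

definition w where "w = e \<ominus> c \<odot>\<^bsub>A\<^esub> \<one>"

lemma w_closed [simp]: "w \<in> carrier A" by (simp add: w_def)

lemma w_comm: "a \<in> carrier A \<Longrightarrow> e \<otimes> a = a \<otimes> e \<Longrightarrow> w \<otimes> a = a \<otimes> w"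
  using shift_comm[of a \<zero>] by (simp add: w_def)

definition dgen where
  "dgen g = (case g of gen_e \<Rightarrow> \<zero> | gen_h \<Rightarrow> (-2) \<odot>\<^bsub>A\<^esub> e | gen_f \<Rightarrow> h | gen_x \<Rightarrow> \<zero> | gen_y \<Rightarrow> x)"

lemma dgen_closed [simp]: "dgen g \<in> carrier A"
  by (simp add: dgen_def split: sl2V.split)

lemma w_gen: "w \<otimes> s g = s g \<otimes> w \<oplus> dgen g"
  unfolding w_def by (rule shift_comm[OF s_closed dgen_closed]) (use e_gen_comm[of g] in \<open>simp add: dgen_def\<close>)

lemma gen_w: "s g \<otimes> w = w \<otimes> s g \<oplus> (\<ominus> dgen g)"
  unfolding w_gen by (simp add: a_assoc r_neg)

lemma e_sm_comm: "e \<otimes> (k \<odot>\<^bsub>A\<^esub> e) = (k \<odot>\<^bsub>A\<^esub> e) \<otimes> e"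
  by (simp add: sm_mult_l sm_mult_r)

text \<open>The chains under ad e are f, h, -2e, 0 and y, x, 0; \<open>lnil_step\<close> is applied
  from their ends backwards.\<close>

lemma lnil_gen: "lnil w (s g)"
proof -
  have st: "lnil w (s g)" if "lnil w (dgen g)" for g
    by (rule lnil_step[OF _ _ _ w_gen that]) simp_all
  have "lnil w (s gen_x)" "lnil w (dgen gen_h)"
    by (rule lnil_comm, simp, simp, rule w_comm, simp_all add: ex dgen_def e_sm_comm)+
  then show ?thesis using st[of g] st[of gen_h] lnil_zero[of w] by (cases g) (simp_all add: dgen_def)
qed

lemma rnil_gen: "rnil w (s g)"
proof -
  have st: "rnil w (s g)" if "rnil w (\<ominus> dgen g)" for g
    by (rule rnil_step[OF _ _ _ gen_w that]) simp_all
  have "rnil w ((-1) \<odot>\<^bsub>A\<^esub> s gen_x)"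
    by (rule rnil_comm, simp, simp, rule w_comm) (simp_all add: ex sm_mult_l sm_mult_r)
  moreover have "rnil w ((-1) \<odot>\<^bsub>A\<^esub> ((-2) \<odot>\<^bsub>A\<^esub> e))"
    by (rule rnil_comm, simp, simp, rule w_comm) (simp_all add: sm_mult_l sm_mult_r)
  moreover have "rnil w ((-1) \<odot>\<^bsub>A\<^esub> h)"
  proof (rule rnil_step)
    show "((-1) \<odot>\<^bsub>A\<^esub> h) \<otimes> w = w \<otimes> ((-1) \<odot>\<^bsub>A\<^esub> h) \<oplus> dgen gen_h"
      by (simp add: sm_mult_l sm_mult_r gen_w sm_add_r) (simp add: sm_minus_r sm_minus_one)
    show "rnil w (dgen gen_h)"
      by (rule rnil_comm, simp, simp, rule w_comm) (simp_all add: dgen_def sm_mult_l sm_mult_r)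
  qed simp_all
  moreover have "rnil w (s gen_x)" by (rule rnil_comm, simp, simp, rule w_comm) (simp_all add: ex)
  moreover have "\<ominus> \<zero> = \<zero>" using sm_minus_one[of \<zero>] by simp
  ultimately show ?thesis
    using st[of g] rnil_zero[of w] by (cases g) (simp_all add: dgen_def sm_minus_one)
qed

lemma lnil: "a \<in> carrier A \<Longrightarrow> lnil w a"
proof (induction rule: gen_induct')
  case (const k)
  show ?case by (rule lnil_comm) (simp_all add: sm_mult_l sm_mult_r)
next
  case (add a b)
  show ?case unfolding lnil_def
  proof
    fix j :: nat
    obtain m r where m: "r \<in> carrier A" "w [^] (m::nat) \<otimes> a = r \<otimes> w [^] j" using add(3) unfolding lnil_def by blast
    obtain n q where n: "q \<in> carrier A" "w [^] (n::nat) \<otimes> b = q \<otimes> w [^] j" using add(4) unfolding lnil_def by blast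
    obtain p where p: "p \<in> carrier A" "w [^] (max m n) \<otimes> a = p \<otimes> w [^] j"
      using lnil_more[OF w_closed add(1) m max.cobounded1] by blast
    obtain p' where p': "p' \<in> carrier A" "w [^] (max m n) \<otimes> b = p' \<otimes> w [^] j"
      using lnil_more[OF w_closed add(2) n max.cobounded2] by blast
    show "\<exists>m::nat. \<exists>r\<in>carrier A. w [^] m \<otimes> (a \<oplus> b) = r \<otimes> w [^] j"
      using p p' add(1,2) by (intro exI[of _ "max m n"] bexI[of _ "p \<oplus> p'"]) (simp_all add: r_distr l_distr)
  qed
next
  case (mult g a)
  show ?case unfolding lnil_def
  proof
    fix j :: nat
    obtain i r where i: "r \<in> carrier A" "w [^] (i::nat) \<otimes> a = r \<otimes> w [^] j" using mult(2) unfolding lnil_def by blast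
    obtain m q where m: "q \<in> carrier A" "w [^] (m::nat) \<otimes> s g = q \<otimes> w [^] i" using lnil_gen unfolding lnil_def by blast
    have "w [^] m \<otimes> (s g \<otimes> a) = (w [^] m \<otimes> s g) \<otimes> a" using mult(1) by (simp add: m_assoc)
    also have "\<dots> = q \<otimes> (w [^] i \<otimes> a)" unfolding m(2) using mult(1) m(1) by (simp add: m_assoc)
    also have "\<dots> = (q \<otimes> r) \<otimes> w [^] j" unfolding i(2) using i(1) m(1) by (simp add: m_assoc)
    finally show "\<exists>m::nat. \<exists>r\<in>carrier A. w [^] m \<otimes> (s g \<otimes> a) = r \<otimes> w [^] j" using i(1) m(1) by blast
  qed
qed

lemma rnil: "a \<in> carrier A \<Longrightarrow> rnil w a"
proof (induction rule: gen_induct')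
  case (const k)
  show ?case by (rule rnil_comm) (simp_all add: sm_mult_l sm_mult_r)
next
  case (add a b)
  show ?case unfolding rnil_def
  proof
    fix j :: nat
    obtain m r where m: "r \<in> carrier A" "a \<otimes> w [^] (m::nat) = w [^] j \<otimes> r" using add(3) unfolding rnil_def by blast
    obtain n q where n: "q \<in> carrier A" "b \<otimes> w [^] (n::nat) = w [^] j \<otimes> q" using add(4) unfolding rnil_def by blast
    obtain p where p: "p \<in> carrier A" "a \<otimes> w [^] (max m n) = w [^] j \<otimes> p"
      using rnil_more[OF w_closed add(1) m max.cobounded1] by blast
    obtain p' where p': "p' \<in> carrier A" "b \<otimes> w [^] (max m n) = w [^] j \<otimes> p'"
      using rnil_more[OF w_closed add(2) n max.cobounded2] by blast
    show "\<exists>m::nat. \<exists>r\<in>carrier A. (a \<oplus> b) \<otimes> w [^] m = w [^] j \<otimes> r"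
      using p p' add(1,2) by (intro exI[of _ "max m n"] bexI[of _ "p \<oplus> p'"]) (simp_all add: r_distr l_distr)
  qed
next
  case (mult g a)
  show ?case unfolding rnil_def
  proof
    fix j :: nat
    obtain i r where i: "r \<in> carrier A" "s g \<otimes> w [^] (i::nat) = w [^] j \<otimes> r" using rnil_gen unfolding rnil_def by blast
    obtain m q where m: "q \<in> carrier A" "a \<otimes> w [^] (m::nat) = w [^] i \<otimes> q" using mult(2) unfolding rnil_def by blast
    have "(s g \<otimes> a) \<otimes> w [^] m = s g \<otimes> (a \<otimes> w [^] m)" using mult(1) by (simp add: m_assoc)
    also have "\<dots> = (s g \<otimes> w [^] i) \<otimes> q" unfolding m(2) using m(1) by (simp add: m_assoc)
    also have "\<dots> = w [^] j \<otimes> (r \<otimes> q)" unfolding i(2) using i(1) m(1) by (simp add: m_assoc)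
    finally show "\<exists>m::nat. \<exists>r\<in>carrier A. (s g \<otimes> a) \<otimes> w [^] m = w [^] j \<otimes> r" using i(1) m(1) by blast
  qed
qed

end

end

section \<open>Binomials of -h/2 and the span of G\<close>

locale slV_whittaker = slV_algebra A s for A :: "'a calg" (structure) and s +
  fixes c :: complex
  assumes c_nonzero: "c \<noteq> 0"
begin

abbreviation wc where "wc \<equiv> w c"

text \<open>The factors of a falling factorial in t = -h/2. This multiple of h is the one that e
  shifts by exactly 1.\<close>

definition u :: "nat \<Rightarrow> 'a" where
  "u i = (-1/2) \<odot>\<^bsub>A\<^esub> h \<oplus> (- of_nat i) \<odot>\<^bsub>A\<^esub> \<one>"

text \<open>Up to scaling these are the binomials of \<open>-h/2\<close>: as \<open>e h = (h - 2) e\<close>, commuting with \<open>e\<close> acts on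
  them as a shift, so that \<open>e - c\<close> acts as a difference operator.\<close>

primrec bs :: "nat \<Rightarrow> 'a" where
  "bs 0 = \<one>"
| "bs (Suc i) = (1 / (c * of_nat (Suc i))) \<odot>\<^bsub>A\<^esub> (u i \<otimes> bs i)"

lemma u_closed [simp]: "u i \<in> carrier A" by (simp add: u_def)

lemma bs_closed [simp]: "bs i \<in> carrier A" by (induction i) simp_all

lemma e_u: "e \<otimes> u i = u i \<otimes> e \<oplus> e"
proof -
  have "e \<otimes> h = h \<otimes> e \<oplus> (-2) \<odot>\<^bsub>A\<^esub> e" using e_gen_comm[of gen_h] by simp
  then show ?thesis
    by (simp add: u_def r_distr l_distr sm_mult_l sm_mult_r sm_add_r sm_assoc[symmetric] a_ac)
qed

lemma u_bs: "u i \<otimes> bs i = (c * of_nat (Suc i)) \<odot>\<^bsub>A\<^esub> bs (Suc i)"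
  using c_nonzero by (simp add: sm_assoc[symmetric] del: of_nat_Suc)

lemma u_Suc: "u (Suc i) \<otimes> a \<oplus> a = u i \<otimes> a" if "a \<in> carrier A"
proof -
  have "u (Suc i) \<oplus> \<one> = u i"
    using sm_add_l[of \<one> "- of_nat (Suc i)" 1] by (simp add: u_def a_assoc)
  then have "(u (Suc i) \<oplus> \<one>) \<otimes> a = u i \<otimes> a" by simp
  then show ?thesis using that by (simp add: l_distr)
qed

text \<open>The recursion for \<open>bs\<close> solved for h. It turns polynomials in h into
  combinations of the \<open>bs i\<close>, so that elements of \<open>L\<close> can be rewritten in
  terms of the latter.\<close>

lemma h_bs: "h \<otimes> bs i = (-2 * c * of_nat (Suc i)) \<odot>\<^bsub>A\<^esub> bs (Suc i) \<oplus> (-2 * of_nat i) \<odot>\<^bsub>A\<^esub> bs i"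
proof -
  have "(-2) \<odot>\<^bsub>A\<^esub> u i \<oplus> (-2 * of_nat i) \<odot>\<^bsub>A\<^esub> \<one> = h \<oplus> (2 * of_nat i + -2 * of_nat i) \<odot>\<^bsub>A\<^esub> \<one>"
    unfolding sm_add_l[OF one_closed]
    by (simp add: u_def sm_add_r sm_assoc[symmetric] a_assoc)
  then have "h = (-2) \<odot>\<^bsub>A\<^esub> u i \<oplus> (-2 * of_nat i) \<odot>\<^bsub>A\<^esub> \<one>" by simp
  then have "h \<otimes> bs i = ((-2) \<odot>\<^bsub>A\<^esub> u i \<oplus> (-2 * of_nat i) \<odot>\<^bsub>A\<^esub> \<one>) \<otimes> bs i" by simp
  also have "\<dots> = (-2) \<odot>\<^bsub>A\<^esub> (u i \<otimes> bs i) \<oplus> (-2 * of_nat i) \<odot>\<^bsub>A\<^esub> bs i"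
    by (simp add: l_distr sm_mult_l)
  also have "(-2) \<odot>\<^bsub>A\<^esub> (u i \<otimes> bs i) = (-2 * c * of_nat (Suc i)) \<odot>\<^bsub>A\<^esub> bs (Suc i)"
    unfolding u_bs by (simp add: sm_assoc[symmetric] mult.assoc del: bs.simps of_nat_Suc)
  finally show ?thesis .
qed

text \<open>Pascal's rule: e moves past a polynomial in t = -h/2 by the shift from t to t + 1, and
  binom(t+1, i+1) = binom(t, i+1) + binom(t, i). The factor 1/c reflects the normalisation
  \<open>bs i\<close> = c^(-i) binom(t, i).\<close>

lemma e_bs: "e \<otimes> bs (Suc i) = (bs (Suc i) \<oplus> (1/c) \<odot>\<^bsub>A\<^esub> bs i) \<otimes> e"
proof (induction i)
  case 0
  show ?case by (simp add: sm_mult_r sm_mult_l e_u sm_add_r l_distr)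
next
  case (Suc i)
  define \<kappa> where "\<kappa> = 1 / (c * of_nat (Suc (Suc i)))"
  define B where "B = bs (Suc i)"
  define B' where "B' = bs i"
  have Bc [simp]: "B \<in> carrier A" "B' \<in> carrier A" by (simp_all add: B_def B'_def del: bs.simps)
  have bS: "bs (Suc (Suc i)) = \<kappa> \<odot>\<^bsub>A\<^esub> (u (Suc i) \<otimes> B)" unfolding B_def \<kappa>_def by (rule bs.simps(2))
  have eB: "e \<otimes> B = B \<otimes> e \<oplus> (1/c) \<odot>\<^bsub>A\<^esub> (B' \<otimes> e)"
    using Suc.IH unfolding B_def[symmetric] B'_def[symmetric] by (simp add: l_distr sm_mult_l)
  have uB': "u (Suc i) \<otimes> B' \<oplus> B' = (c * of_nat (Suc i)) \<odot>\<^bsub>A\<^esub> B"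
    unfolding B_def B'_def u_Suc[OF bs_closed] by (rule u_bs)
  have "e \<otimes> bs (Suc (Suc i)) = \<kappa> \<odot>\<^bsub>A\<^esub> ((e \<otimes> u (Suc i)) \<otimes> B)"
    unfolding bS by (simp add: sm_mult_r m_assoc)
  also have "(e \<otimes> u (Suc i)) \<otimes> B = u (Suc i) \<otimes> (e \<otimes> B) \<oplus> e \<otimes> B"
    unfolding e_u by (simp add: l_distr m_assoc)
  also have "\<dots> = (u (Suc i) \<otimes> B) \<otimes> e \<oplus> (B \<otimes> e \<oplus> (1/c) \<odot>\<^bsub>A\<^esub> ((u (Suc i) \<otimes> B' \<oplus> B') \<otimes> e))"
    unfolding eB by (simp add: r_distr l_distr sm_mult_r sm_add_r m_assoc a_ac)
  also have "\<dots> = (u (Suc i) \<otimes> B) \<otimes> e \<oplus> (1 + of_nat (Suc i)) \<odot>\<^bsub>A\<^esub> (B \<otimes> e)"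
    unfolding uB' using c_nonzero by (simp add: sm_mult_l sm_assoc[symmetric] sm_add_l del: of_nat_Suc)
  also have "\<kappa> \<odot>\<^bsub>A\<^esub> \<dots> = (bs (Suc (Suc i)) \<oplus> (\<kappa> * (1 + of_nat (Suc i))) \<odot>\<^bsub>A\<^esub> B) \<otimes> e"
    unfolding bS by (simp add: sm_add_r sm_mult_l l_distr sm_assoc)
  also have "\<kappa> * (1 + of_nat (Suc i)) = 1/c"
  proof -
    have "(1 + of_nat (Suc i) :: complex) = of_nat (Suc (Suc i))" by simp
    moreover have "(of_nat (Suc (Suc i)) :: complex) \<noteq> 0" by (rule of_nat_neq_0)
    ultimately show ?thesis unfolding \<kappa>_def using c_nonzero by (simp del: of_nat_Suc)
  qed
  finally show ?case unfolding B_def .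
qed

text \<open>In \<open>e_bs\<close> replace e on the right by w + c and subtract c times
  \<open>bs (Suc i)\<close>: the contribution c (1/c) b_i survives. The power of 1/c in the
  normalisation is chosen to make its coefficient 1.\<close>

lemma w_bs: "wc \<otimes> bs (Suc i) = bs i \<oplus> (bs (Suc i) \<oplus> (1/c) \<odot>\<^bsub>A\<^esub> bs i) \<otimes> wc"
proof -
  let ?r = "bs (Suc i) \<oplus> (1/c) \<odot>\<^bsub>A\<^esub> bs i"
  have r: "?r \<in> carrier A" by (simp del: bs.simps)
  have "c \<odot>\<^bsub>A\<^esub> ?r = c \<odot>\<^bsub>A\<^esub> bs (Suc i) \<oplus> bs i"
    using c_nonzero by (simp add: sm_add_r sm_assoc[symmetric] del: bs.simps)
  then have "bs i \<oplus> ?r \<otimes> wc = bs i \<oplus> (?r \<otimes> e \<ominus> (c \<odot>\<^bsub>A\<^esub> bs (Suc i) \<oplus> bs i))"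
    unfolding w_def shift_e_right[OF r] by simp
  also have "\<dots> = ?r \<otimes> e \<ominus> c \<odot>\<^bsub>A\<^esub> bs (Suc i)"
    using r by (simp add: minus_eq minus_add a_ac r_neg2 r_neg1 r_neg del: bs.simps)
  also have "\<dots> = wc \<otimes> bs (Suc i)"
    unfolding w_def shift_e[OF bs_closed] e_bs ..
  finally show ?thesis by (rule sym)
qed

sublocale W: whittaker A wc bs
proof (intro whittaker.intro whittaker_axioms.intro ring_axioms)
  show "\<exists>r\<in>carrier A. wc \<otimes> bs (Suc i) = bs i \<oplus> r \<otimes> wc" for i
    using w_bs[of i] by (intro bexI[of _ "bs (Suc i) \<oplus> (1/c) \<odot>\<^bsub>A\<^esub> bs i"]) (simp_all del: bs.simps)
  show "\<exists>k. \<exists>r\<in>carrier A. wc [^] (k::nat) \<otimes> a = r \<otimes> wc" if "a \<in> carrier A" for a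
    using lnil[OF that, of c] unfolding lnil_def by (drule_tac spec[of _ 1]) simp
qed simp_all

lemma e_eq: "e = wc \<oplus> c \<odot>\<^bsub>A\<^esub> \<one>"
  by (simp add: w_def minus_eq a_assoc l_neg)

lemma mult_e: "a \<in> carrier A \<Longrightarrow> a \<otimes> e = c \<odot>\<^bsub>A\<^esub> a \<oplus> a \<otimes> wc"
  by (subst e_eq) (simp add: r_distr sm_mult_r a_comm)

text \<open>The \<open>\<complex>[h]\<close>-span of \<open>G\<close> modulo \<open>A (e - c)\<close>.\<close>

inductive_set L :: "'a set" where
  base: "g \<in> G \<Longrightarrow> a \<in> carrier A \<Longrightarrow> g \<oplus> a \<otimes> wc \<in> L"
| add: "a \<in> L \<Longrightarrow> b \<in> L \<Longrightarrow> a \<oplus> b \<in> L"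
| h: "a \<in> L \<Longrightarrow> h \<otimes> a \<in> L"

lemma L_closed: "a \<in> L \<Longrightarrow> a \<in> carrier A"
  by (induction rule: L.induct) (simp_all add: G_closed)

lemma L_G: "g \<in> G \<Longrightarrow> g \<in> L"
  using L.base[of g \<zero>] G_closed by simp

lemma L_w: "a \<in> carrier A \<Longrightarrow> a \<otimes> wc \<in> L"
  using L.base[OF G_zero, of a] by simp

lemma L_sm: "a \<in> L \<Longrightarrow> k \<odot>\<^bsub>A\<^esub> a \<in> L"
proof (induction rule: L.induct)
  case (base g a)
  then show ?case using L.base[OF G_sm[OF base(1), of k], of "k \<odot>\<^bsub>A\<^esub> a"] G_closed
    by (simp add: sm_add_r sm_mult_l)
next
  case (add a b)
  then show ?case using L.add[OF add.IH] L_closed by (simp add: sm_add_r)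
next
  case (h a)
  then show ?case using L.h[OF h.IH] L_closed by (simp add: sm_mult_r)
qed

text \<open>An element normalising \<open>\<complex>[h]\<close> preserves \<open>L\<close> if it does so on \<open>G\<close>.\<close>

lemma L_mult:
  assumes t: "t \<in> carrier A" "t \<otimes> h = h \<otimes> t \<oplus> k \<odot>\<^bsub>A\<^esub> t" and G: "\<And>g. g \<in> G \<Longrightarrow> t \<otimes> g \<in> L"
  shows "a \<in> L \<Longrightarrow> t \<otimes> a \<in> L"
proof (induction rule: L.induct)
  case (base g a)
  have "t \<otimes> (g \<oplus> a \<otimes> wc) = t \<otimes> g \<oplus> (t \<otimes> a) \<otimes> wc"
    using base t(1) G_closed by (simp add: r_distr m_assoc)
  then show ?case using L.add[OF G[OF base(1)] L_w[of "t \<otimes> a"]] base t(1) by simp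
next
  case (add a b)
  then show ?case using L.add[OF add.IH] L_closed t(1) by (simp add: r_distr)
next
  case (h a)
  have "t \<otimes> (h \<otimes> a) = (t \<otimes> h) \<otimes> a" using t(1) L_closed[OF h.hyps] by (simp add: m_assoc)
  also have "\<dots> = h \<otimes> (t \<otimes> a) \<oplus> k \<odot>\<^bsub>A\<^esub> (t \<otimes> a)"
    unfolding t(2) using t(1) L_closed[OF h.hyps] by (simp add: l_distr m_assoc sm_mult_l)
  finally show ?case using L.add[OF L.h[OF h.IH] L_sm[OF h.IH]] by simp
qed

lemma L_c: "a \<in> carrier A \<Longrightarrow> c \<odot>\<^bsub>A\<^esub> a \<in> L \<Longrightarrow> a \<in> L"
  using L_sm[of "c \<odot>\<^bsub>A\<^esub> a" "1/c"] c_nonzero by (simp add: sm_assoc[symmetric])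

text \<open>Modulo \<open>A (e - c)\<close> one may multiply by \<open>e\<close> on the right instead of by \<open>c\<close>.\<close>

lemma L_e: assumes "a \<in> carrier A" "a \<otimes> e \<in> L" shows "a \<in> L"
proof (rule L_c[OF assms(1)])
  have "c \<odot>\<^bsub>A\<^esub> a = a \<otimes> e \<oplus> (\<ominus> a) \<otimes> wc"
    using assms(1) by (simp add: mult_e a_assoc l_minus r_neg)
  then show "c \<odot>\<^bsub>A\<^esub> a \<in> L" using L.add[OF assms(2) L_w[of "\<ominus> a"]] assms(1) by simp
qed

text \<open>The generators f and y come under control after right multiplication by e, because 4 f e
  = Cas - h^2 - 2h and e y = Y - x h/2. By \<open>L_e\<close> this multiplication loses nothing
  modulo Aw. As e commutes with G, the factor e in f g e or y g e can be moved next to f or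
  y.\<close>

lemma L_gen: "a \<in> L \<Longrightarrow> s g \<otimes> a \<in> L"
proof (cases g)
  assume a: "a \<in> L"
  have mn: "p = q \<oplus> (-1) \<odot>\<^bsub>A\<^esub> r" if "q = p \<oplus> r" "p \<in> carrier A" "r \<in> carrier A" for p q r
    using that by (simp add: sm_minus_one a_assoc r_neg)
  have xL: "x \<otimes> a \<in> L" if "a \<in> L" for a
  proof (rule L_mult[OF _ _ _ that])
    show "x \<otimes> h = h \<otimes> x \<oplus> (-1) \<odot>\<^bsub>A\<^esub> x" by (rule mn[OF hx]) simp_all
  qed (simp_all add: L_G G.mult G.x)
  case gen_e
  have "e \<otimes> a \<in> L"
  proof (rule L_mult[OF _ _ _ a])
    show "e \<otimes> h = h \<otimes> e \<oplus> (-2) \<odot>\<^bsub>A\<^esub> e" using e_gen_comm[of gen_h] by simp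
    show "e \<otimes> g \<in> L" if "g \<in> G" for g
      using that G_comm[OF that] G_closed[OF that] L.base[OF G_sm[OF that, of c], of g] by (simp add: mult_e)
  qed simp
  then show ?thesis using gen_e by simp
next
  assume a: "a \<in> L"
  case gen_h
  then show ?thesis using L.h[OF a] by simp
next
  assume a: "a \<in> L"
  case gen_f
  have "f \<otimes> a \<in> L"
  proof (rule L_mult[OF _ fh _ a])
    fix g assume g: "g \<in> G"
    have gc: "g \<in> carrier A" using G_closed[OF g] .
    \<comment> \<open>The factor 4 is that of the Casimir element; it is divided out at the
      end.\<close>
    have "4 \<odot>\<^bsub>A\<^esub> ((f \<otimes> g) \<otimes> e) = 4 \<odot>\<^bsub>A\<^esub> (f \<otimes> e) \<otimes> g"
      using gc G_comm[OF g] by (simp add: sm_mult_l m_assoc)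
    also have "4 \<odot>\<^bsub>A\<^esub> (f \<otimes> e) = Cas \<oplus> ((-1) \<odot>\<^bsub>A\<^esub> (h \<otimes> h) \<oplus> (-2) \<odot>\<^bsub>A\<^esub> h)"
    proof -
      have "(q \<oplus> p \<oplus> r) \<oplus> (\<ominus> q \<oplus> \<ominus> r) = p" if "p \<in> carrier A" "q \<in> carrier A" "r \<in> carrier A" for p q r
      proof -
        have "(q \<oplus> p \<oplus> r) \<oplus> (\<ominus> q \<oplus> \<ominus> r) = ((q \<oplus> r) \<oplus> \<ominus> (q \<oplus> r)) \<oplus> p"
          unfolding minus_add[OF that(2,3)] using that by (simp add: a_ac)
        then show ?thesis using that by (simp add: r_neg)
      qed
      from this[of "4 \<odot>\<^bsub>A\<^esub> (f \<otimes> e)" "h \<otimes> h" "2 \<odot>\<^bsub>A\<^esub> h"] show ?thesis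
        by (simp add: Cas_eq sm_minus_l sm_minus_one)
    qed
    also have "\<dots> \<otimes> g = Cas \<otimes> g \<oplus> ((-1) \<odot>\<^bsub>A\<^esub> (h \<otimes> (h \<otimes> g)) \<oplus> (-2) \<odot>\<^bsub>A\<^esub> (h \<otimes> g))"
      using gc by (simp add: l_distr sm_mult_l m_assoc)
    finally have "4 \<odot>\<^bsub>A\<^esub> ((f \<otimes> g) \<otimes> e) \<in> L"
      by (simp only:) (intro L.add L.h L_sm L_G[OF G.mult[OF G.Cas g]] L_G[OF g])
    then have "(1/4) \<odot>\<^bsub>A\<^esub> (4 \<odot>\<^bsub>A\<^esub> ((f \<otimes> g) \<otimes> e)) \<in> L" by (rule L_sm)
    moreover have "(1/4) \<odot>\<^bsub>A\<^esub> (4 \<odot>\<^bsub>A\<^esub> ((f \<otimes> g) \<otimes> e)) = (f \<otimes> g) \<otimes> e"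
      by (rule sm_inverse) (simp_all add: gc)
    ultimately have "(f \<otimes> g) \<otimes> e \<in> L" by (simp only:)
    then show "f \<otimes> g \<in> L" by (rule L_e[rotated]) (simp add: gc)
  qed simp
  then show ?thesis using gen_f by simp
next
  assume a: "a \<in> L"
  have mn: "p = q \<oplus> (-1) \<odot>\<^bsub>A\<^esub> r" if "q = p \<oplus> r" "p \<in> carrier A" "r \<in> carrier A" for p q r
    using that by (simp add: sm_minus_one a_assoc r_neg)
  case gen_x
  have "x \<otimes> a \<in> L"
  proof (rule L_mult[OF _ _ _ a])
    show "x \<otimes> h = h \<otimes> x \<oplus> (-1) \<odot>\<^bsub>A\<^esub> x" by (rule mn[OF hx]) simp_all
  qed (simp_all add: L_G G.mult G.x)
  then show ?thesis using gen_x by simp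
next
  assume a: "a \<in> L"
  have mn: "p = q \<oplus> (-1) \<odot>\<^bsub>A\<^esub> r" if "q = p \<oplus> r" "p \<in> carrier A" "r \<in> carrier A" for p q r
    using that by (simp add: sm_minus_one a_assoc r_neg)
  case gen_y
  have "y \<otimes> a \<in> L"
  proof (rule L_mult[OF _ _ _ a])
    show "y \<otimes> h = h \<otimes> y \<oplus> 1 \<odot>\<^bsub>A\<^esub> y" using yh by simp
    fix g assume g: "g \<in> G"
    have gc: "g \<in> carrier A" using G_closed[OF g] .
    have xh: "x \<otimes> h = h \<otimes> x \<oplus> (-1) \<odot>\<^bsub>A\<^esub> x" by (rule mn[OF hx]) simp_all
    have "y \<otimes> e = e \<otimes> y \<oplus> (-1) \<odot>\<^bsub>A\<^esub> x" by (rule mn[OF ey]) simp_all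
    also have "e \<otimes> y = Y \<oplus> (-1) \<odot>\<^bsub>A\<^esub> ((1/2) \<odot>\<^bsub>A\<^esub> (x \<otimes> h))" by (rule mn) (simp_all add: Y_def)
    finally have ye: "y \<otimes> e = (Y \<oplus> ((-1/2) \<odot>\<^bsub>A\<^esub> (h \<otimes> x) \<oplus> (1/2) \<odot>\<^bsub>A\<^esub> x)) \<oplus> (-1) \<odot>\<^bsub>A\<^esub> x"
      unfolding xh by (simp add: sm_add_r sm_assoc[symmetric])
    have "(y \<otimes> g) \<otimes> e = (y \<otimes> e) \<otimes> g" using gc G_comm[OF g] by (simp add: m_assoc)
    also have "\<dots> = (Y \<otimes> g \<oplus> ((-1/2) \<odot>\<^bsub>A\<^esub> (h \<otimes> (x \<otimes> g)) \<oplus> (1/2) \<odot>\<^bsub>A\<^esub> (x \<otimes> g))) \<oplus> (-1) \<odot>\<^bsub>A\<^esub> (x \<otimes> g)"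
      unfolding ye using gc by (simp add: l_distr sm_mult_l m_assoc)
    finally have "(y \<otimes> g) \<otimes> e \<in> L"
      by (simp only:) (intro L.add L.h L_sm L_G[OF G.mult[OF G.Y g]] L_G[OF G.mult[OF G.x g]])
    then show "y \<otimes> g \<in> L" by (rule L_e[rotated]) (simp add: gc)
  qed simp
  then show ?thesis using gen_y by simp
qed

lemma L_all: "a \<in> carrier A \<Longrightarrow> a \<in> L"
proof (induction rule: gen_induct')
  case (const k)
  show ?case by (rule L_G) (rule G.const)
qed (simp_all add: L.add L_gen)

text \<open>A filtration of \<open>L\<close> by the largest index of \<open>bs\<close> that occurs,
  chosen so that a power of w reads off the top coefficient.\<close>

primrec span :: "nat \<Rightarrow> 'a set" where
  "span 0 = {g \<oplus> a \<otimes> wc | g a. g \<in> G \<and> a \<in> carrier A}"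
| "span (Suc n) = {bs (Suc n) \<otimes> g \<oplus> l | g l. g \<in> G \<and> l \<in> span n}"

lemma span_closed: "l \<in> span n \<Longrightarrow> l \<in> carrier A"
  by (induction n arbitrary: l) (auto simp: G_closed simp del: bs.simps)

lemma span_add: "l \<in> span n \<Longrightarrow> m \<in> span n \<Longrightarrow> l \<oplus> m \<in> span n"
proof (induction n arbitrary: l m)
  case 0
  then obtain g a g' a' where "g \<in> G" "a \<in> carrier A" "l = g \<oplus> a \<otimes> wc" "g' \<in> G" "a' \<in> carrier A" "m = g' \<oplus> a' \<otimes> wc"
    by auto
  moreover from this have "l \<oplus> m = (g \<oplus> g') \<oplus> (a \<oplus> a') \<otimes> wc" by (simp add: l_distr a_ac G_closed)
  ultimately show ?case using G.add by auto
next
  case (Suc n)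
  then obtain g k g' k' where *: "g \<in> G" "k \<in> span n" "l = bs (Suc n) \<otimes> g \<oplus> k"
    "g' \<in> G" "k' \<in> span n" "m = bs (Suc n) \<otimes> g' \<oplus> k'" by auto
  then have "l \<oplus> m = bs (Suc n) \<otimes> (g \<oplus> g') \<oplus> (k \<oplus> k')"
    by (simp add: r_distr a_ac G_closed span_closed del: bs.simps)
  moreover have "g \<oplus> g' \<in> G" "k \<oplus> k' \<in> span n" using * Suc.IH G.add by auto
  ultimately show ?case unfolding span.simps by blast
qed

lemma span_Suc: "l \<in> span n \<Longrightarrow> l \<in> span (Suc n)"
proof -
  assume l: "l \<in> span n"
  then have "l = bs (Suc n) \<otimes> \<zero> \<oplus> l" using span_closed[OF l] by (simp del: bs.simps)
  then show ?thesis unfolding span.simps using G_zero l by blast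
qed

lemma span_mono: "n \<le> m \<Longrightarrow> l \<in> span n \<Longrightarrow> l \<in> span m"
  by (induction m rule: dec_induct) (auto intro: span_Suc simp del: span.simps)

lemma span_bs: "g \<in> G \<Longrightarrow> bs n \<otimes> g \<in> span n"
proof (induction n)
  case 0
  then have "bs 0 \<otimes> g = g \<oplus> \<zero> \<otimes> wc" by (simp add: G_closed)
  moreover have "g \<oplus> \<zero> \<otimes> wc \<in> span 0" unfolding span.simps using 0 zero_closed by blast
  ultimately show ?case by (simp only:)
next
  case (Suc n)
  have "\<zero> = \<zero> \<oplus> \<zero> \<otimes> wc" by simp
  then have "\<zero> \<in> span 0" unfolding span.simps using G_zero zero_closed by blast
  then have "\<zero> \<in> span n" using span_mono[of 0 n] by blast
  moreover have "bs (Suc n) \<otimes> g = bs (Suc n) \<otimes> g \<oplus> \<zero>" using Suc G_closed by (simp del: bs.simps)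
  ultimately show ?case unfolding span.simps using Suc.prems by blast
qed

lemma h_bs_span: "g \<in> G \<Longrightarrow> h \<otimes> (bs n \<otimes> g) \<in> span (Suc n)"
proof -
  assume g: "g \<in> G"
  have "h \<otimes> (bs n \<otimes> g) = (h \<otimes> bs n) \<otimes> g" using G_closed[OF g] by (simp add: m_assoc)
  also have "\<dots> = bs (Suc n) \<otimes> ((-2 * c * of_nat (Suc n)) \<odot>\<^bsub>A\<^esub> g) \<oplus> bs n \<otimes> ((-2 * of_nat n) \<odot>\<^bsub>A\<^esub> g)"
    unfolding h_bs using G_closed[OF g] by (simp add: l_distr sm_mult_l sm_mult_r del: bs.simps of_nat_Suc)
  finally show ?thesis
    using span_add[OF span_bs[OF G_sm[OF g]] span_Suc[OF span_bs[OF G_sm[OF g]]]] by metis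
qed

lemma h_span: "l \<in> span n \<Longrightarrow> h \<otimes> l \<in> span (Suc n)"
proof (induction n arbitrary: l)
  case 0
  then obtain g a where g: "g \<in> G" "a \<in> carrier A" "l = g \<oplus> a \<otimes> wc" by auto
  have "h \<otimes> l = h \<otimes> (bs 0 \<otimes> g) \<oplus> (\<zero> \<oplus> (h \<otimes> a) \<otimes> wc)" using g by (simp add: r_distr m_assoc G_closed)
  moreover have "h \<otimes> a \<in> carrier A" using g(2) by simp
  then have "\<zero> \<oplus> (h \<otimes> a) \<otimes> wc \<in> span 0" unfolding span.simps using G_zero by blast
  ultimately show ?case using span_add[OF h_bs_span[OF g(1), of 0] span_Suc] by metis
next
  case (Suc n)
  then obtain g k where g: "g \<in> G" "k \<in> span n" "l = bs (Suc n) \<otimes> g \<oplus> k" by auto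
  have "h \<otimes> l = h \<otimes> (bs (Suc n) \<otimes> g) \<oplus> h \<otimes> k"
    using g by (simp add: r_distr G_closed span_closed del: bs.simps)
  then show ?case using span_add[OF h_bs_span[OF g(1)] span_Suc[OF Suc.IH[OF g(2)]]] by metis
qed

lemma L_span: "a \<in> L \<Longrightarrow> \<exists>n. a \<in> span n"
proof (induction rule: L.induct)
  case (base g a)
  then have "g \<oplus> a \<otimes> wc \<in> span 0" by auto
  then show ?case ..
next
  case (add a b)
  then obtain n m where "a \<in> span n" "b \<in> span m" by blast
  then have "a \<in> span (max n m)" "b \<in> span (max n m)" using span_mono by (meson max.cobounded1 max.cobounded2)+
  then show ?case using span_add by blast
next
  case (h a)
  then show ?case using h_span by blast
qed

lemma G_whit: "g \<in> G \<Longrightarrow> W.J +> g \<in> W.PW.whit"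
proof -
  assume g: "g \<in> G"
  have "wc \<otimes> g = g \<otimes> wc" using w_comm[OF G_closed[OF g] G_comm[OF g]] .
  then have "wc \<otimes> g \<in> W.J" using W.J_iff G_closed[OF g] by auto
  then show ?thesis unfolding W.PW_whit W.in_H_iff using G_closed[OF g] by blast
qed

lemma bs_killed: "g \<in> G \<Longrightarrow> W.PW.killed (Suc i) (W.J +> (bs i \<otimes> g))"
proof -
  assume g: "g \<in> G"
  then have gc: "g \<in> carrier A" by (rule G_closed)
  have eq: "bs i \<odot>\<^bsub>W.P\<^esub> (W.J +> g) = W.J +> (bs i \<otimes> g)" using gc by (simp add: W.P_smult)
  have P: "W.J +> (bs i \<otimes> g) \<in> carrier W.P" using gc by (simp add: W.P_simps(1))
  have "wc [^] Suc i \<odot>\<^bsub>W.P\<^esub> (W.J +> (bs i \<otimes> g)) = wc \<odot>\<^bsub>W.P\<^esub> (wc [^] i \<odot>\<^bsub>W.P\<^esub> (bs i \<odot>\<^bsub>W.P\<^esub> (W.J +> g)))"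
    unfolding eq nat_pow_Suc2[OF w_closed] by (rule W.PM.smult_assoc) (simp_all add: P)
  also have "\<dots> = \<zero>\<^bsub>W.P\<^esub>"
    unfolding W.PW.pow_b_whit[OF G_whit[OF g]] using G_whit[OF g] by (simp add: W.PW.whit_def)
  finally show ?thesis using P by (simp only: W.PW.killed_def)
qed

lemma span_killed: "l \<in> span n \<Longrightarrow> W.PW.killed (Suc n) (W.J +> l)"
proof (induction n arbitrary: l)
  case 0
  then obtain g a where g: "g \<in> G" "a \<in> carrier A" "l = g \<oplus> a \<otimes> wc" by auto
  have "l \<ominus> g = a \<otimes> wc"
    using g G_closed[OF g(1)] by (simp add: minus_eq a_ac r_neg r_neg1 r_neg2)
  then have "W.J +> l = W.J +> g"
    using g G_closed[OF g(1)] W.J_iff by (subst W.JC.rcos_eq_iff) auto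
  then show ?case using G_whit[OF g(1)] by (simp add: W.PW.killed_1)
next
  case (Suc n)
  then obtain g k where g: "g \<in> G" "k \<in> span n" "l = bs (Suc n) \<otimes> g \<oplus> k" by auto
  have "W.J +> l = (W.J +> (bs (Suc n) \<otimes> g)) \<oplus>\<^bsub>W.P\<^esub> (W.J +> k)"
    using g by (simp add: W.P_add G_closed span_closed del: bs.simps)
  then show ?case
    using W.PW.killed_add[OF bs_killed[OF g(1), of "Suc n"] W.PW.killed_mono[OF Suc.IH[OF g(2)], of "Suc (Suc n)"]] by simp
qed

lemma span_J: "l \<in> span n \<Longrightarrow> a \<in> carrier A \<Longrightarrow> l \<oplus> a \<otimes> wc \<in> span n"
proof -
  assume l: "l \<in> span n" and a: "a \<in> carrier A"
  have "\<zero> \<oplus> a \<otimes> wc \<in> span 0" unfolding span.simps using G_zero a by blast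
  then have "\<zero> \<oplus> a \<otimes> wc \<in> span n" using span_mono[of 0 n] by blast
  then show ?thesis using span_add[OF l, of "\<zero> \<oplus> a \<otimes> wc"] a by simp
qed

text \<open>Applying w^(n+1) annihilates both l and the lower terms and returns the top coefficient
  g modulo Aw. So g = a w for some a, the top term is itself in Aw, and l already lies one step
  lower.\<close>

lemma whit_span:
  assumes "W.J +> l \<in> W.PW.whit" "l \<in> span n" shows "l \<in> span 0"
  using assms
proof (induction n arbitrary: l)
  case (Suc n)
  then obtain g k where g: "g \<in> G" "k \<in> span n" "l = bs (Suc n) \<otimes> g \<oplus> k" by auto
  note gc = G_closed[OF g(1)] and kc = span_closed[OF g(2)]
  have Pc: "W.J +> a \<in> carrier W.P" if "a \<in> carrier A" for a
    using that by (simp add: W.P_simps(1))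
  have "W.J +> l = (W.J +> (bs (Suc n) \<otimes> g)) \<oplus>\<^bsub>W.P\<^esub> (W.J +> k)"
    using g gc kc by (simp add: W.P_add del: bs.simps)
  also have "W.J +> (bs (Suc n) \<otimes> g) = bs (Suc n) \<odot>\<^bsub>W.P\<^esub> (W.J +> g)"
    using gc by (simp add: W.P_smult del: bs.simps)
  finally have l: "W.J +> l = bs (Suc n) \<odot>\<^bsub>W.P\<^esub> (W.J +> g) \<oplus>\<^bsub>W.P\<^esub> (W.J +> k)" .
  have l0: "wc [^] Suc n \<odot>\<^bsub>W.P\<^esub> (W.J +> l) = \<zero>\<^bsub>W.P\<^esub>"
  proof -
    have "W.PW.killed (Suc 0) (W.J +> l)" by (simp only: W.PW.killed_1 Suc.prems(1))
    then have "W.PW.killed (Suc n) (W.J +> l)" by (rule W.PW.killed_mono) simp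
    then show ?thesis by (simp only: W.PW.killed_def)
  qed
  have k0: "wc [^] Suc n \<odot>\<^bsub>W.P\<^esub> (W.J +> k) = \<zero>\<^bsub>W.P\<^esub>"
    using span_killed[OF g(2)] by (simp only: W.PW.killed_def)
  have "wc [^] Suc n \<odot>\<^bsub>W.P\<^esub> (W.J +> l) =
      wc [^] Suc n \<odot>\<^bsub>W.P\<^esub> (bs (Suc n) \<odot>\<^bsub>W.P\<^esub> (W.J +> g)) \<oplus>\<^bsub>W.P\<^esub> wc [^] Suc n \<odot>\<^bsub>W.P\<^esub> (W.J +> k)"
    unfolding l by (rule W.PM.smult_r_distr) (use Pc gc kc in \<open>simp_all add: W.PM.smult_closed del: bs.simps nat_pow_Suc\<close>)
  then have "W.J +> g = \<zero>\<^bsub>W.P\<^esub>"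
    unfolding l0 k0 W.PW.pow_b_whit[OF G_whit[OF g(1)]] using Pc[OF gc] by simp
  then have "g \<in> W.J" using W.rcos_eq_zero_iff[OF gc] by simp
  then obtain a where a: "a \<in> carrier A" "g = a \<otimes> wc" unfolding W.J_iff by blast
  have "l = k \<oplus> (bs (Suc n) \<otimes> a) \<otimes> wc"
    unfolding g(3) a(2) using a(1) kc by (simp add: m_assoc a_comm del: bs.simps)
  then have "l \<in> span n" using span_J[OF g(2), of "bs (Suc n) \<otimes> a"] a(1) by (simp del: bs.simps)
  then show ?case using Suc.IH Suc.prems(1) by blast
qed simp

lemma G_surj:
  assumes "X \<in> carrier W.H" shows "\<exists>g\<in>G. X = W.J +> g"
proof -
  obtain l where l: "l \<in> carrier A" "X = W.J +> l" using assms W.in_H_iff by blast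
  obtain n where "l \<in> span n" using L_span[OF L_all[OF l(1)]] by blast
  then have "l \<in> span 0" using whit_span[of l n] assms l W.PW_whit by simp
  then obtain g a where g: "g \<in> G" "a \<in> carrier A" "l = g \<oplus> a \<otimes> wc" by auto
  have "l \<ominus> g = a \<otimes> wc"
    using g G_closed[OF g(1)] by (simp add: minus_eq a_ac r_neg r_neg1 r_neg2)
  then have "X = W.J +> g"
    unfolding l(2) using l(1) g G_closed[OF g(1)] W.J_iff by (subst W.JC.rcos_eq_iff) auto
  then show ?thesis using g(1) by blast
qed

subsection \<open>Comparison of \<open>(e - 1) A\<close> with \<open>A (e - c)\<close>\<close>

lemma comm_one: "a \<in> carrier A \<Longrightarrow> (e \<ominus> \<one>) \<otimes> a = e \<otimes> a \<ominus> a \<and> a \<otimes> (e \<ominus> \<one>) = a \<otimes> e \<ominus> a"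
  by (simp add: minus_eq l_distr r_distr l_minus r_minus)

text \<open>Since e and e - 1 commute, (e - 1) [e, a] = [e, g] = 0, and e - 1 can be cancelled. For
  such a, left and right multiplication by e - 1 agree, which lets one pass between the right and
  the left ideal.\<close>

lemma comm_of_left:
  assumes "a \<in> carrier A" "g = (e \<ominus> \<one>) \<otimes> a" "e \<otimes> g = g \<otimes> e" shows "e \<otimes> a = a \<otimes> e"
proof -
  have "(e \<ominus> \<one>) \<otimes> e = e \<otimes> (e \<ominus> \<one>)" using comm_one[of e] by simp
  then have "(e \<ominus> \<one>) \<otimes> (e \<otimes> a) = e \<otimes> g"
    unfolding assms(2) using assms(1) by (simp add: m_assoc[symmetric])
  also have "\<dots> = (e \<ominus> \<one>) \<otimes> (a \<otimes> e)" unfolding assms(3) unfolding assms(2) using assms(1) by (simp add: m_assoc)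
  finally have "(e \<ominus> \<one>) \<otimes> (e \<otimes> a \<ominus> a \<otimes> e) = \<zero>"
    using assms(1) by (simp only: minus_eq r_distr r_minus m_closed s_closed a_inv_closed e_minus_one_closed r_neg one_closed a_closed)
  then have "e \<otimes> a \<ominus> a \<otimes> e = \<zero>" by (rule left_regular[rotated]) (simp add: assms(1))
  then show ?thesis using assms(1) by (simp add: minus_eq_zero_iff)
qed

lemma comm_of_right:
  assumes "a \<in> carrier A" "g = a \<otimes> (e \<ominus> \<one>)" "e \<otimes> g = g \<otimes> e" shows "e \<otimes> a = a \<otimes> e"
proof -
  have ee: "(e \<ominus> \<one>) \<otimes> e = e \<otimes> (e \<ominus> \<one>)" using comm_one[of e] by simp
  have "(e \<otimes> a) \<otimes> (e \<ominus> \<one>) = e \<otimes> g"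
    unfolding assms(2) using assms(1) by (simp add: m_assoc)
  also have "\<dots> = (a \<otimes> e) \<otimes> (e \<ominus> \<one>)" unfolding assms(3) unfolding assms(2) using assms(1) by (simp add: m_assoc ee)
  finally have "(e \<otimes> a \<ominus> a \<otimes> e) \<otimes> (e \<ominus> \<one>) = \<zero>"
    using assms(1) by (simp only: minus_eq l_distr l_minus m_closed s_closed a_inv_closed e_minus_one_closed r_neg one_closed a_closed)
  then have "e \<otimes> a \<ominus> a \<otimes> e = \<zero>" by (rule right_regular[rotated]) (simp add: assms(1))
  then show ?thesis using assms(1) by (simp add: minus_eq_zero_iff)
qed

lemma tau_e_minus_one:
  assumes "\<gamma> \<noteq> 0" shows "tau \<gamma> (e \<ominus> \<one>) = \<gamma>\<^sup>2 \<odot>\<^bsub>A\<^esub> e \<ominus> \<one>"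
proof -
  note t = alg_homD[OF tau_hom[OF assms]]
  have "tau \<gamma> (e \<oplus> (-1) \<odot>\<^bsub>A\<^esub> \<one>) = \<gamma> powi 2 \<odot>\<^bsub>A\<^esub> e \<oplus> (-1) \<odot>\<^bsub>A\<^esub> \<one>"
    using t(2)[of e "(-1) \<odot>\<^bsub>A\<^esub> \<one>"] t(5)[of \<one> "-1"] t(4) tau_wt[OF wt_e, of \<gamma>] by simp
  then show ?thesis by (simp add: sm_minus_one minus_eq power_int_def)
qed

text \<open>The left side describes the kernel of passing from G to the first component of the
  completion, the right side that of passing, after the twist, to the reduction. As e has weight 2,
  the condition on \<open>\<gamma>\<close> gives tau(e - 1) = e/c - 1 = w/c. Regularity makes the
  cofactor commute with e, so it may be moved to the other side.\<close>

lemma kernel_iff: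
  assumes \<gamma>: "\<gamma>\<^sup>2 = 1 / c" and g: "g \<in> G"
  shows "(\<exists>a\<in>carrier A. g = (e \<ominus> \<one>) \<otimes> a) \<longleftrightarrow> tau \<gamma> g \<in> W.J"
proof -
  have \<gamma>0: "\<gamma> \<noteq> 0" using \<gamma> c_nonzero by (metis divide_eq_0_iff power_zero_numeral zero_neq_one)
  note t = alg_homD[OF tau_hom[OF \<gamma>0]]
  have te: "tau \<gamma> (e \<ominus> \<one>) = (1/c) \<odot>\<^bsub>A\<^esub> wc"
    unfolding tau_e_minus_one[OF \<gamma>0] \<gamma> w_def using c_nonzero by (simp add: sm_diff_r sm_assoc[symmetric])
  show ?thesis
  proof
    assume "\<exists>a\<in>carrier A. g = (e \<ominus> \<one>) \<otimes> a"
    then obtain a where a: "a \<in> carrier A" "g = (e \<ominus> \<one>) \<otimes> a" by blast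
    have "e \<otimes> a = a \<otimes> e" by (rule comm_of_left[OF a G_comm[OF g]])
    then have "g = a \<otimes> (e \<ominus> \<one>)" unfolding a(2) using comm_one[OF a(1)] by simp
    then have "tau \<gamma> g = ((1/c) \<odot>\<^bsub>A\<^esub> tau \<gamma> a) \<otimes> wc"
      using t(3)[OF a(1) e_minus_one_closed] t(1)[OF a(1)] by (simp add: te sm_mult_l sm_mult_r)
    then show "tau \<gamma> g \<in> W.J" unfolding W.J_iff using t(1)[OF a(1)] by (intro bexI[of _ "(1/c) \<odot>\<^bsub>A\<^esub> tau \<gamma> a"]) simp_all
  next
    assume "tau \<gamma> g \<in> W.J"
    then obtain b where b: "b \<in> carrier A" "tau \<gamma> g = b \<otimes> wc" unfolding W.J_iff by blast
    have i0: "inverse \<gamma> \<noteq> 0" using \<gamma>0 by simp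
    define a where "a = c \<odot>\<^bsub>A\<^esub> tau (inverse \<gamma>) b"
    have a: "a \<in> carrier A" using alg_homD(1)[OF tau_hom[OF i0] b(1)] by (simp add: a_def)
    have "wc = c \<odot>\<^bsub>A\<^esub> tau \<gamma> (e \<ominus> \<one>)" unfolding te using c_nonzero by (simp add: sm_assoc[symmetric])
    then have "tau (inverse \<gamma>) wc = c \<odot>\<^bsub>A\<^esub> (e \<ominus> \<one>)"
      using alg_homD(5)[OF tau_hom[OF i0], of "tau \<gamma> (e \<ominus> \<one>)" c] tau_inverse[OF \<gamma>0, of "e \<ominus> \<one>"] t(1)[of "e \<ominus> \<one>"] by simp
    then have "g = a \<otimes> (e \<ominus> \<one>)"
      using tau_inverse[OF \<gamma>0 G_closed[OF g]] alg_homD(3)[OF tau_hom[OF i0] b(1) w_closed] alg_homD(1)[OF tau_hom[OF i0] b(1)]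
      unfolding b(2) a_def by (simp add: sm_mult_l sm_mult_r)
    moreover from this have "e \<otimes> a = a \<otimes> e" by (rule comm_of_right[OF a _ G_comm[OF g]])
    ultimately have "g = (e \<ominus> \<one>) \<otimes> a" using comm_one[OF a] by simp
    then show "\<exists>a\<in>carrier A. g = (e \<ominus> \<one>) \<otimes> a" using a by blast
  qed
qed

end

section \<open>The completion and \<open>U'\<close>\<close>

context slV_algebra
begin

abbreviation eps where "eps \<equiv> e \<ominus> \<one>"
abbreviation Ipow where "Ipow \<equiv> right_ideal_pow A e"
abbreviation Chat where "Chat \<equiv> completion_alg A e"

lemma Ipow_iff: "z \<in> Ipow k \<longleftrightarrow> (\<exists>a\<in>carrier A. z = eps [^] k \<otimes> a)"
  by (auto simp: right_ideal_pow_def)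

lemma Ipow_subgroup: "additive_subgroup (Ipow k) A"
proof (rule additive_subgroup.intro, rule group.subgroupI[OF a_group])
  show "Ipow k \<subseteq> carrier (add_monoid A)" by (auto simp: Ipow_iff)
  show "Ipow k \<noteq> {}" by (auto simp: right_ideal_pow_def)
  show "inv\<^bsub>add_monoid A\<^esub> z \<in> Ipow k" if "z \<in> Ipow k" for z
  proof -
    from that obtain a where a: "a \<in> carrier A" "z = eps [^] k \<otimes> a" by (auto simp: Ipow_iff)
    then have "\<ominus> z = eps [^] k \<otimes> (\<ominus> a)" by (simp add: r_minus)
    then show ?thesis unfolding a_inv_def[symmetric] Ipow_iff using a(1) a_inv_closed by blast
  qed
  show "z \<otimes>\<^bsub>add_monoid A\<^esub> z' \<in> Ipow k" if "z \<in> Ipow k" "z' \<in> Ipow k" for z z'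
  proof -
    from that obtain a a' where a: "a \<in> carrier A" "z = eps [^] k \<otimes> a" "a' \<in> carrier A" "z' = eps [^] k \<otimes> a'"
      by (auto simp: Ipow_iff)
    then have "z \<oplus> z' = eps [^] k \<otimes> (a \<oplus> a')" by (simp add: r_distr)
    then show ?thesis using a(1,3) a_closed by (auto simp: Ipow_iff)
  qed
qed

lemma Ipow_cosets: "cosets (Ipow k) A"
  by (simp add: cosets_def Ipow_subgroup abelian_group_axioms)

sublocale Ic: cosets "Ipow k" A for k by (rule Ipow_cosets)

lemma Ipow_right: "z \<in> Ipow k \<Longrightarrow> a \<in> carrier A \<Longrightarrow> z \<otimes> a \<in> Ipow k"
proof -
  assume "z \<in> Ipow k" and a: "a \<in> carrier A"
  then obtain r where r: "r \<in> carrier A" "z = eps [^] k \<otimes> r" unfolding Ipow_iff by blast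
  then have "z \<otimes> a = eps [^] k \<otimes> (r \<otimes> a)" "r \<otimes> a \<in> carrier A" using a by (simp_all add: m_assoc)
  then show ?thesis unfolding Ipow_iff by blast
qed

lemma Ipow_sm: "z \<in> Ipow k \<Longrightarrow> l \<odot>\<^bsub>A\<^esub> z \<in> Ipow k"
  using Ipow_right[of z k "l \<odot>\<^bsub>A\<^esub> \<one>"] Ic.a_Hcarr[of z k] by (simp add: sm_mult_r)

lemma Ipow_mono: assumes "k \<le> m" "z \<in> Ipow m" shows "z \<in> Ipow k"
proof -
  obtain r where r: "r \<in> carrier A" "z = eps [^] m \<otimes> r" using assms(2) unfolding Ipow_iff by blast
  then have "z = eps [^] k \<otimes> (eps [^] (m - k) \<otimes> r)" "eps [^] (m - k) \<otimes> r \<in> carrier A"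
    using assms(1) by (simp_all add: m_assoc[symmetric] nat_pow_mult)
  then show ?thesis unfolding Ipow_iff by blast
qed

lemma Ipow_0: "a \<in> carrier A \<Longrightarrow> a \<in> Ipow 0"
  unfolding Ipow_iff by (rule bexI[of _ a]) simp_all

lemma eps_pow_in: "eps [^] k \<in> Ipow k"
  unfolding Ipow_iff by (rule bexI[of _ \<one>]) simp_all

text \<open>A modulus of continuity for left multiplication by a: the ideals of the filtration are
  right ideals only, so the index m has to be adapted to a.\<close>

definition absorbs :: "'a \<Rightarrow> nat \<Rightarrow> nat \<Rightarrow> bool" where
  "absorbs a m k \<longleftrightarrow> (\<forall>z\<in>Ipow m. a \<otimes> z \<in> Ipow k)"

lemma absorbs_exists: "a \<in> carrier A \<Longrightarrow> \<exists>m. absorbs a m k"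
proof -
  assume a: "a \<in> carrier A"
  have "w 1 = eps" by (simp add: w_def)
  then obtain m r where m: "r \<in> carrier A" "a \<otimes> eps [^] (m::nat) = eps [^] k \<otimes> r"
    using rnil[OF a, of 1] unfolding rnil_def by metis
  have "absorbs a m k" unfolding absorbs_def
  proof
    fix z assume "z \<in> Ipow m"
    then obtain b where b: "b \<in> carrier A" "z = eps [^] m \<otimes> b" unfolding Ipow_iff by blast
    have "a \<otimes> z = (a \<otimes> eps [^] m) \<otimes> b" using a b by (simp add: m_assoc)
    then show "a \<otimes> z \<in> Ipow k" unfolding m(2)
      using m(1) b(1) Ipow_right[OF Ipow_right[OF eps_pow_in m(1)] b(1)] by simp
  qed
  then show ?thesis ..
qed

lemma absorbs_mono: "absorbs a m k \<Longrightarrow> m \<le> m' \<Longrightarrow> k' \<le> k \<Longrightarrow> absorbs a m' k'"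
  unfolding absorbs_def using Ipow_mono by blast

lemma Chat_simps:
  "carrier Chat = {\<sigma>. \<forall>k. \<sigma> k \<in> a_rcosets (Ipow k) \<and> \<sigma> (Suc k) \<subseteq> \<sigma> k}"
  "one Chat = (\<lambda>k. Ipow k +> \<one>)" "ring.zero Chat = Ipow"
  "add Chat = (\<lambda>\<sigma> \<tau> k. set_add A (\<sigma> k) (\<tau> k))"
  "smult Chat = (\<lambda>r \<sigma> k. \<Union>a\<in>\<sigma> k. Ipow k +> (r \<odot>\<^bsub>A\<^esub> a))"
  by (simp_all add: completion_alg_def Let_def)

lemma Chat_mult: "mult Chat \<sigma> \<tau> k = (THE X. X \<in> a_rcosets (Ipow k) \<and>
                (\<exists>m0. \<forall>m\<ge>m0. \<forall>a\<in>\<sigma> k. \<forall>b\<in>\<tau> m. a \<otimes> b \<in> X))"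
  by (simp add: completion_alg_def Let_def)

lemma Chat_rcos: "\<sigma> \<in> carrier Chat \<Longrightarrow> a \<in> \<sigma> k \<Longrightarrow> \<sigma> k = Ipow k +> a"
  using Ic.rcos_eqI[of "\<sigma> k" k a] by (auto simp: Chat_simps(1))

lemma Chat_rep: assumes "\<sigma> \<in> carrier Chat" obtains a where "a \<in> \<sigma> k" "a \<in> carrier A"
proof -
  have "\<sigma> k \<in> a_rcosets (Ipow k)" using assms by (simp add: Chat_simps(1))
  then have "\<sigma> k \<noteq> {}" "\<sigma> k \<subseteq> carrier A" by (rule Ic.rcos_nonempty, rule Ic.rcos_subset)
  then show ?thesis using that by blast
qed

lemma Chat_closed: "\<sigma> \<in> carrier Chat \<Longrightarrow> a \<in> \<sigma> k \<Longrightarrow> a \<in> carrier A"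
  using Ic.rcos_subset[of "\<sigma> k" k] by (auto simp: Chat_simps(1))

lemma Chat_antimono: "\<sigma> \<in> carrier Chat \<Longrightarrow> k \<le> m \<Longrightarrow> a \<in> \<sigma> m \<Longrightarrow> a \<in> \<sigma> k"
proof (induction m)
  case (Suc m)
  show ?case
  proof (cases "k = Suc m")
    case False
    then show ?thesis using Suc by (simp add: Chat_simps(1) subset_iff)
  qed (use Suc in simp)
qed simp

lemma ChatI:
  assumes "\<And>k. \<exists>a\<in>carrier A. \<sigma> k = Ipow k +> a \<and> \<sigma> (Suc k) = Ipow (Suc k) +> a"
  shows "\<sigma> \<in> carrier Chat"
  unfolding Chat_simps(1)
proof (intro CollectI allI conjI)
  fix k
  obtain a where a: "a \<in> carrier A" "\<sigma> k = Ipow k +> a" "\<sigma> (Suc k) = Ipow (Suc k) +> a"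
    using assms[of k] by blast
  show "\<sigma> k \<in> a_rcosets (Ipow k)" using a by simp
  show "\<sigma> (Suc k) \<subseteq> \<sigma> k"
    unfolding a using a(1) Ipow_mono[of k "Suc k"] by (auto simp: Ic.mem_rcos)
qed

lemma Chat_diff:
  assumes "\<sigma> \<in> carrier Chat" "a \<in> \<sigma> k" "b \<in> \<sigma> k" shows "a \<ominus> b \<in> Ipow k"
  using Chat_rcos[OF assms(1,3)] Chat_closed[OF assms(1,3)] assms(2) Ic.mem_rcos by simp

text \<open>Another choice of representatives changes the product by (a' - a) b', which stays in a
  right ideal, and by a (b' - b), which is absorbed. So the defining description of the product has
  this coset as its only solution.\<close>

lemma mult_rep:
  assumes \<sigma>: "\<sigma> \<in> carrier Chat" and \<tau>: "\<tau> \<in> carrier Chat"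
    and a: "a \<in> \<sigma> k" and b: "b \<in> \<tau> m" and ab: "absorbs a m k"
  shows "(\<sigma> \<otimes>\<^bsub>Chat\<^esub> \<tau>) k = Ipow k +> (a \<otimes> b)"
proof -
  note ac = Chat_closed[OF \<sigma> a] and bc = Chat_closed[OF \<tau> b]
  have mem: "a' \<otimes> b' \<in> Ipow k +> (a \<otimes> b)" if "m \<le> m'" "a' \<in> \<sigma> k" "b' \<in> \<tau> m'" for m' a' b'
  proof -
    have b': "b' \<in> \<tau> m" using Chat_antimono[OF \<tau> that(1,3)] .
    note c = Chat_closed[OF \<sigma> that(2)] Chat_closed[OF \<tau> b']
    have "(a' \<ominus> a) \<otimes> b' \<in> Ipow k" by (rule Ipow_right[OF Chat_diff[OF \<sigma> that(2) a] c(2)])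
    moreover have "a \<otimes> (b' \<ominus> b) \<in> Ipow k" using ab Chat_diff[OF \<tau> b' b] unfolding absorbs_def by (rule bspec)
    ultimately have "(a' \<ominus> a) \<otimes> b' \<oplus> a \<otimes> (b' \<ominus> b) \<in> Ipow k" by (rule Ic.a_closed)
    moreover have "(a' \<ominus> a) \<otimes> b' \<oplus> a \<otimes> (b' \<ominus> b) = a' \<otimes> b' \<ominus> a \<otimes> b"
      using ac bc c by (simp add: minus_eq l_distr r_distr l_minus r_minus a_assoc r_neg1 r_neg2)
    ultimately show ?thesis using ac bc c by (simp add: Ic.mem_rcos)
  qed
  show ?thesis unfolding Chat_mult
  proof (rule the_equality)
    show "Ipow k +> (a \<otimes> b) \<in> a_rcosets (Ipow k) \<and>
        (\<exists>m0. \<forall>m\<ge>m0. \<forall>a'\<in>\<sigma> k. \<forall>b'\<in>\<tau> m. a' \<otimes> b' \<in> Ipow k +> (a \<otimes> b))"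
      using mem ac bc by (intro conjI exI[of _ m]) simp_all
    fix X assume X: "X \<in> a_rcosets (Ipow k) \<and> (\<exists>m0. \<forall>m\<ge>m0. \<forall>a\<in>\<sigma> k. \<forall>b\<in>\<tau> m. a \<otimes> b \<in> X)"
    then obtain m0 where m0: "\<forall>m\<ge>m0. \<forall>a\<in>\<sigma> k. \<forall>b\<in>\<tau> m. a \<otimes> b \<in> X" by blast
    obtain b' where b': "b' \<in> \<tau> (max m m0)" by (rule Chat_rep[OF \<tau>])
    have "a \<otimes> b' \<in> X" by (rule m0[rule_format, OF max.cobounded2 a b'])
    then have "X = Ipow k +> (a \<otimes> b')" by (rule Ic.rcos_eqI[OF conjunct1[OF X]])
    also have "\<dots> = Ipow k +> (a \<otimes> b)"
      by (rule sym, rule Ic.rcos_eqI[OF _ mem[OF max.cobounded1 a b']]) (simp add: ac bc)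
    finally show "X = Ipow k +> (a \<otimes> b)" .
  qed
qed

text \<open>One pair of representatives serves all components up to k, as compatibility of the
  product requires. The slack n asks for b at a deeper level than the multiplication itself;
  \<open>com_mult\<close> spends it on ad h.\<close>

lemma mult_rep_exists:
  assumes \<sigma>: "\<sigma> \<in> carrier Chat" and \<tau>: "\<tau> \<in> carrier Chat"
  shows "\<exists>a b m. a \<in> \<sigma> k \<and> absorbs a m k \<and> b \<in> \<tau> (m + n) \<and>
    (\<forall>j\<le>k. (\<sigma> \<otimes>\<^bsub>Chat\<^esub> \<tau>) j = Ipow j +> (a \<otimes> b))"
proof -
  obtain a where a: "a \<in> \<sigma> k" "a \<in> carrier A" by (rule Chat_rep[OF \<sigma>])
  obtain m where m: "absorbs a m k" using absorbs_exists[OF a(2)] ..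
  obtain b where b: "b \<in> \<tau> (m + n)" by (rule Chat_rep[OF \<tau>])
  have "(\<sigma> \<otimes>\<^bsub>Chat\<^esub> \<tau>) j = Ipow j +> (a \<otimes> b)" if "j \<le> k" for j
    by (rule mult_rep[OF \<sigma> \<tau> Chat_antimono[OF \<sigma> that a(1)] b(1)]) (rule absorbs_mono[OF m], use that in simp_all)
  then show ?thesis using a(1) m b by (intro exI conjI allI impI)
qed

lemma Chat_mult_closed:
  assumes \<sigma>: "\<sigma> \<in> carrier Chat" and \<tau>: "\<tau> \<in> carrier Chat"
  shows "\<sigma> \<otimes>\<^bsub>Chat\<^esub> \<tau> \<in> carrier Chat"
proof (rule ChatI)
  fix k
  obtain a b m where r: "a \<in> \<sigma> (Suc k)" "absorbs a m (Suc k)" "b \<in> \<tau> (m + 0)"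
    "\<forall>j\<le>Suc k. (\<sigma> \<otimes>\<^bsub>Chat\<^esub> \<tau>) j = Ipow j +> (a \<otimes> b)"
    using mult_rep_exists[OF \<sigma> \<tau>, of "Suc k" 0] by (elim exE conjE)
  show "\<exists>c\<in>carrier A. (\<sigma> \<otimes>\<^bsub>Chat\<^esub> \<tau>) k = Ipow k +> c \<and> (\<sigma> \<otimes>\<^bsub>Chat\<^esub> \<tau>) (Suc k) = Ipow (Suc k) +> c"
    using r(4) Chat_closed[OF \<sigma> r(1)] Chat_closed[OF \<tau> r(3)] by (intro bexI[of _ "a \<otimes> b"]) simp_all
qed

lemma add_rep:
  assumes "\<sigma> \<in> carrier Chat" "\<tau> \<in> carrier Chat" "a \<in> \<sigma> k" "b \<in> \<tau> k"
  shows "(\<sigma> \<oplus>\<^bsub>Chat\<^esub> \<tau>) k = Ipow k +> (a \<oplus> b)"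
  unfolding Chat_simps Chat_rcos[OF assms(1,3)] Chat_rcos[OF assms(2,4)]
  by (rule Ic.rcos_add) (use Chat_closed assms in blast)+

lemma smult_rep:
  assumes "\<sigma> \<in> carrier Chat" "a \<in> \<sigma> k"
  shows "(l \<odot>\<^bsub>Chat\<^esub> \<sigma>) k = Ipow k +> (l \<odot>\<^bsub>A\<^esub> a)"
  unfolding Chat_simps Chat_rcos[OF assms]
proof (rule Ic.UN_rcos[OF Chat_closed[OF assms] Ipow_cosets])
  fix z assume "z \<in> Ipow k +> a"
  then have z: "z \<in> carrier A" "z \<ominus> a \<in> Ipow k" using Ic.mem_rcos[OF Chat_closed[OF assms]] by auto
  then show "l \<odot>\<^bsub>A\<^esub> z \<in> carrier A" by simp
  show "l \<odot>\<^bsub>A\<^esub> z \<ominus> l \<odot>\<^bsub>A\<^esub> a \<in> Ipow k"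
    using Ipow_sm[OF z(2), of l] z(1) Chat_closed[OF assms] by (simp add: sm_diff_r)
qed

lemma Chat_add_closed:
  assumes \<sigma>: "\<sigma> \<in> carrier Chat" and \<tau>: "\<tau> \<in> carrier Chat" shows "\<sigma> \<oplus>\<^bsub>Chat\<^esub> \<tau> \<in> carrier Chat"
proof (rule ChatI)
  fix k
  obtain a where a: "a \<in> \<sigma> (Suc k)" "a \<in> carrier A" by (rule Chat_rep[OF \<sigma>])
  obtain b where b: "b \<in> \<tau> (Suc k)" "b \<in> carrier A" by (rule Chat_rep[OF \<tau>])
  have "a \<in> \<sigma> k" "b \<in> \<tau> k" using Chat_antimono[OF \<sigma> _ a(1)] Chat_antimono[OF \<tau> _ b(1)] by simp_all
  then show "\<exists>c\<in>carrier A. (\<sigma> \<oplus>\<^bsub>Chat\<^esub> \<tau>) k = Ipow k +> c \<and> (\<sigma> \<oplus>\<^bsub>Chat\<^esub> \<tau>) (Suc k) = Ipow (Suc k) +> c"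
    using a b add_rep[OF \<sigma> \<tau>] by (intro bexI[of _ "a \<oplus> b"]) simp_all
qed

lemma Chat_smult_closed:
  assumes \<sigma>: "\<sigma> \<in> carrier Chat" shows "l \<odot>\<^bsub>Chat\<^esub> \<sigma> \<in> carrier Chat"
proof (rule ChatI)
  fix k
  obtain a where a: "a \<in> \<sigma> (Suc k)" "a \<in> carrier A" by (rule Chat_rep[OF \<sigma>])
  have "a \<in> \<sigma> k" using Chat_antimono[OF \<sigma> _ a(1)] by simp
  then show "\<exists>c\<in>carrier A. (l \<odot>\<^bsub>Chat\<^esub> \<sigma>) k = Ipow k +> c \<and> (l \<odot>\<^bsub>Chat\<^esub> \<sigma>) (Suc k) = Ipow (Suc k) +> c"
    using a smult_rep[OF \<sigma>] by (intro bexI[of _ "l \<odot>\<^bsub>A\<^esub> a"]) simp_all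
qed

lemma to_completion_closed: "a \<in> carrier A \<Longrightarrow> to_completion A e a \<in> carrier Chat"
  by (rule ChatI) (auto simp: to_completion_def)

lemma to_completion_rep: "a \<in> carrier A \<Longrightarrow> a \<in> to_completion A e a k"
  by (simp add: to_completion_def)

lemma one_eq: "\<one>\<^bsub>Chat\<^esub> = to_completion A e \<one>"
  by (simp add: Chat_simps to_completion_def)

lemma zero_eq: "\<zero>\<^bsub>Chat\<^esub> = to_completion A e \<zero>"
  by (simp add: Chat_simps to_completion_def)

lemma Chat_eqI:
  assumes "\<sigma> \<in> carrier Chat" "\<tau> \<in> carrier Chat" "\<And>k. \<exists>a. a \<in> \<sigma> k \<and> a \<in> \<tau> k" shows "\<sigma> = \<tau>"
proof
  fix k
  obtain a where "a \<in> \<sigma> k" "a \<in> \<tau> k" using assms(3) by blast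
  then show "\<sigma> k = \<tau> k" using Chat_rcos assms(1,2) by blast
qed

lemma Chat_neg:
  assumes \<sigma>: "\<sigma> \<in> carrier Chat" shows "((-1) \<odot>\<^bsub>Chat\<^esub> \<sigma>) \<oplus>\<^bsub>Chat\<^esub> \<sigma> = \<zero>\<^bsub>Chat\<^esub>"
proof (rule Chat_eqI)
  fix k
  obtain a where a: "a \<in> \<sigma> k" "a \<in> carrier A" by (rule Chat_rep[OF \<sigma>])
  have "(-1) \<odot>\<^bsub>A\<^esub> a \<in> ((-1) \<odot>\<^bsub>Chat\<^esub> \<sigma>) k" using smult_rep[OF \<sigma> a(1)] a(2) by simp
  then have "(((-1) \<odot>\<^bsub>Chat\<^esub> \<sigma>) \<oplus>\<^bsub>Chat\<^esub> \<sigma>) k = Ipow k +> ((-1) \<odot>\<^bsub>A\<^esub> a \<oplus> a)"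
    by (rule add_rep[OF Chat_smult_closed[OF \<sigma>] \<sigma> _ a(1)])
  also have "(-1) \<odot>\<^bsub>A\<^esub> a \<oplus> a = \<zero>" using a(2) by (simp add: sm_minus_one l_neg)
  finally show "\<exists>a. a \<in> (((-1) \<odot>\<^bsub>Chat\<^esub> \<sigma>) \<oplus>\<^bsub>Chat\<^esub> \<sigma>) k \<and> a \<in> \<zero>\<^bsub>Chat\<^esub> k"
    unfolding zero_eq to_completion_def using Ic.zero_closed[of k] by (intro exI[of _ \<zero>]) simp
qed (simp_all add: Chat_add_closed Chat_smult_closed \<sigma> zero_eq to_completion_closed)

lemma Chat_abelian_group: "abelian_group Chat"
proof (rule abelian_groupI)
  fix \<rho> \<sigma> \<tau> assume c: "\<rho> \<in> carrier Chat" "\<sigma> \<in> carrier Chat" "\<tau> \<in> carrier Chat"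
  show "\<rho> \<oplus>\<^bsub>Chat\<^esub> \<sigma> \<oplus>\<^bsub>Chat\<^esub> \<tau> = \<rho> \<oplus>\<^bsub>Chat\<^esub> (\<sigma> \<oplus>\<^bsub>Chat\<^esub> \<tau>)"
  proof
    fix k
    obtain r where r: "r \<in> \<rho> k" "r \<in> carrier A" by (rule Chat_rep[OF c(1)])
    obtain a where a: "a \<in> \<sigma> k" "a \<in> carrier A" by (rule Chat_rep[OF c(2)])
    obtain b where b: "b \<in> \<tau> k" "b \<in> carrier A" by (rule Chat_rep[OF c(3)])
    have ra: "r \<oplus> a \<in> (\<rho> \<oplus>\<^bsub>Chat\<^esub> \<sigma>) k" using add_rep[OF c(1,2) r(1) a(1)] r a by simp
    have ab: "a \<oplus> b \<in> (\<sigma> \<oplus>\<^bsub>Chat\<^esub> \<tau>) k" using add_rep[OF c(2,3) a(1) b(1)] a b by simp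
    show "(\<rho> \<oplus>\<^bsub>Chat\<^esub> \<sigma> \<oplus>\<^bsub>Chat\<^esub> \<tau>) k = (\<rho> \<oplus>\<^bsub>Chat\<^esub> (\<sigma> \<oplus>\<^bsub>Chat\<^esub> \<tau>)) k"
      unfolding add_rep[OF Chat_add_closed[OF c(1,2)] c(3) ra b(1)] add_rep[OF c(1) Chat_add_closed[OF c(2,3)] r(1) ab]
      using r a b by (simp add: a_assoc)
  qed
next
  fix \<sigma> \<tau> assume c: "\<sigma> \<in> carrier Chat" "\<tau> \<in> carrier Chat"
  show "\<sigma> \<oplus>\<^bsub>Chat\<^esub> \<tau> = \<tau> \<oplus>\<^bsub>Chat\<^esub> \<sigma>"
  proof
    fix k
    obtain a where a: "a \<in> \<sigma> k" "a \<in> carrier A" by (rule Chat_rep[OF c(1)])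
    obtain b where b: "b \<in> \<tau> k" "b \<in> carrier A" by (rule Chat_rep[OF c(2)])
    show "(\<sigma> \<oplus>\<^bsub>Chat\<^esub> \<tau>) k = (\<tau> \<oplus>\<^bsub>Chat\<^esub> \<sigma>) k"
      unfolding add_rep[OF c a(1) b(1)] add_rep[OF c(2,1) b(1) a(1)] using a b by (simp add: a_comm)
  qed
next
  fix \<sigma> assume c: "\<sigma> \<in> carrier Chat"
  show "\<zero>\<^bsub>Chat\<^esub> \<oplus>\<^bsub>Chat\<^esub> \<sigma> = \<sigma>"
  proof
    fix k
    obtain a where a: "a \<in> \<sigma> k" "a \<in> carrier A" by (rule Chat_rep[OF c])
    show "(\<zero>\<^bsub>Chat\<^esub> \<oplus>\<^bsub>Chat\<^esub> \<sigma>) k = \<sigma> k"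
      unfolding zero_eq add_rep[OF to_completion_closed[OF zero_closed] c to_completion_rep[OF zero_closed] a(1)]
        Chat_rcos[OF c a(1)] using a(2) by simp
  qed
  show "\<exists>\<tau>\<in>carrier Chat. \<tau> \<oplus>\<^bsub>Chat\<^esub> \<sigma> = \<zero>\<^bsub>Chat\<^esub>"
    using Chat_neg[OF c] Chat_smult_closed[OF c] by blast
qed (simp_all add: Chat_add_closed zero_eq to_completion_closed)

lemma Chat_a_inv: "\<sigma> \<in> carrier Chat \<Longrightarrow> \<ominus>\<^bsub>Chat\<^esub> \<sigma> = (-1) \<odot>\<^bsub>Chat\<^esub> \<sigma>"
  using abelian_group.minus_equality[OF Chat_abelian_group Chat_neg] Chat_smult_closed by blast

end

text \<open>Both series solve (1 + X) E' = r E with constant term 1. Consequently the coefficients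
  of e^r in powers of e - 1 are generalised binomial coefficients.\<close>

lemma fps_power_eq_binomial: "fps_compose (fps_exp r) (fps_ln 1) = fps_binomial (r :: complex)"
proof -
  let ?E = "fps_compose (fps_exp r) (fps_ln 1)"
  have "fps_deriv ?E = (fps_deriv (fps_exp r) oo fps_ln 1) * fps_deriv (fps_ln 1)"
    by (rule fps_compose_deriv) (simp add: fps_ln_def)
  also have "fps_deriv (fps_ln (1::complex)) = 1 / (1 + fps_X)"
    by (simp add: fps_ln_deriv fps_divide_unit)
  also have "fps_deriv (fps_exp r) oo fps_ln 1 = fps_const r * ?E"
    by (simp add: fps_compose_mult_distrib fps_ln_def)
  finally have "fps_deriv ?E = fps_const r * ?E / (1 + fps_X)"
    by (simp add: fps_divide_unit)
  then have "?E = fps_const (fps_nth ?E 0) * fps_binomial r"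
    by (simp add: fps_binomial_ODE_unique)
  moreover have "fps_nth ?E 0 = 1" by simp
  ultimately show ?thesis by simp
qed

section \<open>Eigenvectors of ad h in the completion\<close>

context slV_algebra
begin

text \<open>Since e = eps + 1 has weight 2, ad eps = 2 (eps + 1). The summand with the lower power
  is the reason why ad h drops the filtration by one.\<close>

lemma ad_eps_pow: "ad (eps [^] Suc n) = (2 * of_nat (Suc n)) \<odot>\<^bsub>A\<^esub> (eps [^] Suc n \<oplus> eps [^] n)"
proof (induction n)
  case 0
  have "eps [^] Suc 0 = eps" "eps [^] (0::nat) = \<one>" by simp_all
  then show ?case by (simp only: ad_e1) simp
next
  case (Suc n)
  have "ad (eps [^] Suc (Suc n)) = ad (eps [^] Suc n) \<otimes> eps \<oplus> eps [^] Suc n \<otimes> ad eps"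
    unfolding nat_pow_Suc[of eps "Suc n"] by (rule ad_mult) simp_all
  also have "\<dots> = (2 * of_nat (Suc n)) \<odot>\<^bsub>A\<^esub> (eps [^] Suc (Suc n) \<oplus> eps [^] Suc n) \<oplus> 2 \<odot>\<^bsub>A\<^esub> (eps [^] Suc (Suc n) \<oplus> eps [^] Suc n)"
    unfolding Suc.IH ad_e1 by (simp add: sm_mult_l sm_mult_r l_distr r_distr del: of_nat_Suc)
  also have "\<dots> = (2 * of_nat (Suc n) + 2) \<odot>\<^bsub>A\<^esub> (eps [^] Suc (Suc n) \<oplus> eps [^] Suc n)"
    by (rule sm_add_l[symmetric]) simp
  also have "(2 * of_nat (Suc n) + 2 :: complex) = 2 * of_nat (Suc (Suc n))" by simp
  finally show ?case .
qed

lemma ad_Ipow: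
  assumes "z \<in> Ipow (Suc k)" shows "ad z \<in> Ipow k"
proof -
  obtain a where a: "a \<in> carrier A" "z = eps [^] Suc k \<otimes> a" using assms unfolding Ipow_iff by blast
  have "eps [^] Suc k \<oplus> eps [^] k \<in> Ipow k"
    by (rule Ic.a_closed) (rule Ipow_mono[of k "Suc k"], simp, rule eps_pow_in, rule eps_pow_in)
  then have "ad (eps [^] Suc k) \<in> Ipow k" unfolding ad_eps_pow by (rule Ipow_sm)
  then have "ad (eps [^] Suc k) \<otimes> a \<in> Ipow k" using a(1) by (rule Ipow_right)
  moreover have "eps [^] Suc k \<otimes> ad a \<in> Ipow k"
    by (rule Ipow_mono[of k "Suc k"]) (use a Ipow_right[OF eps_pow_in, of "ad a" "Suc k"] in simp_all)
  ultimately show ?thesis unfolding a(2) using a(1) by (subst ad_mult) (simp_all add: Ic.a_closed)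
qed

text \<open>States that ad h acts on sigma as the scalar t. Level k + 1 is tested against the ideal
  of level k because ad h loses one level. The eigenvalue is complex since that of e^r is
  2r.\<close>

definition com :: "complex \<Rightarrow> (nat \<Rightarrow> 'a set) \<Rightarrow> bool" where
  "com t \<sigma> \<longleftrightarrow> (\<forall>k. \<forall>b\<in>\<sigma> (Suc k). ad b \<ominus> t \<odot>\<^bsub>A\<^esub> b \<in> Ipow k)"

lemma ad_diff: "a \<in> carrier A \<Longrightarrow> b \<in> carrier A \<Longrightarrow> ad (a \<ominus> b) = ad a \<ominus> ad b"
  using ad_add[of a "\<ominus> b"] ad_sm[of b "-1"] by (simp add: minus_eq sm_minus_one)

text \<open>By \<open>ad_Ipow\<close> the condition at a level does not depend on the
  representative, so one per level is enough.\<close>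

lemma comI:
  assumes \<sigma>: "\<sigma> \<in> carrier Chat" and "\<And>k. \<exists>b\<in>\<sigma> (Suc k). ad b \<ominus> t \<odot>\<^bsub>A\<^esub> b \<in> Ipow k"
  shows "com t \<sigma>"
  unfolding com_def
proof (intro allI ballI)
  fix k a assume a: "a \<in> \<sigma> (Suc k)"
  obtain b where b: "b \<in> \<sigma> (Suc k)" "ad b \<ominus> t \<odot>\<^bsub>A\<^esub> b \<in> Ipow k" using assms(2)[of k] by (elim bexE)
  note ac = Chat_closed[OF \<sigma> a] and bc = Chat_closed[OF \<sigma> b(1)]
  have d: "a \<ominus> b \<in> Ipow (Suc k)" by (rule Chat_diff[OF \<sigma> a b(1)])
  have "t \<odot>\<^bsub>A\<^esub> (a \<ominus> b) \<in> Ipow k" using Ipow_sm[OF Ipow_mono[OF _ d]] by simp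
  then have "\<ominus> (t \<odot>\<^bsub>A\<^esub> (a \<ominus> b)) \<in> Ipow k" by (rule Ic.a_inv_closed)
  then have "(ad b \<ominus> t \<odot>\<^bsub>A\<^esub> b) \<oplus> (ad (a \<ominus> b) \<oplus> \<ominus> (t \<odot>\<^bsub>A\<^esub> (a \<ominus> b))) \<in> Ipow k"
    by (intro Ic.a_closed b(2) ad_Ipow[OF d])
  moreover have "(ad b \<ominus> t \<odot>\<^bsub>A\<^esub> b) \<oplus> (ad (a \<ominus> b) \<oplus> \<ominus> (t \<odot>\<^bsub>A\<^esub> (a \<ominus> b))) = ad a \<ominus> t \<odot>\<^bsub>A\<^esub> a"
  proof -
    have *: "(p \<ominus> q) \<oplus> ((p' \<ominus> p) \<oplus> \<ominus> (q' \<ominus> q)) = p' \<ominus> q'"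
      if "p \<in> carrier A" "q \<in> carrier A" "p' \<in> carrier A" "q' \<in> carrier A" for p q p' q'
    proof -
      have "(p \<ominus> q) \<oplus> ((p' \<ominus> p) \<oplus> \<ominus> (q' \<ominus> q)) = (p \<oplus> \<ominus> p) \<oplus> ((q \<oplus> \<ominus> q) \<oplus> (p' \<oplus> \<ominus> q'))"
        using that by (simp add: minus_eq minus_add a_ac)
      then show ?thesis using that by (simp add: r_neg minus_eq)
    qed
    show ?thesis using ac bc by (simp add: ad_diff sm_diff_r *)
  qed
  ultimately show "ad a \<ominus> t \<odot>\<^bsub>A\<^esub> a \<in> Ipow k" by simp
qed

lemma comD: "com t \<sigma> \<Longrightarrow> b \<in> \<sigma> (Suc k) \<Longrightarrow> ad b \<ominus> t \<odot>\<^bsub>A\<^esub> b \<in> Ipow k"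
  by (simp add: com_def)

lemma com_to_completion: "wt k a \<Longrightarrow> com (of_int k) (to_completion A e a)"
proof (rule comI)
  assume a: "wt k a"
  then show "to_completion A e a \<in> carrier Chat" by (intro to_completion_closed wt_closed)
  fix j
  show "\<exists>b\<in>to_completion A e a (Suc j). ad b \<ominus> of_int k \<odot>\<^bsub>A\<^esub> b \<in> Ipow j"
    using a to_completion_rep[OF wt_closed[OF a]] Ic.zero_closed[of j]
    by (intro bexI[of _ a]) (simp_all add: wt_ad minus_eq r_neg)
qed

lemma com_add:
  assumes \<sigma>: "\<sigma> \<in> carrier Chat" and \<tau>: "\<tau> \<in> carrier Chat" and "com t \<sigma>" "com t \<tau>"
  shows "com t (\<sigma> \<oplus>\<^bsub>Chat\<^esub> \<tau>)"
proof (rule comI[OF Chat_add_closed[OF \<sigma> \<tau>]])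
  fix k
  obtain a where a: "a \<in> \<sigma> (Suc k)" "a \<in> carrier A" by (rule Chat_rep[OF \<sigma>])
  obtain b where b: "b \<in> \<tau> (Suc k)" "b \<in> carrier A" by (rule Chat_rep[OF \<tau>])
  have "(ad a \<ominus> t \<odot>\<^bsub>A\<^esub> a) \<oplus> (ad b \<ominus> t \<odot>\<^bsub>A\<^esub> b) \<in> Ipow k"
    by (intro Ic.a_closed comD[OF assms(3) a(1)] comD[OF assms(4) b(1)])
  moreover have "(ad a \<ominus> t \<odot>\<^bsub>A\<^esub> a) \<oplus> (ad b \<ominus> t \<odot>\<^bsub>A\<^esub> b) = ad (a \<oplus> b) \<ominus> t \<odot>\<^bsub>A\<^esub> (a \<oplus> b)"
    using a b by (simp add: ad_add sm_add_r minus_eq minus_add a_ac)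
  moreover have "a \<oplus> b \<in> (\<sigma> \<oplus>\<^bsub>Chat\<^esub> \<tau>) (Suc k)" unfolding add_rep[OF \<sigma> \<tau> a(1) b(1)] using a b by simp
  ultimately show "\<exists>c\<in>(\<sigma> \<oplus>\<^bsub>Chat\<^esub> \<tau>) (Suc k). ad c \<ominus> t \<odot>\<^bsub>A\<^esub> c \<in> Ipow k" by (intro bexI) simp_all
qed

lemma com_smult:
  assumes \<sigma>: "\<sigma> \<in> carrier Chat" and "com t \<sigma>" shows "com t (l \<odot>\<^bsub>Chat\<^esub> \<sigma>)"
proof (rule comI[OF Chat_smult_closed[OF \<sigma>]])
  fix k
  obtain a where a: "a \<in> \<sigma> (Suc k)" "a \<in> carrier A" by (rule Chat_rep[OF \<sigma>])
  have "l \<odot>\<^bsub>A\<^esub> (ad a \<ominus> t \<odot>\<^bsub>A\<^esub> a) \<in> Ipow k" by (rule Ipow_sm[OF comD[OF assms(2) a(1)]])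
  moreover have "l \<odot>\<^bsub>A\<^esub> (ad a \<ominus> t \<odot>\<^bsub>A\<^esub> a) = ad (l \<odot>\<^bsub>A\<^esub> a) \<ominus> t \<odot>\<^bsub>A\<^esub> (l \<odot>\<^bsub>A\<^esub> a)"
    using a by (simp add: ad_sm sm_diff_r sm_assoc[symmetric] mult.commute)
  moreover have "l \<odot>\<^bsub>A\<^esub> a \<in> (l \<odot>\<^bsub>Chat\<^esub> \<sigma>) (Suc k)" unfolding smult_rep[OF \<sigma> a(1)] using a by simp
  ultimately show "\<exists>c\<in>(l \<odot>\<^bsub>Chat\<^esub> \<sigma>) (Suc k). ad c \<ominus> t \<odot>\<^bsub>A\<^esub> c \<in> Ipow k" by (intro bexI) simp_all
qed

lemma com_mult:
  assumes \<sigma>: "\<sigma> \<in> carrier Chat" and \<tau>: "\<tau> \<in> carrier Chat" and "com t \<sigma>" "com u \<tau>"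
  shows "com (t + u) (\<sigma> \<otimes>\<^bsub>Chat\<^esub> \<tau>)"
proof (rule comI[OF Chat_mult_closed[OF \<sigma> \<tau>]])
  fix k
  \<comment> \<open>The representative b is taken one level beyond m, so that ad b - u b still lies
    in the ideal that a absorbs.\<close>
  obtain a b m where r: "a \<in> \<sigma> (Suc k)" "absorbs a m (Suc k)" "b \<in> \<tau> (m + 1)"
    "\<forall>j\<le>Suc k. (\<sigma> \<otimes>\<^bsub>Chat\<^esub> \<tau>) j = Ipow j +> (a \<otimes> b)"
    using mult_rep_exists[OF \<sigma> \<tau>, of "Suc k" 1] by (elim exE conjE)
  note ac = Chat_closed[OF \<sigma> r(1)] and bc = Chat_closed[OF \<tau> r(3)]
  have "ad b \<ominus> u \<odot>\<^bsub>A\<^esub> b \<in> Ipow m" using comD[OF assms(4), of b m] r(3) by simp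
  then have "a \<otimes> (ad b \<ominus> u \<odot>\<^bsub>A\<^esub> b) \<in> Ipow (Suc k)" by (rule bspec[OF r(2)[unfolded absorbs_def]])
  then have "a \<otimes> (ad b \<ominus> u \<odot>\<^bsub>A\<^esub> b) \<in> Ipow k" by (rule Ipow_mono[rotated]) simp
  then have "(ad a \<ominus> t \<odot>\<^bsub>A\<^esub> a) \<otimes> b \<oplus> a \<otimes> (ad b \<ominus> u \<odot>\<^bsub>A\<^esub> b) \<in> Ipow k"
    by (rule Ic.a_closed[OF Ipow_right[OF comD[OF assms(3) r(1)] bc]])
  moreover have "(ad a \<ominus> t \<odot>\<^bsub>A\<^esub> a) \<otimes> b \<oplus> a \<otimes> (ad b \<ominus> u \<odot>\<^bsub>A\<^esub> b) = ad (a \<otimes> b) \<ominus> (t + u) \<odot>\<^bsub>A\<^esub> (a \<otimes> b)"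
    using ac bc
    by (simp add: ad_mult minus_eq l_distr r_distr l_minus r_minus sm_mult_l sm_mult_r sm_add_l minus_add a_ac)
  moreover have "a \<otimes> b \<in> (\<sigma> \<otimes>\<^bsub>Chat\<^esub> \<tau>) (Suc k)" using r(4) ac bc by simp
  ultimately show "\<exists>c\<in>(\<sigma> \<otimes>\<^bsub>Chat\<^esub> \<tau>) (Suc k). ad c \<ominus> (t + u) \<odot>\<^bsub>A\<^esub> c \<in> Ipow k" by (intro bexI) simp_all
qed

lemma eps_pow_cancel:
  assumes "a \<in> carrier A" "eps [^] (k::nat) \<otimes> a \<in> Ipow (Suc k)" shows "a \<in> Ipow 1"
proof -
  obtain r where r: "r \<in> carrier A" "eps [^] k \<otimes> a = eps [^] Suc k \<otimes> r" using assms(2) unfolding Ipow_iff by blast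
  have inj: "b = \<zero>" if "b \<in> carrier A" "eps [^] (k::nat) \<otimes> b = \<zero>" for b
    using that
  proof (induction k arbitrary: b)
    case (Suc k)
    have "eps [^] k \<otimes> (eps \<otimes> b) = \<zero>" using Suc.prems by (simp add: m_assoc)
    then have "eps \<otimes> b = \<zero>" using Suc.IH[of "eps \<otimes> b"] Suc.prems(1) by simp
    then show ?case by (rule left_regular[OF Suc.prems(1)])
  qed simp
  have m_diff: "p \<otimes> (q \<ominus> q') = p \<otimes> q \<ominus> p \<otimes> q'" if "p \<in> carrier A" "q \<in> carrier A" "q' \<in> carrier A" for p q q'
    using that by (simp add: minus_eq r_distr r_minus)
  have "eps [^] Suc k \<otimes> r = eps [^] k \<otimes> (eps \<otimes> r)" using r(1) by (simp add: m_assoc)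
  then have "eps [^] k \<otimes> (a \<ominus> eps \<otimes> r) = eps [^] k \<otimes> a \<ominus> eps [^] Suc k \<otimes> r"
    using assms(1) r(1) by (simp only: m_diff nat_pow_closed m_closed e_minus_one_closed)
  then have "eps [^] k \<otimes> (a \<ominus> eps \<otimes> r) = \<zero>"
    unfolding r(2) using r(1) by (simp add: minus_eq r_neg)
  then have "a \<ominus> eps \<otimes> r = \<zero>" by (rule inj[rotated]) (simp add: assms(1) r(1))
  then have "a = eps \<otimes> r" using assms(1) r(1) by (simp add: minus_eq_zero_iff)
  then show ?thesis unfolding Ipow_iff using r(1) by (intro bexI[of _ r]) simp_all
qed

lemma Ipow_cancel:
  assumes "p \<in> carrier A" "q \<in> Ipow k" "p \<oplus> q \<in> Ipow k" shows "p \<in> Ipow k"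
proof -
  have "(p \<oplus> q) \<oplus> \<ominus> q \<in> Ipow k" by (rule Ic.a_closed[OF assms(3) Ic.a_inv_closed[OF assms(2)]])
  moreover have "(p \<oplus> q) \<oplus> \<ominus> q = p" using assms(1) Ic.a_Hcarr[OF assms(2)] by (simp add: a_assoc r_neg)
  ultimately show ?thesis by (simp only:)
qed

text \<open>An element of the completion that commutes with \<open>h\<close> is determined by its first component:
  if \<open>(e - 1)\<^sup>k a\<close> commutes with \<open>h\<close> up to \<open>(e - 1)\<^sup>k A\<close> then \<open>a \<in> (e - 1) A\<close>.\<close>

lemma com_zero_determined:
  assumes \<sigma>: "\<sigma> \<in> carrier Chat" and \<tau>: "\<tau> \<in> carrier Chat" and "com 0 \<sigma>" "com 0 \<tau>" and 1: "\<sigma> 1 = \<tau> 1"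
  shows "\<sigma> = \<tau>"
proof -
  have step: "\<sigma> (Suc k) = \<tau> (Suc k)" for k
  proof (induction k)
    case (Suc k)
    obtain a where a: "a \<in> \<sigma> (Suc (Suc k))" "a \<in> carrier A" by (rule Chat_rep[OF \<sigma>])
    obtain b where b: "b \<in> \<tau> (Suc (Suc k))" "b \<in> carrier A" by (rule Chat_rep[OF \<tau>])
    have "a \<in> \<sigma> (Suc k)" "b \<in> \<sigma> (Suc k)"
      using Chat_antimono[OF \<sigma> _ a(1), of "Suc k"] Chat_antimono[OF \<tau> _ b(1), of "Suc k"] Suc.IH by simp_all
    then have d: "a \<ominus> b \<in> Ipow (Suc k)" by (rule Chat_diff[OF \<sigma>])
    then obtain r where r: "r \<in> carrier A" "a \<ominus> b = eps [^] Suc k \<otimes> r" unfolding Ipow_iff by blast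
    have "ad a \<in> Ipow (Suc k)" "ad b \<in> Ipow (Suc k)"
      using comD[OF assms(3) a(1)] comD[OF assms(4) b(1)] a b by simp_all
    then have adI: "ad (a \<ominus> b) \<in> Ipow (Suc k)"
      unfolding ad_diff[OF a(2) b(2)] minus_eq[of "ad a" "ad b"] by (intro Ic.a_closed Ic.a_inv_closed)
    \<comment> \<open>If the difference is eps^(k+1) r, the term 2 (k+1) eps^k r is the only one not
      visibly in the ideal of level k + 1. As the sum lies there, so does this term, and cancelling
      eps^k puts r into (e - 1) A.\<close>
    have "ad (a \<ominus> b) = (2 * of_nat (Suc k)) \<odot>\<^bsub>A\<^esub> (eps [^] k \<otimes> r) \<oplus>
        ((2 * of_nat (Suc k)) \<odot>\<^bsub>A\<^esub> (eps [^] Suc k \<otimes> r) \<oplus> eps [^] Suc k \<otimes> ad r)"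
      unfolding r(2) using r(1) ad_eps_pow[of k]
      by (subst ad_mult) (simp_all add: l_distr sm_mult_l sm_add_r a_ac del: of_nat_Suc nat_pow_Suc)
    moreover have "(2 * of_nat (Suc k)) \<odot>\<^bsub>A\<^esub> (eps [^] Suc k \<otimes> r) \<oplus> eps [^] Suc k \<otimes> ad r \<in> Ipow (Suc k)"
      by (intro Ic.a_closed Ipow_sm Ipow_right eps_pow_in) (use r in simp_all)
    ultimately have "(2 * of_nat (Suc k)) \<odot>\<^bsub>A\<^esub> (eps [^] k \<otimes> r) \<in> Ipow (Suc k)"
      using adI r(1)
      by (metis Ipow_cancel sm_closed m_closed nat_pow_closed e_minus_one_closed)
    then have "(1 / (2 * of_nat (Suc k))) \<odot>\<^bsub>A\<^esub> ((2 * of_nat (Suc k)) \<odot>\<^bsub>A\<^esub> (eps [^] k \<otimes> r)) \<in> Ipow (Suc k)"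
      by (rule Ipow_sm)
    then have "eps [^] k \<otimes> r \<in> Ipow (Suc k)"
      using r(1) by (subst (asm) sm_inverse) (simp_all del: of_nat_Suc)
    then have "r \<in> Ipow 1" by (rule eps_pow_cancel[OF r(1)])
    then obtain q where q: "q \<in> carrier A" "r = eps \<otimes> q" unfolding Ipow_iff by auto
    have "a \<ominus> b = eps [^] Suc (Suc k) \<otimes> q" unfolding r(2) q(2) using q(1) by (simp add: m_assoc)
    then have "a \<ominus> b \<in> Ipow (Suc (Suc k))" unfolding Ipow_iff using q(1) by blast
    then show ?case unfolding Chat_rcos[OF \<sigma> a(1)] Chat_rcos[OF \<tau> b(1)] using a b by (simp add: Ic.rcos_eq_iff)
  qed (use 1 in simp)
  show ?thesis
  proof
    fix k
    show "\<sigma> k = \<tau> k"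
    proof (cases k)
      \<comment> \<open>Component 0 carries no information, because the zeroth ideal is the whole
        algebra.\<close>
      case 0
      obtain a where a: "a \<in> \<sigma> 0" "a \<in> carrier A" by (rule Chat_rep[OF \<sigma>])
      obtain b where b: "b \<in> \<tau> 0" "b \<in> carrier A" by (rule Chat_rep[OF \<tau>])
      have "a \<ominus> b \<in> Ipow 0" using a b by (simp add: Ipow_0)
      then show ?thesis unfolding 0 Chat_rcos[OF \<sigma> a(1)] Chat_rcos[OF \<tau> b(1)] using a b by (simp add: Ic.rcos_eq_iff)
    qed (simp add: step)
  qed
qed

end

section \<open>The powers of e and the algebra U'\<close>

context slV_algebra
begin

definition ser :: "complex \<Rightarrow> nat \<Rightarrow> 'a" where
  "ser r k = (\<Oplus>i\<in>{..<k}. (r gchoose i) \<odot>\<^bsub>A\<^esub> eps [^] i)"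

lemma ser_closed [simp]: "ser r k \<in> carrier A"
  unfolding ser_def by (rule finsum_closed) auto

lemma ser_0: "ser r 0 = \<zero>" by (simp add: ser_def)

lemma ser_Suc: "ser r (Suc k) = ser r k \<oplus> (r gchoose k) \<odot>\<^bsub>A\<^esub> eps [^] k"
proof -
  have "ser r (Suc k) = (r gchoose k) \<odot>\<^bsub>A\<^esub> eps [^] k \<oplus> ser r k"
    unfolding ser_def lessThan_Suc by (rule finsum_insert) auto
  then show ?thesis by (simp add: a_comm)
qed

abbreviation epow where "epow r \<equiv> e_power A e r"

lemma epow_eq: "epow r k = Ipow k +> ser r k"
  by (simp add: e_power_def series_at_def fps_power_eq_binomial ser_def)

lemma epow_closed: "epow r \<in> carrier Chat"
proof (rule ChatI)
  fix k
  have "ser r (Suc k) \<ominus> ser r k = (r gchoose k) \<odot>\<^bsub>A\<^esub> eps [^] k"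
    unfolding ser_Suc by (simp add: minus_eq a_ac r_neg2 r_neg1 r_neg)
  then have "ser r (Suc k) \<ominus> ser r k \<in> Ipow k" using Ipow_sm[OF eps_pow_in] by simp
  then have "Ipow k +> ser r (Suc k) = Ipow k +> ser r k" by (subst Ic.rcos_eq_iff) simp_all
  then show "\<exists>a\<in>carrier A. epow r k = Ipow k +> a \<and> epow r (Suc k) = Ipow (Suc k) +> a"
    by (intro bexI[of _ "ser r (Suc k)"]) (simp_all add: epow_eq)
qed

lemma epow_rep: "ser r k \<in> epow r k" by (simp add: epow_eq)

lemma ad_one: "ad \<one> = \<zero>" by (simp add: ad_def minus_eq r_neg)

text \<open>A truncated form of [h, e^r] = 2r e^r; the last term is the truncation error. The
  coefficients match by k binom(r, k) + (k+1) binom(r, k+1) = r binom(r, k).\<close>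

lemma ad_ser: "ad (ser r (Suc k)) = (2 * r) \<odot>\<^bsub>A\<^esub> ser r k \<oplus> (2 * of_nat k * (r gchoose k)) \<odot>\<^bsub>A\<^esub> eps [^] k"
proof (induction k)
  case 0
  then show ?case by (simp add: ser_Suc ser_0 ad_one)
next
  case (Suc k)
  have c: "2 * of_nat k * (r gchoose k) + 2 * of_nat (Suc k) * (r gchoose Suc k) = 2 * r * (r gchoose k)"
    using gbinomial_mult_1[of r k] by (simp only: mult.assoc distrib_left[symmetric])
  have "ad (ser r (Suc (Suc k))) = ad (ser r (Suc k)) \<oplus> (r gchoose Suc k) \<odot>\<^bsub>A\<^esub> ad (eps [^] Suc k)"
    unfolding ser_Suc[of r "Suc k"] by (simp add: ad_add ad_sm del: nat_pow_Suc)
  also have "\<dots> = (2 * r) \<odot>\<^bsub>A\<^esub> ser r k \<oplus> ((2 * of_nat k * (r gchoose k)) \<odot>\<^bsub>A\<^esub> eps [^] k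
      \<oplus> (2 * of_nat (Suc k) * (r gchoose Suc k)) \<odot>\<^bsub>A\<^esub> eps [^] k)
      \<oplus> (2 * of_nat (Suc k) * (r gchoose Suc k)) \<odot>\<^bsub>A\<^esub> eps [^] Suc k"
    unfolding Suc.IH ad_eps_pow
    by (simp add: sm_add_r sm_assoc[symmetric] mult.commute[of "r gchoose Suc k"] a_ac del: of_nat_Suc nat_pow_Suc)
  also have "(2 * of_nat k * (r gchoose k)) \<odot>\<^bsub>A\<^esub> eps [^] k
      \<oplus> (2 * of_nat (Suc k) * (r gchoose Suc k)) \<odot>\<^bsub>A\<^esub> eps [^] k = (2 * r) \<odot>\<^bsub>A\<^esub> ((r gchoose k) \<odot>\<^bsub>A\<^esub> eps [^] k)"
    unfolding sm_add_l[OF nat_pow_closed[OF e_minus_one_closed], symmetric] c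
    by (rule sm_assoc) simp
  also have "(2 * r) \<odot>\<^bsub>A\<^esub> ser r k \<oplus> (2 * r) \<odot>\<^bsub>A\<^esub> ((r gchoose k) \<odot>\<^bsub>A\<^esub> eps [^] k) = (2 * r) \<odot>\<^bsub>A\<^esub> ser r (Suc k)"
    unfolding ser_Suc by (rule sm_add_r[symmetric]) simp_all
  finally show ?case .
qed

lemma com_epow: "com (2 * r) (epow r)"
proof (rule comI[OF epow_closed])
  fix k
  have "ad (ser r (Suc k)) \<ominus> (2 * r) \<odot>\<^bsub>A\<^esub> ser r (Suc k) =
      (2 * of_nat k * (r gchoose k)) \<odot>\<^bsub>A\<^esub> eps [^] k \<oplus> \<ominus> ((2 * r * (r gchoose k)) \<odot>\<^bsub>A\<^esub> eps [^] k)"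
  proof -
    have "(l \<odot>\<^bsub>A\<^esub> p \<oplus> q) \<ominus> l \<odot>\<^bsub>A\<^esub> (p \<oplus> q') = q \<oplus> \<ominus> (l \<odot>\<^bsub>A\<^esub> q')"
      if "p \<in> carrier A" "q \<in> carrier A" "q' \<in> carrier A" for l p q q'
      using that by (simp add: sm_add_r minus_eq minus_add a_ac r_neg1 r_neg2)
    moreover have "(2 * r * (r gchoose k)) \<odot>\<^bsub>A\<^esub> eps [^] k = (2 * r) \<odot>\<^bsub>A\<^esub> ((r gchoose k) \<odot>\<^bsub>A\<^esub> eps [^] k)"
      by (rule sm_assoc) simp
    ultimately show ?thesis
      unfolding ad_ser unfolding ser_Suc by (simp only: ser_closed sm_closed nat_pow_closed e_minus_one_closed)
  qed
  moreover have "\<dots> \<in> Ipow k"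
    by (intro Ic.a_closed Ic.a_inv_closed Ipow_sm eps_pow_in)
  ultimately show "\<exists>b\<in>epow r (Suc k). ad b \<ominus> (2 * r) \<odot>\<^bsub>A\<^esub> b \<in> Ipow k"
    by (intro bexI[OF _ epow_rep]) simp
qed

lemma e_eps_pow: "e \<otimes> eps [^] k = eps [^] Suc k \<oplus> eps [^] (k::nat)"
proof -
  have ee: "e = eps \<oplus> \<one>" by (simp add: minus_eq a_assoc l_neg)
  have "e \<otimes> eps [^] k = eps \<otimes> eps [^] k \<oplus> eps [^] k"
    by (subst ee) (simp only: l_distr l_one e_minus_one_closed one_closed nat_pow_closed)
  then show ?thesis using nat_pow_Suc2[of eps k] by simp
qed

text \<open>A truncated form of e e^r = e^(r+1). By Pascal's rule the coefficients agree below the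
  cut, and the error lies in the ideal of level k + 1.\<close>

lemma e_ser: "e \<otimes> ser r (Suc k) = ser (r + 1) (Suc k) \<oplus> (r gchoose k) \<odot>\<^bsub>A\<^esub> eps [^] Suc k"
proof (induction k)
  case 0
  have "\<one> \<oplus> eps = e \<oplus> (\<one> \<oplus> \<ominus> \<one>)" unfolding minus_eq by (rule a_lcomm) simp_all
  then have "e = \<one> \<oplus> eps" by (simp add: r_neg)
  then show ?case by (simp add: ser_Suc ser_0)
next
  case (Suc k)
  have "e \<otimes> ser r (Suc (Suc k)) = e \<otimes> ser r (Suc k) \<oplus> (r gchoose Suc k) \<odot>\<^bsub>A\<^esub> (e \<otimes> eps [^] Suc k)"
    unfolding ser_Suc[of r "Suc k"] by (simp add: r_distr sm_mult_r del: nat_pow_Suc)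
  also have "\<dots> = ser (r + 1) (Suc k) \<oplus> ((r gchoose k) \<odot>\<^bsub>A\<^esub> eps [^] Suc k \<oplus> (r gchoose Suc k) \<odot>\<^bsub>A\<^esub> eps [^] Suc k)
      \<oplus> (r gchoose Suc k) \<odot>\<^bsub>A\<^esub> eps [^] Suc (Suc k)"
    unfolding Suc.IH e_eps_pow by (simp add: sm_add_r a_ac del: nat_pow_Suc)
  also have "(r gchoose k) \<odot>\<^bsub>A\<^esub> eps [^] Suc k \<oplus> (r gchoose Suc k) \<odot>\<^bsub>A\<^esub> eps [^] Suc k = ((r + 1) gchoose Suc k) \<odot>\<^bsub>A\<^esub> eps [^] Suc k"
    unfolding gbinomial_Suc_Suc by (rule sm_add_l[symmetric]) simp
  also have "ser (r + 1) (Suc k) \<oplus> ((r + 1) gchoose Suc k) \<odot>\<^bsub>A\<^esub> eps [^] Suc k = ser (r + 1) (Suc (Suc k))"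
    by (rule ser_Suc[symmetric])
  finally show ?case .
qed

abbreviation iota where "iota \<equiv> to_completion A e"

lemma absorbs_comm: assumes "a \<in> carrier A" "e \<otimes> a = a \<otimes> e" shows "absorbs a k k"
  unfolding absorbs_def
proof
  fix z assume "z \<in> Ipow k"
  then obtain b where b: "b \<in> carrier A" "z = eps [^] k \<otimes> b" unfolding Ipow_iff by blast
  have "eps \<otimes> a = a \<otimes> eps" using w_comm[OF assms, of 1] by (simp add: w_def)
  then have "eps [^] k \<otimes> a = a \<otimes> eps [^] k" using assms(1) by (induction k) (simp_all add: m_assoc, simp add: m_assoc[symmetric])
  then have "a \<otimes> z = eps [^] k \<otimes> (a \<otimes> b)" using assms(1) b by (simp add: m_assoc[symmetric])
  then show "a \<otimes> z \<in> Ipow k" using Ipow_right[OF eps_pow_in, of "a \<otimes> b" k] assms(1) b(1) by simp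
qed

text \<open>The square root of e occurs in \<open>elC\<close>, whereas \<open>Bhat\<close> is
  generated by its inverse; this identity places the root in \<open>Bhat\<close>.\<close>

lemma epow_half: "epow (1/2) = iota e \<otimes>\<^bsub>Chat\<^esub> epow (-1/2)"
proof
  fix k
  have "(iota e \<otimes>\<^bsub>Chat\<^esub> epow (-1/2)) k = Ipow k +> (e \<otimes> ser (-1/2) k)"
    by (rule mult_rep[OF to_completion_closed epow_closed to_completion_rep epow_rep])
      (simp_all add: absorbs_comm)
  also have "\<dots> = Ipow k +> ser (1/2) k"
  proof (cases k)
    case 0
    then show ?thesis by (subst Ic.rcos_eq_iff) (simp_all add: Ipow_0)
  next
    case (Suc j)
    have "e \<otimes> ser (-1/2) (Suc j) = ser (1/2) (Suc j) \<oplus> ((-1/2) gchoose j) \<odot>\<^bsub>A\<^esub> eps [^] Suc j"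
      using e_ser[of "-1/2" j] by (simp del: nat_pow_Suc)
    then have "e \<otimes> ser (-1/2) (Suc j) \<ominus> ser (1/2) (Suc j) = ((-1/2) gchoose j) \<odot>\<^bsub>A\<^esub> eps [^] Suc j"
      by (simp add: minus_eq a_ac r_neg2 r_neg1 r_neg del: nat_pow_Suc)
    then have "e \<otimes> ser (-1/2) (Suc j) \<ominus> ser (1/2) (Suc j) \<in> Ipow (Suc j)"
      using Ipow_sm[OF eps_pow_in] by (simp only:)
    then show ?thesis unfolding Suc by (subst Ic.rcos_eq_iff) simp_all
  qed
  finally show "epow (1/2) k = (iota e \<otimes>\<^bsub>Chat\<^esub> epow (-1/2)) k" by (simp add: epow_eq)
qed

abbreviation Bhat where "Bhat \<equiv> adjoin_inv_sqrt A e"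

lemma gen_subalg_simps:
  "carrier (gen_subalg B X) = generate_ring B (X \<union> {k \<odot>\<^bsub>B\<^esub> \<one>\<^bsub>B\<^esub> | k. True})"
  "mult (gen_subalg B X) = mult B" "one (gen_subalg B X) = one B" "ring.zero (gen_subalg B X) = ring.zero B"
  "add (gen_subalg B X) = add B" "smult (gen_subalg B X) = smult B"
  by (simp_all add: gen_subalg_def)

lemma Bhat_simps:
  "mult Bhat = mult Chat" "one Bhat = one Chat" "ring.zero Bhat = ring.zero Chat" "add Bhat = add Chat"
  "smult Bhat = smult Chat"
  by (simp_all add: adjoin_inv_sqrt_def gen_subalg_simps)

lemma Bhat_carrier:
  "carrier Bhat = generate_ring Chat (iota ` carrier A \<union> {epow (-1/2)} \<union> {k \<odot>\<^bsub>Chat\<^esub> \<one>\<^bsub>Chat\<^esub> | k. True})"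
  by (simp add: adjoin_inv_sqrt_def gen_subalg_simps)

lemma Bhat_sub: "\<sigma> \<in> carrier Bhat \<Longrightarrow> \<sigma> \<in> carrier Chat"
  unfolding Bhat_carrier
proof (induction rule: generate_ring.induct)
  case one
  show ?case by (simp add: one_eq to_completion_closed)
next
  case (incl h)
  then show ?case
    by (elim UnE imageE CollectE exE conjE singletonE)
      (simp_all add: to_completion_closed epow_closed Chat_smult_closed one_eq)
qed (simp_all add: Chat_a_inv Chat_smult_closed Chat_add_closed Chat_mult_closed)

lemma Bhat_ops:
  assumes "\<sigma> \<in> carrier Bhat" "\<tau> \<in> carrier Bhat"
  shows "\<sigma> \<oplus>\<^bsub>Chat\<^esub> \<tau> \<in> carrier Bhat" "\<sigma> \<otimes>\<^bsub>Chat\<^esub> \<tau> \<in> carrier Bhat" "\<ominus>\<^bsub>Chat\<^esub> \<sigma> \<in> carrier Bhat"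
  using assms unfolding Bhat_carrier
  by (blast intro: generate_ring.eng_add generate_ring.eng_mult generate_ring.a_inv)+

lemma iota_Bhat: "a \<in> carrier A \<Longrightarrow> iota a \<in> carrier Bhat"
  unfolding Bhat_carrier by (rule generate_ring.incl) simp

lemma epow_Bhat: "epow (-1/2) \<in> carrier Bhat"
  unfolding Bhat_carrier by (rule generate_ring.incl) simp

lemma iota_sm_one: "a \<in> carrier A \<Longrightarrow> k \<odot>\<^bsub>Chat\<^esub> iota a = iota (k \<odot>\<^bsub>A\<^esub> a)"
  by (rule ext, subst smult_rep[OF to_completion_closed to_completion_rep]) (simp_all add: to_completion_def)

text \<open>\<open>generate_ring\<close> is closed under ring operations, so closure under scalars
  is obtained by multiplying with constants.\<close>

lemma smult_as_mult:
  assumes \<sigma>: "\<sigma> \<in> carrier Chat" shows "k \<odot>\<^bsub>Chat\<^esub> \<sigma> = iota (k \<odot>\<^bsub>A\<^esub> \<one>) \<otimes>\<^bsub>Chat\<^esub> \<sigma>"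
proof
  fix j
  obtain a where a: "a \<in> \<sigma> j" "a \<in> carrier A" by (rule Chat_rep[OF \<sigma>])
  have "(iota (k \<odot>\<^bsub>A\<^esub> \<one>) \<otimes>\<^bsub>Chat\<^esub> \<sigma>) j = Ipow j +> ((k \<odot>\<^bsub>A\<^esub> \<one>) \<otimes> a)"
    by (rule mult_rep[OF to_completion_closed \<sigma> to_completion_rep a(1)])
      (simp_all add: absorbs_comm sm_mult_l sm_mult_r)
  then show "(k \<odot>\<^bsub>Chat\<^esub> \<sigma>) j = (iota (k \<odot>\<^bsub>A\<^esub> \<one>) \<otimes>\<^bsub>Chat\<^esub> \<sigma>) j"
    unfolding smult_rep[OF \<sigma> a(1)] using a by (simp add: sm_mult_l)
qed

lemma Bhat_smult: "\<sigma> \<in> carrier Bhat \<Longrightarrow> k \<odot>\<^bsub>Chat\<^esub> \<sigma> \<in> carrier Bhat"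
  using smult_as_mult[OF Bhat_sub] Bhat_ops(2)[OF iota_Bhat] by simp

text \<open>Negatives are described relative to a carrier. The value in the subalgebra is compared
  with that in the completion because \<open>generate_ring\<close> over \<open>Bhat\<close> uses the
  former.\<close>

lemma Bhat_a_inv:
  assumes "\<sigma> \<in> carrier Bhat" shows "\<ominus>\<^bsub>Bhat\<^esub> \<sigma> = \<ominus>\<^bsub>Chat\<^esub> \<sigma>"
proof -
  interpret C: abelian_group Chat by (rule Chat_abelian_group)
  note s = Bhat_sub[OF assms]
  show ?thesis unfolding a_inv_def[of Bhat] m_inv_def
  proof (rule the_equality)
    show "\<ominus>\<^bsub>Chat\<^esub> \<sigma> \<in> carrier (add_monoid Bhat) \<and> \<sigma> \<otimes>\<^bsub>add_monoid Bhat\<^esub> \<ominus>\<^bsub>Chat\<^esub> \<sigma> = \<one>\<^bsub>add_monoid Bhat\<^esub>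
        \<and> \<ominus>\<^bsub>Chat\<^esub> \<sigma> \<otimes>\<^bsub>add_monoid Bhat\<^esub> \<sigma> = \<one>\<^bsub>add_monoid Bhat\<^esub>"
      using Bhat_ops(3)[OF assms assms] s by (simp add: Bhat_simps C.r_neg C.l_neg)
    fix \<tau> assume "\<tau> \<in> carrier (add_monoid Bhat) \<and> \<sigma> \<otimes>\<^bsub>add_monoid Bhat\<^esub> \<tau> = \<one>\<^bsub>add_monoid Bhat\<^esub>
        \<and> \<tau> \<otimes>\<^bsub>add_monoid Bhat\<^esub> \<sigma> = \<one>\<^bsub>add_monoid Bhat\<^esub>"
    then have "\<tau> \<in> carrier Bhat" "\<tau> \<oplus>\<^bsub>Chat\<^esub> \<sigma> = \<zero>\<^bsub>Chat\<^esub>" by (simp_all add: Bhat_simps)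
    then show "\<tau> = \<ominus>\<^bsub>Chat\<^esub> \<sigma>" using C.minus_equality[of \<tau> \<sigma>] s Bhat_sub by simp
  qed
qed

definition elA where "elA = epow (-1/2) \<otimes>\<^bsub>Bhat\<^esub> iota x"

definition elC where
  "elC = epow (1/2) \<otimes>\<^bsub>Bhat\<^esub> iota y \<oplus>\<^bsub>Bhat\<^esub> (1/2) \<odot>\<^bsub>Bhat\<^esub> (iota h \<otimes>\<^bsub>Bhat\<^esub> elA)"

definition Uprime where "Uprime = gen_subalg Bhat {elA, elC, iota (casimir A s)}"

text \<open>The correspondence between U' and G: sigma commutes with h and has g as first component.
  It is a relation because g is determined only modulo (e - 1) A, whereas sigma is determined by g.
  The index is \<open>Suc 0\<close> since component 0 is trivial.\<close>

definition good :: "(nat \<Rightarrow> 'a set) \<Rightarrow> 'a \<Rightarrow> bool" where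
  "good \<sigma> g \<longleftrightarrow> \<sigma> \<in> carrier Bhat \<and> com 0 \<sigma> \<and> g \<in> G \<and> \<sigma> (Suc 0) = Ipow (Suc 0) +> g"

text \<open>An element commuting with e preserves (e - 1) A under left multiplication, so first
  components multiply without going to a deeper level. Elements of G qualify.\<close>

lemma level_one_mult:
  assumes "\<sigma> \<in> carrier Chat" "\<tau> \<in> carrier Chat" "\<sigma> (Suc 0) = Ipow (Suc 0) +> a" "\<tau> (Suc 0) = Ipow (Suc 0) +> b"
    "a \<in> carrier A" "b \<in> carrier A" "e \<otimes> a = a \<otimes> e"
  shows "(\<sigma> \<otimes>\<^bsub>Chat\<^esub> \<tau>) (Suc 0) = Ipow (Suc 0) +> (a \<otimes> b)"
  by (rule mult_rep[OF assms(1,2), of a "Suc 0" b "Suc 0"]) (use assms absorbs_comm in simp_all)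

lemma level_one_add:
  assumes "\<sigma> \<in> carrier Chat" "\<tau> \<in> carrier Chat" "\<sigma> (Suc 0) = Ipow (Suc 0) +> a" "\<tau> (Suc 0) = Ipow (Suc 0) +> b"
    "a \<in> carrier A" "b \<in> carrier A"
  shows "(\<sigma> \<oplus>\<^bsub>Chat\<^esub> \<tau>) (Suc 0) = Ipow (Suc 0) +> (a \<oplus> b)"
  by (rule add_rep[OF assms(1,2), of a "Suc 0" b]) (use assms in simp_all)

lemma level_one_smult:
  assumes "\<sigma> \<in> carrier Chat" "\<sigma> (Suc 0) = Ipow (Suc 0) +> a" "a \<in> carrier A"
  shows "(k \<odot>\<^bsub>Chat\<^esub> \<sigma>) (Suc 0) = Ipow (Suc 0) +> (k \<odot>\<^bsub>A\<^esub> a)"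
  by (rule smult_rep[OF assms(1), of a "Suc 0"]) (use assms in simp_all)

lemma level_one_iota: "iota a (Suc 0) = Ipow (Suc 0) +> a"
  by (simp add: to_completion_def)

lemma level_one_epow: "epow r (Suc 0) = Ipow (Suc 0) +> \<one>"
proof -
  have "ser r (Suc 0) = \<one>" using ser_Suc[of r 0] by (simp add: ser_0)
  then show ?thesis by (simp add: epow_eq)
qed

lemma good_const: "good (k \<odot>\<^bsub>Chat\<^esub> \<one>\<^bsub>Chat\<^esub>) (k \<odot>\<^bsub>A\<^esub> \<one>)"
  unfolding good_def one_eq iota_sm_one[OF one_closed]
  using com_to_completion[OF wt_sm[OF wt_one]] by (auto simp: iota_Bhat level_one_iota G.const)

lemma good_Cas: "good (iota (casimir A s)) Cas"
  unfolding good_def Cas_def[symmetric]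
  using com_to_completion[OF wt_Cas] by (auto simp: iota_Bhat level_one_iota G.Cas)

lemma good_elA: "good elA x"
proof -
  \<comment> \<open>The weights -1 of e^(-1/2) and 1 of x add up to 0.\<close>
  have "com (2 * (-1/2) + of_int 1) (epow (-1/2) \<otimes>\<^bsub>Chat\<^esub> iota x)"
    by (rule com_mult[OF epow_closed to_completion_closed com_epow com_to_completion[OF wt_x]]) simp
  moreover have "(epow (-1/2) \<otimes>\<^bsub>Chat\<^esub> iota x) (Suc 0) = Ipow (Suc 0) +> (\<one> \<otimes> x)"
    by (rule level_one_mult[OF epow_closed to_completion_closed level_one_epow level_one_iota]) simp_all
  ultimately show ?thesis
    unfolding good_def elA_def Bhat_simps using Bhat_ops(2)[OF epow_Bhat iota_Bhat] G.x by simp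
qed

lemma good_elC: "good elC Y"
proof -
  have A: "elA \<in> carrier Bhat" "elA \<in> carrier Chat" "com 0 elA" "elA (Suc 0) = Ipow (Suc 0) +> x"
    using good_elA Bhat_sub unfolding good_def by simp_all
  have P: "epow (1/2) \<in> carrier Bhat" unfolding epow_half by (rule Bhat_ops(2)[OF iota_Bhat epow_Bhat]) simp
  let ?p = "epow (1/2) \<otimes>\<^bsub>Chat\<^esub> iota y" and ?q = "iota h \<otimes>\<^bsub>Chat\<^esub> elA"
  have p: "?p \<in> carrier Bhat" and q: "?q \<in> carrier Bhat"
    by (rule Bhat_ops(2)[OF P iota_Bhat], simp, rule Bhat_ops(2)[OF iota_Bhat A(1)], simp)
  have cp: "com (2 * (1/2) + of_int (-1)) ?p"
    by (rule com_mult[OF epow_closed to_completion_closed com_epow com_to_completion[OF wt_y]]) simp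
  have cq: "com (of_int 0 + 0) ?q"
    by (rule com_mult[OF to_completion_closed A(2) com_to_completion[OF wt_h] A(3)]) simp
  have p1: "?p (Suc 0) = Ipow (Suc 0) +> (\<one> \<otimes> y)"
    by (rule level_one_mult[OF epow_closed to_completion_closed level_one_epow level_one_iota]) simp_all
  have q1: "?q (Suc 0) = Ipow (Suc 0) +> (x \<otimes> h)"
  proof -
    obtain m where m: "absorbs h m (Suc 0)" using absorbs_exists[of h "Suc 0"] by auto
    obtain b where b: "b \<in> elA (Suc (Suc m))" "b \<in> carrier A" by (rule Chat_rep[OF A(2)])
    have "?q (Suc 0) = Ipow (Suc 0) +> (h \<otimes> b)"
      by (rule mult_rep[OF to_completion_closed A(2) to_completion_rep b(1)])
        (simp_all add: absorbs_mono[OF m])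
    also have "\<dots> = Ipow (Suc 0) +> (x \<otimes> h)"
    proof (subst Ic.rcos_eq_iff)
      have "ad b \<ominus> 0 \<odot>\<^bsub>A\<^esub> b \<in> Ipow (Suc m)" by (rule comD[OF A(3) b(1)])
      then have 1: "ad b \<in> Ipow (Suc 0)" using b(2) Ipow_mono[of "Suc 0" "Suc m" "ad b"] by simp
      have "b \<in> elA (Suc 0)" by (rule Chat_antimono[OF A(2) _ b(1)]) simp
      then have "b \<ominus> x \<in> Ipow (Suc 0)" using A(4) by (simp add: Ic.mem_rcos)
      then have "(b \<ominus> x) \<otimes> h \<in> Ipow (Suc 0)" by (rule Ipow_right) simp
      then have "ad b \<oplus> (b \<ominus> x) \<otimes> h \<in> Ipow (Suc 0)" by (rule Ic.a_closed[OF 1])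
      moreover have "ad b \<oplus> (b \<ominus> x) \<otimes> h = h \<otimes> b \<ominus> x \<otimes> h"
        using b(2) by (simp add: ad_def minus_eq l_distr l_minus a_assoc r_neg1 r_neg2)
      ultimately show "h \<otimes> b \<ominus> x \<otimes> h \<in> Ipow (Suc 0)" by (simp only:)
    qed (use b in simp_all)
    finally show ?thesis .
  qed
  have eq: "elC = ?p \<oplus>\<^bsub>Chat\<^esub> (1/2) \<odot>\<^bsub>Chat\<^esub> ?q" by (simp add: elC_def Bhat_simps)
  have "com 0 elC" unfolding eq
    by (rule com_add[OF Bhat_sub[OF p] Bhat_sub[OF Bhat_smult[OF q]] _ com_smult[OF Bhat_sub[OF q]]]) (use cp cq in simp_all)
  moreover have "elC \<in> carrier Bhat" unfolding eq by (rule Bhat_ops(1)[OF p Bhat_smult[OF q]])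
  moreover have "elC (Suc 0) = Ipow (Suc 0) +> (\<one> \<otimes> y \<oplus> (1/2) \<odot>\<^bsub>A\<^esub> (x \<otimes> h))" unfolding eq
    by (rule level_one_add[OF Bhat_sub[OF p] Bhat_sub[OF Bhat_smult[OF q]] p1 level_one_smult[OF Bhat_sub[OF q] q1]]) simp_all
  moreover have "\<dots> = Ipow (Suc 0) +> Y"
  proof (subst Ic.rcos_eq_iff)
    \<comment> \<open>Replacing y by e y changes the representative by (e - 1) y and turns it into
      an element of G.\<close>
    have "Y \<ominus> (\<one> \<otimes> y \<oplus> (1/2) \<odot>\<^bsub>A\<^esub> (x \<otimes> h)) = eps \<otimes> y"
    proof -
      have "(p \<oplus> q) \<ominus> (r \<oplus> q) = p \<ominus> r" if "p \<in> carrier A" "q \<in> carrier A" "r \<in> carrier A" for p q r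
        using that by (simp add: minus_eq minus_add a_ac r_neg2 r_neg1)
      then have "Y \<ominus> (y \<oplus> (1/2) \<odot>\<^bsub>A\<^esub> (x \<otimes> h)) = e \<otimes> y \<ominus> y" by (simp add: Y_def)
      then show ?thesis using shift_e[of y 1] by simp
    qed
    moreover have "eps \<otimes> y \<in> Ipow (Suc 0)" unfolding Ipow_iff by (rule bexI[of _ y]) simp_all
    ultimately have "Y \<ominus> (\<one> \<otimes> y \<oplus> (1/2) \<odot>\<^bsub>A\<^esub> (x \<otimes> h)) \<in> Ipow (Suc 0)" by (simp only:)
    then show "(\<one> \<otimes> y \<oplus> (1/2) \<odot>\<^bsub>A\<^esub> (x \<otimes> h)) \<ominus> Y \<in> Ipow (Suc 0)" by (rule Ic.minus_sym[rotated 2]) simp_all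
  qed simp_all
  ultimately show ?thesis unfolding good_def using G.Y by simp
qed

lemma good_add: "good \<sigma> a \<Longrightarrow> good \<tau> b \<Longrightarrow> good (\<sigma> \<oplus>\<^bsub>Chat\<^esub> \<tau>) (a \<oplus> b)"
  unfolding good_def
  using Bhat_ops(1) com_add[OF Bhat_sub Bhat_sub] level_one_add[OF Bhat_sub Bhat_sub] G_closed G.add by simp

lemma good_mult: "good \<sigma> a \<Longrightarrow> good \<tau> b \<Longrightarrow> good (\<sigma> \<otimes>\<^bsub>Chat\<^esub> \<tau>) (a \<otimes> b)"
  unfolding good_def
  using Bhat_ops(2) com_mult[OF Bhat_sub Bhat_sub, of \<sigma> \<tau> 0 0] level_one_mult[OF Bhat_sub Bhat_sub] G_closed G.mult G_comm
  by simp

lemma good_smult: "good \<sigma> a \<Longrightarrow> good (k \<odot>\<^bsub>Chat\<^esub> \<sigma>) (k \<odot>\<^bsub>A\<^esub> a)"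
  unfolding good_def
  using Bhat_smult com_smult[OF Bhat_sub] level_one_smult[OF Bhat_sub] G_closed G_sm by simp

lemma Uprime_simps:
  "mult Uprime = mult Chat" "one Uprime = one Chat" "ring.zero Uprime = ring.zero Chat" "add Uprime = add Chat"
  "smult Uprime = smult Chat"
  by (simp_all add: Uprime_def gen_subalg_simps Bhat_simps)

lemma Uprime_carrier:
  "carrier Uprime = generate_ring Bhat ({elA, elC, iota (casimir A s)} \<union> {k \<odot>\<^bsub>Chat\<^esub> \<one>\<^bsub>Chat\<^esub> | k. True})"
  by (simp add: Uprime_def gen_subalg_simps Bhat_simps)

lemma Uprime_good: "\<sigma> \<in> carrier Uprime \<Longrightarrow> \<exists>g. good \<sigma> g"
  unfolding Uprime_carrier
proof (induction rule: generate_ring.induct)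
  case one
  have "1 \<odot>\<^bsub>Chat\<^esub> \<one>\<^bsub>Chat\<^esub> = \<one>\<^bsub>Chat\<^esub>" unfolding one_eq by (simp add: iota_sm_one)
  then show ?case using good_const[of 1] unfolding Bhat_simps by (intro exI[of _ \<one>]) simp
next
  case (incl h)
  then show ?case
    using good_elA good_elC good_Cas good_const by auto
next
  case (a_inv \<sigma>)
  obtain g where g: "good \<sigma> g" using a_inv.IH ..
  then have "\<ominus>\<^bsub>Bhat\<^esub> \<sigma> = (-1) \<odot>\<^bsub>Chat\<^esub> \<sigma>" unfolding good_def by (simp add: Bhat_a_inv Chat_a_inv Bhat_sub)
  then show ?case using good_smult[OF g, of "-1"] by (intro exI) simp
next
  case (eng_add \<sigma> \<tau>)
  then show ?case unfolding Bhat_simps by (elim exE) (rule exI, rule good_add)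
next
  case (eng_mult \<sigma> \<tau>)
  then show ?case unfolding Bhat_simps by (elim exE) (rule exI, rule good_mult)
qed

lemma Uprime_surj: "g \<in> G \<Longrightarrow> \<exists>\<sigma>\<in>carrier Uprime. good \<sigma> g"
proof (induction rule: G.induct)
  case (const k)
  have "k \<odot>\<^bsub>Chat\<^esub> \<one>\<^bsub>Chat\<^esub> \<in> carrier Uprime" unfolding Uprime_carrier by (rule generate_ring.incl) auto
  then show ?case using good_const by blast
next
  case x
  have "elA \<in> carrier Uprime" unfolding Uprime_carrier by (rule generate_ring.incl) auto
  then show ?case using good_elA by blast
next
  case Y
  have "elC \<in> carrier Uprime" unfolding Uprime_carrier by (rule generate_ring.incl) auto
  then show ?case using good_elC by blast
next
  case Cas
  have "iota (casimir A s) \<in> carrier Uprime" unfolding Uprime_carrier by (rule generate_ring.incl) auto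
  then show ?case using good_Cas by blast
next
  case (add a b)
  then obtain \<sigma> \<tau> where st: "\<sigma> \<in> carrier Uprime" "good \<sigma> a" "\<tau> \<in> carrier Uprime" "good \<tau> b" by blast
  then have "\<sigma> \<oplus>\<^bsub>Bhat\<^esub> \<tau> \<in> carrier Uprime" unfolding Uprime_carrier by (intro generate_ring.eng_add)
  then show ?case using good_add[OF st(2,4)] unfolding Bhat_simps by blast
next
  case (mult a b)
  then obtain \<sigma> \<tau> where st: "\<sigma> \<in> carrier Uprime" "good \<sigma> a" "\<tau> \<in> carrier Uprime" "good \<tau> b" by blast
  then have "\<sigma> \<otimes>\<^bsub>Bhat\<^esub> \<tau> \<in> carrier Uprime" unfolding Uprime_carrier by (intro generate_ring.eng_mult)
  then show ?case using good_mult[OF st(2,4)] unfolding Bhat_simps by blast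
qed

lemma good_determined: "good \<sigma> g \<Longrightarrow> good \<tau> g \<Longrightarrow> \<sigma> = \<tau>"
  unfolding good_def by (rule com_zero_determined) (auto simp: Bhat_sub)

end

section \<open>The isomorphism of U' with the reduction\<close>

context slV_whittaker
begin

lemma good_iff_kernel:
  assumes \<gamma>: "\<gamma>\<^sup>2 = 1 / c" and g: "g \<in> G" "g' \<in> G"
  shows "Ipow (Suc 0) +> g = Ipow (Suc 0) +> g' \<longleftrightarrow> W.J +> tau \<gamma> g = W.J +> tau \<gamma> g'"
proof -
  have \<gamma>0: "\<gamma> \<noteq> 0" using \<gamma> c_nonzero by (metis divide_eq_0_iff power_zero_numeral zero_neq_one)
  note t = alg_homD[OF tau_hom[OF \<gamma>0]]
  note gc = G_closed[OF g(1)] G_closed[OF g(2)]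
  have d: "g \<ominus> g' \<in> G" unfolding minus_eq by (rule G.add[OF g(1) G_minus[OF g(2)]])
  have td: "tau \<gamma> (g \<ominus> g') = tau \<gamma> g \<ominus> tau \<gamma> g'"
    by (rule alg_hom_zero_minus(3)[OF tau_hom[OF \<gamma>0] calgebra_axioms calgebra_axioms gc])
  have "Ipow (Suc 0) +> g = Ipow (Suc 0) +> g' \<longleftrightarrow> g \<ominus> g' \<in> Ipow (Suc 0)" by (rule Ic.rcos_eq_iff[OF gc])
  also have "\<dots> \<longleftrightarrow> (\<exists>a\<in>carrier A. g \<ominus> g' = eps \<otimes> a)" by (simp add: Ipow_iff)
  also have "\<dots> \<longleftrightarrow> tau \<gamma> (g \<ominus> g') \<in> W.J" by (rule kernel_iff[OF \<gamma> d])
  also have "\<dots> \<longleftrightarrow> W.J +> tau \<gamma> g = W.J +> tau \<gamma> g'"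
    unfolding td by (rule W.JC.rcos_eq_iff[symmetric]) (use t(1) gc in simp_all)
  finally show ?thesis .
qed

theorem Uprime_iso: "alg_iso Uprime (ham_red A wc) \<noteq> {}"
proof -
  define \<gamma> where "\<gamma> = csqrt (1 / c)"
  have \<gamma>: "\<gamma>\<^sup>2 = 1 / c" by (simp add: \<gamma>_def)
  have \<gamma>0: "\<gamma> \<noteq> 0" using \<gamma> c_nonzero by (metis divide_eq_0_iff power_zero_numeral zero_neq_one)
  note t = alg_homD[OF tau_hom[OF \<gamma>0]]
  \<comment> \<open>The choice of g is immaterial: two candidates have the same first component,
    hence by \<open>good_iff_kernel\<close> the same twisted coset modulo Aw.\<close>
  define \<psi> where "\<psi> \<sigma> = W.J +> tau \<gamma> (SOME g. good \<sigma> g)" for \<sigma>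
  have \<psi>: "\<psi> \<sigma> = W.J +> tau \<gamma> g" if "good \<sigma> g" for \<sigma> g
  proof -
    define g' where "g' = (SOME g. good \<sigma> g)"
    have g': "good \<sigma> g'" unfolding g'_def using that by (rule someI)
    then have "Ipow (Suc 0) +> g' = Ipow (Suc 0) +> g" "g' \<in> G" "g \<in> G" using that by (simp_all add: good_def)
    then show ?thesis unfolding \<psi>_def g'_def[symmetric] using good_iff_kernel[OF \<gamma>, of g' g] by simp
  qed
  have tG: "tau \<gamma> g \<in> G" if "g \<in> G" for g by (rule tau_G[OF \<gamma>0 that])
  have wt: "wc \<otimes> tau \<gamma> g \<in> W.J" if "g \<in> G" for g
  proof -
    have "wc \<otimes> tau \<gamma> g = tau \<gamma> g \<otimes> wc" using w_comm[OF G_closed G_comm] tG[OF that] by simp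
    then show ?thesis unfolding W.J_iff using G_closed[OF tG[OF that]] by (intro bexI)
  qed
  have "\<psi> \<in> alg_iso Uprime (ham_red A wc)"
    unfolding alg_iso_def
  proof (intro CollectI conjI allI ballI ring_iso_memI)
    fix \<sigma> assume s: "\<sigma> \<in> carrier Uprime"
    then obtain g where g: "good \<sigma> g" using Uprime_good by blast
    then have gG: "g \<in> G" by (simp add: good_def)
    show "\<psi> \<sigma> \<in> carrier W.H"
      unfolding \<psi>[OF g] W.in_H_iff by (rule bexI[of _ "tau \<gamma> g"], rule conjI, rule refl, rule wt[OF gG], rule G_closed[OF tG[OF gG]])
    show "\<psi> (k \<odot>\<^bsub>Uprime\<^esub> \<sigma>) = k \<odot>\<^bsub>W.H\<^esub> \<psi> \<sigma>" for k
    proof -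
      have "k \<odot>\<^bsub>W.H\<^esub> (W.J +> tau \<gamma> g) = W.J +> (k \<odot>\<^bsub>A\<^esub> tau \<gamma> g)"
        unfolding W.H_simps
      proof (rule W.JC.UN_rcos[OF G_closed[OF tG[OF gG]] W.J_cosets])
        fix z assume "z \<in> W.J +> tau \<gamma> g"
        then have z: "z \<in> carrier A" "z \<ominus> tau \<gamma> g \<in> W.J" using W.JC.mem_rcos[OF G_closed[OF tG[OF gG]]] by auto
        then show "k \<odot>\<^bsub>A\<^esub> z \<in> carrier A" by simp
        have "(k \<odot>\<^bsub>A\<^esub> \<one>) \<otimes> (z \<ominus> tau \<gamma> g) \<in> W.J" using z(2) by (intro W.J_left) simp
        then show "k \<odot>\<^bsub>A\<^esub> z \<ominus> k \<odot>\<^bsub>A\<^esub> tau \<gamma> g \<in> W.J"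
          using z(1) G_closed[OF tG[OF gG]] by (simp add: sm_mult_l sm_diff_r)
      qed
      then show ?thesis
        unfolding Uprime_simps \<psi>[OF g] \<psi>[OF good_smult[OF g]] using t(5)[OF G_closed[OF gG]] by simp
    qed
    fix \<tau> assume "\<tau> \<in> carrier Uprime"
    then obtain g' where g': "good \<tau> g'" using Uprime_good by blast
    then have gG': "g' \<in> G" by (simp add: good_def)
    note c = G_closed[OF gG] G_closed[OF gG'] G_closed[OF tG[OF gG]] G_closed[OF tG[OF gG']]
    show "\<psi> (\<sigma> \<otimes>\<^bsub>Uprime\<^esub> \<tau>) = \<psi> \<sigma> \<otimes>\<^bsub>W.H\<^esub> \<psi> \<tau>"
      unfolding Uprime_simps W.H_simps \<psi>[OF g] \<psi>[OF g'] \<psi>[OF good_mult[OF g g']]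
        W.rcoset_mult_H[OF c(3,4) wt[OF gG']] by (simp add: t(3) c)
    show "\<psi> (\<sigma> \<oplus>\<^bsub>Uprime\<^esub> \<tau>) = \<psi> \<sigma> \<oplus>\<^bsub>W.H\<^esub> \<psi> \<tau>"
      unfolding Uprime_simps W.H_simps \<psi>[OF g] \<psi>[OF g'] \<psi>[OF good_add[OF g g']]
        W.JC.rcos_add[OF c(3,4)] by (simp add: t(2) c)
  next
    have "good \<one>\<^bsub>Chat\<^esub> \<one>" using good_const[of 1] by (simp add: one_eq iota_sm_one)
    then show "\<psi> \<one>\<^bsub>Uprime\<^esub> = \<one>\<^bsub>W.H\<^esub>"
      unfolding Uprime_simps W.H_simps by (simp add: \<psi> t(4))
  next
    show "bij_betw \<psi> (carrier Uprime) (carrier W.H)"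
      unfolding bij_betw_def
    proof
      show "inj_on \<psi> (carrier Uprime)"
      proof (rule inj_onI)
        fix \<sigma> \<tau> assume st: "\<sigma> \<in> carrier Uprime" "\<tau> \<in> carrier Uprime" and eq: "\<psi> \<sigma> = \<psi> \<tau>"
        obtain g where g: "good \<sigma> g" using Uprime_good[OF st(1)] ..
        obtain g' where g': "good \<tau> g'" using Uprime_good[OF st(2)] ..
        have G: "g \<in> G" "g' \<in> G" using g g' by (simp_all add: good_def)
        have "Ipow (Suc 0) +> g = Ipow (Suc 0) +> g'"
          using eq unfolding \<psi>[OF g] \<psi>[OF g'] good_iff_kernel[OF \<gamma> G] .
        then have "good \<tau> g" using g g' by (simp add: good_def)
        then show "\<sigma> = \<tau>" by (rule good_determined[OF g])
      qed
      show "\<psi> ` carrier Uprime = carrier W.H"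
      proof (intro equalityI subsetI)
        fix X assume "X \<in> \<psi> ` carrier Uprime"
        then obtain \<sigma> where s: "\<sigma> \<in> carrier Uprime" "X = \<psi> \<sigma>" by blast
        then obtain g where g: "good \<sigma> g" using Uprime_good by blast
        then have gG: "g \<in> G" by (simp add: good_def)
        show "X \<in> carrier W.H"
          unfolding s(2) \<psi>[OF g] W.in_H_iff by (rule bexI[of _ "tau \<gamma> g"], rule conjI, rule refl, rule wt[OF gG], rule G_closed[OF tG[OF gG]])
      next
        fix X assume "X \<in> carrier W.H"
        then obtain g where g: "g \<in> G" "X = W.J +> g" using G_surj by blast
        have i0: "inverse \<gamma> \<noteq> 0" using \<gamma>0 by simp
        have tg: "tau (inverse \<gamma>) g \<in> G" by (rule tau_G[OF i0 g(1)])
        have "tau \<gamma> (tau (inverse \<gamma>) g) = g" using tau_inverse[OF i0 G_closed[OF g(1)]] by simp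
        moreover obtain \<sigma> where "\<sigma> \<in> carrier Uprime" "good \<sigma> (tau (inverse \<gamma>) g)" using Uprime_surj[OF tg] by blast
        ultimately show "X \<in> \<psi> ` carrier Uprime" using \<psi> g(2) by (intro image_eqI[of _ _ \<sigma>]) simp_all
      qed
    qed
  qed
  then show ?thesis by blast
qed

end

section \<open>The algebra \<open>U\<^sub>z\<close>\<close>

context calgebra
begin

lemma commutator_closed: "a \<in> carrier A \<Longrightarrow> b \<in> carrier A \<Longrightarrow> commutator A a b \<in> carrier A"
  by (simp add: commutator_def)

lemma poly_eval_closed: "a \<in> carrier A \<Longrightarrow> poly_eval A p a \<in> carrier A"
  unfolding poly_eval_def by (rule finsum_closed) auto

lemma casimir_closed: "(\<And>g. t g \<in> carrier A) \<Longrightarrow> casimir A t \<in> carrier A"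
  by (simp add: casimir_def)

lemma t_elt_closed: "(\<And>g. t g \<in> carrier A) \<Longrightarrow> t_elt A t p \<in> carrier A"
  by (simp add: t_elt_def Let_def poly_eval_closed casimir_closed)

end

lemma smash_quotient: "quotient_algebra free_alg smash_rels"
  by (intro quotient_algebra.intro quotient_algebra_axioms.intro free_alg_calgebra) simp

lemma smash_calgebra: "calgebra smash_alg"
  unfolding smash_alg_def by (rule quotient_algebra.Q_calgebra[OF smash_quotient])

lemma smash_proj_hom: "quot_proj free_alg smash_rels \<in> alg_hom free_alg smash_alg"
  unfolding smash_alg_def by (rule quotient_algebra.quot_proj_hom[OF smash_quotient])

lemma smash_gen_closed: "smash_gen g \<in> carrier smash_alg"
  unfolding smash_gen_def by (rule alg_homD(1)[OF smash_proj_hom]) simp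

lemma H_quotient: "quotient_algebra smash_alg (H_rels z')"
proof (intro quotient_algebra.intro quotient_algebra_axioms.intro smash_calgebra)
  interpret calgebra smash_alg by (rule smash_calgebra)
  show "H_rels z' \<subseteq> carrier smash_alg"
    unfolding H_rels_def by (simp add: smash_gen_closed commutator_closed poly_eval_closed casimir_closed)
qed

lemma H_calgebra: "calgebra (H_alg z')"
  unfolding H_alg_def by (rule quotient_algebra.Q_calgebra[OF H_quotient])

lemma H_proj_hom: "quot_proj smash_alg (H_rels z') \<in> alg_hom smash_alg (H_alg z')"
  unfolding H_alg_def by (rule quotient_algebra.quot_proj_hom[OF H_quotient])

lemma H_gen_closed: "H_gen z' g \<in> carrier (H_alg z')"
  unfolding H_gen_def by (rule alg_homD(1)[OF H_proj_hom smash_gen_closed])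

lemma U_quotient: "quotient_algebra (H_alg z') {t_H z' z}"
proof (intro quotient_algebra.intro quotient_algebra_axioms.intro H_calgebra)
  interpret calgebra "H_alg z'" by (rule H_calgebra)
  show "{t_H z' z} \<subseteq> carrier (H_alg z')"
    unfolding t_H_def by (simp add: t_elt_closed H_gen_closed)
qed

lemma U_calgebra: "calgebra (U_alg z' z)"
  unfolding U_alg_def by (rule quotient_algebra.Q_calgebra[OF U_quotient])

lemma U_proj_hom: "quot_proj (H_alg z') {t_H z' z} \<in> alg_hom (H_alg z') (U_alg z' z)"
  unfolding U_alg_def by (rule quotient_algebra.quot_proj_hom[OF U_quotient])

definition U_proj :: "complex poly \<Rightarrow> complex poly \<Rightarrow> sl2V free \<Rightarrow> U_elt" where
  "U_proj z' z = quot_proj (H_alg z') {t_H z' z} \<circ> (quot_proj smash_alg (H_rels z') \<circ> quot_proj free_alg smash_rels)"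

lemma U_proj_alg_hom: "U_proj z' z \<in> alg_hom free_alg (U_alg z' z)"
  unfolding U_proj_def by (rule alg_hom_compose[OF alg_hom_compose[OF smash_proj_hom H_proj_hom] U_proj_hom])

lemma U_proj_letter: "U_proj z' z (letter g) = U_gen z' z g"
  by (simp add: U_proj_def U_gen_def H_gen_def smash_gen_def)

lemma U_proj_surj: "a \<in> carrier (U_alg z' z) \<Longrightarrow> \<exists>p. a = U_proj z' z p"
proof -
  assume "a \<in> carrier (U_alg z' z)"
  then obtain b where b: "b \<in> carrier (H_alg z')" "a = quot_proj (H_alg z') {t_H z' z} b"
    unfolding U_alg_def quotient_algebra.in_Q_iff[OF U_quotient] by (elim bexE)
  from b(1) obtain c where c: "c \<in> carrier smash_alg" "b = quot_proj smash_alg (H_rels z') c"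
    unfolding H_alg_def quotient_algebra.in_Q_iff[OF H_quotient] by (elim bexE)
  from c(1) obtain p where "c = quot_proj free_alg smash_rels p"
    unfolding smash_alg_def quotient_algebra.in_Q_iff[OF smash_quotient] by (elim bexE)
  then show ?thesis using b c by (auto simp: U_proj_def)
qed

lemma U_proj_rel:
  assumes "p - q \<in> smash_rels" shows "U_proj z' z p = U_proj z' z q"
proof -
  interpret U: calgebra "U_alg z' z" by (rule U_calgebra)
  note h = U_proj_alg_hom[of z' z]
  have "quot_proj free_alg smash_rels (p - q) = \<zero>\<^bsub>smash_alg\<^esub>"
    unfolding smash_alg_def by (rule quotient_algebra.proj_eq_zero[OF smash_quotient assms])
  then have "U_proj z' z (p - q) = \<zero>\<^bsub>U_alg z' z\<^esub>"
    by (simp add: U_proj_def alg_hom_zero_minus(1)[OF H_proj_hom smash_calgebra H_calgebra]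
        alg_hom_zero_minus(1)[OF U_proj_hom H_calgebra U_calgebra])
  moreover have "U_proj z' z (p - q) = U_proj z' z p \<ominus>\<^bsub>U_alg z' z\<^esub> U_proj z' z q"
    using alg_hom_zero_minus(3)[OF h free_alg_calgebra U_calgebra, of p q] by simp
  ultimately show ?thesis using alg_homD(1)[OF h] by (simp add: U.minus_eq_zero_iff)
qed

lemma two_eq_const: "(2 :: 'g free) = free_const 2"
  using free_const_simps(1)[of 1 1] free_const_simps(3) by (metis one_add_one)

text \<open>The commutation rules are images of elements of \<open>smash_rels\<close>, so they
  survive the two further quotients; the induction over words comes from the free algebra through
  the surjection \<open>U_proj\<close>.\<close>

lemma U_slV_algebra: "slV_algebra (U_alg z' z) (U_gen z' z)"
proof (intro slV_algebra.intro slV_algebra_axioms.intro U_calgebra)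
  let ?U = "U_alg z' z" and ?\<pi> = "U_proj z' z"
  interpret U: calgebra ?U by (rule U_calgebra)
  note h = alg_homD[OF U_proj_alg_hom[of z' z]]
  have h': "?\<pi> p \<in> carrier ?U" "?\<pi> (p + q) = ?\<pi> p \<oplus>\<^bsub>?U\<^esub> ?\<pi> q" "?\<pi> (p * q) = ?\<pi> p \<otimes>\<^bsub>?U\<^esub> ?\<pi> q"
    "?\<pi> 1 = \<one>\<^bsub>?U\<^esub>" "?\<pi> (free_const k * p) = k \<odot>\<^bsub>?U\<^esub> ?\<pi> p" for p q k
    using h(1)[of p] h(2)[of p q] h(3)[of p q] h(4) h(5)[of p k] by simp_all
  have two: "?\<pi> (2 * p) = 2 \<odot>\<^bsub>?U\<^esub> ?\<pi> p" for p
    using h'(5)[of 2 p] by (simp only: two_eq_const)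
  note g = U_proj_letter[symmetric, of z' z]
  note c = commutator_def free_alg_simps free_alg_diff
  show "U_gen z' z g \<in> carrier ?U" for g by (simp only: g h')
  have "?\<pi> (letter gen_h * letter gen_e) = ?\<pi> (letter gen_e * letter gen_h + 2 * letter gen_e)"
    by (rule U_proj_rel) (simp add: smash_rels_def Let_def c algebra_simps)
  then show "U_gen z' z gen_h \<otimes>\<^bsub>?U\<^esub> U_gen z' z gen_e
      = U_gen z' z gen_e \<otimes>\<^bsub>?U\<^esub> U_gen z' z gen_h \<oplus>\<^bsub>?U\<^esub> 2 \<odot>\<^bsub>?U\<^esub> U_gen z' z gen_e"
    unfolding g two[symmetric] h'(3)[symmetric] h'(2)[symmetric] by (simp only:)
  have "?\<pi> (letter gen_h * letter gen_f + 2 * letter gen_f) = ?\<pi> (letter gen_f * letter gen_h)"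
    by (rule U_proj_rel) (simp add: smash_rels_def Let_def c algebra_simps)
  then show "U_gen z' z gen_f \<otimes>\<^bsub>?U\<^esub> U_gen z' z gen_h
      = U_gen z' z gen_h \<otimes>\<^bsub>?U\<^esub> U_gen z' z gen_f \<oplus>\<^bsub>?U\<^esub> 2 \<odot>\<^bsub>?U\<^esub> U_gen z' z gen_f"
    unfolding g two[symmetric] h'(3)[symmetric] h'(2)[symmetric] by (simp only:)
  have "?\<pi> (letter gen_e * letter gen_f) = ?\<pi> (letter gen_f * letter gen_e + letter gen_h)"
    by (rule U_proj_rel) (simp add: smash_rels_def Let_def c algebra_simps)
  then show "U_gen z' z gen_e \<otimes>\<^bsub>?U\<^esub> U_gen z' z gen_f
      = U_gen z' z gen_f \<otimes>\<^bsub>?U\<^esub> U_gen z' z gen_e \<oplus>\<^bsub>?U\<^esub> U_gen z' z gen_h"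
    unfolding g two[symmetric] h'(3)[symmetric] h'(2)[symmetric] by (simp only:)
  have "?\<pi> (letter gen_e * letter gen_x) = ?\<pi> (letter gen_x * letter gen_e)"
    by (rule U_proj_rel) (simp add: smash_rels_def Let_def c algebra_simps)
  then show "U_gen z' z gen_e \<otimes>\<^bsub>?U\<^esub> U_gen z' z gen_x = U_gen z' z gen_x \<otimes>\<^bsub>?U\<^esub> U_gen z' z gen_e"
    unfolding g two[symmetric] h'(3)[symmetric] h'(2)[symmetric] by (simp only:)
  have "?\<pi> (letter gen_h * letter gen_x) = ?\<pi> (letter gen_x * letter gen_h + letter gen_x)"
    by (rule U_proj_rel) (simp add: smash_rels_def Let_def c algebra_simps)
  then show "U_gen z' z gen_h \<otimes>\<^bsub>?U\<^esub> U_gen z' z gen_x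
      = U_gen z' z gen_x \<otimes>\<^bsub>?U\<^esub> U_gen z' z gen_h \<oplus>\<^bsub>?U\<^esub> U_gen z' z gen_x"
    unfolding g two[symmetric] h'(3)[symmetric] h'(2)[symmetric] by (simp only:)
  have "?\<pi> (letter gen_e * letter gen_y) = ?\<pi> (letter gen_y * letter gen_e + letter gen_x)"
    by (rule U_proj_rel) (simp add: smash_rels_def Let_def c algebra_simps)
  then show "U_gen z' z gen_e \<otimes>\<^bsub>?U\<^esub> U_gen z' z gen_y
      = U_gen z' z gen_y \<otimes>\<^bsub>?U\<^esub> U_gen z' z gen_e \<oplus>\<^bsub>?U\<^esub> U_gen z' z gen_x"
    unfolding g two[symmetric] h'(3)[symmetric] h'(2)[symmetric] by (simp only:)
  have "?\<pi> (letter gen_h * letter gen_y + letter gen_y) = ?\<pi> (letter gen_y * letter gen_h)"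
    by (rule U_proj_rel) (simp add: smash_rels_def Let_def c algebra_simps)
  then show "U_gen z' z gen_y \<otimes>\<^bsub>?U\<^esub> U_gen z' z gen_h
      = U_gen z' z gen_h \<otimes>\<^bsub>?U\<^esub> U_gen z' z gen_y \<oplus>\<^bsub>?U\<^esub> U_gen z' z gen_y"
    unfolding g two[symmetric] h'(3)[symmetric] h'(2)[symmetric] by (simp only:)
  fix a and Q :: "U_elt \<Rightarrow> bool"
  assume a: "a \<in> carrier ?U" and const: "\<And>k. Q (k \<odot>\<^bsub>?U\<^esub> \<one>\<^bsub>?U\<^esub>)"
    and add: "\<And>a b. \<lbrakk>a \<in> carrier ?U; b \<in> carrier ?U; Q a; Q b\<rbrakk> \<Longrightarrow> Q (a \<oplus>\<^bsub>?U\<^esub> b)"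
    and mult: "\<And>g a. \<lbrakk>a \<in> carrier ?U; Q a\<rbrakk> \<Longrightarrow> Q (U_gen z' z g \<otimes>\<^bsub>?U\<^esub> a)"
  obtain p where p: "a = ?\<pi> p" using U_proj_surj[OF a] ..
  have "Q (?\<pi> p)"
  proof (induction p rule: free_induct)
    case (const k)
    have "?\<pi> (free_const k) = k \<odot>\<^bsub>?U\<^esub> \<one>\<^bsub>?U\<^esub>" using h'(5)[of k 1] by (simp add: h'(4))
    then show ?case using \<open>\<And>k. Q (k \<odot>\<^bsub>?U\<^esub> \<one>\<^bsub>?U\<^esub>)\<close> by simp
  next
    case (add p q)
    then show ?case unfolding h'(2) by (intro \<open>\<And>a b. \<lbrakk>a \<in> carrier ?U; b \<in> carrier ?U; Q a; Q b\<rbrakk> \<Longrightarrow> Q (a \<oplus>\<^bsub>?U\<^esub> b)\<close> h'(1))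
  next
    case (letter g p)
    then show ?case unfolding h'(3) U_proj_letter by (intro mult h'(1))
  qed
  then show "Q a" by (simp only: p)
qed

section \<open>The algebra \<open>\<O>\<^sup>\<lambda>\<close>\<close>

definition diag2 :: "complex \<Rightarrow> mat2" where
  "diag2 r = vector [vector [r, 0], vector [0, inverse r]]"

definition anti2 :: "complex \<Rightarrow> mat2" where
  "anti2 r = vector [vector [0, r], vector [- inverse r, 0]]"

lemma dihedral_mult:
  "diag2 r ** diag2 t = diag2 (r * t)" "diag2 r ** anti2 t = anti2 (r * t)"
  "t \<noteq> 0 \<Longrightarrow> anti2 r ** diag2 t = anti2 (r * inverse t)" "t \<noteq> 0 \<Longrightarrow> anti2 r ** anti2 t = diag2 (- (r * inverse t))"
  by (simp_all add: diag2_def anti2_def matrix_matrix_mult_def vec_eq_iff forall_2 vector_2 sum_2 mult.commute)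

lemma diag2_one: "diag2 1 = mat 1"
  by (simp add: diag2_def mat_def vec_eq_iff forall_2 vector_2)

lemma binary_dihedral_eq: "binary_dihedral n = diag2 ` {r. r ^ (2 * n) = 1} \<union> anti2 ` {r. r ^ (2 * n) = 1}"
  by (auto simp: binary_dihedral_def diag2_def anti2_def)

locale matrix_group =
  fixes \<Gamma> :: "mat2 set"
  assumes finite_group: "finite \<Gamma>" and one_in: "mat 1 \<in> \<Gamma>"
    and mult_in: "g \<in> \<Gamma> \<Longrightarrow> h \<in> \<Gamma> \<Longrightarrow> g ** h \<in> \<Gamma>"
    and inv_in: "g \<in> \<Gamma> \<Longrightarrow> \<exists>h\<in>\<Gamma>. g ** h = mat 1 \<and> h ** g = mat 1"

lemma binary_dihedral_group: assumes "n \<ge> 1" shows "matrix_group (binary_dihedral n)"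
proof
  let ?R = "{r :: complex. r ^ (2 * n) = 1}"
  have R: "r * t \<in> ?R" "inverse r \<in> ?R" "- r \<in> ?R" "r \<noteq> 0" if "r \<in> ?R" "t \<in> ?R" for r t
    using that assms by (auto simp: power_mult_distrib power_inverse power_mult power_0_left)
  show "finite (binary_dihedral n)"
    unfolding binary_dihedral_eq using assms finite_roots_unity[of "2 * n", where 'a = complex] by simp
  show "mat 1 \<in> binary_dihedral n" unfolding binary_dihedral_eq diag2_one[symmetric] by simp
  show "g ** h \<in> binary_dihedral n" if "g \<in> binary_dihedral n" "h \<in> binary_dihedral n" for g h
    using that R unfolding binary_dihedral_eq by (auto simp: dihedral_mult)
  show "\<exists>h\<in>binary_dihedral n. g ** h = mat 1 \<and> h ** g = mat 1" if "g \<in> binary_dihedral n" for g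
    using that unfolding binary_dihedral_eq
  proof (elim UnE imageE)
    fix r assume r: "g = diag2 r" "r \<in> ?R"
    then show "\<exists>h\<in>diag2 ` ?R \<union> anti2 ` ?R. g ** h = mat 1 \<and> h ** g = mat 1"
      using R[OF r(2) r(2)] by (intro bexI[of _ "diag2 (inverse r)"]) (auto simp: dihedral_mult diag2_one)
  next
    \<comment> \<open>The antidiagonal matrices square to -1, so the inverse has parameter -r. This
      is again a root of unity of the required order because 2n is even.\<close>
    fix r assume r: "g = anti2 r" "r \<in> ?R"
    then show "\<exists>h\<in>diag2 ` ?R \<union> anti2 ` ?R. g ** h = mat 1 \<and> h ** g = mat 1"
      using R[OF r(2) r(2)] by (intro bexI[of _ "anti2 (- r)"]) (auto simp: dihedral_mult diag2_one)
  qed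
qed

lemma tensor_act_one: "tensor_act (mat 1) p = p"
proof -
  have "(\<lambda>j. \<Sum>i\<in>UNIV. free_const (mat 1 $ i $ j) * letter i) = (letter :: 2 \<Rightarrow> 2 free)"
  proof
    fix j :: 2
    have "(\<Sum>i\<in>UNIV. free_const (mat 1 $ i $ j) * letter i) = (\<Sum>i\<in>UNIV. if i = j then letter i else 0 :: 2 free)"
      by (intro sum.cong) (auto simp: mat_def free_const_simps)
    then show "(\<Sum>i\<in>UNIV. free_const (mat 1 $ i $ j) * letter i) = (letter j :: 2 free)" by simp
  qed
  then show ?thesis by (simp add: tensor_act_def free_subst_id)
qed

lemma free_const_sum: "free_const (sum f X) = (\<Sum>x\<in>X. free_const (f x))"
  by (induction X rule: infinite_finite_induct) (simp_all add: free_const_simps)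

lemma tensor_act_mult: "tensor_act (g ** h) p = tensor_act g (tensor_act h p)"
proof -
  have c: "free_const (a * b) * p = free_const a * (free_const b * p)" for a b and p :: "2 free"
    by (simp add: free_const_simps mult.assoc)
  have "free_subst (\<lambda>j. \<Sum>i\<in>UNIV. free_const (g $ i $ j) * letter i) (\<Sum>k\<in>UNIV. free_const (h $ k $ j) * letter k)
    = (\<Sum>i\<in>UNIV. free_const ((g ** h) $ i $ j) * letter i)" for j :: 2
  proof -
    have "free_subst (\<lambda>j. \<Sum>i\<in>UNIV. free_const (g $ i $ j) * letter i) (\<Sum>k\<in>UNIV. free_const (h $ k $ j) * letter k)
      = (\<Sum>k\<in>UNIV. \<Sum>i\<in>UNIV. free_const (h $ k $ j * g $ i $ k) * letter i)"
      by (simp add: free_subst_sum free_subst_add free_subst_mult sum_distrib_left c)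
    also have "\<dots> = (\<Sum>i\<in>UNIV. \<Sum>k\<in>UNIV. free_const (g $ i $ k * h $ k $ j) * letter i)"
      by (subst sum.swap) (simp only: mult.commute)
    also have "\<dots> = (\<Sum>i\<in>UNIV. free_const ((g ** h) $ i $ j) * letter i)"
      by (simp add: matrix_matrix_mult_def free_const_sum sum_distrib_right)
    finally show ?thesis .
  qed
  then show ?thesis by (simp add: tensor_act_def free_subst_comp)
qed

lemma tensor_act_hom:
  "tensor_act g (p + q) = tensor_act g p + tensor_act g q" "tensor_act g (p * q) = tensor_act g p * tensor_act g q"
  "tensor_act g (free_const k) = free_const k" "tensor_act g 0 = 0" "tensor_act g 1 = 1"
  "tensor_act g (sum f X) = (\<Sum>x\<in>X. tensor_act g (f x))"
  by (simp_all add: tensor_act_def free_subst_add free_subst_mult free_subst_sum)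

lemma finsum_free_alg: "finsum free_alg f X = sum f X"
proof (induction X rule: infinite_finite_induct)
  interpret calgebra free_alg by (rule free_alg_calgebra)
  {
    case (insert x X)
    then show ?case using finsum_insert[of X x f] by simp
  next
    case (infinite X)
    then show ?case by (simp add: finsum_infinite)
  next
    case empty
    show ?case by simp
  }
qed

context matrix_group
begin

abbreviation TS where "TS \<equiv> tensor_skew \<Gamma>"

lemma TS_simps:
  "carrier TS = \<Gamma> \<rightarrow>\<^sub>E UNIV"
  "a \<otimes>\<^bsub>TS\<^esub> b = (\<lambda>g\<in>\<Gamma>. \<Sum>p\<in>{p \<in> \<Gamma> \<times> \<Gamma>. fst p ** snd p = g}. a (fst p) * tensor_act (fst p) (b (snd p)))"
  "\<one>\<^bsub>TS\<^esub> = (\<lambda>g\<in>\<Gamma>. if g = mat 1 then 1 else 0)" "\<zero>\<^bsub>TS\<^esub> = (\<lambda>g\<in>\<Gamma>. 0)"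
  "a \<oplus>\<^bsub>TS\<^esub> b = (\<lambda>g\<in>\<Gamma>. a g + b g)" "k \<odot>\<^bsub>TS\<^esub> a = (\<lambda>g\<in>\<Gamma>. free_const k * a g)"
  by (simp_all add: tensor_skew_def skew_group_alg_def finsum_free_alg cong del: if_weak_cong)

lemma TS_mult_apply:
  "g \<in> \<Gamma> \<Longrightarrow> (a \<otimes>\<^bsub>TS\<^esub> b) g = (\<Sum>p\<in>{p \<in> \<Gamma> \<times> \<Gamma>. fst p ** snd p = g}. a (fst p) * tensor_act (fst p) (b (snd p)))"
  by (simp add: TS_simps)

lemma left_cancel: "g \<in> \<Gamma> \<Longrightarrow> g ** h = g ** h' \<Longrightarrow> h = h'"
proof -
  assume "g \<in> \<Gamma>" and eq: "g ** h = g ** h'"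
  then obtain k where k: "k ** g = mat 1" using inv_in by blast
  have "k ** (g ** h) = k ** (g ** h')" by (simp only: eq)
  then show ?thesis unfolding matrix_mul_assoc k matrix_mul_lid .
qed

lemma pairs_finite: "finite {p \<in> \<Gamma> \<times> \<Gamma>. fst p ** snd p = g}"
  by (rule finite_subset[of _ "\<Gamma> \<times> \<Gamma>"]) (auto simp: finite_group)

lemma TS_assoc:
  assumes "a \<in> carrier TS" "b \<in> carrier TS" "c \<in> carrier TS"
  shows "(a \<otimes>\<^bsub>TS\<^esub> b) \<otimes>\<^bsub>TS\<^esub> c = a \<otimes>\<^bsub>TS\<^esub> (b \<otimes>\<^bsub>TS\<^esub> c)"
proof (rule extensionalityI[of _ \<Gamma>])
  fix g assume g: "g \<in> \<Gamma>"
  let ?D = "\<lambda>g. {p \<in> \<Gamma> \<times> \<Gamma>. fst p ** snd p = g}"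
  let ?t = "\<lambda>r s q. a r * (tensor_act r (b s) * tensor_act (r ** s) (c q))"
  have "((a \<otimes>\<^bsub>TS\<^esub> b) \<otimes>\<^bsub>TS\<^esub> c) g = (\<Sum>p\<in>?D g. \<Sum>q\<in>?D (fst p). ?t (fst q) (snd q) (snd p))"
    unfolding TS_mult_apply[OF g]
  proof (rule sum.cong)
    fix p assume p: "p \<in> ?D g"
    then have "fst p \<in> \<Gamma>" by auto
    then have "(a \<otimes>\<^bsub>TS\<^esub> b) (fst p) * tensor_act (fst p) (c (snd p))
        = (\<Sum>q\<in>?D (fst p). a (fst q) * tensor_act (fst q) (b (snd q)) * tensor_act (fst p) (c (snd p)))"
      by (simp only: TS_mult_apply sum_distrib_right)
    also have "\<dots> = (\<Sum>q\<in>?D (fst p). ?t (fst q) (snd q) (snd p))"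
      by (rule sum.cong) (simp_all add: mult.assoc)
    finally show "(a \<otimes>\<^bsub>TS\<^esub> b) (fst p) * tensor_act (fst p) (c (snd p)) = (\<Sum>q\<in>?D (fst p). ?t (fst q) (snd q) (snd p))" .
  qed simp
  also have "\<dots> = (\<Sum>(p, q)\<in>Sigma (?D g) (\<lambda>p. ?D (fst p)). ?t (fst q) (snd q) (snd p))"
    by (rule sum.Sigma) (simp_all add: pairs_finite)
  also have "\<dots> = (\<Sum>(p, q)\<in>Sigma (?D g) (\<lambda>p. ?D (snd p)). ?t (fst p) (fst q) (snd q))"
    \<comment> \<open>Both sides run over triples (r, s, q) with product g; the witnesses convert
      ((r s, q), (r, s)) into ((r, s q), (s, q)) and back.\<close>
    by (rule sum.reindex_bij_witness[where
          i = "\<lambda>(p, q). ((fst p ** fst q, snd q), (fst p, fst q))" and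
          j = "\<lambda>(p, q). ((fst q, snd q ** snd p), (snd q, snd p))"])
      (auto simp: mult_in matrix_mul_assoc)
  also have "\<dots> = (\<Sum>p\<in>?D g. \<Sum>q\<in>?D (snd p). ?t (fst p) (fst q) (snd q))"
    by (rule sum.Sigma[symmetric]) (simp_all add: pairs_finite)
  also have "\<dots> = (a \<otimes>\<^bsub>TS\<^esub> (b \<otimes>\<^bsub>TS\<^esub> c)) g"
    unfolding TS_mult_apply[OF g]
  proof (rule sum.cong)
    fix p assume p: "p \<in> ?D g"
    then have "snd p \<in> \<Gamma>" by auto
    then show "(\<Sum>q\<in>?D (snd p). ?t (fst p) (fst q) (snd q)) = a (fst p) * tensor_act (fst p) ((b \<otimes>\<^bsub>TS\<^esub> c) (snd p))"
      by (simp only: TS_mult_apply tensor_act_hom sum_distrib_left tensor_act_mult)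
  qed simp
  finally show "((a \<otimes>\<^bsub>TS\<^esub> b) \<otimes>\<^bsub>TS\<^esub> c) g = (a \<otimes>\<^bsub>TS\<^esub> (b \<otimes>\<^bsub>TS\<^esub> c)) g" .
qed (simp_all add: TS_simps)

lemma TS_calgebra: "calgebra TS"
proof (intro calgebra.intro calgebra_axioms.intro ringI abelian_groupI monoidI)
  fix a b c assume abc: "a \<in> carrier TS" "b \<in> carrier TS" "c \<in> carrier TS"
  show "a \<otimes>\<^bsub>TS\<^esub> b \<otimes>\<^bsub>TS\<^esub> c = a \<otimes>\<^bsub>TS\<^esub> (b \<otimes>\<^bsub>TS\<^esub> c)" by (rule TS_assoc[OF abc])
  show "(a \<oplus>\<^bsub>TS\<^esub> b) \<otimes>\<^bsub>TS\<^esub> c = a \<otimes>\<^bsub>TS\<^esub> c \<oplus>\<^bsub>TS\<^esub> b \<otimes>\<^bsub>TS\<^esub> c"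
    by (auto simp: TS_simps fun_eq_iff distrib_right sum.distrib[symmetric] intro!: sum.cong)
  show "c \<otimes>\<^bsub>TS\<^esub> (a \<oplus>\<^bsub>TS\<^esub> b) = c \<otimes>\<^bsub>TS\<^esub> a \<oplus>\<^bsub>TS\<^esub> c \<otimes>\<^bsub>TS\<^esub> b"
    by (auto simp: TS_simps fun_eq_iff distrib_left tensor_act_hom sum.distrib[symmetric] intro!: sum.cong)
next
  fix a assume a: "a \<in> carrier TS"
  show "\<one>\<^bsub>TS\<^esub> \<otimes>\<^bsub>TS\<^esub> a = a"
  proof (rule extensionalityI[of _ \<Gamma>])
    fix g assume g: "g \<in> \<Gamma>"
    have "(\<one>\<^bsub>TS\<^esub> \<otimes>\<^bsub>TS\<^esub> a) g = (\<Sum>p\<in>{(mat 1, g)}. \<one>\<^bsub>TS\<^esub> (fst p) * tensor_act (fst p) (a (snd p)))"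
      unfolding TS_mult_apply[OF g]
      by (rule sum.mono_neutral_right[OF pairs_finite]) (use g one_in in \<open>auto simp: TS_simps\<close>)
    then show "(\<one>\<^bsub>TS\<^esub> \<otimes>\<^bsub>TS\<^esub> a) g = a g" using one_in by (simp add: TS_simps tensor_act_one)
  qed (use a in \<open>auto simp: TS_simps PiE_def\<close>)
  show "a \<otimes>\<^bsub>TS\<^esub> \<one>\<^bsub>TS\<^esub> = a"
  proof (rule extensionalityI[of _ \<Gamma>])
    fix g assume g: "g \<in> \<Gamma>"
    have "(a \<otimes>\<^bsub>TS\<^esub> \<one>\<^bsub>TS\<^esub>) g = (\<Sum>p\<in>{(g, mat 1)}. a (fst p) * tensor_act (fst p) (\<one>\<^bsub>TS\<^esub> (snd p)))"
      unfolding TS_mult_apply[OF g]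
      by (rule sum.mono_neutral_right[OF pairs_finite]) (use g one_in in \<open>auto simp: TS_simps tensor_act_hom\<close>)
    then show "(a \<otimes>\<^bsub>TS\<^esub> \<one>\<^bsub>TS\<^esub>) g = a g" using one_in by (simp add: TS_simps tensor_act_hom)
  qed (use a in \<open>auto simp: TS_simps PiE_def\<close>)
  show "\<zero>\<^bsub>TS\<^esub> \<oplus>\<^bsub>TS\<^esub> a = a" "1 \<odot>\<^bsub>TS\<^esub> a = a"
    using a by (auto simp: TS_simps fun_eq_iff PiE_def extensional_def free_const_simps)
  show "\<exists>y\<in>carrier TS. y \<oplus>\<^bsub>TS\<^esub> a = \<zero>\<^bsub>TS\<^esub>"
    by (rule bexI[of _ "\<lambda>g\<in>\<Gamma>. - a g"]) (auto simp: TS_simps)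
next
  fix a b :: "mat2 \<Rightarrow> 2 free" and k l
  show "k \<odot>\<^bsub>TS\<^esub> a \<otimes>\<^bsub>TS\<^esub> b = k \<odot>\<^bsub>TS\<^esub> (a \<otimes>\<^bsub>TS\<^esub> b)"
    by (auto simp: TS_simps fun_eq_iff sum_distrib_left mult.assoc intro!: sum.cong)
  have *: "p * (free_const k * q) = free_const k * (p * q)" for p q :: "2 free"
    using mult_free_const[of p k] by (metis mult.assoc)
  show "a \<otimes>\<^bsub>TS\<^esub> (k \<odot>\<^bsub>TS\<^esub> b) = k \<odot>\<^bsub>TS\<^esub> (a \<otimes>\<^bsub>TS\<^esub> b)"
    by (auto simp: TS_simps fun_eq_iff sum_distrib_left tensor_act_hom * intro!: sum.cong)
  show "(k + l) \<odot>\<^bsub>TS\<^esub> a = k \<odot>\<^bsub>TS\<^esub> a \<oplus>\<^bsub>TS\<^esub> l \<odot>\<^bsub>TS\<^esub> a" "(k * l) \<odot>\<^bsub>TS\<^esub> a = k \<odot>\<^bsub>TS\<^esub> (l \<odot>\<^bsub>TS\<^esub> a)"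
    "k \<odot>\<^bsub>TS\<^esub> (a \<oplus>\<^bsub>TS\<^esub> b) = k \<odot>\<^bsub>TS\<^esub> a \<oplus>\<^bsub>TS\<^esub> k \<odot>\<^bsub>TS\<^esub> b"
    by (auto simp: TS_simps fun_eq_iff free_const_simps distrib_left distrib_right mult.assoc)
qed (auto simp: TS_simps add_ac)

definition sym :: "mat2 \<Rightarrow> 2 free" where
  "sym = (\<lambda>g\<in>\<Gamma>. free_const (1 / of_nat (card \<Gamma>)))"

text \<open>Each g is a product of two group elements in card Gamma ways, one for every first
  factor. Constants are fixed by the action, so each way contributes the square of 1 / card
  Gamma.\<close>

lemma sym_idem: "sym \<otimes>\<^bsub>TS\<^esub> sym = sym"
proof (rule extensionalityI[of _ \<Gamma>])
  fix g assume g: "g \<in> \<Gamma>"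
  let ?D = "{p \<in> \<Gamma> \<times> \<Gamma>. fst p ** snd p = g}"
  define k :: complex where "k = 1 / of_nat (card \<Gamma>)"
  have sym: "sym h = free_const k" if "h \<in> \<Gamma>" for h using that by (simp add: sym_def k_def)
  have "bij_betw fst ?D \<Gamma>"
  proof (rule bij_betwI')
    show "fst p = fst q \<longleftrightarrow> p = q" if "p \<in> ?D" "q \<in> ?D" for p q
    proof
      assume eq: "fst p = fst q"
      have "fst p ** snd p = fst p ** snd q" using that by (simp add: eq)
      moreover have "fst p \<in> \<Gamma>" using that by auto
      ultimately show "p = q" using eq left_cancel prod_eqI by blast
    qed simp
    show "\<exists>p\<in>?D. h = fst p" if h: "h \<in> \<Gamma>" for h
    proof -
      obtain h' where "h' \<in> \<Gamma>" "h ** h' = mat 1" using inv_in[OF h] by blast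
      then have "(h, h' ** g) \<in> ?D" using h g by (simp add: mult_in matrix_mul_assoc)
      then show ?thesis by (rule rev_bexI) simp
    qed
  qed auto
  then have card: "card ?D = card \<Gamma>" by (rule bij_betw_same_card)
  have "(sym \<otimes>\<^bsub>TS\<^esub> sym) g = (\<Sum>p\<in>?D. free_const (k * k))"
    unfolding TS_mult_apply[OF g]
    by (rule sum.cong) (auto simp: sym tensor_act_hom free_const_simps)
  also have "\<dots> = free_const (\<Sum>p\<in>?D. k * k)" by (simp only: free_const_sum)
  also have "(\<Sum>p\<in>?D. k * k) = k"
    using card finite_group one_in card_gt_0_iff[of \<Gamma>] by (auto simp: k_def)
  also have "free_const k = sym g" using g by (rule sym[symmetric])
  finally show "(sym \<otimes>\<^bsub>TS\<^esub> sym) g = sym g" .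
qed (simp_all add: TS_simps sym_def)

end

lemma corner_ring:
  assumes "ring A" "p \<in> carrier A" "p \<otimes>\<^bsub>A\<^esub> p = p" shows "ring (corner_alg A p)"
proof -
  interpret ring A by fact
  let ?C = "corner_alg A p"
  have s: "carrier ?C = {p \<otimes>\<^bsub>A\<^esub> a \<otimes>\<^bsub>A\<^esub> p | a. a \<in> carrier A}" "mult ?C = mult A" "one ?C = p"
    "ring.zero ?C = ring.zero A" "add ?C = add A"
    by (simp_all add: corner_alg_def)
  \<comment> \<open>Describing the corner by p x = x = x p instead of the form p a p makes its
    closure properties direct calculations.\<close>
  have c: "x \<in> carrier ?C \<longleftrightarrow> x \<in> carrier A \<and> p \<otimes>\<^bsub>A\<^esub> x = x \<and> x \<otimes>\<^bsub>A\<^esub> p = x" for x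
  proof
    assume "x \<in> carrier ?C"
    then obtain a where a: "a \<in> carrier A" "x = p \<otimes>\<^bsub>A\<^esub> a \<otimes>\<^bsub>A\<^esub> p" by (auto simp: s)
    have "p \<otimes>\<^bsub>A\<^esub> (p \<otimes>\<^bsub>A\<^esub> b) = p \<otimes>\<^bsub>A\<^esub> b" if "b \<in> carrier A" for b
      using that assms(2,3) by (simp add: m_assoc[symmetric])
    then show "x \<in> carrier A \<and> p \<otimes>\<^bsub>A\<^esub> x = x \<and> x \<otimes>\<^bsub>A\<^esub> p = x"
      using a assms(2,3) by (simp add: m_assoc)
  next
    assume x: "x \<in> carrier A \<and> p \<otimes>\<^bsub>A\<^esub> x = x \<and> x \<otimes>\<^bsub>A\<^esub> p = x"
    then have "x = p \<otimes>\<^bsub>A\<^esub> x \<otimes>\<^bsub>A\<^esub> p" by simp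
    then show "x \<in> carrier ?C" unfolding s using x by blast
  qed
  show ?thesis
  proof (intro ringI abelian_groupI monoidI)
    fix x assume x: "x \<in> carrier ?C"
    then have "\<ominus>\<^bsub>A\<^esub> x \<in> carrier ?C" using assms(2) by (simp add: c l_minus r_minus)
    then show "\<exists>y\<in>carrier ?C. y \<oplus>\<^bsub>?C\<^esub> x = \<zero>\<^bsub>?C\<^esub>"
      using x c[of x] by (intro bexI[of _ "\<ominus>\<^bsub>A\<^esub> x"]) (simp_all add: s(4,5) l_neg)
  next
    fix x y assume xy: "x \<in> carrier ?C" "y \<in> carrier ?C"
    then show "x \<otimes>\<^bsub>?C\<^esub> y \<in> carrier ?C"
      using assms(2) unfolding c s(2) by (metis m_assoc m_closed)
    show "x \<oplus>\<^bsub>?C\<^esub> y \<in> carrier ?C" using xy assms(2) unfolding c s(5) by (simp add: l_distr r_distr)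
  qed (use assms in \<open>auto simp: c s(2-5) m_assoc l_distr r_distr a_ac\<close>)
qed

text \<open>Modules are formed over rings, and an algebra isomorphism alone does not guarantee that
  its source is one. The ring axioms therefore come from the construction: associativity of the skew
  group algebra and idempotency of the symmetriser.\<close>

lemma O_alg_ring: assumes "matrix_group \<Gamma>" shows "ring (O_alg \<Gamma> lam)"
proof -
  interpret matrix_group \<Gamma> by fact
  interpret Q: quotient_algebra TS "CBH_rels \<Gamma> lam"
  proof (intro quotient_algebra.intro quotient_algebra_axioms.intro TS_calgebra)
    show "CBH_rels \<Gamma> lam \<subseteq> carrier TS" by (auto simp: CBH_rels_def TS_simps)
  qed
  have s: "sym \<in> carrier TS" by (simp add: sym_def TS_simps)
  show ?thesis
    unfolding O_alg_def sym_def[symmetric]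
  proof (rule corner_ring[OF Q.Q_ring])
    show "quot_proj TS (CBH_rels \<Gamma> lam) sym \<in> carrier Q.Q" by (rule alg_homD(1)[OF Q.quot_proj_hom s])
    show "quot_proj TS (CBH_rels \<Gamma> lam) sym \<otimes>\<^bsub>Q.Q\<^esub> quot_proj TS (CBH_rels \<Gamma> lam) sym = quot_proj TS (CBH_rels \<Gamma> lam) sym"
      using alg_homD(3)[OF Q.quot_proj_hom s s] by (simp add: sym_idem)
  qed
qed

lemma alg_iso_compose:
  assumes "\<phi> \<in> alg_iso A B" "\<psi> \<in> alg_iso B C" shows "\<psi> \<circ> \<phi> \<in> alg_iso A C"
proof -
  have \<phi>: "\<phi> \<in> ring_hom A B" "bij_betw \<phi> (carrier A) (carrier B)"
    and \<psi>: "\<psi> \<in> ring_hom B C" "bij_betw \<psi> (carrier B) (carrier C)"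
    using assms by (simp_all add: alg_iso_def ring_iso_def)
  have "\<psi> \<circ> \<phi> \<in> ring_iso A C"
    using ring_hom_trans[OF \<phi>(1) \<psi>(1)] bij_betw_trans[OF \<phi>(2) \<psi>(2)] by (simp add: ring_iso_def)
  moreover have "\<phi> a \<in> carrier B" if "a \<in> carrier A" for a using \<phi>(1) that by (rule ring_hom_closed)
  ultimately show ?thesis using assms by (simp add: alg_iso_def)
qed

theorem theorem5p1:
  fixes n :: nat and z z' :: "complex poly" and c :: complex and lam :: "mat2 \<Rightarrow> complex"
  defines "U \<equiv> U_alg z' z"
    and "w \<equiv> e_minus z' z c"
    and "\<O> \<equiv> O_alg (binary_dihedral n) lam"
  assumes "n \<ge> 2"
    and "degree z = n + 1" and "lead_coeff z = 1"
    and "c \<noteq> 0"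
    and "t_H z' z \<in> alg_center (H_alg z')"
    and "lam \<in> alg_center (group_alg (binary_dihedral n))"
    and "alg_iso \<O> (U'_alg z' z) \<noteq> {}"
  shows "alg_iso \<O> (ham_red U w) \<noteq> {} \<and>
    (\<forall>\<phi> \<in> alg_iso \<O> (ham_red U w).
       lmod_functor U (loc_nilp_mods U w :: (U_elt, 'm) module set) \<O> (all_mods \<O>)
         (Wh U w \<phi>) (Wh_map U w \<phi>) \<and>
       lmod_functor \<O> (all_mods \<O> :: (O_elt, 'k) module set) U (loc_nilp_mods U w)
         (Ind U w \<O> \<phi>) (Ind_map U w \<O> \<phi>) \<and>
       naturally_iso_id U (loc_nilp_mods U w :: (U_elt, 'm) module set)
         (\<lambda>M. Ind U w \<O> \<phi> (Wh U w \<phi> M))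
         (\<lambda>M N f. Ind_map U w \<O> \<phi> (Wh U w \<phi> M) (Wh U w \<phi> N) (Wh_map U w \<phi> M N f)) \<and>
       naturally_iso_id \<O> (all_mods \<O> :: (O_elt, 'k) module set)
         (\<lambda>N. Wh U w \<phi> (Ind U w \<O> \<phi> N))
         (\<lambda>M N g. Wh_map U w \<phi> (Ind U w \<O> \<phi> M) (Ind U w \<O> \<phi> N) (Ind_map U w \<O> \<phi> M N g)))"
proof -
  interpret slV_whittaker U "U_gen z' z" c
    unfolding assms(1) by (intro slV_whittaker.intro slV_whittaker_axioms.intro U_slV_algebra assms(7))
  have w: "w = wc" unfolding assms(2) e_minus_def assms(1)[symmetric] w_def ..
  have U': "U'_alg z' z = Uprime"
    unfolding U'_alg_def Let_def assms(1)[symmetric] Uprime_def elC_def elA_def ..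
  have "ring \<O>" unfolding assms(3) using assms(4) by (intro O_alg_ring binary_dihedral_group) simp
  then interpret O: ring \<O> .
  obtain \<phi> \<psi> where "\<phi> \<in> alg_iso \<O> Uprime" "\<psi> \<in> alg_iso Uprime (ham_red U w)"
    using assms(10) Uprime_iso unfolding U' w by blast
  then have "\<psi> \<circ> \<phi> \<in> alg_iso \<O> (ham_red U w)" by (rule alg_iso_compose)
  then have ne: "alg_iso \<O> (ham_red U w) \<noteq> {}" by blast
  \<comment> \<open>Every isomorphism onto the reduction meets the requirements of
    \<open>whittaker_iso\<close>, so the equivalence is obtained for all of them and not only for
    the composite built above.\<close>
  have I: "whittaker_iso U w bs \<O> \<phi>" if "\<phi> \<in> alg_iso \<O> (ham_red U w)" for \<phi>
    unfolding w
  proof (intro whittaker_iso.intro whittaker_iso_axioms.intro W.whittaker_axioms O.ring_axioms)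
    show "\<phi> \<in> ring_iso \<O> (ham_red U wc)" using that unfolding alg_iso_def w by simp
  qed
  show ?thesis
    by (intro conjI ballI ne whittaker_iso.Wh_functor[OF I] whittaker_iso.Ind_functor[OF I]
        whittaker_iso.Ind_Wh_id[OF I] whittaker_iso.Wh_Ind_id[OF I])
qed

end
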